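(* Let $\mathbb{K}$ be an imaginary quadratic field, let $m\in\mathbb{N}$, and let $\alpha,\beta\in\mathbb{C}$ with $\mathrm{Re}(\alpha),\mathrm{Re}(\beta)>0$ and $\alpha\beta=\frac{D_\mathbb{K}^2}{16\pi^2}$. Put $A=\frac{8\pi}{D_\mathbb{K}}$. Then \begin{equation*} \alpha^m \sum_{n=1}^\infty\sigma_{\mathbb{K},2m-1}(n)e^{-A\pi n\alpha} = - (-\beta)^m \bigg \{ \frac{4}{\sqrt{D_\mathbb{K}}} \sum_{n=1}^\infty\frac{\sigma_{\mathbb{K},1-2m}(n)}{n^{1-2m}}\mathrm{kei}(A\sqrt{\pi n\beta}) + \frac{\pi h}{w\sqrt{D_\mathbb{K}}}\frac{B_{2m}}{2m}\bigg \} \end{equation*} and \begin{equation*} \alpha^{m+\frac{1}{2}} \sum_{n=1}^\infty\sigma_{\mathbb{K},2m}(n)e^{-A\pi n\alpha} = \beta^{m+\frac{1}{2}} \bigg \{ \frac{4(-1)^m}{\sqrt{D_\mathbb{K}}} \sum_{n=1}^\infty\frac{\sigma_{\mathbb{K},-2m}(n)}{n^{-2m}}\mathrm{ker}(A\sqrt{\pi n\beta}) + \frac{h\, (2m)!}{(2\pi)^{2m}w\sqrt{D_\mathbb{K}}}\zeta(2m+1)\bigg \}. \end{equation*}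
   Context: $\mathbb{K}$ is an imaginary quadratic field with discriminant $D<0$; $D_\mathbb{K}=|D|$; $h$ is its class number and $w$ the number of roots of unity in $\mathbb{K}$. $v_\mathbb{K}(m)$ denotes the number of nonzero integral ideals of $\mathcal{O}_\mathbb{K}$ of norm $m$; for $a\in\mathbb{C}$, $\sigma_{\mathbb{K},a}(n)=\sum_{d\mid n}v_\mathbb{K}(d)d^a$. $B_{2m}$ is the $2m$-th Bernoulli number and $\zeta$ the Riemann zeta function. Kelvin functions: for $x>0$, $\mathrm{ker}(x)+i\,\mathrm{kei}(x)=K_0(xe^{\pi i/4})$ with $K_0$ the modified Bessel function of the second kind, extended analytically to complex arguments; complex powers use principal branches.
   Formalization: The first identity (with kei and B_{2m}) is proved only for m ≥ 2: for m = 1 it is false, its right side lacking the nonzero term −h/(wAπ) that comes from ζ_K(0) = −h/w. The second identity is proved for all m ≥ 1. *)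

theory Defs
  imports
    "HOL-Analysis.Analysis"
    "HOL-Algebra.Algebra"
    "HOL-Algebra.Algebraic_Closure_Type"
begin

section \<open>Imaginary quadratic fields\<close>

text \<open>Every imaginary quadratic field embeds into the complex numbers, and everything defined
  below is intrinsic to the field, so it is realised as a subfield of \<open>\<complex>\<close>. Its two embeddings into
  \<open>\<complex>\<close> are then the inclusion and complex conjugation.\<close>

definition imaginary_quadratic_field :: "complex set \<Rightarrow> bool" where
  "imaginary_quadratic_field K \<longleftrightarrow>
     subfield K ring_of_type_algebra \<and>
     ring.dimension (ring_of_type_algebra :: complex ring) 2 \<rat> K \<and>
     \<not> K \<subseteq> \<real>"

definition ring_of_integers :: "complex set \<Rightarrow> complex ring" where
  "ring_of_integers K = ring_of_type_algebra \<lparr>carrier := {z \<in> K. algebraic_int z}\<rparr>"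

definition integral_basis :: "complex set \<Rightarrow> complex \<Rightarrow> complex \<Rightarrow> bool" where
  "integral_basis K u v \<longleftrightarrow>
     u \<in> carrier (ring_of_integers K) \<and> v \<in> carrier (ring_of_integers K) \<and>
     (\<forall>z \<in> carrier (ring_of_integers K).
        \<exists>!c :: int \<times> int. z = of_int (fst c) * u + of_int (snd c) * v)"

text \<open>The squared determinant of the two embeddings on an integral basis; it does not depend
  on the basis.\<close>

definition discriminant :: "complex set \<Rightarrow> int" where
  "discriminant K =
     (THE D. \<exists>u v. integral_basis K u v \<and> of_int D = (u * cnj v - v * cnj u)\<^sup>2)"

definition nonzero_ideals :: "complex set \<Rightarrow> complex set set" where
  "nonzero_ideals K = {I. ideal I (ring_of_integers K) \<and> I \<noteq> {0}}"

definition ideal_norm :: "complex set \<Rightarrow> complex set \<Rightarrow> nat" where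
  "ideal_norm K I = card (carrier (ring_of_integers K Quot I))"

text \<open>Two nonzero ideals \<open>I\<close>, \<open>J\<close> are in the same class iff \<open>aI = bJ\<close> for some nonzero integers
  \<open>a\<close>, \<open>b\<close> of the field.\<close>

definition ideal_class_rel :: "complex set \<Rightarrow> (complex set \<times> complex set) set" where
  "ideal_class_rel K =
     {(I, J). I \<in> nonzero_ideals K \<and> J \<in> nonzero_ideals K \<and>
        (\<exists>a \<in> carrier (ring_of_integers K) - {0}. \<exists>b \<in> carrier (ring_of_integers K) - {0}.
           (\<lambda>x. a * x) ` I = (\<lambda>x. b * x) ` J)}"

definition class_number :: "complex set \<Rightarrow> nat" where
  "class_number K = card (nonzero_ideals K // ideal_class_rel K)"

definition num_roots_of_unity :: "complex set \<Rightarrow> nat" where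
  "num_roots_of_unity K = card {z \<in> K. \<exists>n > 0. z ^ n = 1}"

definition ideal_count :: "complex set \<Rightarrow> nat \<Rightarrow> nat" where
  "ideal_count K n = card {I \<in> nonzero_ideals K. ideal_norm K I = n}"

definition ideal_sigma :: "complex set \<Rightarrow> complex \<Rightarrow> nat \<Rightarrow> complex" where
  "ideal_sigma K a n = (\<Sum>d | d dvd n. of_nat (ideal_count K d) * of_nat d powr a)"


section \<open>Special functions and constants\<close>

text \<open>Generating function \<open>x / (e\<^sup>x - 1) = \<Sum> B\<^sub>n x\<^sup>n / n!\<close>.\<close>

definition bernoulli :: "nat \<Rightarrow> real" where
  "bernoulli n = fact n * fps_nth (fps_X / (fps_exp 1 - 1)) n"

text \<open>The Dirichlet series, meaningful for \<open>Re s > 1\<close> only.\<close>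

definition zeta :: "complex \<Rightarrow> complex" where
  "zeta s = suminf (\<lambda>n. 1 / of_nat (Suc n) powr s)"

text \<open>The modified Bessel function of the second kind and order zero, by its integral
  representation, which is valid on the half-plane \<open>Re z > 0\<close>.\<close>

definition bessel_K0 :: "complex \<Rightarrow> complex" where
  "bessel_K0 z = integral {0..} (\<lambda>t :: real. exp (- z * of_real (cosh t)))"

text \<open>For \<open>x > 0\<close> the Kelvin functions are the real and imaginary part of \<open>K\<^sub>0 (x e\<^bsup>\<pi>i/4\<^esup>)\<close>; since
  \<open>K\<^sub>0 (cnj z) = cnj (K\<^sub>0 z)\<close>, their analytic continuation to \<open>|arg z| < \<pi>/4\<close> is as follows.\<close>

definition kelvin_ker :: "complex \<Rightarrow> complex" where
  "kelvin_ker z = (bessel_K0 (z * cis (pi / 4)) + bessel_K0 (z * cis (- pi / 4))) / 2"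

definition kelvin_kei :: "complex \<Rightarrow> complex" where
  "kelvin_kei z = (bessel_K0 (z * cis (pi / 4)) - bessel_K0 (z * cis (- pi / 4))) / (2 * \<i>)"

lemma bessel_K0_cnj: "bessel_K0 (cnj z) = cnj (bessel_K0 z)"
  unfolding bessel_K0_def integral_cnj by (simp add: exp_cnj)

lemma kelvin_of_real:
  fixes x :: real
  shows "kelvin_ker (of_real x) = of_real (Re (bessel_K0 (of_real x * cis (pi / 4))))"
    and "kelvin_kei (of_real x) = of_real (Im (bessel_K0 (of_real x * cis (pi / 4))))"
proof -
  have "of_real x * cis (- pi / 4) = cnj (of_real x * cis (pi / 4))"
    by (simp add: cis_cnj)
  then have *: "bessel_K0 (of_real x * cis (- pi / 4)) = cnj (bessel_K0 (of_real x * cis (pi / 4)))"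
    by (simp only: bessel_K0_cnj)
  show "kelvin_ker (of_real x) = of_real (Re (bessel_K0 (of_real x * cis (pi / 4))))"
    unfolding kelvin_ker_def * by (simp add: complex_add_cnj)
  show "kelvin_kei (of_real x) = of_real (Im (bessel_K0 (of_real x * cis (pi / 4))))"
    unfolding kelvin_kei_def * by (simp add: complex_eq_iff)
qed

end

theory Submission
  imports
    Defs
    "HOL-Complex_Analysis.Complex_Analysis"
    "HOL-Probability.Characteristic_Functions"
    "HOL-Real_Asymp.Real_Asymp"
begin

text \<open>
  The ideals in a given class correspond, up to the \<open>w\<close> units, to the nonzero elements of a lattice
  in \<open>\<complex>\<close>, namely of an ideal \<open>J\<close>, with norms \<open>\<bar>\<mu>\<bar>\<^sup>2 / N J\<close>. Poisson summation on these lattices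
  turns into the functional equation
  \<open>g y = - \<kappa> + \<kappa> \<rho> / y + (\<rho> / y) g (\<rho>\<^sup>2 / y)\<close> of the generating function
  \<open>g y = \<Sum>n. v n exp (- n y)\<close> of the numbers \<open>v n\<close> of ideals of norm \<open>n\<close>, where \<open>\<kappa> = h / w\<close>
  and \<open>\<rho> = 2 \<pi> / sqrt D\<close>.

  With \<open>\<eta> = A \<pi> \<alpha>\<close>, the left-hand side of either identity is, up to sign,
  the sum over \<open>k \<ge> 1\<close> of the derivative \<open>g\<^sup>(\<^sup>a\<^sup>) (k \<eta>)\<close>, where \<open>a\<close> is \<open>2 m - 1\<close> or \<open>2 m\<close>.
  After insertion of the functional equation, the middle term gives the zeta value, and
  for every \<open>d\<close> the sum over \<open>k\<close> of the \<open>a\<close>-th derivative of \<open>\<phi> y = (\<rho> / y) exp (- \<rho>\<^sup>2 d / y)\<close> at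
  \<open>k \<eta>\<close> is transformed once more by Poisson summation. The Laplace transform of \<open>\<phi>\<close> along the
  ray is a \<open>K\<^sub>0\<close> Bessel function; on the imaginary axis its argument is a positive multiple of
  \<open>sqrt \<beta> exp (\<plusminus> \<pi> \<i> / 4)\<close>, which yields the Kelvin functions. This needs \<open>a \<ge> 2\<close>, since for \<open>a = 1\<close> the double series over
  \<open>d\<close> and \<open>k\<close> no longer converges absolutely.
\<close>

section \<open>Imaginary quadratic fields: integers and ideals\<close>

text \<open>The functional equation is inserted before the sum over \<open>k\<close> is transformed
  because it makes the summand flat at the origin: \<open>exp (- d y)\<close>, cut off to a
  half-line, jumps there, while \<open>\<phi>\<close> and all its derivatives tend to 0 along the
  ray. Its extension by zero is smooth, and Poisson summation over the whole line yields exactly the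
  sum over \<open>k \<ge> 1\<close>. The obstacle at \<open>a = 1\<close> is not merely technical.
  Every \<open>\<phi>'\<close> has integral 0 along the ray, but the weighted sum of all
  \<open>\<phi>\<close>, which is \<open>g y + \<kappa> - \<kappa> \<rho> / y\<close>, tends to 0 at
  the origin and to \<open>\<kappa>\<close> at infinity. Frequency 0 would thus contribute a further
  term \<open>\<kappa> / \<eta>\<close>, up to sign, which is lost when the sums over
  \<open>d\<close> and \<open>k\<close> are exchanged. This is why the first identity is stated for
  \<open>m \<ge> 2\<close>. The condition \<open>Re \<beta> > 0\<close> keeps the argument of
  \<open>sqrt \<beta>\<close> below \<open>\<pi> / 4\<close> in absolute value, so that both Bessel
  arguments stay in the right half-plane, where the integral for \<open>K\<^sub>0\<close>
  converges.\<close>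

lemma quadratic_algebraic_int:
  fixes z :: complex
  assumes z: "algebraic_int z" "Im z \<noteq> 0" and T: "2 * Re z \<in> \<rat>" and N: "(cmod z)\<^sup>2 \<in> \<rat>"
  shows "2 * Re z \<in> \<int>" "(cmod z)\<^sup>2 \<in> \<int>"
proof -
  define ev where "ev = (\<lambda>p. poly (map_poly of_int p) z)"
  have ev_add: "ev (p + q) = ev p + ev q" for p q
  proof -
    have "map_poly of_int (p + q) = map_poly of_int p + (map_poly of_int q :: complex poly)"
      by (simp add: poly_eq_iff coeff_map_poly)
    then show ?thesis by (simp add: ev_def)
  qed
  have ev_mult: "ev (p * q) = ev p * ev q" for p q
  proof -
    have "map_poly of_int (p * q) = map_poly of_int p * (map_poly of_int q :: complex poly)"
      by (simp add: poly_eq_iff coeff_map_poly coeff_mult)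
    then show ?thesis by (simp add: ev_def)
  qed
  have ev_smult: "ev (Polynomial.smult c p) = of_int c * ev p" for c p
    by (simp add: ev_def map_poly_smult)
  obtain t s where s: "(s::int) > 0" "2 * Re z = of_int t / of_int s"
    by (rule Rats_cases'[OF T])
  obtain n s' where s': "(s'::int) > 0" "(cmod z)\<^sup>2 = of_int n / of_int s'"
    by (rule Rats_cases'[OF N])
  have quad: "z ^ 2 - of_real (2 * Re z) * z + of_real ((cmod z)\<^sup>2) = 0"
    by (simp only: cmod_power2) (auto simp: complex_eq_iff power2_eq_square algebra_simps)
  \<comment> \<open>The quadratic with root \<open>z\<close>, cleared of denominators. Once its
    primitive part \<open>q\<close> is known to have leading coefficient 1 or -1, the trace and the
    norm are the other coefficients up to sign.\<close>
  define q0 where "q0 = [: n * s, - (t * s'), s * s' :]"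
  have q00: "q0 \<noteq> 0" using s s' by (auto simp: q0_def)
  define q where "q = primitive_part q0"
  have dq: "Polynomial.degree q = 2" using s s' by (simp add: q_def q0_def)
  have cq: "content q = 1" using q00 by (simp add: q_def)
  have q0: "q \<noteq> 0" using dq by auto
  have "ev q0 = of_int (s * s') * (z ^ 2 - of_real (2 * Re z) * z + of_real ((cmod z)\<^sup>2))"
    unfolding s s' using s(1) s'(1)
    by (simp add: ev_def q0_def map_poly_pCons field_simps power2_eq_square)
  then have "ev q0 = 0" using quad by simp
  moreover have q0q: "q0 = Polynomial.smult (content q0) q" by (simp add: q_def)
  ultimately have qz: "ev q = 0" using q00 ev_smult
    by (metis content_eq_zero_iff mult_eq_0_iff of_int_eq_0_iff)
  obtain p where p: "ev p = 0" "Polynomial.lead_coeff p = 1"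
    using z by (auto simp: algebraic_int_altdef_ipoly ev_def)
  have cp: "content p = 1"
    using content_dvd_coeff[of p "Polynomial.degree p"] p(2) by (metis is_unit_content_iff)
  obtain f r where fr: "pseudo_divmod p q = (f, r)" by fastforce
  define k where "k = Suc (Polynomial.degree p) - Polynomial.degree q"
  have eq: "Polynomial.smult (Polynomial.lead_coeff q ^ k) p = q * f + r" and r: "r = 0 \<or> Polynomial.degree r < Polynomial.degree q"
    using pseudo_divmod[OF q0 fr] by (auto simp: k_def)
  have "ev r = 0"
    using arg_cong[OF eq, of ev] by (simp add: ev_add ev_mult ev_smult p(1) qz)
  \<comment> \<open>The remainder has integer coefficients, degree at most 1 and the nonreal root
    \<open>z\<close>, so it vanishes.\<close>
  have "Polynomial.degree r \<le> 1" using r dq by auto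
  then have "Polynomial.degree r = 0 \<or> Polynomial.degree r = 1" by auto
  moreover have "r = [:Polynomial.coeff r 0, Polynomial.coeff r 1:]"
    using \<open>Polynomial.degree r \<le> 1\<close> by (auto simp: poly_eq_iff coeff_pCons coeff_eq_0 split: nat.splits)
  then have rr: "of_int (Polynomial.coeff r 0) + of_int (Polynomial.coeff r 1) * z = 0"
  proof -
    have "ev [:x, y:] = of_int x + of_int y * z" for x y
      by (cases "y = 0"; cases "x = 0") (simp_all add: ev_def map_poly_pCons)
    from this[of "Polynomial.coeff r 0" "Polynomial.coeff r 1"] show ?thesis
      using \<open>ev r = 0\<close> \<open>r = [:_, _:]\<close> by simp
  qed
  have "Polynomial.coeff r 1 = 0" using arg_cong[OF rr, of Im] z(2) by simp
  with rr have "Polynomial.coeff r 0 = 0" by simp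
  with \<open>Polynomial.coeff r 1 = 0\<close> \<open>r = [:Polynomial.coeff r 0, Polynomial.coeff r 1:]\<close> have "r = 0" by simp
  with eq have eq: "Polynomial.smult (Polynomial.lead_coeff q ^ k) p = q * f" by simp
  \<comment> \<open>Gauss's lemma: \<open>p\<close> and \<open>q\<close> are primitive, so up to
    sign the factor \<open>lead_coeff q ^ k\<close> is the content of \<open>f\<close> and divides
    its leading coefficient. As \<open>p\<close> is monic, comparing leading coefficients makes
    \<open>lead_coeff q\<close> a unit.\<close>
  from arg_cong[OF eq, of content] have "normalize (Polynomial.lead_coeff q ^ k) = content f"
    by (simp add: content_mult cp cq)
  then have "Polynomial.lead_coeff q ^ k dvd Polynomial.lead_coeff f"
    by (metis content_dvd_coeff normalize_dvd_iff)
  then obtain m where m: "Polynomial.lead_coeff f = Polynomial.lead_coeff q ^ k * m" by auto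
  have "Polynomial.lead_coeff q ^ k = Polynomial.lead_coeff q * Polynomial.lead_coeff f"
    using arg_cong[OF eq, of Polynomial.lead_coeff] p(2) q0 by (simp add: lead_coeff_mult lead_coeff_smult)
  then have "Polynomial.lead_coeff q ^ k * (Polynomial.lead_coeff q * m) = Polynomial.lead_coeff q ^ k * 1" using m by simp
  then have "Polynomial.lead_coeff q * m = 1" using q0 by (metis leading_coeff_0_iff mult_left_cancel power_not_zero)
  then have lq: "\<bar>Polynomial.lead_coeff q\<bar> = 1" using abs_zmult_eq_1[of "Polynomial.lead_coeff q" m] by simp
  define c where "c = content q0"
  have co: "n * s = c * Polynomial.coeff q 0" "- (t * s') = c * Polynomial.coeff q 1" "s * s' = c * Polynomial.coeff q 2"
    using arg_cong[OF q0q, of "\<lambda>p. Polynomial.coeff p 0"] arg_cong[OF q0q, of "\<lambda>p. Polynomial.coeff p 1"]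
      arg_cong[OF q0q, of "\<lambda>p. Polynomial.coeff p 2"] by (simp_all add: q0_def c_def numeral_2_eq_2)
  have "Polynomial.coeff q 2 = 1 \<or> Polynomial.coeff q 2 = -1" using lq dq by simp arith
  then obtain e where e: "c = e * (s * s')" "Polynomial.coeff q 2 = e" "e * e = 1" using co(3) by fastforce
  have "(t + e * s * Polynomial.coeff q 1) * s' = 0" using co(2) by (simp add: e(1) algebra_simps)
  then have 1: "t = - (e * s * Polynomial.coeff q 1)" using s'(1) by simp
  have "(n - e * s' * Polynomial.coeff q 0) * s = 0" using co(1) by (simp add: e(1) algebra_simps)
  then have 2: "n = e * s' * Polynomial.coeff q 0" using s(1) by simp
  show "2 * Re z \<in> \<int>" unfolding s(2) 1 using s(1) by simp
  show "(cmod z)\<^sup>2 \<in> \<int>" unfolding s'(2) 2 using s'(1) by simp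
qed

section \<open>The field and its ring of integers\<close>

locale imag_quad =
  fixes K :: "complex set"
  assumes K: "imaginary_quadratic_field K"
begin

definition OK :: "complex set" where "OK = {z \<in> K. algebraic_int z}"

lemma carrier_OK: "carrier (ring_of_integers K) = OK"
  by (simp add: ring_of_integers_def OK_def)

lemma subf: "subfield K ring_of_type_algebra" using K by (simp add: imaginary_quadratic_field_def)

lemma K_add: "a \<in> K \<Longrightarrow> b \<in> K \<Longrightarrow> a + b \<in> K"
  and K_mult: "a \<in> K \<Longrightarrow> b \<in> K \<Longrightarrow> a * b \<in> K"
  and K_1: "1 \<in> K" and K_0: "0 \<in> K"
  and K_uminus: "a \<in> K \<Longrightarrow> - a \<in> K"
  and K_inverse: "a \<in> K \<Longrightarrow> inverse a \<in> K"
proof -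
  interpret R: field "ring_of_type_algebra :: complex ring" by (rule field_from_type_algebra)
  have sr: "subring K ring_of_type_algebra" using subfieldE(1)[OF subf] .
  note E = subringE[OF sr]
  have um: "\<ominus>\<^bsub>ring_of_type_algebra\<^esub> x = - x" for x :: complex
    by (rule R.minus_equality) (auto simp: ring_of_type_algebra_def)
  show "a \<in> K \<Longrightarrow> b \<in> K \<Longrightarrow> a + b \<in> K" "a \<in> K \<Longrightarrow> b \<in> K \<Longrightarrow> a * b \<in> K" "1 \<in> K" "0 \<in> K"
    using E by (simp_all add: ring_of_type_algebra_def)
  show "a \<in> K \<Longrightarrow> - a \<in> K" using E(5)[of a] by (simp add: um)
  show "inverse a \<in> K" if "a \<in> K"
  proof (cases "a = 0")
    case False
    have "a \<in> Units (ring_of_type_algebra \<lparr> carrier := K \<rparr>)"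
      using subfield.subfield_Units[OF subf] False that by (simp add: ring_of_type_algebra_def)
    then obtain b where "b \<in> K" "b * a = 1"
      by (auto simp: Units_def ring_of_type_algebra_def)
    then show ?thesis by (metis inverse_unique mult.commute)
  qed (use that in simp)
qed

lemma K_minus: "a \<in> K \<Longrightarrow> b \<in> K \<Longrightarrow> a - b \<in> K"
  using K_add[of a "-b"] K_uminus by simp

lemma K_of_nat: "of_nat n \<in> K"
  by (induct n) (auto intro: K_0 K_1 K_add)

lemma K_of_int: "of_int n \<in> K"
  by (cases n) (auto intro: K_of_nat K_uminus simp del: of_nat_Suc)

lemma K_divide: "a \<in> K \<Longrightarrow> b \<in> K \<Longrightarrow> a / b \<in> K"
  by (simp add: divide_inverse K_mult K_inverse)

lemma K_Rats: "r \<in> \<rat> \<Longrightarrow> r \<in> K"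
  by (auto elim!: Rats_cases' intro!: K_divide K_of_int)

text \<open>The predicate \<open>dimension\<close> only provides some basis \<open>v1\<close>,
  \<open>v2\<close>. Cramer's rule passes to the basis \<open>1\<close>, \<open>\<theta>\<close>; a
  vanishing determinant \<open>d\<close> would make \<open>\<theta>\<close> rational and hence
  real.\<close>

lemma K_decomp:
  assumes th: "\<theta> \<in> K" "Im \<theta> \<noteq> 0" and z: "z \<in> K"
  obtains p q where "p \<in> \<rat>" "q \<in> \<rat>" "z = p + q * \<theta>"
proof -
  interpret R: field "ring_of_type_algebra :: complex ring" by (rule field_from_type_algebra)
  have "R.dimension 2 \<rat> K" using K by (simp add: imaginary_quadratic_field_def)
  then have "R.dimension (Suc (Suc 0)) \<rat> K" by (simp add: numeral_2_eq_2)
  then obtain v1 E1 where E1: "K = R.line_extension \<rat> v1 E1" "R.dimension (Suc 0) \<rat> E1"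
    by cases auto
  from E1(2) obtain v2 E2 where E2: "E1 = R.line_extension \<rat> v2 E2" "R.dimension 0 \<rat> E2"
    by cases auto
  from E2(2) have E20: "E2 = {0}" by cases (auto simp: ring_of_type_algebra_def)
  have Kiff: "x \<in> K \<longleftrightarrow> (\<exists>a\<in>\<rat>. \<exists>b\<in>\<rat>. x = a * v1 + b * v2)" for x
    unfolding E1(1) E2(1) E20 R.line_extension_mem_iff Bex_def
    by (simp add: ring_of_type_algebra_def) blast
  obtain a1 b1 where 1: "a1 \<in> \<rat>" "b1 \<in> \<rat>" "1 = a1 * v1 + b1 * v2" using K_1 Kiff by auto
  obtain a2 b2 where 2: "a2 \<in> \<rat>" "b2 \<in> \<rat>" "\<theta> = a2 * v1 + b2 * v2" using th(1) Kiff by auto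
  obtain a b where 3: "a \<in> \<rat>" "b \<in> \<rat>" "z = a * v1 + b * v2" using z Kiff by auto
  define d where "d = a1 * b2 - a2 * b1"
  have "d \<noteq> 0"
  proof
    assume d: "d = 0"
    have "a1 * \<theta> = (a1 * b2 - a2 * b1) * v2 + a2 * (a1 * v1 + b1 * v2)"
      "b1 * \<theta> = - (a1 * b2 - a2 * b1) * v1 + b2 * (a1 * v1 + b1 * v2)"
      unfolding 2(3) by (simp_all add: algebra_simps)
    then have "a1 * \<theta> = a2" "b1 * \<theta> = b2"
      using d unfolding d_def 1(3)[symmetric] by simp_all
    moreover have "a1 \<noteq> 0 \<or> b1 \<noteq> 0" using 1(3) by auto
    ultimately have "\<theta> = a2 / a1 \<or> \<theta> = b2 / b1" by (auto simp: field_simps)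
    then have "\<theta> \<in> \<rat>" using 1 2 by auto
    then have "\<theta> \<in> \<real>" by (auto elim!: Rats_cases')
    with th(2) show False by (simp add: complex_is_Real_iff)
  qed
  have "d * z = (a * b2 - b * a2) * (a1 * v1 + b1 * v2) + (b * a1 - a * b1) * \<theta>"
    unfolding d_def 2(3) 3(3) by (simp add: algebra_simps)
  then have "d * z = (a * b2 - b * a2) + (b * a1 - a * b1) * \<theta>"
    by (simp add: 1(3)[symmetric])
  then have "z = (a * b2 - b * a2) / d + (b * a1 - a * b1) / d * \<theta>"
    using \<open>d \<noteq> 0\<close> by (simp add: field_simps)
  moreover have "d \<in> \<rat>" using 1 2 by (simp add: d_def)
  ultimately show ?thesis using 1(1,2) 2(1,2) 3(1,2)
    by (intro that[of "(a * b2 - b * a2) / d" "(b * a1 - a * b1) / d"]) auto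
qed

lemma Rats_imp_Re: "x \<in> \<rat> \<Longrightarrow> Im x = 0 \<and> Re x \<in> \<rat>"
  by (auto elim!: Rats_cases')

lemma ex_nonreal: obtains \<theta> where "\<theta> \<in> K" "Im \<theta> \<noteq> 0"
  using K unfolding imaginary_quadratic_field_def subset_iff complex_is_Real_iff by blast

lemma K_real_Rats: assumes z: "z \<in> K" "Im z = 0" shows "z \<in> \<rat>"
proof -
  obtain \<theta> where th: "\<theta> \<in> K" "Im \<theta> \<noteq> 0" by (rule ex_nonreal)
  obtain p q where pq: "p \<in> \<rat>" "q \<in> \<rat>" "z = p + q * \<theta>" by (rule K_decomp[OF th z(1)])
  with Rats_imp_Re[of p] Rats_imp_Re[of q] z(2) th(2) have "q = 0"
    by (auto simp: complex_eq_iff)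
  with pq show ?thesis by simp
qed

text \<open>For nonreal \<open>z\<close>, the imaginary part of \<open>z * z = p + q * z\<close>
  gives the trace \<open>q\<close>, and the real part then gives the norm
  \<open>- p\<close>.\<close>

lemma K_trace_norm:
  assumes z: "z \<in> K" shows "2 * Re z \<in> \<rat>" "(cmod z)\<^sup>2 \<in> \<rat>"
proof -
  have "2 * Re z \<in> \<rat> \<and> (cmod z)\<^sup>2 \<in> \<rat>"
  proof (cases "Im z = 0")
    case True
    from Rats_imp_Re[OF K_real_Rats[OF z True]] show ?thesis
      by (auto simp: cmod_power2 True)
  next
    case False
    obtain p q where pq: "p \<in> \<rat>" "q \<in> \<rat>" "z * z = p + q * z"
      by (rule K_decomp[OF z False K_mult[OF z z]])
    note p = Rats_imp_Re[OF pq(1)] and q = Rats_imp_Re[OF pq(2)]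
    have im: "2 * Re z = Re q"
      using arg_cong[OF pq(3), of Im] False p q by simp
    have "(cmod z)\<^sup>2 = - Re p"
      using arg_cong[OF pq(3), of Re] p q im[symmetric]
      unfolding cmod_power2 by (simp add: power2_eq_square)
    then show ?thesis using im p q by simp
  qed
  then show "2 * Re z \<in> \<rat>" "(cmod z)\<^sup>2 \<in> \<rat>" by auto
qed

lemma K_cnj: assumes z: "z \<in> K" shows "cnj z \<in> K"
proof -
  have "cnj z = of_real (2 * Re z) - z" by (simp add: complex_eq_iff)
  moreover have "of_real (2 * Re z) \<in> K"
    using K_trace_norm(1)[OF z] by (intro K_Rats) (auto elim!: Rats_cases' simp del: of_real_mult)
  ultimately show ?thesis using z by (simp add: K_minus)
qed

text \<open>Reduces integrality to two numbers that can be computed with, the trace and the norm;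
  the closure properties of the ring are derived from it. Real elements are treated apart because
  their minimal polynomial is linear.\<close>

lemma OK_iff: "z \<in> OK \<longleftrightarrow> z \<in> K \<and> 2 * Re z \<in> \<int> \<and> (cmod z)\<^sup>2 \<in> \<int>"
proof (cases "z \<in> K")
  case zK: True
  note TN = K_trace_norm[OF zK]
  show ?thesis
  proof (cases "Im z = 0")
    case True
    note R = K_real_Rats[OF zK True]
    then obtain a b where ab: "b > 0" "z = of_int a / of_int b" by (auto elim: Rats_cases')
    have *: "algebraic_int z \<longleftrightarrow> z \<in> \<int>" using rational_algebraic_int_is_int[OF _ R] int_imp_algebraic_int by auto
    have "z \<in> \<int>" if "(cmod z)\<^sup>2 \<in> \<int>"
    proof -
      have "poly [:- ((cmod z)\<^sup>2), 0, 1:] (Re z) = 0" using True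
        unfolding cmod_power2 by (simp add: power2_eq_square)
      then have "algebraic_int (Re z)"
        by (intro algebraic_int.intros[of "[:- ((cmod z)\<^sup>2), 0, 1:]"]) (use that in \<open>auto simp: coeff_pCons split: nat.splits\<close>)
      moreover have "Re z \<in> \<rat>" using Rats_imp_Re[OF R] by simp
      ultimately have "Re z \<in> \<int>" by (rule rational_algebraic_int_is_int)
      moreover have "z = of_real (Re z)" using True by (simp add: complex_eq_iff)
      ultimately show ?thesis by (metis Ints_cases Ints_of_int of_real_of_int_eq)
    qed
    moreover have "2 * Re z \<in> \<int> \<and> (cmod z)\<^sup>2 \<in> \<int>" if "z \<in> \<int>"
      using that by (auto elim!: Ints_cases)
    ultimately show ?thesis using zK * by (auto simp: OK_def)
  next
    case False
    have "algebraic_int z" if "2 * Re z \<in> \<int>" "(cmod z)\<^sup>2 \<in> \<int>"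
    proof (rule algebraic_int.intros[of "[:of_real ((cmod z)\<^sup>2), - of_real (2 * Re z), 1:]"])
      have 1: "of_real x \<in> (\<int> :: complex set)" if "x \<in> \<int>" for x
        using that by (auto elim!: Ints_cases)
      show "\<forall>i. Polynomial.coeff [:of_real ((cmod z)\<^sup>2), - of_real (2 * Re z), 1:] i \<in> (\<int> :: complex set)"
        using that[THEN 1] by (auto simp: coeff_pCons simp del: of_real_mult of_real_power split: nat.splits)
      show "poly [:of_real ((cmod z)\<^sup>2), - of_real (2 * Re z), 1:] z = 0"
        unfolding cmod_power2 by (simp add: complex_eq_iff power2_eq_square algebra_simps)
    qed simp
    then show ?thesis using quadratic_algebraic_int[OF _ False TN] zK by (auto simp: OK_def)
  qed
qed (simp add: OK_def)

lemma OK_K: "z \<in> OK \<Longrightarrow> z \<in> K" by (simp add: OK_def)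

lemma OK_cnj: "z \<in> OK \<Longrightarrow> cnj z \<in> OK"
  by (auto simp: OK_iff K_cnj)

lemma OK_uminus: "z \<in> OK \<Longrightarrow> - z \<in> OK"
  by (auto simp: OK_iff K_uminus)

lemma OK_of_int: "of_int n \<in> OK"
  by (auto simp: OK_def K_of_int)

text \<open>The traces of \<open>z * w\<close> and of \<open>z * cnj w\<close> are the two roots of
  a monic quadratic with integer coefficients, and rational roots of it are integers. The case of
  the product \<open>z * w\<close> serves \<open>OK_mult\<close>; the case with \<open>cnj w\<close>
  in place of \<open>w\<close> serves \<open>OK_add\<close>.\<close>

lemma OK_mult_real_part:
  assumes z: "z \<in> OK" and w: "w \<in> OK"
  shows "2 * Re (z * w) \<in> \<int>"
proof -
  define \<tau> \<tau>' where "\<tau> = 2 * Re (z * w)" and "\<tau>' = 2 * Re (z * cnj w)"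
  have Z: "2 * Re z \<in> \<int>" "(cmod z)\<^sup>2 \<in> \<int>" "2 * Re w \<in> \<int>" "(cmod w)\<^sup>2 \<in> \<int>"
    using z w by (auto simp: OK_iff)
  have s: "\<tau> + \<tau>' = (2 * Re z) * (2 * Re w)"
    by (simp add: \<tau>_def \<tau>'_def)
  have p: "\<tau> * \<tau>' = (cmod w)\<^sup>2 * ((2 * Re z)^2 - 2 * (cmod z)\<^sup>2) + (cmod z)\<^sup>2 * ((2 * Re w)^2 - 2 * (cmod w)\<^sup>2)"
    unfolding \<tau>_def \<tau>'_def cmod_power2 by (simp add: power2_eq_square algebra_simps)
  define P S where "P = \<tau> * \<tau>'" and "S = \<tau> + \<tau>'"
  have root: "poly [:P, - S, 1:] \<tau> = 0" by (simp add: P_def S_def algebra_simps)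
  have "P \<in> \<int>" unfolding P_def p by (intro Ints_add Ints_mult[OF Z(4)] Ints_mult[OF Z(2)] Ints_diff
        Ints_power Z Ints_mult[OF Ints_numeral])
  moreover have "S \<in> \<int>" unfolding S_def s by (intro Ints_mult Z)
  ultimately have "\<forall>i. Polynomial.coeff [:P, - S, 1:] i \<in> \<int>"
    by (auto simp: coeff_pCons split: nat.splits)
  then have "algebraic_int \<tau>"
    by (intro algebraic_int.intros[OF _ _ root]) simp_all
  moreover have "\<tau> \<in> \<rat>" unfolding \<tau>_def
    using K_trace_norm(1)[of "z * w"] z w by (auto simp: OK_def K_mult)
  ultimately show ?thesis unfolding \<tau>_def by (rule rational_algebraic_int_is_int)
qed

lemma OK_mult: "z \<in> OK \<Longrightarrow> w \<in> OK \<Longrightarrow> z * w \<in> OK"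
  using OK_mult_real_part[of z w]
  by (subst OK_iff) (auto simp: OK_K K_mult norm_mult power_mult_distrib, auto simp: OK_iff)

lemma OK_add:
  assumes z: "z \<in> OK" and w: "w \<in> OK" shows "z + w \<in> OK"
proof -
  have "(cmod (z + w))\<^sup>2 = (cmod z)\<^sup>2 + (cmod w)\<^sup>2 + 2 * Re (z * cnj w)"
    unfolding cmod_power2 by (simp add: power2_eq_square algebra_simps)
  moreover have "2 * Re (z * cnj w) \<in> \<int>" by (intro OK_mult_real_part OK_cnj z w)
  ultimately show ?thesis using z w by (auto simp: OK_iff K_add algebra_simps)
qed

lemma OK_diff: "z \<in> OK \<Longrightarrow> w \<in> OK \<Longrightarrow> z - w \<in> OK"
  using OK_add[of z "-w"] OK_uminus by simp

lemma OK_real: "z \<in> OK \<Longrightarrow> Im z = 0 \<Longrightarrow> z \<in> \<int>"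
  using K_real_Rats[of z] rational_algebraic_int_is_int[of z] by (auto simp: OK_def)

lemma K_quotient:
  assumes "z \<in> K" obtains n :: int where "n > 0" "of_int n * z \<in> OK"
proof -
  obtain t s where s: "(s::int) > 0" "2 * Re z = of_int t / of_int s"
    by (rule Rats_cases'[OF K_trace_norm(1)[OF assms]])
  obtain n s' where s': "(s'::int) > 0" "(cmod z)\<^sup>2 = of_int n / of_int s'"
    by (rule Rats_cases'[OF K_trace_norm(2)[OF assms]])
  have "2 * Re (of_int (s * s') * z) = of_int (t * s')"
    using s(1) by (simp add: s(2) mult.left_commute)
  moreover have "(cmod (of_int (s * s') * z))\<^sup>2 = of_int (n * s' * s ^ 2)"
    unfolding norm_mult power_mult_distrib s'(2) using s'(1)
    by (simp add: power2_eq_square norm_mult)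
  ultimately have "of_int (s * s') * z \<in> OK"
    using assms by (subst OK_iff) (metis Ints_of_int K_mult K_of_int)
  then show ?thesis using s s' by (intro that[of "s * s'"]) auto
qed

text \<open>An integer of least positive imaginary part; together with \<open>1\<close> it is an integral basis.\<close>

definition om :: complex where
  "om = (SOME z. z \<in> OK \<and> Im z > 0 \<and> (\<forall>z'\<in>OK. Im z' > 0 \<longrightarrow> Im z \<le> Im z'))"

lemma om: "om \<in> OK" "Im om > 0" "\<And>z. z \<in> OK \<Longrightarrow> Im z > 0 \<Longrightarrow> Im om \<le> Im z"
proof -
  \<comment> \<open>For integers of the field, \<open>4 (Im z)^2\<close> is four times the norm
    minus the squared trace, a natural number; so a least positive imaginary part exists.\<close>
  define f where "f = (\<lambda>z. nat \<lfloor>4 * (Im z)\<^sup>2\<rfloor>)"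
  have f: "real (f z) = 4 * (Im z)\<^sup>2" if "z \<in> OK" for z
  proof -
    have "4 * (Im z)\<^sup>2 = 4 * (cmod z)\<^sup>2 - (2 * Re z)\<^sup>2"
      unfolding cmod_power2 by (simp add: power_mult_distrib)
    also have "\<dots> \<in> \<int>"
      using that unfolding OK_iff power2_eq_square by (metis Ints_diff Ints_mult Ints_numeral)
    finally obtain n where "4 * (Im z)\<^sup>2 = of_int n" by (auto elim: Ints_cases)
    moreover from this have "n \<ge> 0" by (metis of_int_0_le_iff zero_le_mult_iff zero_le_numeral zero_le_power2)
    ultimately show ?thesis by (simp add: f_def)
  qed
  obtain \<theta> where th: "\<theta> \<in> K" "Im \<theta> \<noteq> 0" by (rule ex_nonreal)
  obtain n :: int where n: "n > 0" "of_int n * \<theta> \<in> OK" by (rule K_quotient[OF th(1)])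
  have "\<exists>z. z \<in> OK \<and> Im z > 0"
  proof (cases "Im \<theta> > 0")
    case True then show ?thesis using n by (intro exI[of _ "of_int n * \<theta>"]) auto
  next
    case False then show ?thesis using n th OK_uminus[OF n(2)]
      by (intro exI[of _ "- (of_int n * \<theta>)"]) (auto simp: mult_pos_neg)
  qed
  then obtain z where z: "z \<in> OK" "Im z > 0" "\<And>y. y \<in> OK \<and> Im y > 0 \<Longrightarrow> f z \<le> f y"
    using ex_has_least_nat[of "\<lambda>z. z \<in> OK \<and> Im z > 0" _ f] by blast
  have "Im z \<le> Im z'" if "z' \<in> OK" "Im z' > 0" for z'
  proof -
    have "real (f z) \<le> real (f z')" using z(3) that by simp
    then have "(Im z)\<^sup>2 \<le> (Im z')\<^sup>2" using f z that by simp
    then show ?thesis using that by (meson less_imp_le power2_le_imp_le)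
  qed
  with z(1,2) have "\<exists>z. z \<in> OK \<and> Im z > 0 \<and> (\<forall>z'\<in>OK. Im z' > 0 \<longrightarrow> Im z \<le> Im z')" by blast
  from someI_ex[OF this] show "om \<in> OK" "Im om > 0" "\<And>z. z \<in> OK \<Longrightarrow> Im z > 0 \<Longrightarrow> Im om \<le> Im z"
    unfolding om_def by auto
qed

text \<open>Euclidean division of imaginary parts: the remainder has imaginary part in
  \<open>[0, Im om)\<close>, which is 0 by minimality, and a real integer of the field is
  rational.\<close>

lemma OK_decomp: "z \<in> OK \<longleftrightarrow> (\<exists>x y :: int. z = of_int x + of_int y * om)"
proof
  assume z: "z \<in> OK"
  define y where "y = \<lfloor>Im z / Im om\<rfloor>"
  define r where "r = z - of_int y * om"
  have r: "r \<in> OK" unfolding r_def by (intro OK_diff OK_mult OK_of_int z om)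
  have "of_int y \<le> Im z / Im om" "Im z / Im om < of_int y + 1" unfolding y_def by linarith+
  then have "Im r \<ge> 0" "Im r < Im om" using om(2) by (auto simp: r_def field_simps)
  with om(3)[OF r] have "Im r = 0" by force
  from OK_real[OF r this] obtain x where "r = of_int x" by (auto elim: Ints_cases)
  then have "z = of_int x + of_int y * om" by (simp add: r_def algebra_simps)
  then show "\<exists>x y :: int. z = of_int x + of_int y * om" by blast
qed (auto intro!: OK_add OK_mult OK_of_int om)

end

section \<open>Plane lattices and their covolume\<close>

definition lat :: "complex \<Rightarrow> complex \<Rightarrow> complex set" where
  "lat a b = {of_int x * a + of_int y * b | x y. True}"

lemma lat_memI: "of_int x * a + of_int y * b \<in> lat a b"
  by (auto simp: lat_def)

lemma lat_base: "a \<in> lat a b" "b \<in> lat a b"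
  using lat_memI[of 1 a 0 b] lat_memI[of 0 a 1 b] by auto

text \<open>\<open>Im (cnj a * b)\<close> is the determinant of \<open>a\<close>, \<open>b\<close>
  as vectors of the real plane, and \<open>k\<close> is the determinant of the integer matrix that
  expresses \<open>a'\<close>, \<open>b'\<close> by \<open>a\<close>, \<open>b\<close>.\<close>

lemma lat_covol_multiple:
  assumes "lat a' b' \<subseteq> lat a b"
  obtains k :: int where "Im (cnj a' * b') = of_int k * Im (cnj a * b)"
proof -
  obtain x y where a: "a' = of_int x * a + of_int y * b" using subsetD[OF assms lat_base(1)] by (auto simp: lat_def)
  obtain z w where b: "b' = of_int z * a + of_int w * b" using subsetD[OF assms lat_base(2)] by (auto simp: lat_def)
  show ?thesis
    by (rule that[of "x * w - y * z"]) (simp add: a b algebra_simps)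
qed

text \<open>Each determinant is an integer multiple of the other. Norms of ideals can therefore be
  read off any basis, and not only the triangular one of \<open>ideal_hermite\<close>.\<close>

lemma lat_covol_unique:
  assumes "lat a b = lat a' b'"
  shows "\<bar>Im (cnj a * b)\<bar> = \<bar>Im (cnj a' * b')\<bar>"
proof -
  obtain k where k: "Im (cnj a * b) = of_int k * Im (cnj a' * b')"
    using lat_covol_multiple[of a b a' b'] assms by auto
  obtain l where l: "Im (cnj a' * b') = of_int l * Im (cnj a * b)"
    using lat_covol_multiple[of a' b' a b] assms by auto
  show ?thesis
  proof (cases "Im (cnj a * b) = 0")
    case False
    with k l have "of_int k * of_int l = (1 :: real)"
      by (metis mult.assoc mult_cancel_right1)
    then have "k * l = 1" by (metis of_int_eq_1_iff of_int_mult)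
    then have "\<bar>k\<bar> = 1" using abs_zmult_eq_1[of k l] by simp
    then have "\<bar>of_int k :: real\<bar> = 1" by (metis of_int_1 of_int_abs)
    then show ?thesis unfolding k abs_mult by simp
  qed (use l in simp)
qed

lemma lat_scale: "(\<lambda>z. c * z) ` lat a b = lat (c * a) (c * b)"
proof -
  have "c * (of_int x * a + of_int y * b) = of_int x * (c * a) + of_int y * (c * b)" for x y
    by (simp add: algebra_simps)
  then show ?thesis unfolding lat_def by (auto simp: image_iff) metis
qed

lemma int_subgroup:
  fixes S :: "int set"
  assumes "0 \<in> S" "\<And>x y. x \<in> S \<Longrightarrow> y \<in> S \<Longrightarrow> x + y \<in> S" "\<And>x. x \<in> S \<Longrightarrow> - x \<in> S" "\<exists>x\<in>S. x > 0"
  obtains g where "g > 0" "S = {k * g |k. True}"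
proof -
  obtain g where g: "g \<in> S" "g > 0" "\<And>y. y \<in> S \<and> y > 0 \<Longrightarrow> nat g \<le> nat y"
    using ex_has_least_nat[of "\<lambda>x. x \<in> S \<and> x > 0" _ nat] assms(4) by blast
  have mult: "of_nat n * g \<in> S" for n by (induct n) (auto simp: assms g algebra_simps)
  have mult: "k * g \<in> S" for k
    by (cases k) (use mult assms(3) in \<open>auto simp del: of_nat_Suc\<close>)
  have "g dvd x" if "x \<in> S" for x
  proof -
    have "x mod g = x + (- (x div g)) * g" by (simp add: minus_div_mult_eq_mod[symmetric])
    also have "\<dots> \<in> S" by (intro assms(2) that mult)
    finally have "x mod g \<in> S" .
    moreover have "0 \<le> x mod g" "x mod g < g" using g(2) by auto
    ultimately have "x mod g = 0" using g(3)[of "x mod g"] by force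
    then show ?thesis by auto
  qed
  then have "S = {k * g |k. True}" using mult by (auto simp: dvd_def mult.commute)
  with g(2) show ?thesis by (rule that)
qed

section \<open>Ideals as plane lattices, and their norms\<close>

context imag_quad begin

text \<open>The notion of ideal without ring records. Closure under negation is contained in the
  last clause, as \<open>-1 \<in> OK\<close>.\<close>

definition is_ideal :: "complex set \<Rightarrow> bool" where
  "is_ideal I \<longleftrightarrow> I \<subseteq> OK \<and> 0 \<in> I \<and> (\<forall>x\<in>I. \<forall>y\<in>I. x + y \<in> I) \<and> (\<forall>x\<in>I. \<forall>c\<in>OK. c * x \<in> I)"

lemma roi: "ring_of_integers K = ring_of_type_algebra \<lparr>carrier := OK\<rparr>"
  by (simp add: ring_of_integers_def OK_def)

lemma OK_1: "1 \<in> OK"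
  using OK_of_int[of 0] OK_of_int[of 1] by auto

lemma ring_uminus: "\<ominus>\<^bsub>ring_of_type_algebra\<^esub> x = - (x::complex)"
proof -
  interpret R: field "ring_of_type_algebra :: complex ring" by (rule field_from_type_algebra)
  show ?thesis by (rule R.minus_equality) (auto simp: ring_of_type_algebra_def)
qed

lemma ring_roi: "ring (ring_of_integers K)"
proof -
  interpret R: field "ring_of_type_algebra :: complex ring" by (rule field_from_type_algebra)
  have "subring OK ring_of_type_algebra"
    by (rule R.subringI) (auto simp: ring_uminus OK_uminus, auto simp: ring_of_type_algebra_def OK_1 OK_mult OK_add)
  then show ?thesis unfolding roi by (rule R.subring_is_ring)
qed

lemma ideal_iff: "ideal I (ring_of_integers K) \<longleftrightarrow> is_ideal I"
proof
  assume I: "ideal I (ring_of_integers K)"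
  note sub = ideal.axioms(1)[OF I]
  show "is_ideal I" unfolding is_ideal_def
    using additive_subgroup.a_subset[OF sub] additive_subgroup.zero_closed[OF sub]
      additive_subgroup.a_closed[OF sub] ideal.I_l_closed[OF I]
    by (auto simp: roi ring_of_type_algebra_def)
next
  assume I: "is_ideal I"
  interpret R: ring "ring_of_integers K" by (rule ring_roi)
  have um: "- x \<in> I" if "x \<in> I" for x
    using I that OK_of_int[of "-1"] by (force simp: is_ideal_def)
  have inv: "\<ominus>\<^bsub>ring_of_integers K\<^esub> x = - x" if "x \<in> OK" for x
    using R.minus_equality[of "-x" x] that OK_uminus[OF that]
    by (auto simp: roi ring_of_type_algebra_def)
  have "subgroup I (add_monoid (ring_of_integers K))"
  proof (rule R.add.subgroupI)
    show "I \<subseteq> carrier (ring_of_integers K)" "I \<noteq> {}" using I by (auto simp: is_ideal_def carrier_OK)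
    show "\<ominus>\<^bsub>ring_of_integers K\<^esub> a \<in> I" if "a \<in> I" for a
      using that I um inv[of a] by (auto simp: is_ideal_def)
    show "a \<oplus>\<^bsub>ring_of_integers K\<^esub> b \<in> I" if "a \<in> I" "b \<in> I" for a b
      using that I by (auto simp: is_ideal_def roi ring_of_type_algebra_def)
  qed
  then show "ideal I (ring_of_integers K)"
    by (intro idealI ring_roi) (use I in \<open>auto simp: is_ideal_def, auto simp: roi ring_of_type_algebra_def mult.commute\<close>)
qed

definition NI :: "complex set set" where "NI = {I. is_ideal I \<and> I \<noteq> {0}}"

lemma nonzero_ideals_eq: "nonzero_ideals K = NI"
  by (simp add: nonzero_ideals_def NI_def ideal_iff)

abbreviation nrm :: "complex set \<Rightarrow> nat" where "nrm \<equiv> ideal_norm K"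

lemma ideal_norm_eq: "nrm I = card ((\<lambda>z. (\<lambda>i. i + z) ` I) ` OK)"
proof -
  have "carrier (ring_of_integers K Quot I) = (\<lambda>z. (\<lambda>i. i + z) ` I) ` OK"
    unfolding FactRing_def A_RCOSETS_def' a_r_coset_def' by (auto simp: roi ring_of_type_algebra_def)
  then show ?thesis by (simp add: ideal_norm_def)
qed

lemma is_ideal_uminus: "is_ideal I \<Longrightarrow> x \<in> I \<Longrightarrow> - x \<in> I"
  using OK_of_int[of "-1"] by (force simp: is_ideal_def)

lemma is_ideal_add: "is_ideal I \<Longrightarrow> x \<in> I \<Longrightarrow> y \<in> I \<Longrightarrow> x + y \<in> I"
  by (auto simp: is_ideal_def)

lemma is_ideal_diff: "is_ideal I \<Longrightarrow> x \<in> I \<Longrightarrow> y \<in> I \<Longrightarrow> x - y \<in> I"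
  using is_ideal_add[of I x "-y"] is_ideal_uminus by auto

lemma is_ideal_mult: "is_ideal I \<Longrightarrow> x \<in> I \<Longrightarrow> c \<in> OK \<Longrightarrow> c * x \<in> I"
  by (auto simp: is_ideal_def)

lemma is_ideal_OK: "is_ideal I \<Longrightarrow> x \<in> I \<Longrightarrow> x \<in> OK"
  by (auto simp: is_ideal_def)

lemma coset_eq_iff:
  assumes "is_ideal I"
  shows "(\<lambda>i. i + z) ` I = (\<lambda>i. i + z') ` I \<longleftrightarrow> z - z' \<in> I"
proof
  assume "(\<lambda>i. i + z) ` I = (\<lambda>i. i + z') ` I"
  moreover have "z \<in> (\<lambda>i. i + z) ` I" using assms by (auto simp: is_ideal_def image_iff)
  ultimately show "z - z' \<in> I" by auto
next
  assume z: "z - z' \<in> I"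
  have 1: "i + z = (i + (z - z')) + z'" and 2: "i + z' = (i - (z - z')) + z" for i by simp_all
  have "i + z \<in> (\<lambda>i. i + z') ` I" if "i \<in> I" for i
    by (subst 1) (intro imageI is_ideal_add assms that z)
  moreover have "i + z' \<in> (\<lambda>i. i + z) ` I" if "i \<in> I" for i
    by (subst 2) (intro imageI is_ideal_diff assms that z)
  ultimately show "(\<lambda>i. i + z) ` I = (\<lambda>i. i + z') ` I" by blast
qed

lemma om_coord_unique:
  assumes "of_int x + of_int y * om = of_int x' + of_int y' * om"
  shows "x = x'" "y = y'"
proof -
  have "of_int y * Im om = of_int y' * Im om" using arg_cong[OF assms, of Im] by simp
  then show y: "y = y'" using om(2) by simp
  show "x = x'" using assms y by simp
qed

text \<open>A triangular basis: \<open>a\<close> generates the rational integers in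
  \<open>I\<close>, and \<open>e\<close> generates the coordinates at \<open>om\<close> of its
  elements. The rectangle \<open>[0, a) \<times> [0, e)\<close> of coordinates is then a system of
  representatives modulo \<open>I\<close>.\<close>

lemma ideal_hermite:
  assumes I: "I \<in> NI"
  obtains a c e :: int where "a > 0" "e > 0" "0 \<le> c" "c < a"
    "I = lat (of_int a) (of_int c + of_int e * om)" "nrm I = nat (a * e)"
proof -
  have id: "is_ideal I" using I by (simp add: NI_def)
  define S1 where "S1 = {n :: int. of_int n \<in> I}"
  define S2 where "S2 = {y :: int. \<exists>x :: int. of_int x + of_int y * om \<in> I}"
  obtain x where x: "x \<in> I" "x \<noteq> 0" using I id by (auto simp: NI_def is_ideal_def)
  have "(cmod x)\<^sup>2 \<in> \<int>" using is_ideal_OK[OF id x(1)] by (simp add: OK_iff)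
  then obtain n where n: "(cmod x)\<^sup>2 = of_int n" by (auto elim: Ints_cases)
  have "n > 0" using x(2) n by (metis of_int_0_less_iff zero_less_norm_iff zero_less_power)
  \<comment> \<open>The norm of a nonzero element is a positive rational integer in
    \<open>I\<close>, so \<open>S1\<close> is not trivial.\<close>
  have "of_int n = cnj x * x" using n
    by (metis complex_norm_square mult.commute of_real_of_int_eq)
  then have nI: "of_int n \<in> I" using is_ideal_mult[OF id x(1)] OK_cnj is_ideal_OK[OF id x(1)] by simp
  obtain a where a: "a > 0" "S1 = {k * a |k. True}"
  proof (rule int_subgroup[of S1])
    show "\<exists>x\<in>S1. 0 < x" using nI \<open>n > 0\<close> by (auto simp: S1_def)
  qed (use id in \<open>auto simp: S1_def is_ideal_def is_ideal_uminus[OF id]\<close>)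
  obtain e where e: "e > 0" "S2 = {k * e |k. True}"
  proof (rule int_subgroup[of S2])
    show "0 \<in> S2" using id by (auto simp: S2_def is_ideal_def intro!: exI[of _ 0])
    show "\<exists>x\<in>S2. 0 < x" using is_ideal_mult[OF id nI om(1)] \<open>n > 0\<close>
      by (intro bexI[of _ n]) (auto simp: S2_def mult.commute intro!: exI[of _ 0])
    show "x + y \<in> S2" if "x \<in> S2" "y \<in> S2" for x y
    proof -
      from that obtain x' y' where "of_int x' + of_int x * om \<in> I" "of_int y' + of_int y * om \<in> I"
        by (auto simp: S2_def)
      from is_ideal_add[OF id this] show ?thesis
        unfolding S2_def by (auto intro!: exI[of _ "x' + y'"] simp: algebra_simps)
    qed
    show "- x \<in> S2" if "x \<in> S2" for x
    proof -
      from that obtain x' where "of_int x' + of_int x * om \<in> I" by (auto simp: S2_def)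
      from is_ideal_uminus[OF id this] show ?thesis
        unfolding S2_def by (auto intro!: exI[of _ "- x'"] simp: algebra_simps)
    qed
  qed
  have aI: "of_int k * of_int a \<in> I" for k
  proof -
    have "k * a \<in> S1" using a(2) by auto
    then show ?thesis by (simp add: S1_def)
  qed
  have "1 * e \<in> S2" using e(2) by blast
  then obtain c0 where c0: "of_int c0 + of_int e * om \<in> I" by (auto simp: S2_def)
  \<comment> \<open>Reduction modulo \<open>a\<close> leaves finitely many \<open>c\<close>; the
    finiteness of the set of ideals of bounded norm rests on this.\<close>
  define c where "c = c0 mod a"
  define b where "b = of_int c + of_int e * om"
  have "b = (of_int c0 + of_int e * om) - of_int (c0 div a) * of_int a"
    unfolding b_def c_def minus_div_mult_eq_mod[symmetric] by simp
  then have b: "b \<in> I" using is_ideal_diff[OF id c0 aI] by simp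
  have red: "of_int x + of_int y * om \<in> I \<longleftrightarrow> (\<exists>k l. y = l * e \<and> x = k * a + l * c)" for x y
  proof
    assume xy: "of_int x + of_int y * om \<in> I"
    then have "y \<in> S2" by (auto simp: S2_def)
    then obtain l where l: "y = l * e" using e by auto
    have "of_int (x - l * c) = (of_int x + of_int y * om) - of_int l * b"
      by (simp add: l b_def algebra_simps)
    also have "\<dots> \<in> I" by (intro is_ideal_diff id xy is_ideal_mult b OK_of_int)
    finally have "x - l * c \<in> S1" by (simp only: S1_def mem_Collect_eq)
    then obtain k where "x - l * c = k * a" using a by auto
    then have "x = k * a + l * c" by simp
    with l show "\<exists>k l. y = l * e \<and> x = k * a + l * c" by blast
  next
    assume "\<exists>k l. y = l * e \<and> x = k * a + l * c"
    then obtain k l where kl: "y = l * e" "x = k * a + l * c" by blast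
    have "of_int x + of_int y * om = of_int k * of_int a + of_int l * b"
      by (simp add: kl b_def algebra_simps)
    also have "\<dots> \<in> I" by (intro is_ideal_add id aI is_ideal_mult b OK_of_int)
    finally show "of_int x + of_int y * om \<in> I" .
  qed
  have Ilat: "I = lat (of_int a) b"
  proof (intro equalityI subsetI)
    fix z assume z: "z \<in> I"
    then obtain x y where xy: "z = of_int x + of_int y * om" using is_ideal_OK[OF id] OK_decomp by metis
    with z red obtain k l where kl: "y = l * e" "x = k * a + l * c" by blast
    have "z = of_int k * of_int a + of_int l * b" by (simp add: xy kl b_def algebra_simps)
    then show "z \<in> lat (of_int a) b" by (simp add: lat_memI)
  next
    fix z assume "z \<in> lat (of_int a) b"
    then show "z \<in> I" by (auto simp: lat_def intro!: is_ideal_add id aI is_ideal_mult b OK_of_int)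
  qed
  define coset where "coset = (\<lambda>z. (\<lambda>i. i + z) ` I)"
  define R where "R = {0..<a} \<times> {0..<e}"
  define el where "el = (\<lambda>(x::int, y::int). of_int x + of_int y * om)"
  have "coset ` OK = coset ` el ` R"
  proof (intro equalityI subsetI)
    fix C assume "C \<in> coset ` OK"
    then obtain x y where xy: "C = coset (of_int x + of_int y * om)" using OK_decomp by auto
    \<comment> \<open>Division with remainder by the triangular basis. The coordinate at
      \<open>om\<close> is reduced first, because this changes the other one by
      \<open>l * c\<close>.\<close>
    define l where "l = y div e"
    define k where "k = (x - l * c) div a"
    define x' where "x' = (x - l * c) mod a"
    define y' where "y' = y mod e"
    have 1: "x - x' = k * a + l * c" unfolding x'_def k_def by (simp add: minus_mod_eq_div_mult algebra_simps)
    have 2: "y - y' = l * e" unfolding y'_def l_def by (simp add: minus_mod_eq_div_mult)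
    have "of_int (x - x') + of_int (y - y') * om \<in> I" using red 1 2 by blast
    then have "(of_int x + of_int y * om) - el (x', y') \<in> I" by (simp add: el_def algebra_simps)
    then have "C = coset (el (x', y'))" unfolding xy coset_def using coset_eq_iff[OF id] by blast
    moreover have "(x', y') \<in> R" using a(1) e(1) by (simp add: R_def x'_def y'_def)
    ultimately show "C \<in> coset ` el ` R" by blast
  next
    fix C assume "C \<in> coset ` el ` R"
    then show "C \<in> coset ` OK" using OK_decomp by (auto simp: el_def)
  qed
  moreover have "inj_on (coset \<circ> el) R"
  proof (rule inj_onI)
    fix p q assume p: "p \<in> R" and q: "q \<in> R" and eq: "(coset \<circ> el) p = (coset \<circ> el) q"
    obtain x y where p': "p = (x, y)" by force
    obtain x' y' where q': "q = (x', y')" by force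
    from eq have "el p - el q \<in> I" by (simp add: coset_def coset_eq_iff[OF id])
    then have "of_int (x - x') + of_int (y - y') * om \<in> I" by (simp add: p' q' el_def algebra_simps)
    with red obtain k l where kl: "y - y' = l * e" "x - x' = k * a + l * c" by blast
    have "\<bar>l * e\<bar> < e" using p q kl(1)[symmetric] by (auto simp: p' q' R_def)
    then have l: "l = 0" using e(1) by (simp add: abs_mult)
    then have "\<bar>k * a\<bar> < a" using p q kl(2)[symmetric] by (auto simp: p' q' R_def)
    then have "k = 0" using a(1) by (simp add: abs_mult)
    with l kl show "p = q" by (simp add: p' q')
  qed
  ultimately have "nrm I = card R"
    unfolding ideal_norm_eq coset_def[symmetric] by (metis card_image image_comp)
  also have "\<dots> = nat (a * e)" using a(1) e(1) by (simp add: R_def nat_mult_distrib)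
  finally show ?thesis using Ilat a(1) e(1) by (intro that[of a e c]) (auto simp: c_def b_def)
qed

lemma ideal_lat:
  assumes I: "I \<in> NI"
  obtains a b where "I = lat a b" "\<bar>Im (cnj a * b)\<bar> = real (nrm I) * Im om"
proof -
  obtain a c e :: int where h: "a > 0" "e > 0" "0 \<le> c" "c < a"
    "I = lat (of_int a) (of_int c + of_int e * om)" "nrm I = nat (a * e)"
    by (rule ideal_hermite[OF I])
  show ?thesis using h om(2) by (intro that[OF h(5)]) (simp add: abs_mult)
qed

lemma nrm_pos: "I \<in> NI \<Longrightarrow> nrm I > 0"
  by (erule ideal_hermite) simp

lemma nrm_lat:
  assumes "lat a b \<in> NI"
  shows "\<bar>Im (cnj a * b)\<bar> = real (nrm (lat a b)) * Im om"
  using ideal_lat[OF assms] lat_covol_unique by metis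

text \<open>Multiplication by \<open>lm\<close> scales areas by \<open>(cmod lm)^2\<close>, and the
  norm of an ideal is its covolume in units of \<open>Im om\<close>.\<close>

lemma scale_ideal:
  assumes J: "J \<in> NI" and l: "lm \<noteq> 0" and sub: "(\<lambda>z. lm * z) ` J \<subseteq> OK"
  shows "(\<lambda>z. lm * z) ` J \<in> NI" "real (nrm ((\<lambda>z. lm * z) ` J)) = (cmod lm)\<^sup>2 * real (nrm J)"
proof -
  have id: "is_ideal J" using J by (simp add: NI_def)
  have add: "lm * x + lm * y = lm * (x + y)" and mul: "c * (lm * x) = lm * (c * x)" for c x y
    by (simp_all add: algebra_simps)
  have "is_ideal ((\<lambda>z. lm * z) ` J)"
    using sub id unfolding is_ideal_def by (auto simp: add mul)
  moreover have "(\<lambda>z. lm * z) ` J \<noteq> {0}"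
  proof -
    obtain x where "x \<in> J" "x \<noteq> 0" using J id by (auto simp: NI_def is_ideal_def)
    with l have "lm * x \<in> (\<lambda>z. lm * z) ` J" "lm * x \<noteq> 0" by auto
    then show ?thesis by (metis singletonD)
  qed
  ultimately show N: "(\<lambda>z. lm * z) ` J \<in> NI" by (simp add: NI_def)
  obtain a b where ab: "J = lat a b" "\<bar>Im (cnj a * b)\<bar> = real (nrm J) * Im om"
    by (rule ideal_lat[OF J])
  have im: "Im (cnj (lm * a) * (lm * b)) = (cmod lm)\<^sup>2 * Im (cnj a * b)"
    unfolding cmod_power2 by (simp add: power2_eq_square algebra_simps)
  have "(\<lambda>z. lm * z) ` J = lat (lm * a) (lm * b)" by (simp add: ab lat_scale)
  with N nrm_lat[of "lm * a" "lm * b"] have "real (nrm ((\<lambda>z. lm * z) ` J)) * Im om = (cmod lm)\<^sup>2 * \<bar>Im (cnj a * b)\<bar>"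
    unfolding im by (simp add: abs_mult)
  then have "real (nrm ((\<lambda>z. lm * z) ` J)) * Im om = ((cmod lm)\<^sup>2 * real (nrm J)) * Im om"
    unfolding ab(2) by simp
  then show "real (nrm ((\<lambda>z. lm * z) ` J)) = (cmod lm)\<^sup>2 * real (nrm J)"
    using om(2) by simp
qed

text \<open>The fractional ideal \<open>J\<^sup>-\<^sup>1\<close> is \<open>cnj J / N J\<close>. This uses no factorisation of ideals: as the imaginary
  part of an integer is a multiple of that of \<^term>\<open>om\<close>, membership \<open>lm J \<subseteq> OK\<close> can be read off the
  imaginary parts of \<open>lm a\<close> and \<open>lm b\<close> for a \<open>\<int>\<close>-basis \<open>a\<close>, \<open>b\<close> of \<open>J\<close>.\<close>

lemma ideal_inverse:
  assumes J: "J \<in> NI"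
  shows "(\<lambda>z. lm * z) ` J \<subseteq> OK \<longleftrightarrow> cnj lm * of_nat (nrm J) \<in> J"
proof -
  have id: "is_ideal J" using J by (simp add: NI_def)
  obtain a b where ab: "J = lat a b" "\<bar>Im (cnj a * b)\<bar> = real (nrm J) * Im om"
    by (rule ideal_lat[OF J])
  define V where "V = Im (cnj a * b)"
  have V: "V \<noteq> 0" using ab nrm_pos[OF J] om(2) by (auto simp: V_def)
  obtain s :: int where s: "V = of_int s * real (nrm J) * Im om" "s * s = 1"
  proof (cases "V \<ge> 0")
    case True then show ?thesis using ab(2) by (intro that[of 1]) (auto simp: V_def)
  next
    case False then show ?thesis using ab(2) by (intro that[of "-1"]) (auto simp: V_def)
  qed
  \<comment> \<open>Cramer's rule for \<open>cnj lm\<close> in terms of \<open>a\<close> and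
    \<open>b\<close>: the coefficients are the imaginary parts of \<open>lm * a\<close> and
    \<open>lm * b\<close>, so integrality of the coordinates of \<open>cnj lm * N J\<close> can be
    compared with them.\<close>
  have key: "of_real (Im (lm * a)) * b - of_real (Im (lm * b)) * a = - cnj lm * of_real V"
    unfolding V_def by (simp add: complex_eq_iff algebra_simps)
  show ?thesis
  proof
    assume sub: "(\<lambda>z. lm * z) ` J \<subseteq> OK"
    have t: "\<exists>p :: int. Im z = of_int p * Im om" if "z \<in> OK" for z
      using that by (auto simp: OK_decomp)
    obtain p where p: "Im (lm * a) = of_int p * Im om" using t[of "lm * a"] sub ab(1) lat_base(1) by (meson image_subset_iff)
    obtain q where q: "Im (lm * b) = of_int q * Im om" using t[of "lm * b"] sub ab(1) lat_base(2) by (meson image_subset_iff)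
    have eq0: "of_real (Im om) * (of_int p * b - of_int q * a) = of_real (Im om) * (- of_int s * (cnj lm * of_nat (nrm J)))"
      using key unfolding p q s by (simp add: algebra_simps)
    then have eq: "of_int p * b - of_int q * a = - of_int s * (cnj lm * of_nat (nrm J))"
      using om(2) iffD1[OF mult_cancel_left eq0] by simp
    have "cnj lm * of_nat (nrm J) = of_int (s * s) * (cnj lm * of_nat (nrm J))" by (simp add: s(2))
    also have "\<dots> = - of_int s * (of_int p * b - of_int q * a)" unfolding eq by simp
    also have "\<dots> = of_int (s * q) * a + of_int (- s * p) * b" by (simp add: algebra_simps)
    finally show "cnj lm * of_nat (nrm J) \<in> J" using ab(1) by (simp only: lat_memI)
  next
    assume mem: "cnj lm * of_nat (nrm J) \<in> J"
    then obtain q p where qp: "cnj lm * of_nat (nrm J) = of_int q * a + of_int p * b"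
      using ab(1) by (auto simp: lat_def)
    have N: "of_real (of_nat (nrm J)) = (of_nat (nrm J) :: complex)" by simp
    define n where "n = real (nrm J)"
    have n: "n > 0" using nrm_pos[OF J] by (simp add: n_def)
    have V': "V = of_int s * n * Im om" using s by (simp add: n_def)
    have conj: "lm * of_real n = of_int q * cnj a + of_int p * cnj b"
      using arg_cong[OF qp, of cnj] by (simp add: n_def)
    have "Im (lm * of_real n * a) = - of_int p * V" "Im (lm * of_real n * b) = of_int q * V"
      unfolding conj V_def by (simp_all add: algebra_simps)
    then have nn: "n * Im (lm * a) = n * (of_int (- p * s) * Im om)" "n * Im (lm * b) = n * (of_int (q * s) * Im om)"
      unfolding V' by (simp_all add: algebra_simps)
    then have base: "Im (lm * a) = of_int (- p * s) * Im om" "Im (lm * b) = of_int (q * s) * Im om"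
      using iffD1[OF mult_cancel_left nn(1)] iffD1[OF mult_cancel_left nn(2)] n by (blast dest: less_imp_neq)+
    have ex: "\<exists>r :: int. Im (lm * x) = of_int r * Im om" if "x \<in> J" for x
    proof -
      from that ab(1) obtain k l where "x = of_int k * a + of_int l * b" by (auto simp: lat_def)
      then have "Im (lm * x) = of_int k * Im (lm * a) + of_int l * Im (lm * b)"
        by (simp add: algebra_simps)
      also have "\<dots> = of_int (k * (- p * s) + l * (q * s)) * Im om"
        unfolding base by (simp add: algebra_simps)
      finally show ?thesis by blast
    qed
    show "(\<lambda>z. lm * z) ` J \<subseteq> OK"
    proof safe
      fix x assume x: "x \<in> J"
      \<comment> \<open>With \<open>x\<close> also \<open>om * x\<close> lies in \<open>J\<close>.
        The imaginary parts of \<open>z = lm * x\<close> and of \<open>z * om\<close> determine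
        \<open>z\<close>, and as both are integer multiples of \<open>Im om\<close>, the coordinates
        of \<open>z\<close> at \<open>1\<close> and \<open>om\<close> are integers.\<close>
      obtain r where r: "Im (lm * x) = of_int r * Im om" using ex[OF x] by blast
      obtain r' where r': "Im (lm * (om * x)) = of_int r' * Im om"
        using ex[OF is_ideal_mult[OF id x om(1)]] by blast
      define z where "z = lm * x"
      have zo: "Im (z * om) = of_int r' * Im om" using r' by (simp add: z_def algebra_simps)
      have tr: "2 * Re om \<in> \<int>" using om(1) by (simp add: OK_iff)
      then obtain t :: int where t: "2 * Re om = of_int t" by (auto elim: Ints_cases)
      have "Re z * Im om + of_int r * Im om * Re om = of_int r' * Im om"
        using zo r by (simp add: z_def[symmetric])
      then have "(Re z + of_int r * Re om) * Im om = of_int r' * Im om" by (simp add: algebra_simps)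
      then have "Re z + of_int r * Re om = of_int r'" using om(2) by simp
      moreover have "Re z + of_int r * Re om = (Re z - of_int r * Re om) + of_int r * (2 * Re om)" by simp
      ultimately have re: "Re z - of_int r * Re om = of_int (r' - r * t)" unfolding t by simp
      have "z = of_int (r' - r * t) + of_int r * om"
        using re r by (simp add: complex_eq_iff z_def[symmetric] del: of_int_diff)
      then show "lm * x \<in> OK" unfolding z_def[symmetric] using OK_decomp by blast
    qed
  qed
qed

end

section \<open>Discriminant, units and ideal classes\<close>

context imag_quad begin

text \<open>Uniqueness of coordinates comes from the nonzero determinant: they are recovered from
  \<open>Im (cnj u * z)\<close> and \<open>Im (cnj v * z)\<close>. In the other direction the
  determinant agrees up to sign with that of the basis \<open>1\<close>, \<open>om\<close>.\<close>

lemma integral_basis_iff: "integral_basis K u v \<longleftrightarrow> OK = lat u v \<and> Im (cnj u * v) \<noteq> 0"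
proof
  assume "integral_basis K u v"
  then have ib: "u \<in> OK" "v \<in> OK" "\<And>z. z \<in> OK \<Longrightarrow> \<exists>!c :: int \<times> int. z = of_int (fst c) * u + of_int (snd c) * v"
    by (auto simp: integral_basis_def carrier_OK)
  have "OK \<subseteq> lat u v"
  proof
    fix z assume "z \<in> OK"
    from ib(3)[OF this] obtain c :: "int \<times> int" where "z = of_int (fst c) * u + of_int (snd c) * v" by auto
    then show "z \<in> lat u v" using lat_memI by simp
  qed
  moreover have "lat u v \<subseteq> OK" by (auto simp: lat_def intro!: OK_add OK_mult OK_of_int ib)
  ultimately have eq: "OK = lat u v" by auto
  have "OK = lat 1 om" using OK_decomp by (auto simp: lat_def)
  with eq have "lat u v = lat 1 om" by simp
  from lat_covol_unique[OF this] om(2) eq show "OK = lat u v \<and> Im (cnj u * v) \<noteq> 0" by auto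
next
  assume r: "OK = lat u v \<and> Im (cnj u * v) \<noteq> 0"
  have "\<exists>!c :: int \<times> int. z = of_int (fst c) * u + of_int (snd c) * v" if z: "z \<in> OK" for z
  proof -
    obtain x y where xy: "z = of_int x * u + of_int y * v" using z r by (auto simp: lat_def)
    show ?thesis
    proof (rule ex1I[of _ "(x, y)"])
      fix c :: "int \<times> int" assume c: "z = of_int (fst c) * u + of_int (snd c) * v"
      have "Im (cnj u * z) = of_int y * Im (cnj u * v)" unfolding xy by (simp add: algebra_simps)
      moreover have "Im (cnj u * z) = of_int (snd c) * Im (cnj u * v)" unfolding c by (simp add: algebra_simps)
      ultimately have y: "snd c = y" using r by simp
      have "Im (cnj v * z) = - of_int x * Im (cnj u * v)" unfolding xy by (simp add: algebra_simps)
      moreover have "Im (cnj v * z) = - of_int (fst c) * Im (cnj u * v)" unfolding c by (simp add: algebra_simps)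
      ultimately have x: "fst c = x" using r by simp
      show "c = (x, y)" using x y by (simp add: prod_eq_iff)
    qed (simp add: xy)
  qed
  then show "integral_basis K u v" using r lat_base by (auto simp: integral_basis_def carrier_OK)
qed

text \<open>By \<open>lat_covol_unique\<close> the squared determinant is the same for all integral
  bases, so the description by \<open>THE\<close> denotes. The result makes \<open>2 * Im om\<close>
  the square root of the absolute discriminant, the form in which it enters the analysis.\<close>

lemma discriminant_eq: "of_int (discriminant K) = - ((2 * Im om)\<^sup>2)"
proof -
  have OKl: "OK = lat 1 om" using OK_decomp by (auto simp: lat_def)
  have "4 * (Im om)\<^sup>2 = 4 * (cmod om)\<^sup>2 - (2 * Re om)\<^sup>2"
    unfolding cmod_power2 by (simp add: power_mult_distrib)
  also have "\<dots> \<in> \<int>" using om(1) unfolding OK_iff power2_eq_square by (metis Ints_diff Ints_mult Ints_numeral)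
  finally obtain n where n: "4 * (Im om)\<^sup>2 = of_int n" by (auto elim: Ints_cases)
  have sq: "(u * cnj v - v * cnj u)\<^sup>2 = of_real (- ((2 * Im (cnj u * v))\<^sup>2))" for u v
  proof -
    define t where "t = Im (cnj u * v)"
    have "u * cnj v - v * cnj u = - 2 * \<i> * of_real t"
      by (simp add: t_def complex_eq_iff algebra_simps)
    then show ?thesis unfolding t_def[symmetric] by (simp add: power_mult_distrib)
  qed
  have P: "(\<exists>u v. integral_basis K u v \<and> of_int D = (u * cnj v - v * cnj u)\<^sup>2) \<longleftrightarrow> D = - n" for D
  proof
    assume "\<exists>u v. integral_basis K u v \<and> of_int D = (u * cnj v - v * cnj u)\<^sup>2"
    then obtain u v where uv: "OK = lat u v" "of_int D = (u * cnj v - v * cnj u)\<^sup>2"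
      by (auto simp: integral_basis_iff)
    have "\<bar>Im (cnj u * v)\<bar> = \<bar>Im (cnj 1 * om)\<bar>" by (rule lat_covol_unique) (simp add: uv[symmetric] OKl[symmetric])
    then have "(Im (cnj u * v))\<^sup>2 = (Im om)\<^sup>2" using power2_abs[of "Im (cnj u * v)"] power2_abs[of "Im om"] by simp
    then have "(of_int D :: complex) = of_real (- of_int n)" unfolding uv(2) sq by (simp only: power_mult_distrib n[symmetric]) simp
    then have "(of_int D :: complex) = of_int (- n)" by simp
    then show "D = - n" using of_int_eq_iff by blast
  next
    assume D: "D = - n"
    have "integral_basis K 1 om" using OKl om(2) by (simp add: integral_basis_iff)
    moreover have "of_int D = (1 * cnj om - om * cnj 1)\<^sup>2" unfolding sq D
      by (simp add: power_mult_distrib n)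
    ultimately show "\<exists>u v. integral_basis K u v \<and> of_int D = (u * cnj v - v * cnj u)\<^sup>2" by blast
  qed
  have "discriminant K = - n" unfolding discriminant_def P by simp
  then show ?thesis using n by (simp add: power_mult_distrib)
qed

text \<open>The units: an integer of modulus 1 has its conjugate as inverse. In this form the group
  is visibly finite.\<close>

definition U :: "complex set" where "U = {z \<in> OK. cmod z = 1}"

lemma U_mult: "x \<in> U \<Longrightarrow> y \<in> U \<Longrightarrow> x * y \<in> U"
  by (auto simp: U_def OK_mult norm_mult)

lemma U_cnj: "x \<in> U \<Longrightarrow> cnj x \<in> U" "x \<in> U \<Longrightarrow> cnj x * x = 1"
  by (auto simp: U_def OK_cnj) (metis complex_norm_square mult.commute of_real_1 power_one)

lemma finite_OK_bounded: "finite {z \<in> OK. cmod z \<le> B}"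
proof -
  define C where "C = max 0 (B / Im om)"
  define M where "M = B + C * cmod om"
  have "{z \<in> OK. cmod z \<le> B} \<subseteq> (\<lambda>(x, y). of_int x + of_int y * om) ` ({x. \<bar>of_int x\<bar> \<le> M} \<times> {y. \<bar>of_int y\<bar> \<le> C})"
  proof safe
    fix z assume z: "z \<in> OK" "cmod z \<le> B"
    then obtain x y :: int where xy: "z = of_int x + of_int y * om" by (auto simp: OK_decomp)
    have "\<bar>of_int y\<bar> * Im om = \<bar>Im z\<bar>" using om(2) by (simp add: xy abs_mult)
    also have "\<dots> \<le> B" using abs_Im_le_cmod[of z] z by linarith
    finally have y: "\<bar>of_int y\<bar> \<le> C" using om(2) by (simp add: C_def field_simps le_max_iff_disj)
    have "\<bar>of_int x\<bar> = cmod (z - of_int y * om)" by (simp add: xy)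
    also have "\<dots> \<le> B + \<bar>of_int y\<bar> * cmod om" using norm_triangle_ineq4[of z "of_int y * om"] z by (simp add: norm_mult)
    also have "\<dots> \<le> M" unfolding M_def using y by (simp add: mult_right_mono)
    finally show "z \<in> (\<lambda>(x, y). of_int x + of_int y * om) ` ({x. \<bar>of_int x\<bar> \<le> M} \<times> {y. \<bar>of_int y\<bar> \<le> C})"
      using y xy by auto
  qed
  moreover have "finite {x :: int. \<bar>of_int x\<bar> \<le> (r :: real)}" for r
    by (rule finite_subset[of _ "{- \<lceil>r\<rceil>..\<lceil>r\<rceil>}"]) (auto simp: abs_le_iff, linarith+)
  ultimately show ?thesis by (meson finite_SigmaI finite_imageI finite_subset)
qed

lemma finite_U: "finite U"
  by (rule finite_subset[OF _ finite_OK_bounded[of 1]]) (auto simp: U_def)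

text \<open>All powers of an element of \<open>U\<close> lie in the finite set \<open>U\<close>, so
  two of them coincide.\<close>

lemma roots_of_unity_eq: "{z \<in> K. \<exists>n > 0. z ^ n = 1} = U"
proof safe
  fix z and n :: nat assume z: "z \<in> K" "n > 0" "z ^ n = 1"
  have "algebraic_int z"
  proof (rule algebraic_int_root)
    show "poly (Polynomial.monom 1 n) z = 1" using z by (simp add: poly_monom)
  qed (use z(2) in \<open>auto simp: Polynomial.degree_monom_eq Polynomial.lead_coeff_monom\<close>)
  moreover have "cmod z = 1"
    using z by (metis norm_one norm_power norm_ge_zero power_eq_imp_eq_base power_one zero_le_one)
  ultimately show "z \<in> U" using z by (simp add: U_def OK_def)
next
  fix z assume z: "z \<in> U"
  then show "z \<in> K" by (simp add: U_def OK_def)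
  have pw: "z ^ n \<in> U" for n by (induct n) (auto simp: z U_mult, auto simp: U_def OK_1)
  have "\<not> inj (\<lambda>n. z ^ n)"
    using finite_U pw by (metis finite_imageD finite_subset image_subsetI infinite_UNIV_nat)
  then obtain m n where mn: "z ^ m = z ^ n" "m < n" unfolding inj_def by (metis nat_neq_iff)
  have "z \<noteq> 0" using z by (auto simp: U_def)
  have "z ^ n = z ^ m * z ^ (n - m)" using mn(2) by (simp flip: power_add)
  then have "z ^ (n - m) = 1" using mn(1) \<open>z \<noteq> 0\<close> by simp
  then show "\<exists>n>0. z ^ n = 1" using mn(2) by (intro exI[of _ "n - m"]) auto
qed

lemma card_U: "card U = num_roots_of_unity K" "card U > 0"
proof -
  show "card U = num_roots_of_unity K" by (simp add: num_roots_of_unity_def roots_of_unity_eq)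
  have "1 \<in> U" by (simp add: U_def OK_1)
  then show "card U > 0" using finite_U by (auto simp: card_gt_0_iff)
qed

lemma NI_ideal: "I \<in> NI \<Longrightarrow> is_ideal I"
  by (simp add: NI_def)

lemma NI_nonzero: "I \<in> NI \<Longrightarrow> \<exists>x\<in>I. x \<noteq> 0"
  by (auto simp: NI_def is_ideal_def)

lemma nrm_in_OK: "of_nat (nrm J) \<in> OK"
  using OK_of_int[of "int (nrm J)"] by simp

text \<open>The definition asks for two integers of the field, while \<open>l\<close> is any complex
  number. By \<open>ideal_inverse\<close>, \<open>l * N J\<close> is an integer, so
  \<open>a = N J\<close> and \<open>b = l * N J\<close> can be taken.\<close>

lemma class_rel_iff:
  "(I, J) \<in> ideal_class_rel K \<longleftrightarrow> I \<in> NI \<and> J \<in> NI \<and> (\<exists>l. l \<noteq> 0 \<and> I = (\<lambda>z. l * z) ` J)"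
proof
  assume "(I, J) \<in> ideal_class_rel K"
  then obtain a b where ab: "I \<in> NI" "J \<in> NI" "a \<noteq> 0" "b \<noteq> 0" "(\<lambda>x. a * x) ` I = (\<lambda>x. b * x) ` J"
    by (auto simp: ideal_class_rel_def nonzero_ideals_eq)
  have "I = (\<lambda>x. inverse a * x) ` (\<lambda>x. a * x) ` I" using ab(3) by (simp add: image_image mult.assoc[symmetric])
  also have "\<dots> = (\<lambda>z. (inverse a * b) * z) ` J" unfolding ab(5) by (simp add: image_image mult.assoc)
  finally show "I \<in> NI \<and> J \<in> NI \<and> (\<exists>l. l \<noteq> 0 \<and> I = (\<lambda>z. l * z) ` J)" using ab
    by (intro conjI exI[of _ "inverse a * b"]) auto
next
  assume "I \<in> NI \<and> J \<in> NI \<and> (\<exists>l. l \<noteq> 0 \<and> I = (\<lambda>z. l * z) ` J)"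
  then obtain l where l: "I \<in> NI" "J \<in> NI" "l \<noteq> 0" "I = (\<lambda>z. l * z) ` J" by auto
  have "(\<lambda>z. l * z) ` J \<subseteq> OK" using NI_ideal[OF l(1)] by (auto simp: l(4) is_ideal_def)
  then have "cnj l * of_nat (nrm J) \<in> J" using ideal_inverse[OF l(2)] by simp
  then have "cnj (cnj l * of_nat (nrm J)) \<in> OK" using OK_cnj NI_ideal[OF l(2)] is_ideal_OK by blast
  then have "l * of_nat (nrm J) \<in> OK" by simp
  moreover have "(\<lambda>x. of_nat (nrm J) * x) ` I = (\<lambda>x. (l * of_nat (nrm J)) * x) ` J"
    unfolding l(4) by (simp add: image_image algebra_simps)
  ultimately have "\<exists>a \<in> OK - {0}. \<exists>b \<in> OK - {0}. (\<lambda>x. a * x) ` I = (\<lambda>x. b * x) ` J"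
    using l nrm_in_OK[of J] nrm_pos[OF l(2)]
    by (intro bexI[of _ "of_nat (nrm J)"] bexI[of _ "l * of_nat (nrm J)"]) simp_all
  with l(1,2) show "(I, J) \<in> ideal_class_rel K"
    by (simp add: ideal_class_rel_def nonzero_ideals_eq carrier_OK)
qed

lemma equiv_class_rel: "equiv NI (ideal_class_rel K)"
proof (rule equivI)
  show "ideal_class_rel K \<subseteq> NI \<times> NI" by (auto simp: class_rel_iff)
  show "refl_on NI (ideal_class_rel K)"
    by (auto simp: refl_on_def class_rel_iff intro!: exI[of _ 1])
  show "sym (ideal_class_rel K)"
  proof (rule symI)
    fix I J assume "(I, J) \<in> ideal_class_rel K"
    then obtain l where l: "I \<in> NI" "J \<in> NI" "l \<noteq> 0" "I = (\<lambda>z. l * z) ` J" by (auto simp: class_rel_iff)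
    then have "J = (\<lambda>z. inverse l * z) ` I" by (simp add: image_image mult.assoc[symmetric])
    with l show "(J, I) \<in> ideal_class_rel K" unfolding class_rel_iff
      by (metis inverse_nonzero_iff_nonzero)
  qed
  show "trans (ideal_class_rel K)"
  proof (rule transI)
    fix I J L assume "(I, J) \<in> ideal_class_rel K" "(J, L) \<in> ideal_class_rel K"
    then obtain l k where l: "I \<in> NI" "J \<in> NI" "L \<in> NI" "l \<noteq> 0" "I = (\<lambda>z. l * z) ` J"
       "k \<noteq> 0" "J = (\<lambda>z. k * z) ` L" by (auto simp: class_rel_iff)
    then have "I = (\<lambda>z. (l * k) * z) ` L" by (simp add: image_image mult.assoc)
    with l show "(I, L) \<in> ideal_class_rel K" unfolding class_rel_iff by (metis mult_eq_0_iff)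
  qed
qed

text \<open>Multiplication by \<open>e\<close> acts on a basis of \<open>J\<close> by an integer
  matrix, whose characteristic polynomial makes \<open>e\<close> an algebraic integer
  (Cayley-Hamilton); it preserves the covolume, so \<open>e\<close> has modulus 1. Conversely, the
  inverse of \<open>e\<close> is its conjugate, again an integer.\<close>

lemma stabilizer:
  assumes J: "J \<in> NI"
  shows "(\<lambda>z. e * z) ` J = J \<longleftrightarrow> e \<in> U"
proof
  assume e: "(\<lambda>z. e * z) ` J = J"
  have id: "is_ideal J" by (rule NI_ideal[OF J])
  obtain x where x: "x \<in> J" "x \<noteq> 0" using NI_nonzero[OF J] by auto
  then have "e * x \<in> J" using e by blast
  then have eK: "e \<in> K"
    using K_divide[of "e * x" x] x is_ideal_OK[OF id] OK_K by auto
  have e0: "e \<noteq> 0"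
  proof
    assume "e = 0" then have "J \<subseteq> {0}" using e by auto
    with x show False by auto
  qed
  have "(\<lambda>z. e * z) ` J \<subseteq> OK" using e id by (auto simp: is_ideal_def)
  from scale_ideal(2)[OF J e0 this] have "(cmod e)\<^sup>2 = 1" using nrm_pos[OF J] by (simp add: e)
  then have n1: "cmod e = 1" by (metis norm_ge_zero power2_eq_1_iff power2_eq_imp_eq real_sqrt_one real_sqrt_unique)
  obtain a b where ab: "J = lat a b" by (rule ideal_lat[OF J])
  have "e * a \<in> J" "e * b \<in> J" using e ab lat_base by (metis imageI)+
  then obtain p q r s :: int where pq: "e * a = of_int p * a + of_int q * b" "e * b = of_int r * a + of_int s * b"
    using ab by (auto simp: lat_def)
  have "(e * e - of_int (p + s) * e + of_int (p * s - q * r)) * a = 0"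
       "(e * e - of_int (p + s) * e + of_int (p * s - q * r)) * b = 0"
  proof -
    have "(e * e - of_int (p + s) * e + of_int (p * s - q * r)) * a =
      e * (e * a) - of_int p * (e * a) - of_int s * (e * a) + of_int (p * s - q * r) * a" by (simp add: algebra_simps)
    also have "e * (e * a) = e * (of_int p * a + of_int q * b)" by (simp only: pq(1))
    also have "\<dots> = of_int p * (e * a) + of_int q * (e * b)" by (simp add: algebra_simps)
    finally show "(e * e - of_int (p + s) * e + of_int (p * s - q * r)) * a = 0" unfolding pq by (simp add: algebra_simps)
    have "(e * e - of_int (p + s) * e + of_int (p * s - q * r)) * b =
      e * (e * b) - of_int p * (e * b) - of_int s * (e * b) + of_int (p * s - q * r) * b" by (simp add: algebra_simps)
    also have "e * (e * b) = e * (of_int r * a + of_int s * b)" by (simp only: pq(2))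
    also have "\<dots> = of_int r * (e * a) + of_int s * (e * b)" by (simp add: algebra_simps)
    finally show "(e * e - of_int (p + s) * e + of_int (p * s - q * r)) * b = 0" unfolding pq by (simp add: algebra_simps)
  qed
  moreover have "a \<noteq> 0 \<or> b \<noteq> 0" using x ab by (auto simp: lat_def)
  ultimately have root: "e * e - of_int (p + s) * e + of_int (p * s - q * r) = 0" by auto
  have "algebraic_int e"
    by (rule algebraic_int.intros[of "[:of_int (p * s - q * r), - of_int (p + s), 1:]"])
       (use root in \<open>auto simp: coeff_pCons algebra_simps split: nat.splits\<close>)
  then show "e \<in> U" using n1 eK by (simp add: U_def OK_def)
next
  assume e: "e \<in> U"
  have id: "is_ideal J" by (rule NI_ideal[OF J])
  have sub: "f * z \<in> J" if "f \<in> U" "z \<in> J" for f z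
    using that is_ideal_mult[OF id] by (auto simp: U_def)
  show "(\<lambda>z. e * z) ` J = J"
  proof (intro equalityI subsetI)
    fix z assume z: "z \<in> J"
    have "z = e * (cnj e * z)" using U_cnj(2)[OF e] by (metis mult.assoc mult.commute mult_1)
    then show "z \<in> (\<lambda>z. e * z) ` J" using sub[OF U_cnj(1)[OF e] z] by blast
  qed (use sub e in auto)
qed

lemma finite_norm_le: "finite {I \<in> NI. nrm I \<le> n}"
proof -
  define f where "f = (\<lambda>(a::int, c::int, e::int). lat (of_int a) (of_int c + of_int e * om))"
  have "{I \<in> NI. nrm I \<le> n} \<subseteq> f ` ({0..int n} \<times> {0..int n} \<times> {0..int n})"
  proof
    fix I assume I: "I \<in> {I \<in> NI. nrm I \<le> n}"
    then have "I \<in> NI" by simp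
    from ideal_hermite[OF this] obtain a c e :: int where h: "a > 0" "e > 0" "0 \<le> c" "c < a"
      "I = lat (of_int a) (of_int c + of_int e * om)" "nrm I = nat (a * e)" by metis
    have "nat (a * e) \<le> n" using I h(6) by simp
    then have "a * e \<le> int n" by linarith
    moreover have "a * 1 \<le> a * e" "1 * e \<le> a * e" using h by (intro mult_left_mono mult_right_mono; simp)+
    ultimately have "a \<le> int n" "e \<le> int n" by linarith+
    then have "(a, c, e) \<in> {0..int n} \<times> {0..int n} \<times> {0..int n}" using h(1-4) by auto
    moreover have "I = f (a, c, e)" using h by (simp add: f_def)
    ultimately show "I \<in> f ` ({0..int n} \<times> {0..int n} \<times> {0..int n})" by blast
  qed
  then show ?thesis by (rule finite_subset) auto
qed

text \<open>The factor \<open>l = cnj \<mu> / N J\<close> solves \<open>cnj l * N J = \<mu>\<close>,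
  so the criterion of \<open>ideal_inverse\<close> is met by the choice of \<open>\<mu>\<close> in
  \<open>J\<close>.\<close>

lemma mu_ideal:
  assumes J: "J \<in> NI" and mu: "\<mu> \<in> J" "\<mu> \<noteq> 0"
  defines "I \<equiv> (\<lambda>z. (cnj \<mu> / of_nat (nrm J)) * z) ` J"
  shows "(I, J) \<in> ideal_class_rel K" "real (nrm I) = (cmod \<mu>)\<^sup>2 / real (nrm J)"
proof -
  have n: "real (nrm J) > 0" using nrm_pos[OF J] by simp
  define l where "l = cnj \<mu> / of_nat (nrm J)"
  have "cnj l * of_nat (nrm J) = \<mu>" using n by (simp add: l_def)
  then have sub: "(\<lambda>z. l * z) ` J \<subseteq> OK" using ideal_inverse[OF J] mu by simp
  have l0: "l \<noteq> 0" using mu n by (simp add: l_def)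
  note s = scale_ideal[OF J l0 sub]
  show "(I, J) \<in> ideal_class_rel K" using s(1) J l0 unfolding I_def l_def[symmetric] class_rel_iff by blast
  show "real (nrm I) = (cmod \<mu>)\<^sup>2 / real (nrm J)"
    using s(2) n unfolding I_def l_def[symmetric] by (simp add: l_def norm_divide power2_eq_square field_simps)
qed

text \<open>Pigeonhole: more than \<open>N J\<close> small elements \<open>x + y om\<close> cannot be pairwise incongruent modulo \<open>J\<close>.\<close>

lemma short_element:
  assumes J: "J \<in> NI"
  obtains \<mu> where "\<mu> \<in> J" "\<mu> \<noteq> 0" "(cmod \<mu>)\<^sup>2 \<le> (1 + cmod om)\<^sup>2 * real (nrm J)"
proof -
  have id: "is_ideal J" by (rule NI_ideal[OF J])
  define N where "N = nrm J"
  \<comment> \<open>With this \<open>M\<close> the \<open>(M + 1)^2\<close> coordinate pairs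
    outnumber the \<open>N\<close> residue classes, while differences of coordinates stay below
    \<open>sqrt N\<close>.\<close>
  define M where "M = nat \<lfloor>sqrt N\<rfloor>"
  have N: "N > 0" using nrm_pos[OF J] by (simp add: N_def)
  have M: "real M \<le> sqrt N" "sqrt N < real M + 1" by (simp_all add: M_def)
  define R where "R = {0..int M} \<times> {0..int M}"
  define co where "co = (\<lambda>(x::int, y::int). (\<lambda>i. i + (of_int x + of_int y * om)) ` J)"
  have "real N = sqrt N * sqrt N" by simp
  also have "\<dots> < (real M + 1) * (real M + 1)" using M N by (intro mult_strict_mono) auto
  also have "\<dots> = real ((M + 1) * (M + 1))" by (simp add: algebra_simps)
  finally have "N < (M + 1) * (M + 1)" by (simp only: of_nat_less_iff)
  also have "\<dots> = card R"
  proof -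
    have "nat (int M + 1) = M + 1" by simp
    then show ?thesis unfolding R_def card_cartesian_product by simp
  qed
  finally have "N < card R" .
  have fin: "finite ((\<lambda>z. (\<lambda>i. i + z) ` J) ` OK)" using N unfolding N_def ideal_norm_eq by (auto intro: card_ge_0_finite)
  have "co ` R \<subseteq> (\<lambda>z. (\<lambda>i. i + z) ` J) ` OK" using OK_decomp by (auto simp: co_def)
  then have "card (co ` R) \<le> N" unfolding N_def ideal_norm_eq using card_mono[OF fin] by blast
  with \<open>N < card R\<close> have "\<not> inj_on co R" using pigeonhole[of co R] by linarith
  then obtain p q where pq: "p \<in> R" "q \<in> R" "p \<noteq> q" "co p = co q" by (auto simp: inj_on_def)
  obtain x y where p: "p = (x, y)" by force
  obtain x' y' where q: "q = (x', y')" by force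
  define \<mu> where "\<mu> = of_int (x - x') + of_int (y - y') * om"
  have "\<mu> \<in> J" using pq(4) coset_eq_iff[OF id] by (simp add: co_def p q \<mu>_def algebra_simps)
  moreover have "\<mu> \<noteq> 0"
  proof
    assume "\<mu> = 0"
    then have "of_int (x - x') + of_int (y - y') * om = of_int 0 + of_int 0 * om" by (simp add: \<mu>_def)
    from om_coord_unique[OF this] pq(3) show False by (simp add: p q)
  qed
  moreover have "(cmod \<mu>)\<^sup>2 \<le> (1 + cmod om)\<^sup>2 * real (nrm J)"
  proof -
    have "\<bar>x - x'\<bar> \<le> int M" "\<bar>y - y'\<bar> \<le> int M" using pq by (auto simp: R_def p q)
    then have xy: "\<bar>of_int (x - x') :: real\<bar> \<le> M" "\<bar>of_int (y - y') :: real\<bar> \<le> M" by linarith+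
    have "cmod \<mu> \<le> \<bar>of_int (x - x')\<bar> + \<bar>of_int (y - y')\<bar> * cmod om"
      unfolding \<mu>_def by (rule order.trans[OF norm_triangle_ineq]) (simp add: norm_mult del: of_int_diff)
    also have "\<dots> \<le> M + M * cmod om" by (intro add_mono mult_right_mono xy) simp
    also have "\<dots> \<le> sqrt N * (1 + cmod om)" using mult_right_mono[OF M(1), of "1 + cmod om"] by (simp add: algebra_simps)
    finally have "(cmod \<mu>)\<^sup>2 \<le> (sqrt N * (1 + cmod om))\<^sup>2" by (intro power_mono) auto
    also have "\<dots> = (1 + cmod om)\<^sup>2 * real N" by (simp add: power_mult_distrib)
    finally show ?thesis by (simp add: N_def)
  qed
  ultimately show ?thesis by (rule that)
qed

text \<open>Each class contains an ideal of norm at most \<open>(1 + cmod om)^2\<close>: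
  \<open>mu_ideal\<close> with a short \<open>\<mu> \<in> J\<close> leads back into the class of
  \<open>J\<close>, with norm \<open>(cmod \<mu>)^2 / N J\<close>.\<close>

lemma finite_classes: "finite (NI // ideal_class_rel K)"
proof -
  define B where "B = nat \<lceil>(1 + cmod om)\<^sup>2\<rceil>"
  have "NI // ideal_class_rel K \<subseteq> (\<lambda>I. ideal_class_rel K `` {I}) ` {I \<in> NI. nrm I \<le> B}"
  proof
    fix C assume "C \<in> NI // ideal_class_rel K"
    then obtain J where J: "J \<in> NI" "C = ideal_class_rel K `` {J}" by (auto elim: quotientE)
    obtain \<mu> where mu: "\<mu> \<in> J" "\<mu> \<noteq> 0" "(cmod \<mu>)\<^sup>2 \<le> (1 + cmod om)\<^sup>2 * real (nrm J)"
      by (rule short_element[OF J(1)])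
    obtain I where I: "(I, J) \<in> ideal_class_rel K" "real (nrm I) = (cmod \<mu>)\<^sup>2 / real (nrm J)"
      using mu_ideal[OF J(1) mu(1,2)] by blast
    have "real (nrm I) \<le> (1 + cmod om)\<^sup>2" using mu(3) nrm_pos[OF J(1)] by (simp add: I(2) field_simps)
    then have "nrm I \<le> B" unfolding B_def by linarith
    moreover have "I \<in> NI" using I by (simp add: class_rel_iff)
    moreover have "C = ideal_class_rel K `` {I}" using J(2) equiv_class_eq[OF equiv_class_rel I(1)] by simp
    ultimately show "C \<in> (\<lambda>I. ideal_class_rel K `` {I}) ` {I \<in> NI. nrm I \<le> B}" by blast
  qed
  then show ?thesis using finite_norm_le by (meson finite_imageI finite_subset)
qed

text \<open>Every ideal in the class of \<open>J\<close> is \<open>cnj \<mu> / N J \<cdot> J\<close> for some nonzero \<open>\<mu> \<in> J\<close>, which is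
  unique up to units.\<close>

definition mu_ideal_map :: "complex set \<Rightarrow> complex \<Rightarrow> complex set" where
  "mu_ideal_map J \<mu> = (\<lambda>z. (cnj \<mu> / of_nat (nrm J)) * z) ` J"

text \<open>The fibre over \<open>I = l J\<close> is a single orbit of the units:
  \<open>m0 = cnj l * N J\<close> lies in \<open>J\<close> by \<open>ideal_inverse\<close>, and
  \<open>e * m0\<close> is sent to \<open>cnj e * I\<close>, which equals \<open>I\<close> exactly
  for \<open>e \<in> U\<close>.\<close>

lemma mu_fibre:
  assumes IJ: "(I, J) \<in> ideal_class_rel K"
  shows "finite {\<mu> \<in> J - {0}. mu_ideal_map J \<mu> = I}" "card {\<mu> \<in> J - {0}. mu_ideal_map J \<mu> = I} = card U"
proof -
  from IJ obtain l where l: "I \<in> NI" "J \<in> NI" "l \<noteq> 0" "I = (\<lambda>z. l * z) ` J" by (auto simp: class_rel_iff)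
  have id: "is_ideal J" by (rule NI_ideal[OF l(2)])
  have n: "nrm J > 0" by (rule nrm_pos[OF l(2)])
  define m0 where "m0 = cnj l * of_nat (nrm J)"
  have m0J: "m0 \<in> J" using ideal_inverse[OF l(2), of l] NI_ideal[OF l(1)] by (simp add: l(4) is_ideal_def m0_def)
  have m0: "m0 \<noteq> 0" using l n by (simp add: m0_def)
  have map_e: "mu_ideal_map J (e * m0) = (\<lambda>z. cnj e * z) ` I" for e
    unfolding mu_ideal_map_def l(4) using n by (simp add: m0_def image_image mult.assoc)
  have "{\<mu> \<in> J - {0}. mu_ideal_map J \<mu> = I} = (\<lambda>e. e * m0) ` U"
  proof (intro equalityI subsetI)
    fix \<mu> assume "\<mu> \<in> {\<mu> \<in> J - {0}. mu_ideal_map J \<mu> = I}"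
    then have mu: "\<mu> \<in> J" "\<mu> \<noteq> 0" "I = mu_ideal_map J \<mu>" by auto
    define e where "e = \<mu> / m0"
    have e: "\<mu> = e * m0" using m0 by (simp add: e_def)
    have "(\<lambda>z. cnj e * z) ` I = I" using mu(3) map_e[of e] e by simp
    then have "cnj e \<in> U" using stabilizer[OF l(1)] by simp
    then have "e \<in> U" using U_cnj(1)[of "cnj e"] by simp
    with e show "\<mu> \<in> (\<lambda>e. e * m0) ` U" by blast
  next
    fix \<mu> assume "\<mu> \<in> (\<lambda>e. e * m0) ` U"
    then obtain e where e: "e \<in> U" "\<mu> = e * m0" by auto
    have "e * m0 \<in> J" using e m0J is_ideal_mult[OF id] by (simp add: U_def)
    moreover have "mu_ideal_map J (e * m0) = I"
      using stabilizer[OF l(1)] U_cnj(1)[OF e(1)] map_e by simp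
    moreover have "e * m0 \<noteq> 0" using m0 e by (auto simp: U_def)
    ultimately show "\<mu> \<in> {\<mu> \<in> J - {0}. mu_ideal_map J \<mu> = I}" using e by simp
  qed
  moreover have "inj_on (\<lambda>e. e * m0) U" using m0 by (auto intro: inj_onI)
  ultimately show "finite {\<mu> \<in> J - {0}. mu_ideal_map J \<mu> = I}" "card {\<mu> \<in> J - {0}. mu_ideal_map J \<mu> = I} = card U"
    using finite_U by (auto simp: card_image)
qed

text \<open>The nonzero \<open>\<mu> \<in> J\<close> are grouped by the ideal
  \<open>mu_ideal_map J \<mu>\<close>; each group has \<open>card U\<close> members, on all of which
  the summand is \<open>f (nrm I)\<close>.\<close>

lemma class_sum:
  fixes f :: "real \<Rightarrow> real"
  assumes J: "J \<in> NI" and s: "((\<lambda>\<mu>. f ((cmod \<mu>)\<^sup>2 / real (nrm J))) has_sum S) (J - {0})"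
  shows "((\<lambda>I. f (real (nrm I))) has_sum (S / real (card U))) (ideal_class_rel K `` {J})"
proof -
  define C where "C = ideal_class_rel K `` {J}"
  have C: "(I, J) \<in> ideal_class_rel K" if "I \<in> C" for I
    using that equiv_class_rel by (auto simp: C_def elim!: equivE dest: symD)
  define F where "F = (\<lambda>I. {\<mu> \<in> J - {0}. mu_ideal_map J \<mu> = I})"
  have bij: "bij_betw snd (Sigma C F) (J - {0})"
  proof (rule bij_betwI[of _ _ _ "\<lambda>\<mu>. (mu_ideal_map J \<mu>, \<mu>)"])
    show "(\<lambda>\<mu>. (mu_ideal_map J \<mu>, \<mu>)) \<in> J - {0} \<rightarrow> Sigma C F"
    proof
      fix \<mu> assume "\<mu> \<in> J - {0}"
      then have "(mu_ideal_map J \<mu>, J) \<in> ideal_class_rel K" unfolding mu_ideal_map_def using mu_ideal(1)[OF J] by auto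
      then show "(mu_ideal_map J \<mu>, \<mu>) \<in> Sigma C F" using \<open>\<mu> \<in> J - {0}\<close> equiv_class_rel
        by (auto simp: C_def F_def elim!: equivE dest: symD)
    qed
  qed (auto simp: F_def)
  have "((\<lambda>p. f ((cmod (snd p))\<^sup>2 / real (nrm J))) has_sum S) (Sigma C F)"
    using has_sum_reindex_bij_betw[OF bij, of "\<lambda>\<mu>. f ((cmod \<mu>)\<^sup>2 / real (nrm J))" S] s by simp
  then have s2: "((\<lambda>(I, \<mu>). f ((cmod \<mu>)\<^sup>2 / real (nrm J))) has_sum S) (Sigma C F)"
    by (simp add: case_prod_unfold)
  have inner: "((\<lambda>\<mu>. f ((cmod \<mu>)\<^sup>2 / real (nrm J))) has_sum (real (card U) * f (real (nrm I)))) (F I)" if "I \<in> C" for I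
  proof -
    have fin: "finite (F I)" "card (F I) = card U" unfolding F_def using mu_fibre[OF C[OF that]] by auto
    have "(\<Sum>\<mu>\<in>F I. f ((cmod \<mu>)\<^sup>2 / real (nrm J))) = (\<Sum>\<mu>\<in>F I. f (real (nrm I)))"
    proof (rule sum.cong)
      fix \<mu> assume mu: "\<mu> \<in> F I"
      then have "real (nrm I) = (cmod \<mu>)\<^sup>2 / real (nrm J)"
        using mu_ideal(2)[OF J, of \<mu>] by (auto simp: F_def mu_ideal_map_def)
      then show "f ((cmod \<mu>)\<^sup>2 / real (nrm J)) = f (real (nrm I))" by simp
    qed simp
    with has_sum_finite[OF fin(1)] fin(2) show ?thesis by (metis sum_constant)
  qed
  have "((\<lambda>I. real (card U) * f (real (nrm I))) has_sum S) C"
    by (rule has_sum_SigmaD[OF s2]) (simp add: inner)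
  from has_sum_cmult_right[OF this, of "1 / real (card U)"] card_U(2)
  show ?thesis by (simp add: C_def)
qed

lemma has_sum_disjoint_UN:
  fixes f :: "'a \<Rightarrow> real"
  assumes "finite \<C>" "\<And>C C'. C \<in> \<C> \<Longrightarrow> C' \<in> \<C> \<Longrightarrow> C \<noteq> C' \<Longrightarrow> C \<inter> C' = {}"
    "\<And>C. C \<in> \<C> \<Longrightarrow> (f has_sum S C) C"
  shows "(f has_sum (\<Sum>C\<in>\<C>. S C)) (\<Union>\<C>)"
  using assms
proof (induct rule: finite_induct)
  case (insert C \<C>)
  have "C \<inter> \<Union>\<C> = {}" using insert(2,4) by auto
  moreover have "(f has_sum (\<Sum>C\<in>\<C>. S C)) (\<Union>\<C>)" using insert by auto
  ultimately have "(f has_sum (S C + (\<Sum>C\<in>\<C>. S C))) (C \<union> \<Union>\<C>)"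
    using insert(5) by (intro has_sum_Un_disjoint) auto
  then show ?case using insert(1,2) by simp
qed simp

text \<open>Convergence is a premise on the lattice side only, so the series over \<open>n\<close>
  converges without a prior bound for the number of ideals of norm \<open>n\<close>. The
  representatives are fixed before \<open>f\<close>, because the functional equation compares two
  different \<open>f\<close> on the same lattices.\<close>

theorem ideal_sum:
  obtains \<R> where "finite \<R>" "\<R> \<subseteq> NI" "card \<R> = class_number K"
    "\<And>f S. (\<And>J. J \<in> \<R> \<Longrightarrow> ((\<lambda>\<mu>. f ((cmod \<mu>)\<^sup>2 / real (nrm J))) has_sum S J) (J - {0})) \<Longrightarrow>
       ((\<lambda>n. real (ideal_count K n) * f (real n)) has_sum ((\<Sum>J\<in>\<R>. S J) / real (num_roots_of_unity K))) UNIV"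
proof -
  define \<C> where "\<C> = NI // ideal_class_rel K"
  define rep where "rep = (\<lambda>C :: complex set set. SOME J. J \<in> C)"
  have rep: "rep C \<in> NI" "C = ideal_class_rel K `` {rep C}" if CC: "C \<in> \<C>" for C
  proof -
    obtain J where J: "J \<in> NI" "C = ideal_class_rel K `` {J}" using CC unfolding \<C>_def by (rule quotientE)
    then have "J \<in> C" using equiv_class_self[OF equiv_class_rel] by simp
    then have "rep C \<in> C" unfolding rep_def by (rule someI)
    then have r: "(J, rep C) \<in> ideal_class_rel K" using J by simp
    then show "rep C \<in> NI" by (simp add: class_rel_iff)
    show "C = ideal_class_rel K `` {rep C}" using J(2) equiv_class_eq[OF equiv_class_rel r] by simp
  qed
  have inj: "inj_on rep \<C>" by (rule inj_onI) (metis rep(2))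
  have fin: "finite \<C>" unfolding \<C>_def by (rule finite_classes)
  have disj: "C \<inter> C' = {}" if "C \<in> \<C>" "C' \<in> \<C>" "C \<noteq> C'" for C C'
    using quotient_disj[OF equiv_class_rel] that unfolding \<C>_def by blast
  have Un: "\<Union>\<C> = NI" unfolding \<C>_def by (rule Union_quotient[OF equiv_class_rel])
  have "card (rep ` \<C>) = class_number K"
    unfolding card_image[OF inj] by (simp add: class_number_def \<C>_def nonzero_ideals_eq)
  moreover have "((\<lambda>n. real (ideal_count K n) * f (real n)) has_sum ((\<Sum>J\<in>rep ` \<C>. S J) / real (num_roots_of_unity K))) UNIV"
    if S: "\<And>J. J \<in> rep ` \<C> \<Longrightarrow> ((\<lambda>\<mu>. f ((cmod \<mu>)\<^sup>2 / real (nrm J))) has_sum S J) (J - {0})" for f :: "real \<Rightarrow> real" and S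
  proof -
    have "((\<lambda>I. f (real (nrm I))) has_sum (S (rep C) / real (card U))) C" if "C \<in> \<C>" for C
      using class_sum[OF rep(1)[OF that] S] that rep(2)[OF that, symmetric] by simp
    from has_sum_disjoint_UN[OF fin disj this]
    have 1: "((\<lambda>I. f (real (nrm I))) has_sum ((\<Sum>J\<in>rep ` \<C>. S J) / real (card U))) NI" (is "(_ has_sum ?T) _")
      unfolding Un by (simp add: sum.reindex[OF inj] sum_divide_distrib)
    define F where "F = (\<lambda>n. {I \<in> NI. nrm I = n})"
    have finF: "finite (F n)" for n unfolding F_def by (rule finite_subset[OF _ finite_norm_le[of n]]) auto
    have bij: "bij_betw snd (Sigma UNIV F) NI"
      by (rule bij_betwI[of _ _ _ "\<lambda>I. (nrm I, I)"]) (auto simp: F_def)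
    have "((\<lambda>p. f (real (nrm (snd p)))) has_sum ?T) (Sigma UNIV F)"
      using has_sum_reindex_bij_betw[OF bij, of "\<lambda>I. f (real (nrm I))" ?T] 1 by simp
    then have 2: "((\<lambda>(n, I). f (real (nrm I))) has_sum ?T) (Sigma UNIV F)" by (simp add: case_prod_unfold)
    have "((\<lambda>I. f (real (nrm I))) has_sum (real (ideal_count K n) * f (real n))) (F n)" for n
    proof -
      have "(\<Sum>I\<in>F n. f (real (nrm I))) = (\<Sum>I\<in>F n. f (real n))" by (rule sum.cong) (auto simp: F_def)
      also have "\<dots> = real (ideal_count K n) * f (real n)" by (simp add: ideal_count_def F_def nonzero_ideals_eq)
      finally show ?thesis using has_sum_finite[OF finF, of "\<lambda>I. f (real (nrm I))"] by metis
    qed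
    then have "((\<lambda>n. real (ideal_count K n) * f (real n)) has_sum ?T) UNIV"
      by (intro has_sum_SigmaD[OF 2]) simp
    then show ?thesis by (simp add: card_U)
  qed
  ultimately show ?thesis using fin rep(1) by (intro that[of "rep ` \<C>"]) auto
qed

end

section \<open>Poisson summation\<close>

text \<open>Orthogonality extends from the \<open>cos (k x)\<close> to all polynomials in
  \<open>cos x\<close>. Since \<open>arccos\<close> is continuous, these approximate
  \<open>h\<close> uniformly on \<open>[0, \<pi>]\<close>, so the integral of \<open>h^2\<close> is
  at most \<open>e\<close> times that of \<open>\<bar>h\<bar>\<close> for every
  \<open>e > 0\<close>.\<close>

lemma cosine_orthogonal_eq_0:
  fixes h :: "real \<Rightarrow> real"
  assumes h: "continuous_on {0..pi} h"
    and orth: "\<And>k :: nat. integral {0..pi} (\<lambda>x. h x * cos (k * x)) = 0"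
    and x: "x \<in> {0..pi}"
  shows "h x = 0"
proof -
  have int_k: "integral {0..pi} (\<lambda>x. h x * cos (of_int k * x)) = 0" for k :: int
  proof (cases "k \<ge> 0")
    case True then show ?thesis using orth[of "nat k"] by simp
  next
    case False then show ?thesis using orth[of "nat (-k)"] by simp
  qed
  \<comment> \<open>The additional factor \<open>cos (k x)\<close> lets the induction close: the
    product formula replaces one factor \<open>cos x\<close> by shifts of \<open>k\<close> by 1 and
    -1, for which \<open>k\<close> has to range over all integers.\<close>
  have pow: "integral {0..pi} (\<lambda>x. h x * cos x ^ n * cos (of_int k * x)) = 0" for n and k :: int
  proof (induct n arbitrary: k)
    case (Suc n)
    have cc: "cos x * cos (of_int k * x) = (cos (of_int (k + 1) * x) + cos (of_int (k - 1) * x)) / 2" for x :: real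
    proof -
      have "cos (of_int (k - 1) * x) = cos (x - of_int k * x)"
        using cos_minus[of "x - of_int k * x"] by (simp add: algebra_simps)
      then show ?thesis by (simp add: cos_times_cos algebra_simps)
    qed
    have "integral {0..pi} (\<lambda>x. h x * cos x ^ Suc n * cos (of_int k * x)) =
      integral {0..pi} (\<lambda>x. (h x * cos x ^ n * cos (of_int (k + 1) * x) + h x * cos x ^ n * cos (of_int (k - 1) * x)) / 2)"
    proof (rule arg_cong[of _ _ "integral _"], rule ext)
      fix x
      have "h x * cos x ^ Suc n * cos (of_int k * x) = h x * cos x ^ n * (cos x * cos (of_int k * x))" by simp
      then show "h x * cos x ^ Suc n * cos (of_int k * x) = (h x * cos x ^ n * cos (of_int (k + 1) * x) + h x * cos x ^ n * cos (of_int (k - 1) * x)) / 2"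
        unfolding cc by (simp add: algebra_simps)
    qed
    also have "\<dots> = (integral {0..pi} (\<lambda>x. h x * cos x ^ n * cos (of_int (k + 1) * x)) + integral {0..pi} (\<lambda>x. h x * cos x ^ n * cos (of_int (k - 1) * x))) / 2"
      by (subst Henstock_Kurzweil_Integration.integral_add[symmetric])
         (auto intro!: integrable_continuous_real continuous_intros h)
    finally show ?case unfolding Suc by simp
  qed (use int_k in simp)
  define M where "M = integral {0..pi} (\<lambda>x. \<bar>h x\<bar>)"
  have ih2: "(\<lambda>x. h x * h x) integrable_on {0..pi}" by (auto intro!: integrable_continuous_real continuous_intros h)
  have M0: "M \<ge> 0" unfolding M_def by (rule integral_nonneg) (auto intro!: integrable_continuous_real continuous_intros h)
  have bound: "integral {0..pi} (\<lambda>x. h x * h x) \<le> e * M" if e: "e > 0" for e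
  proof -
    have cu: "continuous_on {-1..1} (\<lambda>c. h (arccos c))"
      by (rule continuous_on_compose2[OF h]) (auto intro!: continuous_intros arccos_lbound arccos_ubound)
    obtain g where g: "real_polynomial_function g" "\<And>c. c \<in> {-1..1} \<Longrightarrow> \<bar>h (arccos c) - g c\<bar> < e"
      using Stone_Weierstrass_real_polynomial_function[OF _ cu e] by auto
    obtain a n where an: "g = (\<lambda>c. \<Sum>i\<le>n. a i * c ^ i)"
      using g(1) by (auto simp: real_polynomial_function_iff_sum)
    have cg: "continuous_on {0..pi} (\<lambda>x. g (cos x))" unfolding an by (intro continuous_intros)
    have "integral {0..pi} (\<lambda>x. h x * g (cos x)) = (\<Sum>i\<le>n. a i * integral {0..pi} (\<lambda>x. h x * cos x ^ i))"
      unfolding an sum_distrib_left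
      by (subst Henstock_Kurzweil_Integration.integral_sum)
         (auto intro!: integrable_continuous_real continuous_intros h simp: mult.left_commute)
    also have "\<dots> = 0" using pow[of _ 0] by simp
    finally have z: "integral {0..pi} (\<lambda>x. h x * g (cos x)) = 0" .
    have "integral {0..pi} (\<lambda>x. h x * h x) = integral {0..pi} (\<lambda>x. h x * (h x - g (cos x)))"
      unfolding right_diff_distrib
      by (subst Henstock_Kurzweil_Integration.integral_diff) (auto intro!: integrable_continuous_real continuous_intros h cg simp: z)
    also have "\<dots> \<le> integral {0..pi} (\<lambda>x. e * \<bar>h x\<bar>)"
    proof (rule integral_le)
      fix x :: real assume x: "x \<in> {0..pi}"
      then have "\<bar>h x - g (cos x)\<bar> \<le> e" using g(2)[of "cos x"] by (simp add: arccos_cos)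
      then have "\<bar>h x * (h x - g (cos x))\<bar> \<le> \<bar>h x\<bar> * e" unfolding abs_mult by (rule mult_left_mono) simp
      then show "h x * (h x - g (cos x)) \<le> e * \<bar>h x\<bar>" by (simp add: mult.commute)
    qed (auto intro!: integrable_continuous_real continuous_intros h cg)
    also have "\<dots> = e * M" by (simp add: M_def)
    finally show ?thesis .
  qed
  have "integral {0..pi} (\<lambda>x. h x * h x) \<le> 0"
  proof (rule field_le_epsilon)
    fix e :: real assume e: "e > 0"
    have "integral {0..pi} (\<lambda>x. h x * h x) \<le> (e / (M + 1)) * M" by (rule bound) (use e M0 in auto)
    also have "\<dots> \<le> e" using e M0 by (simp add: field_simps)
    finally show "integral {0..pi} (\<lambda>x. h x * h x) \<le> 0 + e" by simp
  qed
  moreover have "integral {0..pi} (\<lambda>x. h x * h x) \<ge> 0" by (rule integral_nonneg[OF ih2]) simp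
  ultimately have "integral {0..pi} (\<lambda>x. h x * h x) = 0" by simp
  moreover have "continuous_on {0..pi} (\<lambda>x. h x * h x)" by (intro continuous_intros h)
  ultimately have "h x * h x = 0"
    using integral_eq_0_iff[of 0 pi "\<lambda>x. h x * h x"] x pi_gt_zero by simp
  then show ?thesis by simp
qed

lemma integral_cosh_cos:
  fixes r :: real
  assumes r: "r > 0"
  shows "integral {0..pi} (\<lambda>y. cosh (r * (pi - y)) * cos (real k * y)) = r * sinh (r * pi) / (r\<^sup>2 + (real k)\<^sup>2)"
proof -
  \<comment> \<open>Integration by parts, done twice, gives this antiderivative of the integrand
    times \<open>r^2 + k^2\<close>.\<close>
  define G where "G = (\<lambda>y. - r * sinh (r * (pi - y)) * cos (real k * y) + real k * cosh (r * (pi - y)) * sin (real k * y))"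
  define F where "F = (\<lambda>y. G y / (r\<^sup>2 + (real k)\<^sup>2))"
  have nz: "r\<^sup>2 + (real k)\<^sup>2 > 0" using r by (simp add: add_pos_nonneg)
  have "((\<lambda>y. cosh (r * (pi - y)) * cos (real k * y)) has_integral (F pi - F 0)) {0..pi}"
  proof (rule fundamental_theorem_of_calculus)
    fix y :: real
    have "(F has_real_derivative (r\<^sup>2 + (real k)\<^sup>2) * (cosh (r * (pi - y)) * cos (real k * y)) / (r\<^sup>2 + (real k)\<^sup>2)) (at y)"
      unfolding F_def G_def
      by (rule DERIV_cdivide) (auto intro!: derivative_eq_intros simp: algebra_simps power2_eq_square)
    then show "(F has_vector_derivative cosh (r * (pi - y)) * cos (real k * y)) (at y within {0..pi})"
      using nz r by (simp add: has_real_derivative_iff_has_vector_derivative has_vector_derivative_at_within)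
  qed simp
  moreover have "F pi - F 0 = r * sinh (r * pi) / (r\<^sup>2 + (real k)\<^sup>2)" by (simp add: F_def G_def)
  ultimately show ?thesis by (simp add: integral_unique)
qed

lemma integral_cos_cos:
  "integral {0..pi} (\<lambda>y. cos (real j * y) * cos (real k * y)) = (if j = k then if k = 0 then pi else pi / 2 else 0)"
proof -
  have c: "integral {0..pi} (\<lambda>y. cos (of_int n * y)) = (if n = 0 then pi else 0)" for n :: int
  proof (cases "n = 0")
    case False
    have "((\<lambda>y. cos (of_int n * y)) has_integral (sin (of_int n * pi) / of_int n - sin (of_int n * 0) / of_int n)) {0..pi}"
      by (rule fundamental_theorem_of_calculus)
         (use False in \<open>auto intro!: derivative_eq_intros simp flip: has_real_derivative_iff_has_vector_derivative\<close>)
    moreover have "sin (of_int n * pi) = 0" using sin_integer_2pi sin_zero_iff_int2 by blast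
    ultimately show ?thesis using False by (simp add: integral_unique)
  qed simp
  have "integral {0..pi} (\<lambda>y. cos (real j * y) * cos (real k * y)) =
    integral {0..pi} (\<lambda>y. (cos (of_int (int j - int k) * y) + cos (of_int (int j + int k) * y)) / 2)"
    by (intro arg_cong[of _ _ "integral _"] ext) (simp add: cos_times_cos algebra_simps)
  also have "\<dots> = (integral {0..pi} (\<lambda>y. cos (of_int (int j - int k) * y)) + integral {0..pi} (\<lambda>y. cos (of_int (int j + int k) * y))) / 2"
    by (subst Henstock_Kurzweil_Integration.integral_add[symmetric]) (auto intro!: integrable_continuous_real continuous_intros)
  finally show ?thesis unfolding c by auto
qed

lemma summable_inverse_shift_square:
  fixes r :: real
  assumes "r > 0" shows "summable (\<lambda>k. 1 / (r\<^sup>2 + (real k)\<^sup>2))"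
proof (rule summable_comparison_test_ev)
  show "summable (\<lambda>k. 1 / (real k)\<^sup>2)" using inverse_power_summable[of 2, where 'a = real] by (simp add: inverse_eq_divide)
  show "\<forall>\<^sub>F k in sequentially. norm (1 / (r\<^sup>2 + (real k)\<^sup>2)) \<le> 1 / (real k)\<^sup>2"
    using eventually_gt_at_top[of 0] by eventually_elim (use assms in \<open>auto intro!: divide_left_mono add_pos_pos mult_pos_pos\<close>)
qed

text \<open>The coefficients are the Fourier coefficients of the right-hand side, and the series converges
  uniformly; so the difference is orthogonal to all cosines and vanishes by
  Weierstrass approximation.\<close>

lemma cosh_fourier:
  fixes r y :: real
  assumes r: "r > 0" and y: "y \<in> {0..2*pi}"
  shows "(\<lambda>k. (if k = 0 then 1 else 2) / (r\<^sup>2 + (real k)\<^sup>2) * cos (real k * y)) sums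
    (pi / (r * sinh (r * pi)) * cosh (r * (pi - y)))"
proof -
  define c where "c = (\<lambda>k. r * sinh (r * pi) / pi * ((if k = 0 then 1 else 2) / (r\<^sup>2 + (real k)\<^sup>2)))"
  have sm: "summable (\<lambda>k. 2 * \<bar>r * sinh (r * pi) / pi\<bar> * (1 / (r\<^sup>2 + (real k)\<^sup>2)))"
    by (intro summable_mult summable_inverse_shift_square r)
  have cb: "norm (c k * t) \<le> 2 * \<bar>r * sinh (r * pi) / pi\<bar> * (1 / (r\<^sup>2 + (real k)\<^sup>2))" if "\<bar>t\<bar> \<le> 1" for k t
  proof -
    have "\<bar>c k\<bar> * \<bar>t\<bar> \<le> \<bar>c k\<bar> * 1" by (intro mult_left_mono that) auto
    also have "\<dots> \<le> 2 * \<bar>r * sinh (r * pi) / pi\<bar> * (1 / (r\<^sup>2 + (real k)\<^sup>2))"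
      by (auto simp: c_def abs_mult intro!: mult_left_mono divide_right_mono)
    finally show ?thesis by (simp add: abs_mult)
  qed
  define S where "S = (\<lambda>y. suminf (\<lambda>k. c k * cos (real k * y)))"
  have ul: "uniform_limit UNIV (\<lambda>n y. \<Sum>k<n. c k * cos (real k * y)) S sequentially"
    unfolding S_def by (rule Weierstrass_m_test[OF _ sm]) (rule cb, simp)
  have Scont: "continuous_on A S" for A
    by (rule uniform_limit_theorem[OF _ uniform_limit_on_subset[OF ul]]) (auto intro!: always_eventually continuous_intros)
  have eq0: "cosh (r * (pi - z)) - S z = 0" if z: "z \<in> {0..pi}" for z
  proof -
    have cont0: "continuous_on {0..pi} (\<lambda>z. cosh (r * (pi - z)) - S z)"
      by (intro continuous_intros Scont)
    have orth0: "integral {0..pi} (\<lambda>z. (cosh (r * (pi - z)) - S z) * cos (real j * z)) = 0" for j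
    proof -
    have ul2: "uniform_limit {0..pi} (\<lambda>n y. (\<Sum>k<n. c k * cos (real k * y)) * cos (real j * y)) (\<lambda>y. S y * cos (real j * y)) sequentially"
    proof (rule uniform_lim_mult)
      show "uniform_limit {0..pi} (\<lambda>n y. \<Sum>k<n. c k * cos (real k * y)) S sequentially"
        by (rule uniform_limit_on_subset[OF ul]) simp
      show "bounded (S ` {0..pi})" by (intro compact_imp_bounded compact_continuous_image Scont) simp
      show "bounded ((\<lambda>y. cos (real j * y)) ` {0..pi})"
        by (intro compact_imp_bounded compact_continuous_image continuous_intros) simp
    qed (rule uniform_limit_const)
    have "(\<lambda>n. integral {0..pi} (\<lambda>y. (\<Sum>k<n. c k * cos (real k * y)) * cos (real j * y))) \<longlonglongrightarrow> integral {0..pi} (\<lambda>y. S y * cos (real j * y))"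
    proof -
      have cn: "continuous_on {0..pi} (\<lambda>y. (\<Sum>k<n. c k * cos (real k * y)) * cos (real j * y))" for n
        by (intro continuous_intros)
      obtain I J where HI: "\<And>n. ((\<lambda>y. (\<Sum>k<n. c k * cos (real k * y)) * cos (real j * y)) has_integral I n) {0..pi}"
        "((\<lambda>y. S y * cos (real j * y)) has_integral J) {0..pi}" "I \<longlonglongrightarrow> J"
        using uniform_limit_integral[OF ul2 cn] by auto
      from HI(3) show ?thesis by (simp only: integral_unique[OF HI(1)] integral_unique[OF HI(2)])
    qed
    moreover have "\<forall>\<^sub>F n in sequentially. integral {0..pi} (\<lambda>y. (\<Sum>k<n. c k * cos (real k * y)) * cos (real j * y)) = r * sinh (r * pi) / (r\<^sup>2 + (real j)\<^sup>2)"
      using eventually_gt_at_top[of j]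
    proof eventually_elim
      case (elim n)
      have "integral {0..pi} (\<lambda>y. (\<Sum>k<n. c k * cos (real k * y)) * cos (real j * y)) =
         (\<Sum>k<n. c k * integral {0..pi} (\<lambda>y. cos (real k * y) * cos (real j * y)))"
        unfolding sum_distrib_right mult.assoc
        by (subst Henstock_Kurzweil_Integration.integral_sum) (simp, intro integrable_continuous_real continuous_intros, simp)
      also have "\<dots> = (\<Sum>k<n. if k = j then c j * (if j = 0 then pi else pi / 2) else 0)"
        unfolding integral_cos_cos by (intro sum.cong) auto
      also have "\<dots> = r * sinh (r * pi) / (r\<^sup>2 + (real j)\<^sup>2)" using elim by (simp add: c_def)
      finally show ?case .
    qed
    ultimately have "integral {0..pi} (\<lambda>y. S y * cos (real j * y)) = r * sinh (r * pi) / (r\<^sup>2 + (real j)\<^sup>2)"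
      by (rule LIMSEQ_unique[OF _ tendsto_eventually])
    moreover have "integral {0..pi} (\<lambda>z. (cosh (r * (pi - z)) - S z) * cos (real j * z)) =
      integral {0..pi} (\<lambda>z. cosh (r * (pi - z)) * cos (real j * z)) - integral {0..pi} (\<lambda>z. S z * cos (real j * z))"
      unfolding left_diff_distrib
      by (rule Henstock_Kurzweil_Integration.integral_diff)
         (intro integrable_continuous_real continuous_intros Scont)+
    ultimately show ?thesis by (simp add: integral_cosh_cos[OF r])
    qed
    from cosine_orthogonal_eq_0[OF cont0 orth0 z] show ?thesis .
  qed
  have Sy: "S y = cosh (r * (pi - y))"
  proof (cases "y \<le> pi")
    case True then show ?thesis using eq0[of y] y by simp
  next
    case False
    have "cos (real k * (2 * pi - y)) = cos (real k * y)" for k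
    proof -
      have "real k * (2 * pi - y) = 2 * pi * real k - real k * y" by (simp add: algebra_simps)
      then show ?thesis by (simp add: cos_diff cos_integer_2pi sin_integer_2pi)
    qed
    then have "S (2 * pi - y) = S y" by (simp add: S_def)
    moreover have "S (2 * pi - y) = cosh (r * (pi - (2 * pi - y)))" using eq0[of "2 * pi - y"] y False by simp
    moreover have "cosh (r * (pi - (2 * pi - y))) = cosh (r * (pi - y))"
      using cosh_minus[of "r * (pi - y)"] by (simp add: algebra_simps)
    ultimately show ?thesis by simp
  qed
  have "(\<lambda>k. c k * cos (real k * y)) sums S y"
    unfolding S_def by (intro summable_sums summable_comparison_test[OF _ sm] exI[of _ 0] allI impI cb) simp
  from sums_mult[OF this, of "pi / (r * sinh (r * pi))"]
  have "(\<lambda>k. pi / (r * sinh (r * pi)) * (c k * cos (real k * y))) sums (pi / (r * sinh (r * pi)) * cosh (r * (pi - y)))"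
    by (simp add: Sy)
  moreover have "pi / (r * sinh (r * pi)) * (c k * t) = (if k = 0 then 1 else 2) / (r\<^sup>2 + (real k)\<^sup>2) * t" for k t
    using r by (simp add: c_def)
  ultimately show ?thesis by simp
qed

section \<open>Fourier transforms on the line and the Poisson formula\<close>

lemma integral_symmetric_limit:
  fixes G :: "real \<Rightarrow> complex"
  assumes "integrable lborel G"
  shows "(\<lambda>N::nat. \<integral>x. indicator {-real N..<real N} x *\<^sub>R G x \<partial>lborel) \<longlonglongrightarrow> (\<integral>x. G x \<partial>lborel)"
proof (rule integral_dominated_convergence[where w = "\<lambda>x. norm (G x)"])
  show "AE x in lborel. (\<lambda>N::nat. indicator {-real N..<real N} x *\<^sub>R G x) \<longlonglongrightarrow> G x"
  proof (rule AE_I2)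
    fix x :: real
    have "\<forall>\<^sub>F N::nat in sequentially. indicator {-real N..<real N} x *\<^sub>R G x = G x"
      using eventually_gt_at_top[of "nat \<lceil>\<bar>x\<bar>\<rceil>"]
    proof eventually_elim
      case (elim N)
      then have "\<bar>x\<bar> < real N" by linarith
      then show ?case by (simp add: abs_less_iff)
    qed
    then show "(\<lambda>N::nat. indicator {-real N..<real N} x *\<^sub>R G x) \<longlonglongrightarrow> G x" by (rule tendsto_eventually)
  qed
qed (use assms in \<open>auto simp: indicator_def\<close>)

text \<open>The fundamental theorem is applied on closed intervals, but half-open ones tile the
  line; the difference is a null set.\<close>

lemma integral_indicator_Icc_Ico:
  fixes G :: "real \<Rightarrow> complex"
  assumes "has_bochner_integral lborel (\<lambda>x. indicator {a..b} x *\<^sub>R G x) v"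
  shows "has_bochner_integral lborel (\<lambda>x. indicator {a..<b} x *\<^sub>R G x) v"
proof -
  have "AE x in lborel. x \<noteq> b" by (rule AE_lborel_singleton)
  then have ae: "AE x in lborel. indicator {a..b} x *\<^sub>R G x = indicator {a..<b} x *\<^sub>R G x"
    by eventually_elim (auto simp: indicator_def)
  have m: "(\<lambda>x. indicator {a..<b} x *\<^sub>R G x) = (\<lambda>x. indicator {a..<b} x *\<^sub>R (indicator {a..b} x *\<^sub>R G x))"
    by (auto simp: fun_eq_iff indicator_def)
  have "(\<lambda>x. indicator {a..b} x *\<^sub>R G x) \<in> borel_measurable lborel"
    using assms by (auto simp: has_bochner_integral_iff)
  then have "(\<lambda>x. indicator {a..<b} x *\<^sub>R G x) \<in> borel_measurable lborel"
    unfolding m by measurable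
  with ae assms show ?thesis
    by (subst has_bochner_integral_cong_AE[symmetric]) (auto simp: has_bochner_integral_iff)
qed

text \<open>Applied to products, this is integration by parts on the whole line without boundary
  terms.\<close>

lemma integral_derivative_eq_0:
  fixes g g' :: "real \<Rightarrow> complex"
  assumes d: "\<And>x. (g has_vector_derivative g' x) (at x)" and c: "continuous_on UNIV g'"
    and i: "integrable lborel g'" and l: "(g \<longlongrightarrow> 0) at_top" "(g \<longlongrightarrow> 0) at_bot"
  shows "(\<integral>x. g' x \<partial>lborel) = 0"
proof -
  have "(\<integral>x. indicator {-real N..<real N} x *\<^sub>R g' x \<partial>lborel) = g (real N) - g (- real N)" for N :: nat
    by (intro has_bochner_integral_integral_eq integral_indicator_Icc_Ico has_bochner_integral_FTC_Icc)
       (auto intro: has_vector_derivative_at_within d continuous_on_subset[OF c])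
  moreover have "(\<lambda>N::nat. g (real N) - g (- real N)) \<longlonglongrightarrow> 0 - 0"
    by (intro tendsto_diff filterlim_compose[OF l(1)] filterlim_compose[OF l(2)] filterlim_real_sequentially
          filterlim_compose[OF filterlim_uminus_at_bot_at_top])
  ultimately show ?thesis using LIMSEQ_unique[OF integral_symmetric_limit[OF i]] by simp
qed

text \<open>Normalised with \<open>2 \<pi>\<close> in the exponent, so that Poisson summation over
  the integers carries no constant.\<close>

definition fourier :: "(real \<Rightarrow> complex) \<Rightarrow> real \<Rightarrow> complex" where
  "fourier f \<omega> = (\<integral>x. f x * cis (- 2 * pi * \<omega> * x) \<partial>lborel)"

lemma integrable_mult_cis:
  fixes f :: "real \<Rightarrow> complex"
  assumes "integrable lborel f"
  shows "integrable lborel (\<lambda>x. f x * cis (c * x))"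
proof (rule Bochner_Integration.integrable_bound[OF assms])
  have "(\<lambda>x. cis (c * x)) \<in> borel_measurable borel"
    by (intro borel_measurable_continuous_onI continuous_intros)
  then show "(\<lambda>x. f x * cis (c * x)) \<in> borel_measurable lborel"
    using assms by (intro borel_measurable_times) auto
qed (auto simp: norm_mult)

lemma fourier_lincomb:
  assumes "integrable lborel f" "integrable lborel g"
  shows "fourier (\<lambda>x. c * f x - g x) \<omega> = c * fourier f \<omega> - fourier g \<omega>"
proof -
  have "fourier (\<lambda>x. c * f x - g x) \<omega> =
    (\<integral>x. c * (f x * cis (- 2 * pi * \<omega> * x)) - g x * cis (- 2 * pi * \<omega> * x) \<partial>lborel)"
    by (simp add: fourier_def left_diff_distrib mult.assoc)
  also have "\<dots> = (\<integral>x. c * (f x * cis (- 2 * pi * \<omega> * x)) \<partial>lborel) - (\<integral>x. g x * cis (- 2 * pi * \<omega> * x) \<partial>lborel)"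
    by (intro Bochner_Integration.integral_diff integrable_mult_right integrable_mult_cis assms)
  finally show ?thesis by (simp add: fourier_def)
qed

lemma fourier_derivative:
  assumes d: "\<And>x. (f has_vector_derivative f' x) (at x)" and c: "continuous_on UNIV f'"
    and i: "integrable lborel f" "integrable lborel f'" and l: "(f \<longlongrightarrow> 0) at_top" "(f \<longlongrightarrow> 0) at_bot"
  shows "fourier f' \<omega> = 2 * pi * \<i> * \<omega> * fourier f \<omega>"
proof -
  define s where "s = - 2 * pi * \<omega>"
  have fc: "continuous_on UNIV f"
    using d by (meson continuous_at_imp_continuous_on has_vector_derivative_continuous)
  have dc: "((\<lambda>x. f x * cis (s * x)) has_vector_derivative (f' x * cis (s * x) + \<i> * s * (f x * cis (s * x)))) (at x)" for x
  proof -
    have "((\<lambda>x. cis (s * x)) has_vector_derivative (s *\<^sub>R (\<i> * cis (s * x)))) (at x)"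
    proof -
      have "((\<lambda>z. exp (\<i> * (of_real s * z))) has_field_derivative (of_real s * (\<i> * cis (s * x)))) (at (of_real x))"
        by (auto intro!: derivative_eq_intros simp: cis_conv_exp)
      from has_vector_derivative_real_field[OF this]
      show ?thesis by (simp add: cis_conv_exp scaleR_conv_of_real)
    qed
    from has_vector_derivative_mult[OF d this] show ?thesis
      by (rule has_vector_derivative_eq_rhs) (simp add: scaleR_conv_of_real algebra_simps)
  qed
  have n: "norm (f x * cis (s * x)) = norm (f x)" for x by (simp add: norm_mult)
  have "(\<integral>x. f' x * cis (s * x) + \<i> * s * (f x * cis (s * x)) \<partial>lborel) = 0"
  proof (rule integral_derivative_eq_0[OF dc])
    show "((\<lambda>x. f x * cis (s * x)) \<longlongrightarrow> 0) at_top" "((\<lambda>x. f x * cis (s * x)) \<longlongrightarrow> 0) at_bot"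
      using l by (auto intro!: tendsto_norm_zero_cancel[of "\<lambda>x. f x * cis (s * x)"] simp: n tendsto_norm_zero)
  qed (intro continuous_intros c fc Bochner_Integration.integrable_add integrable_mult_cis i integrable_mult_right)+
  then have "fourier f' \<omega> + \<i> * s * fourier f \<omega> = 0"
    unfolding fourier_def s_def[symmetric]
    by (subst (asm) Bochner_Integration.integral_add) (auto intro!: integrable_mult_cis i)
  then show ?thesis by (simp add: s_def add_eq_0_iff algebra_simps)
qed

text \<open>The case \<open>r = 1\<close> of \<open>cosh_fourier\<close>, rescaled to period 1. The
  right-hand side is \<open>\<pi> / sinh \<pi>\<close> times the kernel \<open>P\<close> of
  \<open>poisson_summation\<close>.\<close>

lemma cosh_frac_fourier:
  "(\<lambda>k. (if k = 0 then 1 else 2) / (1 + (real k)\<^sup>2) * cos (2 * pi * real k * x)) sums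
    (pi / sinh pi * cosh (pi * (1 - 2 * frac x)))"
proof -
  have "2 * pi * frac x \<in> {0..2*pi}" using frac_ge_0[of x] frac_lt_1[of x] by auto
  from cosh_fourier[OF zero_less_one this]
  have "(\<lambda>k. (if k = 0 then 1 else 2) / (1 + (real k)\<^sup>2) * cos (real k * (2 * pi * frac x))) sums
    (pi / sinh pi * cosh (pi - 2 * pi * frac x))" by simp
  moreover have "cos (real k * (2 * pi * frac x)) = cos (2 * pi * real k * x)" for k
  proof -
    have "real k * (2 * pi * frac x) = 2 * pi * real k * x - 2 * pi * of_int (int k * \<lfloor>x\<rfloor>)"
      by (simp add: frac_def algebra_simps)
    then show ?thesis
      by (simp only: cos_diff cos_integer_2pi[OF Ints_of_int] sin_integer_2pi[OF Ints_of_int])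
  qed
  ultimately show ?thesis by (simp add: algebra_simps)
qed

text \<open>The periodic function \<open>P\<close> below solves \<open>4 \<pi>\<^sup>2 P - P'' = 0\<close> between the integers, where its derivative jumps.
  Integration by parts therefore turns the integral of \<open>(4 \<pi>\<^sup>2 f - f'') P\<close> into the sum of \<open>f\<close> over
  the integers, while inserting the absolutely convergent Fourier series of \<open>P\<close> turns it into the sum
  of the Fourier transform.\<close>

theorem poisson_summation:
  fixes f f' f'' :: "real \<Rightarrow> complex"
  assumes d1: "\<And>x. (f has_vector_derivative f' x) (at x)"
    and d2: "\<And>x. (f' has_vector_derivative f'' x) (at x)"
    and c2: "continuous_on UNIV f''"
    and i: "integrable lborel f" "integrable lborel f'" "integrable lborel f''"
    and l0: "(f \<longlongrightarrow> 0) at_top" "(f \<longlongrightarrow> 0) at_bot"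
    and l1: "(f' \<longlongrightarrow> 0) at_top" "(f' \<longlongrightarrow> 0) at_bot"
    and L: "(\<lambda>N::nat. \<Sum>k = - int N..int N. f (of_int k)) \<longlonglongrightarrow> L"
  shows "(\<lambda>k. if k = 0 then fourier f 0 else fourier f (real k) + fourier f (- real k)) sums L"
proof -
  define P where "P = (\<lambda>x. cosh (pi * (1 - 2 * frac x)))"
  define G where "G = (\<lambda>x. (4 * pi\<^sup>2 * f x - f'' x) * of_real (P x))"
  have c1: "continuous_on UNIV f'" "continuous_on UNIV f"
    using d1 d2 by (meson continuous_at_imp_continuous_on has_vector_derivative_continuous)+
  have ig: "integrable lborel (\<lambda>x. 4 * pi\<^sup>2 * f x - f'' x)" by (intro Bochner_Integration.integrable_diff integrable_mult_right i)
  have Pb: "\<bar>P x\<bar> \<le> cosh pi" for x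
  proof -
    have "\<bar>pi * (1 - 2 * frac x)\<bar> \<le> pi * 1" unfolding abs_mult
      by (intro mult_mono) (use frac_ge_0[of x] frac_lt_1[of x] in \<open>auto simp: abs_le_iff\<close>)
    then have "cosh \<bar>pi * (1 - 2 * frac x)\<bar> \<le> cosh pi" by (intro cosh_real_nonneg_le_iff[THEN iffD2]) auto
    moreover have "cosh \<bar>t\<bar> = cosh t" for t :: real by (simp add: abs_if)
    moreover have "cosh t \<ge> 0" for t :: real using cosh_real_ge_1[of t] by linarith
    ultimately show ?thesis unfolding P_def by simp
  qed
  have Pm: "P \<in> borel_measurable borel" unfolding P_def frac_def cosh_def by measurable
  have iG: "integrable lborel G" unfolding G_def
  proof (rule Bochner_Integration.integrable_bound)
    show "integrable lborel (\<lambda>x. (4 * pi\<^sup>2 * f x - f'' x) * of_real (cosh pi))"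
      using ig by (rule integrable_mult_left)
    show "(\<lambda>x. (4 * pi\<^sup>2 * f x - f'' x) * of_real (P x)) \<in> borel_measurable lborel"
      using ig Pm by (intro borel_measurable_times) auto
  qed (use Pb in \<open>auto simp: norm_mult intro!: mult_left_mono\<close>)
  \<comment> \<open>On \<open>[k, k + 1]\<close> the integrand is the derivative of
    \<open>f P' - f' P\<close>, as \<open>P'' = 4 \<pi>^2 P\<close> there. At the two ends
    \<open>P\<close> takes the same value, so \<open>f'\<close> will telescope, and
    \<open>P'\<close> takes opposite values, so the values of \<open>f\<close> add up.\<close>
  have unit: "has_bochner_integral lborel (\<lambda>x. indicator {of_int k..<of_int k + 1} x *\<^sub>R G x)
     (2 * pi * sinh pi * (f (of_int k) + f (of_int (k + 1))) - cosh pi * (f' (of_int (k + 1)) - f' (of_int k)))" for k :: int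
  proof (rule integral_indicator_Icc_Ico)
    define C where "C = (\<lambda>x. cosh (pi * (1 - 2 * (x - of_int k))))"
    define S where "S = (\<lambda>x. 2 * pi * sinh (pi * (1 - 2 * (x - of_int k))))"
    define H where "H = (\<lambda>x. - (f x * of_real (S x)) - f' x * of_real (C x))"
    have dC: "(C has_field_derivative - S x) (at x)" for x
      unfolding C_def S_def by (auto intro!: derivative_eq_intros)
    have dS: "(S has_field_derivative - 4 * pi\<^sup>2 * C x) (at x)" for x
      unfolding C_def S_def
      by (auto intro!: derivative_eq_intros simp: power2_eq_square)
    have dH: "(H has_vector_derivative ((4 * pi\<^sup>2 * f x - f'' x) * of_real (C x))) (at x)" for x
    proof -
      have 1: "((\<lambda>x. complex_of_real (S x)) has_vector_derivative of_real (- 4 * pi\<^sup>2 * C x)) (at x)"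
        by (rule has_vector_derivative_of_real) (rule dS)
      have 2: "((\<lambda>x. complex_of_real (C x)) has_vector_derivative of_real (- S x)) (at x)"
        by (rule has_vector_derivative_of_real) (rule dC)
      from has_vector_derivative_diff[OF has_vector_derivative_minus[OF has_vector_derivative_mult[OF d1 1]] has_vector_derivative_mult[OF d2 2]]
      show ?thesis unfolding H_def
        by (rule has_vector_derivative_eq_rhs) (simp add: algebra_simps)
    qed
    have cH: "continuous_on A (\<lambda>x. (4 * pi\<^sup>2 * f x - f'' x) * of_real (C x))" for A
      unfolding C_def by (intro continuous_intros continuous_on_subset[OF c2] continuous_on_subset[OF c1(2)]) auto
    have "has_bochner_integral lborel (\<lambda>x. indicator {of_int k..of_int k + 1} x *\<^sub>R ((4 * pi\<^sup>2 * f x - f'' x) * of_real (C x)))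
       (H (of_int k + 1) - H (of_int k))"
      by (rule has_bochner_integral_FTC_Icc) (simp, rule has_vector_derivative_at_within[OF dH], rule cH)
    moreover have "C x = P x" if "x \<in> {of_int k..of_int k + 1}" for x
    proof (cases "x = of_int k + 1")
      case True
      have "frac x = 0" by (simp add: True frac_def)
      then show ?thesis using cosh_minus[of pi] by (simp add: C_def P_def True algebra_simps)
    next
      case False
      then have "\<lfloor>x\<rfloor> = k" using that by (intro floor_unique) auto
      then show ?thesis by (simp add: C_def P_def frac_def)
    qed
    then have "indicator {of_int k..of_int k + 1} x *\<^sub>R ((4 * pi\<^sup>2 * f x - f'' x) * of_real (C x)) = indicator {of_int k..of_int k + 1} x *\<^sub>R G x" for x :: real
      by (auto simp: indicator_def G_def)
    moreover have "H (of_int k + 1) - H (of_int k) = 2 * pi * sinh pi * (f (of_int k) + f (of_int (k + 1))) - cosh pi * (f' (of_int (k + 1)) - f' (of_int k))"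
      by (simp add: H_def S_def C_def algebra_simps)
    ultimately show "has_bochner_integral lborel (\<lambda>x. indicator {of_int k..of_int k + 1} x *\<^sub>R G x)
      (2 * pi * sinh pi * (f (of_int k) + f (of_int (k + 1))) - cosh pi * (f' (of_int (k + 1)) - f' (of_int k)))"
      by (simp only:)
  qed
  have ind: "indicator {- real N..<real N} x = (\<Sum>k = - int N..<int N. indicator {of_int k..<of_int k + 1} x :: real)" for N x
  proof -
    have "indicator {of_int k..<of_int k + 1} x = (if k = \<lfloor>x\<rfloor> then 1 else 0 :: real)" for k
      by (auto simp: indicator_def) linarith+
    moreover have "\<lfloor>x\<rfloor> \<in> {- int N..<int N} \<longleftrightarrow> x \<in> {- real N..<real N}" by (auto simp: le_floor_iff floor_less_iff)
    ultimately show ?thesis by (simp add: indicator_def)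
  qed
  have tele: "(\<Sum>k = - int N..<int N. g (k + 1)) = (\<Sum>k = - int N..<int N. g k) + g (int N) - g (- int N)" for g :: "int \<Rightarrow> complex" and N
  proof -
    have "(\<Sum>k = - int N..<int N. g (k + 1)) = (\<Sum>k = - int N + 1..<int N + 1. g k)"
      by (rule sum.reindex_bij_witness[of _ "\<lambda>k. k - 1" "\<lambda>k. k + 1"]) auto
    also have "{- int N + 1..<int N + 1} = {- int N + 1..int N}" by auto
    also have "(\<Sum>k\<in>{- int N + 1..int N}. g k) = (\<Sum>k\<in>insert (- int N) {- int N + 1..int N}. g k) - g (- int N)" by simp
    also have "insert (- int N) {- int N + 1..int N} = insert (int N) {- int N..<int N}" by auto
    also have "(\<Sum>k\<in>insert (int N) {- int N..<int N}. g k) = g (int N) + (\<Sum>k = - int N..<int N. g k)" by simp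
    finally show ?thesis by simp
  qed
  have partial: "(\<integral>x. indicator {-real N..<real N} x *\<^sub>R G x \<partial>lborel) =
    2 * pi * sinh pi * (2 * (\<Sum>k = - int N..int N. f (of_int k)) - f (real N) - f (- real N)) - cosh pi * (f' (real N) - f' (- real N))" for N
  proof -
    have "(\<integral>x. indicator {-real N..<real N} x *\<^sub>R G x \<partial>lborel) = (\<integral>x. (\<Sum>k = - int N..<int N. indicator {of_int k..<of_int k + 1} x *\<^sub>R G x) \<partial>lborel)"
      unfolding ind scaleR_sum_left ..
    also have "\<dots> = (\<Sum>k = - int N..<int N. 2 * pi * sinh pi * (f (of_int k) + f (of_int (k + 1))) - cosh pi * (f' (of_int (k + 1)) - f' (of_int k)))"
      by (rule has_bochner_integral_integral_eq[OF has_bochner_integral_sum[OF unit]])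
    also have "\<dots> = 2 * pi * sinh pi * ((\<Sum>k = - int N..<int N. f (of_int k)) + (\<Sum>k = - int N..<int N. f (of_int (k + 1)))) -
       cosh pi * ((\<Sum>k = - int N..<int N. f' (of_int (k + 1))) - (\<Sum>k = - int N..<int N. f' (of_int k)))"
      by (simp only: sum_subtractf sum_distrib_left[symmetric] sum.distrib)
    also have "(\<Sum>k = - int N..<int N. f (of_int (k + 1))) = (\<Sum>k = - int N..<int N. f (of_int k)) + f (real N) - f (- real N)"
      using tele[of "\<lambda>k. f (of_int k)" N] by simp
    also have "(\<Sum>k = - int N..<int N. f' (of_int (k + 1))) = (\<Sum>k = - int N..<int N. f' (of_int k)) + f' (real N) - f' (- real N)"
      using tele[of "\<lambda>k. f' (of_int k)" N] by simp
    also have "(\<Sum>k = - int N..<int N. f (of_int k)) = (\<Sum>k = - int N..int N. f (of_int k)) - f (real N)"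
    proof -
      have "{- int N..int N} = insert (int N) {- int N..<int N}" by auto
      then show ?thesis by simp
    qed
    finally show ?thesis by (simp add: algebra_simps)
  qed
  have nat_top: "filterlim (\<lambda>N::nat. - real N) at_bot sequentially"
    by (rule filterlim_compose[OF filterlim_uminus_at_bot_at_top filterlim_real_sequentially])
  note tl = filterlim_compose[OF l0(1) filterlim_real_sequentially] filterlim_compose[OF l0(2) nat_top]
    filterlim_compose[OF l1(1) filterlim_real_sequentially] filterlim_compose[OF l1(2) nat_top]
  have "(\<lambda>N::nat. \<integral>x. indicator {-real N..<real N} x *\<^sub>R G x \<partial>lborel) \<longlonglongrightarrow> 2 * pi * sinh pi * (2 * L - 0 - 0) - of_real (cosh pi) * ((0::complex) - 0)"
    unfolding partial by (intro tendsto_intros L tl)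
  with integral_symmetric_limit[OF iG] have GL: "(\<integral>x. G x \<partial>lborel) = 4 * pi * sinh pi * L"
    using LIMSEQ_unique by fastforce
  define e where "e = (\<lambda>k::nat. (if k = 0 then 1 else 2) / (1 + (real k)\<^sup>2))"
  define T where "T = (\<lambda>k x. (4 * pi\<^sup>2 * f x - f'' x) * of_real (e k * cos (2 * pi * real k * x)))"
  have iT: "integrable lborel (T k)" for k unfolding T_def
  proof (rule Bochner_Integration.integrable_bound[OF integrable_mult_left[OF ig, of "of_real (e k)"]])
    have "(\<lambda>x. complex_of_real (e k * cos (2 * pi * real k * x))) \<in> borel_measurable borel"
      by (intro borel_measurable_continuous_onI continuous_intros)
    then show "(\<lambda>x. (4 * pi\<^sup>2 * f x - f'' x) * of_real (e k * cos (2 * pi * real k * x))) \<in> borel_measurable lborel"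
      using ig by (intro borel_measurable_times) auto
  qed (auto simp: norm_mult abs_mult intro!: mult_left_mono mult_left_le)
  have e0: "e k \<ge> 0" for k by (simp add: e_def)
  have sme: "summable e"
  proof -
    have "summable (\<lambda>k. 2 * (1 / (1\<^sup>2 + (real k)\<^sup>2)))" by (intro summable_mult summable_inverse_shift_square) simp
    then show ?thesis by (rule summable_comparison_test[rotated]) (auto simp: e_def intro!: exI[of _ 0] divide_right_mono)
  qed
  have nT: "norm (T k x) \<le> e k * norm (4 * pi\<^sup>2 * f x - f'' x)" for k x
  proof -
    have "\<bar>e k * cos (2 * pi * real k * x)\<bar> \<le> e k"
      using e0[of k] by (simp add: abs_mult mult_left_le)
    then show ?thesis unfolding T_def norm_mult norm_of_real
      by (subst mult.commute) (rule mult_right_mono, auto)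
  qed
  have sumT: "(\<lambda>k. T k x) sums (G x * of_real (pi / sinh pi))" for x
  proof -
    have "(\<lambda>k. of_real (e k * cos (2 * pi * real k * x)) :: complex) sums of_real (pi / sinh pi * P x)"
      unfolding sums_of_real_iff P_def e_def using cosh_frac_fourier[of x] .
    from sums_mult[OF this, of "4 * pi\<^sup>2 * f x - f'' x"] show ?thesis
      by (simp add: T_def G_def mult_ac)
  qed
  have "(\<lambda>k. \<integral>x. T k x \<partial>lborel) sums (\<integral>x. suminf (\<lambda>k. T k x) \<partial>lborel)"
  proof (rule sums_integral[OF iT])
    show "AE x in lborel. summable (\<lambda>k. norm (T k x))"
      by (intro AE_I2 summable_comparison_test[OF _ summable_mult2[OF sme]] exI[of _ 0] allI impI)
         (use nT in auto)
    show "summable (\<lambda>k. \<integral>x. norm (T k x) \<partial>lborel)"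
    proof (rule summable_comparison_test[OF _ summable_mult2[OF sme]], intro exI allI impI)
      fix k :: nat
      have "(\<integral>x. norm (T k x) \<partial>lborel) \<le> (\<integral>x. e k * norm (4 * pi\<^sup>2 * f x - f'' x) \<partial>lborel)"
        by (rule integral_mono) (use iT ig nT in auto)
      then show "norm (\<integral>x. norm (T k x) \<partial>lborel) \<le> e k * (\<integral>x. norm (4 * pi\<^sup>2 * f x - f'' x) \<partial>lborel)"
        by simp
    qed
  qed
  also have "(\<integral>x. suminf (\<lambda>k. T k x) \<partial>lborel) = (\<integral>x. G x * of_real (pi / sinh pi) \<partial>lborel)"
    using sumT by (simp add: sums_iff)
  also have "\<dots> = 4 * pi\<^sup>2 * L" unfolding integral_mult_left_zero GL by (simp add: power2_eq_square)
  finally have S1: "(\<lambda>k. \<integral>x. T k x \<partial>lborel) sums (4 * pi\<^sup>2 * L)" .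
  have IT: "(\<integral>x. T k x \<partial>lborel) = of_real (e k * (2 * pi\<^sup>2 * (1 + (real k)\<^sup>2))) * (fourier f (real k) + fourier f (- real k))" for k
  proof -
    \<comment> \<open>The factor \<open>1 + \<omega>^2\<close> cancels the denominator of the
      coefficient \<open>e k\<close>, leaving the plain Fourier transform of
      \<open>f\<close>.\<close>
    have F2: "fourier (\<lambda>x. 4 * pi\<^sup>2 * f x - f'' x) \<omega> = 4 * pi\<^sup>2 * (1 + \<omega>\<^sup>2) * fourier f \<omega>" for \<omega>
    proof -
      have "fourier (\<lambda>x. 4 * pi\<^sup>2 * f x - f'' x) \<omega> = 4 * pi\<^sup>2 * fourier f \<omega> - fourier f'' \<omega>"
        by (rule fourier_lincomb[OF i(1,3)])
      also have "fourier f'' \<omega> = 2 * pi * \<i> * \<omega> * (2 * pi * \<i> * \<omega> * fourier f \<omega>)"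
        by (simp only: fourier_derivative[OF d2 c2 i(2,3) l1] fourier_derivative[OF d1 c1(1) i(1,2) l0])
      finally show ?thesis by (simp add: algebra_simps power2_eq_square)
    qed
    have "T k x = of_real (e k / 2) * ((4 * pi\<^sup>2 * f x - f'' x) * cis (- 2 * pi * real k * x) + (4 * pi\<^sup>2 * f x - f'' x) * cis (- 2 * pi * (- real k) * x))" for x
    proof -
      define t where "t = 2 * pi * real k * x"
      have 1: "- 2 * pi * real k * x = - t" "- 2 * pi * (- real k) * x = t" by (simp_all add: t_def)
      have 2: "complex_of_real (e k * cos t) = of_real (e k / 2) * (cis (- t) + cis t)" by (simp add: complex_eq_iff)
      define g where "g = 4 * pi\<^sup>2 * f x - f'' x"
      show ?thesis unfolding T_def t_def[symmetric] g_def[symmetric] 1 2 by (simp add: algebra_simps)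
    qed
    then have "(\<integral>x. T k x \<partial>lborel) = of_real (e k / 2) * (\<integral>x. (4 * pi\<^sup>2 * f x - f'' x) * cis (- 2 * pi * real k * x) + (4 * pi\<^sup>2 * f x - f'' x) * cis (- 2 * pi * (- real k) * x) \<partial>lborel)"
      by (simp only: integral_mult_right_zero)
    also have "\<dots> = of_real (e k / 2) * (fourier (\<lambda>x. 4 * pi\<^sup>2 * f x - f'' x) (real k) + fourier (\<lambda>x. 4 * pi\<^sup>2 * f x - f'' x) (- real k))"
      unfolding fourier_def by (subst Bochner_Integration.integral_add[OF integrable_mult_cis[OF ig] integrable_mult_cis[OF ig]]) (rule refl)
    finally have "(\<integral>x. T k x \<partial>lborel) = of_real (e k / 2) * (fourier (\<lambda>x. 4 * pi\<^sup>2 * f x - f'' x) (real k) + fourier (\<lambda>x. 4 * pi\<^sup>2 * f x - f'' x) (- real k))" .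
    then show ?thesis unfolding F2 by (simp add: algebra_simps)
  qed
  have e1: "of_real (e k * (2 * pi\<^sup>2 * (1 + (real k)\<^sup>2))) = (4 * pi\<^sup>2 * (if k = 0 then 1 / 2 else 1) :: complex)" for k
  proof -
    have "1 + (real k)\<^sup>2 \<noteq> 0" by (metis add_pos_nonneg less_irrefl zero_le_power2 zero_less_one)
    then have 1: "e k * (2 * pi\<^sup>2 * (1 + (real k)\<^sup>2)) = 4 * pi\<^sup>2 * (if k = 0 then 1 / 2 else 1)" by (simp add: e_def)
    show ?thesis unfolding 1 by simp
  qed
  note S2 = S1[unfolded IT e1]
  from S2 have "(\<lambda>k. 4 * pi\<^sup>2 * (if k = 0 then 1 / 2 else 1) * (fourier f (real k) + fourier f (- real k))) sums (4 * pi\<^sup>2 * L)" .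
  from sums_mult[OF this, of "1 / (4 * pi\<^sup>2)"]
  have "(\<lambda>k. of_real (if k = 0 then 1 / 2 else 1) * (fourier f (real k) + fourier f (- real k))) sums L"
    by (simp add: mult.assoc)
  moreover have "of_real (if k = 0 then 1 / 2 else 1) * (fourier f (real k) + fourier f (- real k)) = (if k = 0 then fourier f 0 else fourier f (real k) + fourier f (- real k))" for k
    by simp
  ultimately show ?thesis by simp
qed

section \<open>The Bessel function of order zero\<close>

lemma integrable_inverse_1_plus_square: "integrable lborel (\<lambda>x :: real. 1 / (1 + x\<^sup>2))"
proof -
  have "set_integrable lborel (einterval (-\<infinity>) \<infinity>) (\<lambda>x :: real. 1 / (1 + x\<^sup>2))"
  proof (rule interval_integral_FTC_nonneg[where F = arctan and A = "- pi / 2" and B = "pi / 2"])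
    show "DERIV arctan x :> 1 / (1 + x\<^sup>2)" for x :: real
      using DERIV_arctan[of x] by (simp add: inverse_eq_divide)
    show "isCont (\<lambda>x. 1 / (1 + x\<^sup>2)) x" for x :: real
      by (intro continuous_intros) (metis add_pos_nonneg less_irrefl zero_le_power2 zero_less_one)
    show "((arctan \<circ> real_of_ereal) \<longlongrightarrow> - pi / 2) (at_right (- \<infinity>))"
      using tendsto_arctan_at_bot by (simp add: ereal_tendsto_simps)
    show "((arctan \<circ> real_of_ereal) \<longlongrightarrow> pi / 2) (at_left \<infinity>)"
      using tendsto_arctan_at_top by (simp add: ereal_tendsto_simps)
  qed auto
  then show ?thesis by (simp add: set_integrable_def)
qed

text \<open>The bound \<open>C / (1 + x^2)\<close> is the common measure of decay: it gives
  integrability here, limits at infinity in \<open>tendsto_0_bounded_by_cauchy\<close> and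
  summability over the integers in \<open>abs_summable_on_int_bound\<close>.\<close>

lemma integrable_bounded_by_cauchy:
  fixes f :: "real \<Rightarrow> complex"
  assumes "f \<in> borel_measurable borel" "\<And>x. norm (f x) \<le> C / (1 + x\<^sup>2)"
  shows "integrable lborel f"
proof (rule Bochner_Integration.integrable_bound)
  show "integrable lborel (\<lambda>x. C * (1 / (1 + x\<^sup>2)))"
    by (intro integrable_mult_right integrable_inverse_1_plus_square)
  show "AE x in lborel. norm (f x) \<le> norm (C * (1 / (1 + x\<^sup>2)))"
  proof (rule AE_I2)
    fix x :: real
    have "norm (f x) \<le> C / (1 + x\<^sup>2)" by (rule assms)
    also have "\<dots> \<le> \<bar>C\<bar> / (1 + x\<^sup>2)" by (intro divide_right_mono) auto
    finally show "norm (f x) \<le> norm (C * (1 / (1 + x\<^sup>2)))" by simp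
  qed
qed (use assms in simp)

text \<open>The crude estimates \<open>cosh t \<ge> (1 + t^2) / 4\<close> and
  \<open>exp u \<ge> u\<close> suffice.\<close>

lemma exp_minus_cosh_le:
  fixes c t :: real
  assumes c: "c > 0"
  shows "exp (- c * cosh t) \<le> (4 / c) / (1 + t\<^sup>2)"
proof -
  have pos: "1 + t\<^sup>2 > 0" using zero_le_power2[of t] by linarith
  have "1 + \<bar>t\<bar> + \<bar>t\<bar>\<^sup>2 / 2 \<le> exp \<bar>t\<bar>" by (rule exp_lower_Taylor_quadratic) simp
  moreover have "exp \<bar>t\<bar> \<le> exp t + exp (- t)"
    by (cases "t \<ge> 0") simp_all
  ultimately have "1 + \<bar>t\<bar> + \<bar>t\<bar>\<^sup>2 / 2 \<le> exp t + exp (- t)" by (rule order.trans)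
  then have "(1 + \<bar>t\<bar> + \<bar>t\<bar>\<^sup>2 / 2) / 2 \<le> cosh t" unfolding cosh_field_def by (rule divide_right_mono) simp
  moreover have "(1 + u\<^sup>2) / 4 \<le> (1 + u + u\<^sup>2 / 2) / 2" if "u \<ge> 0" for u :: real
   proof -
    have "(1 + u + u\<^sup>2 / 2) / 2 = (1 + u\<^sup>2) / 4 + (1 + 2 * u) / 4"
      by (simp add: add_divide_distrib)
    then show ?thesis using that by simp
  qed
  from this[of "\<bar>t\<bar>"] have "(1 + t\<^sup>2) / 4 \<le> (1 + \<bar>t\<bar> + \<bar>t\<bar>\<^sup>2 / 2) / 2"
    by simp
  ultimately have "(1 + t\<^sup>2) / 4 \<le> cosh t" by (rule order.trans[rotated])
  then have "c * ((1 + t\<^sup>2) / 4) \<le> c * cosh t" using c by (intro mult_left_mono) auto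
  also have "\<dots> \<le> exp (c * cosh t)" using exp_ge_add_one_self[of "c * cosh t"] by linarith
  finally have "1 / exp (c * cosh t) \<le> 1 / (c * ((1 + t\<^sup>2) / 4))" using c pos by (intro divide_left_mono) auto
  then show ?thesis by (simp add: exp_minus inverse_eq_divide)
qed

lemma integrable_exp_minus_cosh:
  assumes "Re z > 0"
  shows "integrable lborel (\<lambda>t :: real. exp (- z * of_real (cosh t)))"
proof (rule integrable_bounded_by_cauchy)
  show "norm (exp (- z * of_real (cosh t))) \<le> (4 / Re z) / (1 + t\<^sup>2)" for t
    using exp_minus_cosh_le[OF assms, of t] by simp
qed (intro borel_measurable_continuous_onI continuous_intros)

text \<open>The integrand is even in \<open>t\<close>. The integral over the whole line is the one
  that translations of \<open>t\<close> leave unchanged.\<close>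

lemma bessel_K0_eq_lebesgue:
  assumes z: "Re z > 0"
  shows "2 * bessel_K0 z = (\<integral>t. exp (- z * of_real (cosh t)) \<partial>lborel)"
proof -
  define f where "f = (\<lambda>t :: real. exp (- z * of_real (cosh t)))"
  have fi: "integrable lborel f" unfolding f_def by (rule integrable_exp_minus_cosh[OF z])
  have si: "set_integrable lborel A f" if "A \<in> sets borel" for A
    using that fi unfolding set_integrable_def by (intro integrable_mult_indicator) auto
  have "bessel_K0 z = integral {0..} f" by (simp add: bessel_K0_def f_def)
  also have "\<dots> = (\<integral>t. indicator {0..} t *\<^sub>R f t \<partial>lborel)"
    using set_borel_integral_eq_integral(2)[OF si[of "{0..}"]] by (simp add: set_lebesgue_integral_def)
  finally have K: "bessel_K0 z = (\<integral>t. indicator {0..} t *\<^sub>R f t \<partial>lborel)" .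
  have "(\<integral>t. indicator {0..} t *\<^sub>R f t \<partial>lborel) = (\<integral>t. indicator {0..} (-t) *\<^sub>R f (-t) \<partial>lborel)"
    using lborel_integral_real_affine[of "-1" "\<lambda>t. indicator {0..} t *\<^sub>R f t" 0] by simp
  also have "\<dots> = (\<integral>t. indicator {..<0} t *\<^sub>R f t \<partial>lborel)"
  proof (rule integral_cong_AE)
    have "AE t in lborel. t \<noteq> (0::real)" by (rule AE_lborel_singleton)
    then show "AE t in lborel. indicator {0..} (-t) *\<^sub>R f (-t) = indicator {..<0} t *\<^sub>R f t"
      by eventually_elim (auto simp: indicator_def f_def)
    have "f \<in> borel_measurable borel"
      unfolding f_def by (intro borel_measurable_continuous_onI continuous_intros)
    then show "(\<lambda>t. indicator {0..} (-t) *\<^sub>R f (-t)) \<in> borel_measurable lborel"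
      "(\<lambda>t. indicator {..<0} t *\<^sub>R f t) \<in> borel_measurable lborel" by measurable
  qed
  finally have K': "bessel_K0 z = (\<integral>t. indicator {..<0} t *\<^sub>R f t \<partial>lborel)" using K by simp
  have "2 * bessel_K0 z = (\<integral>t. indicator {0..} t *\<^sub>R f t \<partial>lborel) + (\<integral>t. indicator {..<0} t *\<^sub>R f t \<partial>lborel)"
    using K K' by simp
  also have "\<dots> = (\<integral>t. indicator {0..} t *\<^sub>R f t + indicator {..<0} t *\<^sub>R f t \<partial>lborel)"
    using si[of "{0..}"] si[of "{..<0}"] unfolding set_integrable_def
    by (intro Bochner_Integration.integral_add[symmetric]) auto
  also have "\<dots> = (\<integral>t. f t \<partial>lborel)"
    by (intro Bochner_Integration.integral_cong) (auto simp: indicator_def)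
  finally show ?thesis by (simp add: f_def)
qed

text \<open>In the exponent \<open>(Re z - x0) cosh t + x0 cosh t\<close> the first part is at least
  \<open>Re z - x0\<close>, and the second keeps the integral finite.\<close>

lemma bessel_K0_bound:
  assumes x0: "x0 > 0"
  obtains C where "\<And>z. Re z \<ge> x0 \<Longrightarrow> norm (bessel_K0 z) \<le> C * exp (- Re z)"
proof -
  define C where "C = exp x0 * (\<integral>t. exp (- x0 * cosh t) \<partial>lborel)"
  have i0: "integrable lborel (\<lambda>t. exp (- x0 * cosh t))"
    using integrable_norm[OF integrable_exp_minus_cosh[of "of_real x0"]] x0 by simp
  show ?thesis
  proof (rule that[of C])
    fix z assume z: "Re z \<ge> x0"
    then have z0: "Re z > 0" using x0 by simp
    have C0: "C \<ge> 0" unfolding C_def by (intro mult_nonneg_nonneg integral_nonneg_AE) auto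
    have "norm (2 * bessel_K0 z) \<le> (\<integral>t. norm (exp (- z * of_real (cosh t))) \<partial>lborel)"
      unfolding bessel_K0_eq_lebesgue[OF z0] by (rule integral_norm_bound)
    also have "\<dots> \<le> (\<integral>t. exp (x0 - Re z) * exp (- x0 * cosh t) \<partial>lborel)"
    proof (rule integral_mono)
      show "integrable lborel (\<lambda>t. norm (exp (- z * of_real (cosh t))))"
        by (rule integrable_norm[OF integrable_exp_minus_cosh[OF z0]])
      show "integrable lborel (\<lambda>t. exp (x0 - Re z) * exp (- x0 * cosh t))" by (intro integrable_mult_right i0)
      fix t :: real
      have "(Re z - x0) * 1 \<le> (Re z - x0) * cosh t" using z by (intro mult_left_mono cosh_real_ge_1) auto
      then have "- Re z * cosh t \<le> (x0 - Re z) + (- x0 * cosh t)" by (simp add: algebra_simps)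
      then show "norm (exp (- z * of_real (cosh t))) \<le> exp (x0 - Re z) * exp (- x0 * cosh t)"
        by (simp flip: exp_add)
    qed
    also have "\<dots> = exp (x0 - Re z) * (\<integral>t. exp (- x0 * cosh t) \<partial>lborel)" by simp
    also have "exp (x0 - Re z) = exp x0 * exp (- Re z)" by (simp flip: exp_add)
    finally have "norm (2 * bessel_K0 z) \<le> C * exp (- Re z)" by (simp add: C_def mult_ac)
    then have "norm (2 * bessel_K0 z) \<le> C * exp (- Re z)" .
    then have "2 * norm (bessel_K0 z) \<le> C * exp (- Re z)" by (simp add: norm_mult)
    moreover have "C * exp (- Re z) \<ge> 0" using C0 by simp
    ultimately show "norm (bessel_K0 z) \<le> C * exp (- Re z)" using norm_ge_zero[of "bessel_K0 z"] by linarith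
  qed
qed

text \<open>The integral is unchanged if \<open>a\<close> and \<open>b\<close> are replaced by \<open>a + s\<close> and \<open>b - s\<close>: for real \<open>s\<close> this
  is a translation, and for complex \<open>s\<close> the derivative of the integral in \<open>s\<close> is the integral of a
  derivative in \<open>t\<close>. The choice \<open>s = (b - a) / 2\<close> makes the exponent a multiple of \<open>cosh t\<close>.\<close>

lemma K0_two_parameter:
  fixes a b :: complex
  assumes a: "\<bar>Im a\<bar> < pi / 2" and b: "\<bar>Im b\<bar> < pi / 2"
  shows "integrable lborel (\<lambda>t :: real. exp (- exp (b - of_real t) - exp (a + of_real t)))"
    and "(\<integral>t. exp (- exp (b - of_real t) - exp (a + of_real t)) \<partial>lborel) = 2 * bessel_K0 (2 * exp ((a + b) / 2))"
proof -
  define s0 where "s0 = (b - a) / 2"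
  define E where "E = (\<lambda>s (t::real). exp (- exp (b - s - of_real t) - exp (a + s + of_real t)))"
  define T where "T = closed_segment 0 s0"
  \<comment> \<open>On the segment from 0 to \<open>s0\<close> the imaginary parts of
    \<open>b - s\<close> and \<open>a + s\<close> are convex combinations of those of
    \<open>a\<close> and \<open>b\<close>, so they stay below \<open>\<pi> / 2\<close> in absolute
    value.\<close>
  have pos: "Re (exp (b - s)) > 0 \<and> Re (exp (a + s)) > 0" if sT: "s \<in> T" for s
  proof -
    obtain \<tau> where tau: "0 \<le> \<tau>" "\<tau> \<le> 1" "s = of_real \<tau> * s0"
      using sT by (auto simp: T_def in_segment scaleR_conv_of_real)
    have "Im (b - s) = (1 - \<tau> / 2) * Im b + (\<tau> / 2) * Im a" "Im (a + s) = (1 - \<tau> / 2) * Im a + (\<tau> / 2) * Im b"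
      by (simp_all add: tau s0_def algebra_simps)
    moreover have "\<bar>(1 - \<tau> / 2) * u + (\<tau> / 2) * v\<bar> < pi / 2" if "\<bar>u\<bar> < pi / 2" "\<bar>v\<bar> < pi / 2" for u v :: real
    proof -
      have "\<bar>(1 - \<tau> / 2) * u + (\<tau> / 2) * v\<bar> \<le> (1 - \<tau> / 2) * \<bar>u\<bar> + (\<tau> / 2) * \<bar>v\<bar>"
        using tau by (intro order.trans[OF abs_triangle_ineq]) (simp add: abs_mult)
      also have "\<dots> < pi / 2"
        by (rule convex_bound_lt) (use tau that in auto)
      finally show ?thesis .
    qed
    ultimately have "\<bar>Im (b - s)\<bar> < pi / 2" "\<bar>Im (a + s)\<bar> < pi / 2" using a b by metis+
    moreover have "cos u > 0" if "\<bar>u\<bar> < pi / 2" for u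
      using that by (intro cos_gt_zero_pi) linarith+
    ultimately show ?thesis unfolding Re_exp by (intro conjI mult_pos_pos exp_gt_zero) auto
  qed
  have cT: "compact T" "T \<noteq> {}" by (auto simp: T_def)
  \<comment> \<open>Both real parts are positive on a compact segment, so they have a common
    positive lower bound \<open>c\<close>; this gives one majorant for all \<open>s\<close>.\<close>
  obtain s1 where s1: "s1 \<in> T" "\<And>s. s \<in> T \<Longrightarrow> Re (exp (b - s1)) \<le> Re (exp (b - s))"
  proof -
    have "continuous_on T (\<lambda>s. Re (exp (b - s)))" by (intro continuous_intros)
    from continuous_attains_inf[OF cT this] show ?thesis using that by blast
  qed
  obtain s2 where s2: "s2 \<in> T" "\<And>s. s \<in> T \<Longrightarrow> Re (exp (a + s2)) \<le> Re (exp (a + s))"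
  proof -
    have "continuous_on T (\<lambda>s. Re (exp (a + s)))" by (intro continuous_intros)
    from continuous_attains_inf[OF cT this] show ?thesis using that by blast
  qed
  define c where "c = min (Re (exp (b - s1))) (Re (exp (a + s2)))"
  have c: "c > 0" using pos s1(1) s2(1) by (simp add: c_def)
  have bound: "norm (E s t) \<le> exp (- (2 * c) * cosh t)" if s: "s \<in> T" for s t
  proof -
    have "exp (b - s - of_real t) = exp (b - s) * of_real (exp (- t))"
      by (simp add: exp_diff exp_minus divide_inverse flip: exp_of_real)
    then have "Re (exp (b - s - of_real t)) = Re (exp (b - s)) * exp (- t)"
      by simp
    moreover have "exp (a + s + of_real t) = exp (a + s) * of_real (exp t)"
      by (simp add: exp_add flip: exp_of_real)
    then have "Re (exp (a + s + of_real t)) = Re (exp (a + s)) * exp t"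
      by simp
    moreover have "c * exp (- t) \<le> Re (exp (b - s)) * exp (- t)" "c * exp t \<le> Re (exp (a + s)) * exp t"
      using s1(2)[OF s] s2(2)[OF s] by (auto intro!: mult_right_mono simp: c_def)
    moreover have "(2 * c) * cosh t = c * exp (- t) + c * exp t" by (simp add: cosh_field_def algebra_simps)
    ultimately have "Re (- exp (b - s - of_real t) - exp (a + s + of_real t)) \<le> - (2 * c) * cosh t"
      unfolding minus_complex.sel uminus_complex.sel by linarith
    then show ?thesis unfolding E_def norm_exp_eq_Re by simp
  qed
  have Ei: "integrable lborel (E s)" if "s \<in> T" for s
  proof (rule integrable_bounded_by_cauchy)
    show "norm (E s t) \<le> (4 / (2 * c)) / (1 + t\<^sup>2)" for t
      using bound[OF that, of t] exp_minus_cosh_le[of "2 * c" t] c by simp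
  qed (unfold E_def, intro borel_measurable_continuous_onI continuous_intros)
  define Hn where "Hn = (\<lambda>N s. integral (cbox (- real N) (real N)) (E s))"
  have HnL: "Hn N s = (\<integral>t. indicator {- real N..real N} t *\<^sub>R E s t \<partial>lborel)" if "s \<in> T" for N s
  proof -
    have "set_integrable lborel {- real N..real N} (E s)"
      using Ei[OF that] unfolding set_integrable_def by (intro integrable_mult_indicator) auto
    from set_borel_integral_eq_integral(2)[OF this] show ?thesis
      by (simp add: Hn_def set_lebesgue_integral_def)
  qed
  have Hlim: "(\<lambda>N. Hn N s) \<longlonglongrightarrow> (\<integral>t. E s t \<partial>lborel)" if s: "s \<in> T" for s
    unfolding HnL[OF s]
  proof (rule integral_dominated_convergence[where w = "\<lambda>t. norm (E s t)"])
    show "AE x in lborel. (\<lambda>N::nat. indicator {-real N..real N} x *\<^sub>R E s x) \<longlonglongrightarrow> E s x"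
    proof (rule AE_I2)
      fix x :: real
      have "\<forall>\<^sub>F N::nat in sequentially. indicator {-real N..real N} x *\<^sub>R E s x = E s x"
        using eventually_gt_at_top[of "nat \<lceil>\<bar>x\<bar>\<rceil>"]
      proof eventually_elim
        case (elim N)
        then have "\<bar>x\<bar> < real N" by linarith
        then show ?case by (simp add: abs_less_iff)
      qed
      then show "(\<lambda>N::nat. indicator {-real N..real N} x *\<^sub>R E s x) \<longlonglongrightarrow> E s x" by (rule tendsto_eventually)
    qed
  qed (use Ei[OF s] in \<open>auto simp: indicator_def\<close>)
  \<comment> \<open>\<open>E s t\<close> depends on \<open>s + t\<close> only, so the same
    \<open>E'\<close> is its derivative in \<open>s\<close> and in \<open>t\<close>. The derivative
    in \<open>s\<close> of a truncated integral is therefore a boundary term.\<close>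
  define E' where "E' = (\<lambda>s (t::real). E s t * (exp (b - s - of_real t) - exp (a + s + of_real t)))"
  have dEs: "((\<lambda>s. E s t) has_field_derivative E' s t) (at s within T)" for s t
    unfolding E_def E'_def by (auto intro!: derivative_eq_intros simp: algebra_simps)
  have dEt: "(E s has_vector_derivative E' s t) (at t within A)" for s t A
  proof -
    have "((\<lambda>z. exp (- exp (b - s - z) - exp (a + s + z))) has_field_derivative E' s t) (at (of_real t))"
      unfolding E_def E'_def by (auto intro!: derivative_eq_intros simp: algebra_simps)
    from has_vector_derivative_real_field[OF this] show ?thesis by (simp add: E_def)
  qed
  have Hd: "(Hn N has_field_derivative (E s (real N) - E s (- real N))) (at s within T)" if s: "s \<in> T" for N s
  proof -
    have "(Hn N has_field_derivative integral (cbox (- real N) (real N)) (E' s)) (at s within T)"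
      unfolding Hn_def
    proof (rule leibniz_rule_field_derivative[OF dEs _ _ s])
      show "E s integrable_on cbox (- real N) (real N)" for s
        unfolding E_def by (intro integrable_continuous continuous_intros)
      show "continuous_on (T \<times> cbox (- real N) (real N)) (\<lambda>(s, t). E' s t)"
        unfolding E'_def E_def by (auto intro!: continuous_intros simp: case_prod_unfold)
      show "convex T" by (simp add: T_def)
    qed
    moreover have "integral (cbox (- real N) (real N)) (E' s) = E s (real N) - E s (- real N)"
      using fundamental_theorem_of_calculus[of "- real N" "real N" "E s" "E' s"] dEt by (simp add: integral_unique)
    ultimately show ?thesis by simp
  qed
  \<comment> \<open>Mean value inequality in \<open>s\<close>: the boundary terms bound the
    derivative and tend to 0 with growing \<open>N\<close>.\<close>
  have diff: "norm (Hn N s0 - Hn N 0) \<le> (2 * exp (- (2 * c) * cosh (real N))) * norm (s0 - 0)" for N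
  proof (rule field_differentiable_bound[of T "Hn N"])
    fix s assume s: "s \<in> T"
    show "norm (E s (real N) - E s (- real N)) \<le> 2 * exp (- (2 * c) * cosh (real N))"
      using norm_triangle_ineq4[of "E s (real N)" "E s (- real N)"] bound[OF s, of "real N"] bound[OF s, of "- real N"] by simp
  qed (use Hd in \<open>auto simp: T_def\<close>)
  have "(\<lambda>N. (2 * exp (- (2 * c) * cosh (real N))) * norm (s0 - 0)) \<longlonglongrightarrow> 0"
    using c by real_asymp
  then have "(\<lambda>N. Hn N s0 - Hn N 0) \<longlonglongrightarrow> 0"
    by (rule Lim_null_comparison[OF always_eventually[OF allI[OF diff]]])
  moreover have "0 \<in> T" "s0 \<in> T" by (auto simp: T_def)
  then have "(\<lambda>N. Hn N s0 - Hn N 0) \<longlonglongrightarrow> (\<integral>t. E s0 t \<partial>lborel) - (\<integral>t. E 0 t \<partial>lborel)"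
    by (intro tendsto_diff Hlim)
  ultimately have eq: "(\<integral>t. E 0 t \<partial>lborel) = (\<integral>t. E s0 t \<partial>lborel)"
    using LIMSEQ_unique by fastforce
  define w where "w = exp ((a + b) / 2)"
  have E0: "E s0 t = exp (- (2 * w) * of_real (cosh t))" for t
  proof -
    have 1: "b - s0 - of_real t = (a + b) / 2 + (- of_real t)" "a + s0 + of_real t = (a + b) / 2 + of_real t"
      by (simp_all add: s0_def field_simps)
    have "exp (b - s0 - of_real t) + exp (a + s0 + of_real t) = (2 * w) * of_real (cosh t)"
      unfolding 1 exp_add w_def by (simp add: cosh_def field_simps exp_of_real flip: of_real_minus)
    then show ?thesis unfolding E_def by (metis (no_types, lifting) add_uminus_conv_diff minus_add_distrib mult_minus_left)
  qed
  have "b - s0 = (a + b) / 2" by (simp add: s0_def field_simps)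
  then have w: "Re (2 * w) > 0" using pos[OF \<open>s0 \<in> T\<close>] unfolding w_def by (metis Re_complex_of_real
      mult_pos_pos of_real_numeral times_complex.sel(1) zero_less_numeral Im_complex_of_real mult_zero_left diff_zero)
  show "integrable lborel (\<lambda>t :: real. exp (- exp (b - of_real t) - exp (a + of_real t)))"
    using Ei[OF \<open>0 \<in> T\<close>] by (simp add: E_def)
  show "(\<integral>t. exp (- exp (b - of_real t) - exp (a + of_real t)) \<partial>lborel) = 2 * bessel_K0 (2 * exp ((a + b) / 2))"
    using eq bessel_K0_eq_lebesgue[OF w] unfolding E0 by (simp add: E_def w_def)
qed

section \<open>Theta series of plane lattices\<close>

lemma summable_on_product_mult:
  fixes f :: "'a \<Rightarrow> complex" and g :: "'b \<Rightarrow> complex"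
  assumes f: "Infinite_Sum.abs_summable_on (f) (A)" and g: "Infinite_Sum.abs_summable_on (g) (B)"
  shows "Infinite_Sum.abs_summable_on ((\<lambda>(x, y). f x * g y)) (A \<times> B)"
  unfolding Infinite_Sum.abs_summable_on_Sigma_iff
proof (intro conjI ballI)
  show "Infinite_Sum.abs_summable_on ((\<lambda>y. case (x, y) of (x, y) \<Rightarrow> f x * g y)) (B)" if "x \<in> A" for x
    using summable_on_cmult_right[OF g, of "norm (f x)"] by (simp add: norm_mult)
  have "(\<lambda>x. norm (f x) * infsum (\<lambda>y. norm (g y)) B) summable_on A"
    by (rule summable_on_cmult_left[OF f])
  moreover have "infsum (\<lambda>y. norm (g y)) B \<ge> 0" by (rule infsum_nonneg) simp
  ultimately show "Infinite_Sum.abs_summable_on ((\<lambda>x. infsum (\<lambda>y. norm (case (x, y) of (x, y) \<Rightarrow> f x * g y)) B)) (A)"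
    by (simp add: norm_mult infsum_cmult_right' abs_mult)
qed

lemma abs_summable_on_int_bound:
  fixes g :: "int \<Rightarrow> complex"
  assumes "\<And>k. norm (g k) \<le> C / (1 + (of_int k)\<^sup>2)"
  shows "Infinite_Sum.abs_summable_on (g) (UNIV)"
proof -
  have n: "Infinite_Sum.abs_summable_on ((\<lambda>n::nat. C / (1 + (real n)\<^sup>2))) (UNIV)"
  proof -
    have "summable (\<lambda>n::nat. norm C * (1 / (1\<^sup>2 + (real n)\<^sup>2)))"
      by (intro summable_mult summable_inverse_shift_square) simp
    then have "summable (\<lambda>n::nat. norm (C / (1 + (real n)\<^sup>2)))" by (simp add: abs_mult)
    then show ?thesis by (subst summable_on_UNIV_nonneg_real_iff) auto
  qed
  have "(\<lambda>k::int. norm (C / (1 + (of_int k)\<^sup>2))) summable_on (range int)"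
    using n by (subst summable_on_reindex) (auto simp: o_def inj_on_def)
  moreover have "(\<lambda>k::int. norm (C / (1 + (of_int k)\<^sup>2))) summable_on (range (\<lambda>n. - int n))"
    using n by (subst summable_on_reindex) (auto simp: o_def inj_on_def)
  ultimately have "(\<lambda>k::int. norm (C / (1 + (of_int k)\<^sup>2))) summable_on (range int \<union> range (\<lambda>n. - int n))"
    by (rule summable_on_union)
  also have "range int \<union> range (\<lambda>n. - int n) = UNIV"
    by (auto simp: image_iff) (metis nat_0_le add.inverse_inverse int_nat_eq linear neg_0_le_iff_le)
  finally show ?thesis
  proof (rule Infinite_Sum.abs_summable_on_comparison_test)
    fix k :: int
    have "norm (g k) \<le> C / (1 + (of_int k)\<^sup>2)" by (rule assms)
    also have "\<dots> \<le> norm (C / (1 + (of_int k)\<^sup>2))" by (simp only: real_norm_def abs_ge_self)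
    finally show "norm (g k) \<le> norm (C / (1 + (of_int k)\<^sup>2))" .
  qed
qed

lemma infsum_int_symmetric_limit:
  fixes g :: "int \<Rightarrow> complex"
  assumes "g summable_on UNIV"
  shows "(\<lambda>N::nat. \<Sum>k = - int N..int N. g k) \<longlonglongrightarrow> infsum g UNIV"
proof -
  have "filterlim (\<lambda>N::nat. {- int N..int N}) (finite_subsets_at_top UNIV) sequentially"
    unfolding filterlim_finite_subsets_at_top
  proof (intro allI impI)
    fix Y0 :: "int set" assume Y0: "finite Y0 \<and> Y0 \<subseteq> UNIV"
    define M where "M = Max (insert 0 ((\<lambda>k. nat \<bar>k\<bar>) ` Y0))"
    have M: "nat \<bar>k\<bar> \<le> M" if "k \<in> Y0" for k unfolding M_def using Y0 that by (intro Max_ge) auto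
    show "\<forall>\<^sub>F N in sequentially. finite {- int N..int N} \<and> Y0 \<subseteq> {- int N..int N} \<and> {- int N..int N} \<subseteq> UNIV"
      using eventually_ge_at_top[of M]
    proof eventually_elim
      case (elim N)
      have "- int N \<le> k \<and> k \<le> int N" if "k \<in> Y0" for k using M[OF that] elim by linarith
      then show ?case by auto
    qed
  qed
  from filterlim_compose[OF _ this, of "sum g" "nhds (infsum g UNIV)"] has_sum_infsum[OF assms]
  show ?thesis by (simp add: has_sum_def)
qed

lemma infsum_int_sums:
  fixes g :: "int \<Rightarrow> complex"
  assumes "g summable_on UNIV"
  shows "(\<lambda>k. if k = 0 then g 0 else g (int k) + g (- int k)) sums infsum g UNIV"
proof -
  have "(\<Sum>k<Suc N. if k = 0 then g 0 else g (int k) + g (- int k)) = (\<Sum>k = - int N..int N. g k)" for N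
  proof (induct N)
    case (Suc N)
    have "{- int (Suc N)..int (Suc N)} = insert (int (Suc N)) (insert (- int (Suc N)) {- int N..int N})" by auto
    then show ?case using Suc by simp
  qed simp
  then have "(\<lambda>N. \<Sum>k<Suc N. if k = 0 then g 0 else g (int k) + g (- int k)) \<longlonglongrightarrow> infsum g UNIV"
    using infsum_int_symmetric_limit[OF assms] by simp
  then show ?thesis unfolding sums_def by (rule LIMSEQ_imp_Suc)
qed

theorem poisson_summation_int:
  fixes f f' f'' :: "real \<Rightarrow> complex"
  assumes "\<And>x. (f has_vector_derivative f' x) (at x)"
    and "\<And>x. (f' has_vector_derivative f'' x) (at x)"
    and "continuous_on UNIV f''"
    and "integrable lborel f" "integrable lborel f'" "integrable lborel f''"
    and "(f \<longlongrightarrow> 0) at_top" "(f \<longlongrightarrow> 0) at_bot"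
    and "(f' \<longlongrightarrow> 0) at_top" "(f' \<longlongrightarrow> 0) at_bot"
    and s: "(\<lambda>k::int. f (of_int k)) summable_on UNIV"
    and sF: "(\<lambda>k::int. fourier f (of_int k)) summable_on UNIV"
  shows "infsum (\<lambda>k::int. f (of_int k)) UNIV = infsum (\<lambda>k::int. fourier f (of_int k)) UNIV"
proof -
  have "(\<lambda>k. if k = 0 then fourier f 0 else fourier f (real k) + fourier f (- real k)) sums infsum (\<lambda>k::int. f (of_int k)) UNIV"
    by (rule poisson_summation[OF assms(1-10)]) (rule infsum_int_symmetric_limit[OF s])
  moreover have "(\<lambda>k. if k = 0 then fourier f 0 else fourier f (real k) + fourier f (- real k)) sums infsum (\<lambda>k::int. fourier f (of_int k)) UNIV"
    using infsum_int_sums[OF sF] by (simp cong: if_cong)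
  ultimately show ?thesis by (rule sums_unique2)
qed

section \<open>Gaussians and the inversion of one-dimensional theta functions\<close>

lemma bounded_by_cauchy:
  fixes h :: "real \<Rightarrow> complex"
  assumes c: "continuous_on UNIV h"
    and t: "((\<lambda>x. norm (h x) * (1 + x\<^sup>2)) \<longlongrightarrow> 0) at_top" "((\<lambda>x. norm (h x) * (1 + x\<^sup>2)) \<longlongrightarrow> 0) at_bot"
  obtains C where "\<And>x. norm (h x) \<le> C / (1 + x\<^sup>2)"
proof -
  define g where "g = (\<lambda>x. norm (h x) * (1 + x\<^sup>2))"
  have pos: "1 + x\<^sup>2 > 0" for x :: real using zero_le_power2[of x] by linarith
  have "\<forall>\<^sub>F x in at_top. g x < 1" "\<forall>\<^sub>F x in at_bot. g x < 1"
    using order_tendstoD(2)[OF t(1), of 1] order_tendstoD(2)[OF t(2), of 1] by (simp_all add: g_def)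
  then obtain a b where ab: "\<And>x. x \<ge> a \<Longrightarrow> g x < 1" "\<And>x. x \<le> b \<Longrightarrow> g x < 1"
    by (auto simp: eventually_at_top_linorder eventually_at_bot_linorder)
  have "compact (g ` {b..a})" unfolding g_def
    by (intro compact_continuous_image continuous_intros continuous_on_subset[OF c]) auto
  then obtain B where B: "\<And>x. x \<in> {b..a} \<Longrightarrow> \<bar>g x\<bar> \<le> B"
    using bounded_iff[THEN iffD1, OF compact_imp_bounded] that by (metis image_eqI real_norm_def)
  have "g x \<le> max 1 B" for x
    using ab(1)[of x] ab(2)[of x] B[of x] by (cases "x \<ge> a"; cases "x \<le> b") force+
  then show ?thesis using pos by (intro that[of "max 1 B"]) (simp add: g_def field_simps)
qed

lemma tendsto_0_bounded_by_cauchy: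
  fixes h :: "real \<Rightarrow> complex"
  assumes "\<And>x. norm (h x) \<le> C / (1 + x\<^sup>2)"
  shows "(h \<longlongrightarrow> 0) at_top" "(h \<longlongrightarrow> 0) at_bot"
proof -
  have "((\<lambda>x. C / (1 + x\<^sup>2)) \<longlongrightarrow> 0) at_top" by real_asymp
  then show "(h \<longlongrightarrow> 0) at_top" by (rule Lim_null_comparison[OF always_eventually, rotated]) (simp add: assms)
  have "((\<lambda>x. C / (1 + x\<^sup>2)) \<longlongrightarrow> 0) at_bot" by real_asymp
  then show "(h \<longlongrightarrow> 0) at_bot" by (rule Lim_null_comparison[OF always_eventually, rotated]) (simp add: assms)
qed

text \<open>Rescaling by \<open>c = 1 / sqrt (2 \<pi> T)\<close> and shifting by \<open>z\<close>
  turn the integral into the characteristic function of the standard normal distribution.\<close>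

lemma fourier_gaussian:
  fixes T z \<omega> :: real
  assumes T: "T > 0"
  shows "fourier (\<lambda>x. of_real (exp (- pi * T * (x + z)\<^sup>2))) \<omega> =
    of_real (1 / sqrt T * exp (- pi * \<omega>\<^sup>2 / T)) * cis (2 * pi * \<omega> * z)"
proof -
  define c where "c = 1 / sqrt (2 * pi * T)"
  have c: "c > 0" "c\<^sup>2 * (2 * pi * T) = 1" using T by (simp_all add: c_def power_divide)
  define t where "t = - 2 * pi * \<omega> * c"
  have "char std_normal_distribution t = of_real (exp (- (t\<^sup>2) / 2))"
    by (simp add: char_std_normal_distribution)
  then have ch: "(\<integral>x. of_real (std_normal_density x) * cis (t * x) \<partial>lborel) = of_real (exp (- (t\<^sup>2) / 2))"
    unfolding char_def by (subst (asm) integral_density)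
      (auto simp: cis_conv_exp normal_density_nonneg scaleR_conv_of_real mult.commute)
  have "fourier (\<lambda>x. of_real (exp (- pi * T * (x + z)\<^sup>2))) \<omega> =
    c *\<^sub>R (\<integral>x. of_real (exp (- pi * T * (- z + c * x + z)\<^sup>2)) * cis (- 2 * pi * \<omega> * (- z + c * x)) \<partial>lborel)"
    unfolding fourier_def using c(1) by (subst lborel_integral_real_affine[of c _ "- z"]) auto
  also have "(\<lambda>x. of_real (exp (- pi * T * (- z + c * x + z)\<^sup>2)) * cis (- 2 * pi * \<omega> * (- z + c * x))) =
     (\<lambda>x. (of_real (sqrt (2 * pi)) * cis (2 * pi * \<omega> * z)) * (of_real (std_normal_density x) * cis (t * x)))"
  proof
    fix x
    have 1: "- pi * T * (- z + c * x + z)\<^sup>2 = - x\<^sup>2 / 2"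
      using c(2) by (simp add: power_mult_distrib field_simps)
    have 2: "- 2 * pi * \<omega> * (- z + c * x) = 2 * pi * \<omega> * z + t * x" by (simp add: t_def algebra_simps)
    show "of_real (exp (- pi * T * (- z + c * x + z)\<^sup>2)) * cis (- 2 * pi * \<omega> * (- z + c * x)) =
      (of_real (sqrt (2 * pi)) * cis (2 * pi * \<omega> * z)) * (of_real (std_normal_density x) * cis (t * x))"
      unfolding 1 2 by (simp add: std_normal_density_def cis_mult[symmetric])
  qed
  also have "c *\<^sub>R (\<integral>x. (of_real (sqrt (2 * pi)) * cis (2 * pi * \<omega> * z)) * (of_real (std_normal_density x) * cis (t * x)) \<partial>lborel) =
     of_real (c * sqrt (2 * pi) * exp (- (t\<^sup>2) / 2)) * cis (2 * pi * \<omega> * z)"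
    unfolding integral_mult_right_zero ch by (simp add: scaleR_conv_of_real)
  also have "c * sqrt (2 * pi) = 1 / sqrt T" using T by (simp add: c_def real_sqrt_mult)
  also have "- (t\<^sup>2) / 2 = - pi * \<omega>\<^sup>2 / T"
  proof -
    have "t\<^sup>2 * T = 2 * pi * \<omega>\<^sup>2 * (c\<^sup>2 * (2 * pi * T))" by (simp add: t_def power2_eq_square)
    then show ?thesis using T c(2) by (simp add: field_simps)
  qed
  finally show ?thesis .
qed

lemma gaussian_int_bound:
  fixes T z :: real
  assumes T: "T > 0"
  obtains C where "\<And>x. norm (complex_of_real (exp (- pi * T * (x + z)\<^sup>2))) \<le> C / (1 + x\<^sup>2)"
proof -
  have "((\<lambda>x. exp (- pi * T * (x + z)\<^sup>2) * (1 + x\<^sup>2)) \<longlongrightarrow> 0) at_top"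
    "((\<lambda>x. exp (- pi * T * (x + z)\<^sup>2) * (1 + x\<^sup>2)) \<longlongrightarrow> 0) at_bot"
    using T by real_asymp+
  then have t: "((\<lambda>x. norm (complex_of_real (exp (- pi * T * (x + z)\<^sup>2))) * (1 + x\<^sup>2)) \<longlongrightarrow> 0) at_top"
    "((\<lambda>x. norm (complex_of_real (exp (- pi * T * (x + z)\<^sup>2))) * (1 + x\<^sup>2)) \<longlongrightarrow> 0) at_bot"
    by (simp_all only: norm_of_real abs_exp_cancel)
  have "continuous_on UNIV (\<lambda>x. complex_of_real (exp (- pi * T * (x + z)\<^sup>2)))"
    by (intro continuous_intros)
  from bounded_by_cauchy[OF this t] show ?thesis using that by blast
qed

lemma gaussian_summable:
  fixes T z :: real
  assumes T: "T > 0"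
  shows "Infinite_Sum.abs_summable_on ((\<lambda>k::int. complex_of_real (exp (- pi * T * (of_int k + z)\<^sup>2)))) (UNIV)"
proof -
  obtain C where "\<And>x. norm (complex_of_real (exp (- pi * T * (x + z)\<^sup>2))) \<le> C / (1 + x\<^sup>2)"
    using gaussian_int_bound[OF T] by blast
  then show ?thesis by (intro abs_summable_on_int_bound)
qed

text \<open>Jacobi's inversion formula, as Poisson summation for a Gaussian; the shift
  \<open>z\<close> of the lattice becomes a character on the dual side.\<close>

lemma theta_shift:
  fixes T z :: real
  assumes T: "T > 0"
  shows "infsum (\<lambda>k::int. complex_of_real (exp (- pi * T * (of_int k + z)\<^sup>2))) UNIV =
    of_real (1 / sqrt T) * infsum (\<lambda>k::int. of_real (exp (- pi * (of_int k)\<^sup>2 / T)) * cis (2 * pi * of_int k * z)) UNIV"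
proof -
  define f where "f = (\<lambda>x. complex_of_real (exp (- pi * T * (x + z)\<^sup>2)))"
  define f' where "f' = (\<lambda>x. complex_of_real (- 2 * pi * T * (x + z) * exp (- pi * T * (x + z)\<^sup>2)))"
  define f'' where "f'' = (\<lambda>x. complex_of_real ((- 2 * pi * T + (2 * pi * T * (x + z))\<^sup>2) * exp (- pi * T * (x + z)\<^sup>2)))"
  have d1: "(f has_vector_derivative f' x) (at x)" for x unfolding f_def f'_def
    by (rule has_vector_derivative_of_real) (auto intro!: derivative_eq_intros)
  have d2: "(f' has_vector_derivative f'' x) (at x)" for x unfolding f'_def f''_def
    by (rule has_vector_derivative_of_real) (auto intro!: derivative_eq_intros simp: power2_eq_square algebra_simps)
  have c: "continuous_on UNIV f" "continuous_on UNIV f'" "continuous_on UNIV f''"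
    unfolding f_def f'_def f''_def by (intro continuous_intros)+
  obtain C0 where C0: "\<And>x. norm (f x) \<le> C0 / (1 + x\<^sup>2)"
    unfolding f_def using gaussian_int_bound[OF T] by blast
  obtain C1 where C1: "\<And>x. norm (f' x) \<le> C1 / (1 + x\<^sup>2)"
    by (rule bounded_by_cauchy[OF c(2)]) (unfold f'_def norm_of_real, (use T in real_asymp), (use T in real_asymp), blast)
  obtain C2 where C2: "\<And>x. norm (f'' x) \<le> C2 / (1 + x\<^sup>2)"
    by (rule bounded_by_cauchy[OF c(3)]) (unfold f''_def norm_of_real, (use T in real_asymp), (use T in real_asymp), blast)
  have F: "fourier f (of_int k) = of_real (1 / sqrt T) * (of_real (exp (- pi * (of_int k)\<^sup>2 / T)) * cis (2 * pi * of_int k * z))" for k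
    unfolding f_def fourier_gaussian[OF T] by simp
  have sF: "Infinite_Sum.abs_summable_on ((\<lambda>k::int. of_real (1 / sqrt T) * (of_real (exp (- pi * (of_int k)\<^sup>2 / T)) * cis (2 * pi * of_int k * z)))) (UNIV)"
    using summable_on_cmult_right[OF gaussian_summable[of "1 / T" 0], of "1 / sqrt T"] T by (simp add: norm_mult norm_divide)
  have "infsum (\<lambda>k::int. f (of_int k)) UNIV = infsum (\<lambda>k::int. fourier f (of_int k)) UNIV"
  proof (rule poisson_summation_int[OF d1 d2 c(3)])
    show "integrable lborel f" "integrable lborel f'" "integrable lborel f''"
      using c C0 C1 C2 by (auto intro!: integrable_bounded_by_cauchy borel_measurable_continuous_onI)
    show "(\<lambda>k::int. f (of_int k)) summable_on UNIV"
      using gaussian_summable[OF T, of z] unfolding f_def by (rule abs_summable_summable)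
    show "(\<lambda>k::int. fourier f (of_int k)) summable_on UNIV"
      unfolding F by (rule abs_summable_summable[OF sF])
  qed (rule tendsto_0_bounded_by_cauchy[OF C0] tendsto_0_bounded_by_cauchy[OF C1])+
  from this[unfolded F infsum_cmult_right'] show ?thesis unfolding f_def .
qed

section \<open>Theta functions of binary quadratic forms\<close>

lemma infsum_pairs_snd_first:
  fixes q :: "int \<times> int \<Rightarrow> complex"
  assumes "q summable_on UNIV"
  shows "infsum q UNIV = infsum (\<lambda>y. infsum (\<lambda>x. q (x, y)) UNIV) UNIV"
proof -
  have "(q has_sum infsum q UNIV) (UNIV \<times> UNIV)" using has_sum_infsum[OF assms] by simp
  then have hs: "((\<lambda>(y, x). q (x, y)) has_sum infsum q UNIV) (UNIV \<times> UNIV)"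
    by (rule has_sum_swap[THEN iffD1])
  from infsum_Sigma_banach[OF has_sum_imp_summable[OF hs]] infsumI[OF hs] show ?thesis by simp
qed

text \<open>A positive definite binary form (for \<open>T, B > 0\<close>) with the square completed
  in \<open>x\<close>; \<open>T * B\<close> is its determinant.\<close>

definition qtheta :: "real \<Rightarrow> real \<Rightarrow> real \<Rightarrow> int \<times> int \<Rightarrow> complex" where
  "qtheta T B r = (\<lambda>(x, y). of_real (exp (- pi * (T * (of_int x + r * of_int y)\<^sup>2 + B * (of_int y)\<^sup>2))))"

lemma qtheta_split:
  "qtheta T B r (x, y) = of_real (exp (- pi * B * (of_int y)\<^sup>2)) * of_real (exp (- pi * T * (of_int x + r * of_int y)\<^sup>2))"
proof -
  have 1: "- pi * (T * (of_int x + r * of_int y)\<^sup>2 + B * (of_int y)\<^sup>2) = - pi * B * (of_int y)\<^sup>2 + - pi * T * (of_int x + r * of_int y)\<^sup>2"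
    by (simp only: distrib_left mult.assoc add.commute)
  show ?thesis unfolding qtheta_def prod.case 1 exp_add by (rule of_real_mult)
qed

lemma qtheta_summable:
  assumes T: "T > 0" and B: "B > 0"
  shows "Infinite_Sum.abs_summable_on (qtheta T B r) (UNIV)"
proof -
  \<comment> \<open>From \<open>x^2 \<le> 2 (x + r y)^2 + 2 r^2 y^2\<close> the form dominates
    \<open>(x^2 + y^2) / M\<close>, and the double series is compared with a product of two Gaussian
    series.\<close>
  define M where "M = max (2 / T) ((2 * r\<^sup>2 + 1) / B)"
  have M: "M > 0" using T by (simp add: M_def less_max_iff_disj)
  have le: "x\<^sup>2 + y\<^sup>2 \<le> M * (T * (x + r * y)\<^sup>2 + B * y\<^sup>2)" for x y
  proof -
    have "0 \<le> (x + 2 * (r * y))\<^sup>2" by simp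
    then have "x\<^sup>2 \<le> 2 * (x + r * y)\<^sup>2 + 2 * r\<^sup>2 * y\<^sup>2" by (simp add: power2_eq_square algebra_simps)
    then have "x\<^sup>2 + y\<^sup>2 \<le> (2 / T) * (T * (x + r * y)\<^sup>2) + ((2 * r\<^sup>2 + 1) / B) * (B * y\<^sup>2)"
      using T B by (simp add: algebra_simps)
    also have "\<dots> \<le> M * (T * (x + r * y)\<^sup>2) + M * (B * y\<^sup>2)"
      using T B by (intro add_mono mult_right_mono) (auto simp: M_def)
    finally show ?thesis by (simp add: algebra_simps)
  qed
  have g: "Infinite_Sum.abs_summable_on ((\<lambda>k::int. complex_of_real (exp (- pi * (1 / M) * (of_int k)\<^sup>2)))) (UNIV)"
    using gaussian_summable[of "1 / M" 0] M by simp
  have p: "Infinite_Sum.abs_summable_on ((\<lambda>(x, y). complex_of_real (exp (- pi * (1 / M) * (of_int x)\<^sup>2)) * of_real (exp (- pi * (1 / M) * (of_int y)\<^sup>2)))) ((UNIV :: int set) \<times> (UNIV :: int set))"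
    by (rule summable_on_product_mult[OF g g])
  have b: "norm (qtheta T B r p) \<le> norm ((\<lambda>(x, y). complex_of_real (exp (- pi * (1 / M) * (of_int x)\<^sup>2)) * of_real (exp (- pi * (1 / M) * (of_int y)\<^sup>2))) p)" for p
  proof -
    obtain x y where p: "p = (x, y)" by force
    have "(1 / M) * ((of_int x)\<^sup>2 + (of_int y)\<^sup>2) \<le> T * (of_int x + r * of_int y)\<^sup>2 + B * (of_int y)\<^sup>2"
      using le[of "of_int x" "of_int y"] M by (simp add: field_simps)
    then have "pi * ((1 / M) * ((of_int x)\<^sup>2 + (of_int y)\<^sup>2)) \<le> pi * (T * (of_int x + r * of_int y)\<^sup>2 + B * (of_int y)\<^sup>2)"
      by (intro mult_left_mono) auto
    then show ?thesis unfolding p qtheta_def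
      by (simp add: norm_mult algebra_simps flip: exp_add)
  qed
  show ?thesis
    by (rule Infinite_Sum.abs_summable_on_comparison_test[OF p[simplified]]) (use b in simp)
qed

text \<open>One-dimensional Poisson summation is applied in \<open>x\<close> and then, backwards, in \<open>y\<close>; this
  exchanges the roles of the two variables, so that \<open>r\<close> stays the same.\<close>

lemma qtheta_inversion:
  assumes T: "T > 0" and B: "B > 0"
  shows "infsum (qtheta T B r) UNIV = of_real (1 / sqrt (T * B)) * infsum (qtheta (1 / B) (1 / T) r) UNIV"
proof -
  \<comment> \<open>The terms after the first Poisson summation. Exchanging \<open>y\<close> with
    \<open>k\<close> and \<open>B\<close> with \<open>1 / T\<close> leaves them unchanged, so the
    formula can be run backwards in the other variable.\<close>
  define u where "u = (\<lambda>y k :: int. complex_of_real (exp (- pi * B * (of_int y)\<^sup>2)) * (of_real (exp (- pi * (of_int k)\<^sup>2 / T)) * cis (2 * pi * of_int k * (r * of_int y))))"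
  have su: "(\<lambda>(y, k). u y k) summable_on UNIV \<times> UNIV"
  proof -
    have "Infinite_Sum.abs_summable_on ((\<lambda>k::int. complex_of_real (exp (- pi * B * (of_int k)\<^sup>2)))) (UNIV)"
      "Infinite_Sum.abs_summable_on ((\<lambda>k::int. complex_of_real (exp (- pi * (of_int k)\<^sup>2 / T)))) (UNIV)"
      using gaussian_summable[of B 0] gaussian_summable[of "1 / T" 0] T B by simp_all
    from summable_on_product_mult[OF this]
    have "Infinite_Sum.abs_summable_on ((\<lambda>(y, k). u y k)) (UNIV \<times> UNIV)"
      by (simp add: u_def norm_mult case_prod_unfold)
    then show ?thesis by (rule abs_summable_summable)
  qed
  have "infsum (qtheta T B r) UNIV = infsum (\<lambda>y. infsum (\<lambda>x. qtheta T B r (x, y)) UNIV) UNIV"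
    by (rule infsum_pairs_snd_first[OF abs_summable_summable[OF qtheta_summable[OF T B]]])
  also have "\<dots> = infsum (\<lambda>y. of_real (1 / sqrt T) * infsum (\<lambda>k. u y k) UNIV) UNIV"
  proof (rule infsum_cong)
    fix y :: int
    have "infsum (\<lambda>x. qtheta T B r (x, y)) UNIV =
      infsum (\<lambda>x::int. complex_of_real (exp (- pi * B * (of_int y)\<^sup>2)) * of_real (exp (- pi * T * (of_int x + r * of_int y)\<^sup>2))) UNIV"
      by (rule infsum_cong) (rule qtheta_split)
    also have "\<dots> = complex_of_real (exp (- pi * B * (of_int y)\<^sup>2)) *
       (of_real (1 / sqrt T) * infsum (\<lambda>k::int. of_real (exp (- pi * (of_int k)\<^sup>2 / T)) * cis (2 * pi * of_int k * (r * of_int y))) UNIV)"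
      unfolding infsum_cmult_right' theta_shift[OF T] ..
    also have "\<dots> = of_real (1 / sqrt T) * infsum (\<lambda>k. u y k) UNIV"
      unfolding u_def infsum_cmult_right' by simp
    finally show "infsum (\<lambda>x. qtheta T B r (x, y)) UNIV = of_real (1 / sqrt T) * infsum (\<lambda>k. u y k) UNIV" .
  qed
  also have "\<dots> = of_real (1 / sqrt T) * infsum (\<lambda>k. infsum (\<lambda>y. u y k) UNIV) UNIV"
    unfolding infsum_cmult_right' infsum_swap_banach[OF su] ..
  also have "infsum (\<lambda>k. infsum (\<lambda>y. u y k) UNIV) UNIV = infsum (\<lambda>k. of_real (1 / sqrt B) * infsum (\<lambda>l. qtheta (1 / B) (1 / T) r (l, k)) UNIV) UNIV"
  proof (rule infsum_cong)
    fix k :: int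
    have "infsum (\<lambda>l. qtheta (1 / B) (1 / T) r (l, k)) UNIV =
      infsum (\<lambda>l::int. complex_of_real (exp (- pi * (of_int k)\<^sup>2 / T)) * of_real (exp (- pi * (1 / B) * (of_int l + r * of_int k)\<^sup>2))) UNIV"
      unfolding qtheta_split by (rule infsum_cong) simp
    also have "\<dots> = complex_of_real (exp (- pi * (of_int k)\<^sup>2 / T)) * (of_real (1 / sqrt (1 / B)) * infsum (\<lambda>y::int. of_real (exp (- pi * (of_int y)\<^sup>2 / (1 / B))) * cis (2 * pi * of_int y * (r * of_int k))) UNIV)"
      unfolding infsum_cmult_right' using theta_shift[of "1 / B" "r * of_int k"] B by simp
    also have "\<dots> = of_real (sqrt B) * infsum (\<lambda>y. u y k) UNIV"
    proof -
      have "infsum (\<lambda>y. u y k) UNIV = infsum (\<lambda>y. complex_of_real (exp (- pi * (of_int k)\<^sup>2 / T)) * (of_real (exp (- pi * (of_int y)\<^sup>2 / (1 / B))) * cis (2 * pi * of_int y * (r * of_int k)))) UNIV"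
        by (rule infsum_cong) (simp add: u_def mult_ac)
      then show ?thesis unfolding infsum_cmult_right' by (simp add: real_sqrt_divide)
    qed
    finally show "infsum (\<lambda>y. u y k) UNIV = of_real (1 / sqrt B) * infsum (\<lambda>l. qtheta (1 / B) (1 / T) r (l, k)) UNIV"
      using B by simp
  qed
  also have "\<dots> = of_real (1 / sqrt B) * infsum (\<lambda>k. infsum (\<lambda>l. qtheta (1 / B) (1 / T) r (l, k)) UNIV) UNIV"
    unfolding infsum_cmult_right' ..
  also have "infsum (\<lambda>k. infsum (\<lambda>l. qtheta (1 / B) (1 / T) r (l, k)) UNIV) UNIV = infsum (qtheta (1 / B) (1 / T) r) UNIV"
    using T B by (intro infsum_pairs_snd_first[symmetric] abs_summable_summable[OF qtheta_summable]) auto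
  finally show ?thesis using T B by (simp add: real_sqrt_mult)
qed

section \<open>Zeta values at even integers\<close>

lemma coth_partial_fractions:
  fixes r :: real
  assumes r: "0 < r"
  shows "(\<lambda>k. 1 / (r\<^sup>2 + (real (Suc k))\<^sup>2)) sums ((pi * cosh (r * pi) / (r * sinh (r * pi)) - 1 / r\<^sup>2) / 2)"
proof -
  have "(\<lambda>k. (if k = 0 then 1 else 2) / (r\<^sup>2 + (real k)\<^sup>2)) sums (pi / (r * sinh (r * pi)) * cosh (r * pi))"
    using cosh_fourier[OF r, of 0] by simp
  then have "(\<lambda>k. 2 / (r\<^sup>2 + (real (Suc k))\<^sup>2)) sums (pi / (r * sinh (r * pi)) * cosh (r * pi) - 1 / r\<^sup>2)"
  proof -
    define f where "f = (\<lambda>k. (if k = 0 then 1 else 2) / (r\<^sup>2 + (real k)\<^sup>2))"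
    assume "(\<lambda>k. (if k = 0 then 1 else 2) / (r\<^sup>2 + (real k)\<^sup>2)) sums (pi / (r * sinh (r * pi)) * cosh (r * pi))"
    then have "f sums (pi / (r * sinh (r * pi)) * cosh (r * pi))" by (simp only: f_def)
    then have "(\<lambda>k. f (Suc k)) sums (pi / (r * sinh (r * pi)) * cosh (r * pi) - f 0)"
      by (subst sums_Suc_iff) (simp only: diff_add_cancel)
    then show ?thesis by (simp add: f_def)
  qed
  from sums_divide[OF this, of 2]
  have "(\<lambda>k. 2 / (r\<^sup>2 + (real (Suc k))\<^sup>2) / 2) sums ((pi / (r * sinh (r * pi)) * cosh (r * pi) - 1 / r\<^sup>2) / 2)" .
  moreover have "2 / t / 2 = 1 / t" for t :: real by simp
  ultimately show ?thesis by (simp only: times_divide_eq_left)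
qed

text \<open>Each partial fraction is expanded as a geometric series in \<open>- r^2 / k^2\<close>,
  and the order of summation is exchanged; the coefficients are then even zeta values.\<close>

lemma coth_power_series:
  fixes r :: real
  assumes r: "0 < r" "r < 1"
  shows "(\<lambda>m. (-1) ^ m * suminf (\<lambda>k. 1 / real (Suc k) ^ (2 * Suc m)) * r ^ (2 * Suc m)) sums
    ((pi * r * cosh (r * pi) / sinh (r * pi) - 1) / 2)"
proof -
  define F where "F = (\<lambda>(k::nat) (m::nat). (-1) ^ m * r ^ (2 * Suc m) / real (Suc k) ^ (2 * Suc m))"
  have r2: "r\<^sup>2 < 1" using r by (simp add: power_less_one_iff)
  have q: "\<bar>- (r\<^sup>2 / (real (Suc k))\<^sup>2)\<bar> < 1" for k
  proof -
    have "r\<^sup>2 / (real (Suc k))\<^sup>2 \<le> r\<^sup>2 / 1" using r by (intro divide_left_mono) (auto simp: one_le_power)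
    then have "r\<^sup>2 / (real (Suc k))\<^sup>2 < 1" using r2 by linarith
    moreover have "r\<^sup>2 / (real (Suc k))\<^sup>2 \<ge> 0" by simp
    ultimately show ?thesis by linarith
  qed
  have geo: "F k sums (r\<^sup>2 / (r\<^sup>2 + (real (Suc k))\<^sup>2))" for k
  proof -
    have "(\<lambda>m. (r\<^sup>2 / (real (Suc k))\<^sup>2) * (- (r\<^sup>2 / (real (Suc k))\<^sup>2)) ^ m) sums ((r\<^sup>2 / (real (Suc k))\<^sup>2) * (1 / (1 - (- (r\<^sup>2 / (real (Suc k))\<^sup>2)))))"
      using q[of k] by (intro sums_mult geometric_sums) simp
    moreover have "(r\<^sup>2 / (real (Suc k))\<^sup>2) * (- (r\<^sup>2 / (real (Suc k))\<^sup>2)) ^ m = F k m" for m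
    proof -
      have "q * (- q) ^ m = (-1) ^ m * q ^ Suc m" for q :: real by (simp add: power_minus[of q])
      then show ?thesis unfolding F_def by (simp only: power_divide power_mult times_divide_eq_right)
    qed
    moreover have "(r\<^sup>2 / (real (Suc k))\<^sup>2) * (1 / (1 - (- (r\<^sup>2 / (real (Suc k))\<^sup>2)))) = r\<^sup>2 / (r\<^sup>2 + (real (Suc k))\<^sup>2)"
      using r by (simp add: field_simps)
    ultimately show ?thesis by (simp only:)
  qed
  have nF: "norm (F k m) \<le> (1 / (real (Suc k))\<^sup>2) * (r\<^sup>2) ^ Suc m" for k m
  proof -
    have "real (Suc k) ^ 2 \<le> real (Suc k) ^ (2 * Suc m)" by (intro power_increasing) auto
    then have "r ^ (2 * Suc m) / real (Suc k) ^ (2 * Suc m) \<le> r ^ (2 * Suc m) / real (Suc k) ^ 2"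
      using r by (intro divide_left_mono) auto
    moreover have "norm (F k m) = r ^ (2 * Suc m) / real (Suc k) ^ (2 * Suc m)"
      unfolding F_def using r by (simp add: norm_mult norm_divide norm_power abs_mult power_abs)
    ultimately have "norm (F k m) \<le> r ^ (2 * Suc m) / real (Suc k) ^ 2" by linarith
    also have "\<dots> = (1 / (real (Suc k))\<^sup>2) * (r\<^sup>2) ^ Suc m"
      by (subst power_mult) (simp only: times_divide_eq_left mult_1_left)
    finally show ?thesis .
  qed
  have s1: "(\<lambda>k. 1 / (real (Suc k))\<^sup>2) summable_on UNIV"
    using summable_ignore_initial_segment[OF inverse_power_summable[of 2, where 'a = real], of 1]
    by (subst summable_on_UNIV_nonneg_real_iff) (auto simp: inverse_eq_divide)
  have s2: "(\<lambda>m. (r\<^sup>2) ^ Suc m) summable_on UNIV"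
    using r r2 summable_mult[OF summable_geometric[of "r\<^sup>2"], of "r\<^sup>2"]
    by (subst summable_on_UNIV_nonneg_real_iff) auto
  have "(\<lambda>(k, m). (1 / (real (Suc k))\<^sup>2) * (r\<^sup>2) ^ Suc m) summable_on UNIV \<times> UNIV"
  proof (rule summable_on_SigmaI)
    show "((\<lambda>m. case (k, m) of (k, m) \<Rightarrow> (1 / (real (Suc k))\<^sup>2) * (r\<^sup>2) ^ Suc m) has_sum
       (1 / (real (Suc k))\<^sup>2) * infsum (\<lambda>m. (r\<^sup>2) ^ Suc m) UNIV) UNIV" for k
      using has_sum_cmult_right[OF has_sum_infsum[OF s2], of "1 / (real (Suc k))\<^sup>2"] by (simp only: prod.case)
    show "(\<lambda>k. (1 / (real (Suc k))\<^sup>2) * infsum (\<lambda>m. (r\<^sup>2) ^ Suc m) UNIV) summable_on UNIV"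
      by (rule summable_on_cmult_left[OF s1])
  qed auto
  then have absF: "Infinite_Sum.abs_summable_on ((\<lambda>(k, m). F k m)) (UNIV \<times> UNIV)"
    by (rule summable_on_comparison_test) (use nF in auto)
  then have sF: "(\<lambda>(k, m). F k m) summable_on UNIV \<times> UNIV" by (rule abs_summable_summable)
  have sF': "(\<lambda>(m, k). F k m) summable_on UNIV \<times> UNIV"
    using summable_on_swap[THEN iffD1, OF sF] by (simp add: case_prod_unfold)
  have sw: "infsum (\<lambda>k. infsum (F k) UNIV) UNIV = infsum (\<lambda>m. infsum (\<lambda>k. F k m) UNIV) UNIV"
    using infsum_swap_banach[OF sF] by simp
  have geo': "(F k has_sum (r\<^sup>2 / (r\<^sup>2 + (real (Suc k))\<^sup>2))) UNIV" for k
  proof -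
    have "F k summable_on UNIV" using summable_on_SigmaD1[OF sF, of k] by simp
    then show ?thesis using has_sum_infsum has_sum_imp_sums sums_unique2 geo by metis
  qed
  have "(\<lambda>k. r\<^sup>2 / (r\<^sup>2 + (real (Suc k))\<^sup>2)) summable_on UNIV"
    using summable_on_Sigma_banach[OF sF] by (simp only: infsumI[OF geo'])
  note sq = this
  have L: "infsum (\<lambda>k. infsum (F k) UNIV) UNIV = (pi * r * cosh (r * pi) / sinh (r * pi) - 1) / 2"
  proof -
    have "(\<lambda>k. r\<^sup>2 * (1 / (r\<^sup>2 + (real (Suc k))\<^sup>2))) sums (r\<^sup>2 * ((pi * cosh (r * pi) / (r * sinh (r * pi)) - 1 / r\<^sup>2) / 2))"
      by (intro sums_mult coth_partial_fractions r)
    moreover have "r\<^sup>2 * ((pi * cosh (r * pi) / (r * sinh (r * pi)) - 1 / r\<^sup>2) / 2) = (pi * r * cosh (r * pi) / sinh (r * pi) - 1) / 2"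
      using r by (simp add: field_simps power2_eq_square)
    moreover have "(\<lambda>k. r\<^sup>2 / (r\<^sup>2 + (real (Suc k))\<^sup>2)) sums infsum (\<lambda>k. infsum (F k) UNIV) UNIV"
      using has_sum_imp_sums[OF has_sum_infsum[OF sq]] by (simp only: infsumI[OF geo'])
    ultimately show ?thesis using sums_unique2 by (metis (no_types, lifting) mult_1_right times_divide_eq_right sums_cong)
  qed
  have col: "((\<lambda>k. F k m) has_sum ((-1) ^ m * suminf (\<lambda>k. 1 / real (Suc k) ^ (2 * Suc m)) * r ^ (2 * Suc m))) UNIV" for m
  proof -
    have "summable (\<lambda>k. 1 / real (Suc k) ^ (2 * Suc m))"
      using summable_ignore_initial_segment[OF inverse_power_summable[of "2 * Suc m", where 'a = real], of 1]
      by (simp add: inverse_eq_divide)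
    then have "(\<lambda>k. 1 / real (Suc k) ^ (2 * Suc m)) sums suminf (\<lambda>k. 1 / real (Suc k) ^ (2 * Suc m))" by (rule summable_sums)
    from sums_mult[OF this, of "(-1) ^ m * r ^ (2 * Suc m)"]
    have 1: "(\<lambda>k. F k m) sums ((-1) ^ m * suminf (\<lambda>k. 1 / real (Suc k) ^ (2 * Suc m)) * r ^ (2 * Suc m))"
      by (simp add: F_def mult_ac)
    have "(\<lambda>k. F k m) summable_on UNIV"
      using summable_on_SigmaD1[OF sF', of m] by simp
    then show ?thesis using has_sum_infsum has_sum_imp_sums sums_unique2 1 by metis
  qed
  have "(\<lambda>m. infsum (\<lambda>k. F k m) UNIV) summable_on UNIV"
    using summable_on_Sigma_banach[OF sF'] by simp
  then have "(\<lambda>m. infsum (\<lambda>k. F k m) UNIV) sums ((pi * r * cosh (r * pi) / sinh (r * pi) - 1) / 2)"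
    unfolding L[symmetric] sw by (intro has_sum_imp_sums has_sum_infsum)
  then show ?thesis by (simp only: infsumI[OF col])
qed

text \<open>From \<open>x / (exp x - 1) = (x / 2) coth (x / 2) - x / 2\<close> and
  \<open>coth_power_series\<close> at \<open>r = x / (2 \<pi>)\<close>; the range
  \<open>x < 2 \<pi>\<close> is \<open>r < 1\<close>.\<close>

lemma bernoulli_power_series:
  fixes x :: real
  defines "c \<equiv> (\<lambda>n::nat. if n = 0 then 1 else if n = 1 then - 1 / 2 else if even n
    then 2 * (-1) ^ (n div 2 + 1) * suminf (\<lambda>k. 1 / real (Suc k) ^ n) / (2 * pi) ^ n else 0)"
  assumes x: "0 < x" "x < 2 * pi"
  shows "(\<lambda>n. c n * x ^ n) sums (x / (exp x - 1))"
proof -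
  define r where "r = x / (2 * pi)"
  have r: "0 < r" "r < 1" "r * pi = x / 2" using x by (simp_all add: r_def)
  define g where "g = (\<lambda>m. c (2 * Suc m) * x ^ (2 * Suc m))"
  have "2 * ((-1) ^ m * suminf (\<lambda>k. 1 / real (Suc k) ^ (2 * Suc m)) * r ^ (2 * Suc m)) = g m" for m
    unfolding g_def c_def r_def power_divide by simp
  with sums_mult[OF coth_power_series[OF r(1,2)], of 2]
  have "g sums (2 * ((pi * r * cosh (r * pi) / sinh (r * pi) - 1) / 2))" by (simp only:)
  also have "2 * ((pi * r * cosh (r * pi) / sinh (r * pi) - 1) / 2) = x / 2 * cosh (x / 2) / sinh (x / 2) - 1"
  proof -
    have "pi * r = x / 2" using r(3) by (simp only: mult.commute)
    then show ?thesis unfolding r(3) by simp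
  qed
  finally have "g sums (x / 2 * cosh (x / 2) / sinh (x / 2) - 1)" (is "_ sums ?E") .
  from sums_if'[OF this] have e: "(\<lambda>n. if even n then 0 else g ((n - 1) div 2)) sums ?E" .
  have "(\<lambda>n. (if even n then 0 else g ((n - 1) div 2)) + (if n = 0 then - x / 2 else 0)) sums (?E + - x / 2)"
    by (intro sums_add e sums_single[of 0 "\<lambda>_. - x / 2"])
  moreover have "(if even n then 0 else g ((n - 1) div 2)) + (if n = 0 then - x / 2 else 0) = c (Suc n) * x ^ Suc n" for n
  proof (cases "even n")
    case False
    then obtain k where "n = 2 * k + 1" by (auto elim: oddE)
    then show ?thesis by (simp add: g_def)
  qed (auto simp: c_def)
  ultimately have "(\<lambda>n. c (Suc n) * x ^ Suc n) sums (?E + - x / 2)" by (simp only:)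
  then have "(\<lambda>n. c n * x ^ n) sums (?E + - x / 2 + c 0 * x ^ 0)" by (subst (asm) sums_Suc_iff)
  moreover have "?E + - x / 2 + c 0 * x ^ 0 = x / (exp x - 1)"
  proof -
    define t where "t = exp (x / 2)"
    have t: "t > 1" using x by (simp add: t_def)
    have ex: "exp x = t * t" by (simp add: t_def flip: exp_add)
    have "cosh (x / 2) = (t + 1 / t) / 2" "sinh (x / 2) = (t - 1 / t) / 2"
      by (simp_all add: cosh_field_def sinh_field_def t_def exp_minus inverse_eq_divide)
    moreover have u: "t * t - 1 > 0" using t mult_strict_mono[of 1 t 1 t] by simp
    have eqs: "(t + 1 / t) = (t * t + 1) / t" "(t - 1 / t) = (t * t - 1) / t"
      using t by (simp_all add: add_divide_distrib diff_divide_distrib)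
    have q: "((t + 1 / t) / 2) / ((t - 1 / t) / 2) = (t * t + 1) / (t * t - 1)"     proof -
      have g: "(A / t / 2) / (B / t / 2) = A / B" for A B using t by simp
      show ?thesis unfolding eqs g ..
    qed
    ultimately have "?E = x / 2 * ((t * t + 1) / (t * t - 1)) - 1" by (simp only: times_divide_eq_right[symmetric] q)
    moreover have "(t * t + 1) / (t * t - 1) = 1 + 2 / (t * t - 1)"
      using u by (simp add: field_simps)
    ultimately have "?E = x / 2 + x / (t * t - 1) - 1" by (simp add: distrib_left)
    then show ?thesis unfolding ex by (simp add: c_def)
  qed
  ultimately show ?thesis by simp
qed

text \<open>\<open>bernoulli\<close> is defined by a formal quotient, while
  \<open>bernoulli_power_series\<close> speaks of values of a convergent series. The identity
  theorem matches them: \<open>G\<close> vanishes on \<open>(0, 1)\<close>, so all its coefficients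
  vanish.\<close>

lemma suminf_inverse_even_power_bernoulli:
  assumes m: "m \<ge> 1"
  shows "suminf (\<lambda>k. 1 / real (Suc k) ^ (2 * m)) = (-1) ^ (m + 1) * bernoulli (2 * m) * (2 * pi) ^ (2 * m) / (2 * fact (2 * m))"
proof -
  define c where "c = (\<lambda>n::nat. if n = 0 then 1 else if n = 1 then - 1 / 2 else if even n
    then 2 * (-1) ^ (n div 2 + 1) * suminf (\<lambda>k. 1 / real (Suc k) ^ n) / (2 * pi) ^ n else 0)"
  define F where "F = Abs_fps c"
  define G where "G = F * (fps_exp 1 - 1) - fps_X"
  have sm: "(\<lambda>n. c n * x ^ n) sums (x / (exp x - 1))" if "0 < x" "x < 2 * pi" for x
    using bernoulli_power_series[OF that] unfolding c_def .
  have pi1: "1 < 2 * pi" using pi_gt3 by simp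
  have "norm (1 :: real) \<le> conv_radius c"
    using sums_summable[OF sm[of 1]] pi1 by (intro conv_radius_geI) auto
  then have radF: "fps_conv_radius F \<ge> 1" by (simp add: F_def fps_conv_radius_def one_ereal_def)
  have radE: "fps_conv_radius (fps_exp 1 - 1 :: real fps) = \<infinity>"
    using fps_conv_radius_diff[of "fps_exp 1" "1 :: real fps"] by simp
  have radP: "fps_conv_radius (F * (fps_exp 1 - 1)) \<ge> 1"
    using order.trans[OF _ fps_conv_radius_mult[of F "fps_exp 1 - 1"]] radF radE by simp
  have radG: "fps_conv_radius G \<ge> 1"
    unfolding G_def using order.trans[OF _ fps_conv_radius_diff[of "F * (fps_exp 1 - 1)" fps_X]] radP by simp
  have lt: "ereal (norm x) < R" if "\<bar>x\<bar> < 1" "R \<ge> 1" for x :: real and R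
    using that by (metis ereal_less(3) less_ereal.simps(1) one_ereal_def order_less_le_trans real_norm_def)
  have ev: "eval_fps G x = 0" if "0 < x" "x < 1" for x
  proof -
    have "eval_fps F x = x / (exp x - 1)"
      using sm[of x] that pi1 by (simp add: eval_fps_def F_def sums_iff)
    moreover have "eval_fps (fps_exp 1 - 1) x = exp x - 1"
      by (subst eval_fps_diff) auto
    moreover have "eval_fps G x = eval_fps F x * eval_fps (fps_exp 1 - 1) x - x"
      unfolding G_def using lt[OF _ radF, of x] lt[OF _ radP, of x] that radE
      by (subst eval_fps_diff, simp, simp, subst eval_fps_mult) auto
    ultimately show ?thesis using that by simp
  qed
  have "G = 0"
  proof (rule ccontr)
    assume "G \<noteq> 0"
    then obtain n where n: "fps_nth G n \<noteq> 0" by (metis fps_nonzero_nth)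
    have G0: "fps_nth G 0 = 0" by (simp add: G_def fps_mult_nth)
    with n have n0: "n > 0" by (metis gr0I)
    have "(\<lambda>n. fps_nth G n * (x - 0) ^ n) sums eval_fps G x" if "norm (x - 0) < 1" for x
      using sums_eval_fps[of x G] lt[OF _ radG, of x] that by simp
    from powser_0_nonzero[OF zero_less_one this _ n n0] G0
    obtain s where s: "s > 0" "\<And>z. z \<in> cball 0 s - {0} \<Longrightarrow> eval_fps G z \<noteq> 0" by (auto simp: eval_fps_at_0)
    have "eval_fps G (min s (1/2)) \<noteq> 0" using s by (intro s(2)) (auto simp: min_def)
    moreover have "eval_fps G (min s (1/2)) = 0" using s(1) by (intro ev) auto
    ultimately show False by simp
  qed
  then have FX: "F * (fps_exp 1 - 1) = fps_X" by (simp add: G_def)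
  have "fps_nth (fps_exp 1 - 1 :: real fps) 1 \<noteq> 0" by simp
  then have "(fps_exp 1 - 1 :: real fps) \<noteq> 0" by (metis fps_zero_nth)
  then have "fps_X / (fps_exp 1 - 1) = F" unfolding FX[symmetric] by (rule nonzero_mult_div_cancel_right)
  then have "bernoulli (2 * m) = fact (2 * m) * c (2 * m)" by (simp add: bernoulli_def F_def)
  also have "c (2 * m) = 2 * (-1) ^ (m + 1) * suminf (\<lambda>k. 1 / real (Suc k) ^ (2 * m)) / (2 * pi) ^ (2 * m)"
    using m by (simp add: c_def)
  finally have "bernoulli (2 * m) = fact (2 * m) * (2 * (-1) ^ (m + 1) * suminf (\<lambda>k. 1 / real (Suc k) ^ (2 * m)) / (2 * pi) ^ (2 * m))" .
  then have b: "bernoulli (2 * m) = fact (2 * m) * (2 * (-1) ^ (m + 1) * Z / P)"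
    if "Z = suminf (\<lambda>k. 1 / real (Suc k) ^ (2 * m))" "P = (2 * pi) ^ (2 * m)" for Z P using that by simp
  define Z P e where "Z = suminf (\<lambda>k. 1 / real (Suc k) ^ (2 * m))" and "P = (2 * pi) ^ (2 * m)" and "e = (-1 :: real) ^ (m + 1)"
  have nz: "P \<noteq> 0" "e * e = 1" by (simp add: P_def, unfold e_def power_mult_distrib[symmetric], simp)
  have "e * (fact (2 * m) * (2 * e * Z / P)) * P / (2 * fact (2 * m)) = (e * e) * Z"
    using nz(1) by simp
  then show ?thesis using b[OF Z_def P_def] nz(2) unfolding Z_def[symmetric] P_def[symmetric] e_def[symmetric] by simp
qed

section \<open>Derivatives of the generating function\<close>

lemma higher_deriv_explicit:
  fixes D :: "nat \<Rightarrow> complex \<Rightarrow> complex"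
  assumes S: "open S" and D: "\<And>b z. z \<in> S \<Longrightarrow> (D b has_field_derivative D (Suc b) z) (at z)"
    and z: "z \<in> S"
  shows "(deriv ^^ a) (D 0) z = D a z"
  using z
proof (induct a arbitrary: z)
  case (Suc a)
  have hol: "D b holomorphic_on S" for b
    unfolding holomorphic_on_open[OF S] using D by blast
  have "deriv ((deriv ^^ a) (D 0)) z = deriv (D a) z"
    by (rule complex_derivative_transform_within_open[OF holomorphic_higher_deriv[OF hol S] hol S Suc(2) Suc(1)])
  then show ?case using D[OF Suc(2), of a] by (simp add: DERIV_imp_deriv)
qed simp

lemma higher_deriv_sum_lessThan:
  assumes "open S" "\<And>n. f n holomorphic_on S" "z \<in> S"
  shows "(deriv ^^ a) (\<lambda>w. \<Sum>k<(n::nat). f k w) z = (\<Sum>k<n. (deriv ^^ a) (f k) z)"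
  using assms(3)
proof (induct n)
  case 0 then show ?case by (induct a) simp_all
next
  case (Suc n)
  then show ?case using assms
    by (simp, subst higher_deriv_add[where S = S]) (auto intro!: holomorphic_intros)
qed

text \<open>Majorants for the terms themselves suffice: locally uniform limits of holomorphic
  functions may be differentiated any number of times.\<close>

lemma higher_deriv_series:
  fixes f :: "nat \<Rightarrow> complex \<Rightarrow> complex"
  assumes S: "open S" and hol: "\<And>n. f n holomorphic_on S"
    and M: "\<And>z. z \<in> S \<Longrightarrow> \<exists>r>0. \<exists>M. cball z r \<subseteq> S \<and> summable M \<and> (\<forall>n. \<forall>w\<in>cball z r. norm (f n w) \<le> M n)"
  shows "(\<lambda>w. suminf (\<lambda>n. f n w)) holomorphic_on S"
    and "\<And>z. z \<in> S \<Longrightarrow> (\<lambda>n. (deriv ^^ a) (f n) z) sums (deriv ^^ a) (\<lambda>w. suminf (\<lambda>n. f n w)) z"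
proof -
  have ul: "\<exists>r>0. cball z r \<subseteq> S \<and> uniform_limit (cball z r) (\<lambda>n w. \<Sum>k<n. f k w) (\<lambda>w. suminf (\<lambda>n. f n w)) sequentially"
    if zS: "z \<in> S" for z
  proof -
    from M[OF zS] obtain r M where r: "r > 0" "cball z r \<subseteq> S" "summable M" "\<And>n w. w \<in> cball z r \<Longrightarrow> norm (f n w) \<le> M n" by metis
    have "uniform_limit (cball z r) (\<lambda>n w. \<Sum>k<n. f k w) (\<lambda>w. suminf (\<lambda>n. f n w)) sequentially"
      by (rule Weierstrass_m_test) (use r in auto)
    with r show ?thesis by blast
  qed
  show "(\<lambda>w. suminf (\<lambda>n. f n w)) holomorphic_on S"
    by (rule holomorphic_uniform_sequence[OF S, of "\<lambda>n w. \<Sum>k<n. f k w"])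
      (use hol ul in \<open>auto intro!: holomorphic_intros\<close>)
  fix z assume z: "z \<in> S"
  from ul[OF z] obtain r where r: "r > 0" "cball z r \<subseteq> S" "uniform_limit (cball z r) (\<lambda>n w. \<Sum>k<n. f k w) (\<lambda>w. suminf (\<lambda>n. f n w)) sequentially" by blast
  have "(\<lambda>n. (deriv ^^ a) (\<lambda>w. \<Sum>k<n. f k w) z) \<longlonglongrightarrow> (deriv ^^ a) (\<lambda>w. suminf (\<lambda>n. f n w)) z"
  proof (rule higher_deriv_complex_uniform_limit)
    show "uniform_limit (ball z r) (\<lambda>n w. \<Sum>k<n. f k w) (\<lambda>w. suminf (\<lambda>n. f n w)) sequentially"
      by (rule uniform_limit_on_subset[OF r(3)]) auto
    have "f n holomorphic_on ball z r" for n
      by (rule holomorphic_on_subset[OF hol]) (use r(2) in auto)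
    then show "\<forall>\<^sub>F n in sequentially. (\<lambda>w. \<Sum>k<n. f k w) holomorphic_on ball z r"
      by (intro always_eventually allI holomorphic_intros)
  qed (use r in auto)
  then show "(\<lambda>n. (deriv ^^ a) (f n) z) sums (deriv ^^ a) (\<lambda>w. suminf (\<lambda>n. f n w)) z"
    unfolding sums_def higher_deriv_sum_lessThan[OF S hol z] .
qed

text \<open>A single term of the exponential series is at most its sum.\<close>

lemma power_mult_exp_minus_le:
  fixes c u :: real
  assumes "c > 0" "u \<ge> 0"
  shows "u ^ N * exp (- c * u) \<le> fact N / c ^ N"
proof -
  have "(c * u) ^ N / fact N \<le> exp (c * u)"
  proof -
    have "(\<lambda>n. (c * u) ^ n / fact n) sums exp (c * u)"
      using exp_converges[of "c * u"] by (simp add: divide_inverse mult.commute)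
    then have "(\<Sum>n\<in>{N}. (c * u) ^ n / fact n) \<le> exp (c * u)"
      using assms by (intro sum_le_suminf[THEN order.trans]) (auto simp: sums_iff)
    then show ?thesis by simp
  qed
  then show ?thesis using assms by (simp add: field_simps exp_minus power_mult_distrib)
qed

section \<open>The terms \<open>phi\<close> on the right half-plane\<close>

definition RHP :: "complex set" where "RHP = {z. Re z > 0}"

lemma RHP: "open RHP" "connected RHP"
  unfolding RHP_def by (auto intro: open_halfspace_Re_gt convex_halfspace_Re_gt convex_connected)

lemma RHP_nonzero: "z \<in> RHP \<Longrightarrow> z \<noteq> 0"
  by (auto simp: RHP_def)

text \<open>These are the discs for Cauchy's inequality and for the local majorants. The constant 8
  arises from \<open>Re (1 / w) = Re w / (cmod w)^2\<close> with half the real part and twice the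
  modulus of \<open>z\<close>.\<close>

lemma RHP_cball:
  assumes z: "z \<in> RHP" and w: "w \<in> cball z (Re z / 2)"
  shows "w \<in> RHP" "Re w \<ge> Re z / 2" "cmod w \<le> 2 * cmod z" "cmod w \<ge> Re z / 2" "Re (1 / w) \<ge> Re z / (8 * (cmod z)\<^sup>2)"
proof -
  have z0: "Re z > 0" using z by (simp add: RHP_def)
  have d: "cmod (w - z) \<le> Re z / 2" using w by (simp add: dist_norm norm_minus_commute)
  have "\<bar>Re (w - z)\<bar> \<le> Re z / 2" using abs_Re_le_cmod[of "w - z"] d by linarith
  then have "- Re (w - z) \<le> Re z / 2" by (rule abs_le_D2)
  then show 1: "Re w \<ge> Re z / 2" by simp
  then show "w \<in> RHP" using z0 by (simp add: RHP_def)
  show 2: "cmod w \<ge> Re z / 2" using complex_Re_le_cmod[of w] 1 by linarith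
  have "cmod w \<le> cmod z + cmod (w - z)" using norm_triangle_ineq[of z "w - z"] by simp
  then show 3: "cmod w \<le> 2 * cmod z" using d complex_Re_le_cmod[of z] norm_ge_zero[of z] by linarith
  have w0: "cmod w > 0" "cmod z > 0" using 2 z0 complex_Re_le_cmod[of z] by linarith+
  have "(cmod w)\<^sup>2 \<le> (2 * cmod z)\<^sup>2" using 3 by (intro power_mono) auto
  then have "(Re z / 2) / (2 * cmod z)\<^sup>2 \<le> Re w / (cmod w)\<^sup>2"
    using 1 z0 w0 by (intro frac_le) auto
  also have "Re w / (cmod w)\<^sup>2 = Re (1 / w)" by (simp add: Re_divide cmod_power2)
  finally show "Re (1 / w) \<ge> Re z / (8 * (cmod z)\<^sup>2)" by (simp add: power_mult_distrib)
qed

definition phi :: "real \<Rightarrow> real \<Rightarrow> complex \<Rightarrow> complex" where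
  "phi \<rho> d y = (of_real \<rho> / y) * exp (- of_real (\<rho>\<^sup>2 * d) / y)"

lemma phi_holomorphic: "phi \<rho> d holomorphic_on RHP"
  unfolding phi_def by (intro holomorphic_intros) (auto dest: RHP_nonzero)

lemma phi_bound:
  assumes rho: "\<rho> > 0" and d: "d \<ge> 0" and z: "z \<in> RHP" and w: "w \<in> cball z (Re z / 2)"
  shows "norm (phi \<rho> d w) \<le> (2 * \<rho> / Re z) * exp (- (\<rho>\<^sup>2 * Re z / (8 * (cmod z)\<^sup>2)) * d)"
proof -
  note W = RHP_cball[OF z w]
  have z0: "Re z > 0" using z by (simp add: RHP_def)
  have "norm (phi \<rho> d w) = (\<rho> / cmod w) * exp (- (\<rho>\<^sup>2 * d) * Re (1 / w))"
    using rho by (simp add: phi_def norm_mult norm_divide Re_divide)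
  also have "\<dots> \<le> (\<rho> / (Re z / 2)) * exp (- (\<rho>\<^sup>2 * Re z / (8 * (cmod z)\<^sup>2)) * d)"
  proof (intro mult_mono)
    have "cmod w > 0" using W(4) z0 by linarith
    then show "\<rho> / cmod w \<le> \<rho> / (Re z / 2)" using W(4) z0 rho by (intro divide_left_mono) auto
    have "(\<rho>\<^sup>2 * d) * (Re z / (8 * (cmod z)\<^sup>2)) \<le> (\<rho>\<^sup>2 * d) * Re (1 / w)"
      using W(5) d by (intro mult_left_mono) auto
    then show "exp (- (\<rho>\<^sup>2 * d) * Re (1 / w)) \<le> exp (- (\<rho>\<^sup>2 * Re z / (8 * (cmod z)\<^sup>2)) * d)"
      by (simp add: mult_ac)
  qed (use rho z0 in auto)
  finally show ?thesis by (simp add: mult.commute)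
qed

text \<open>Cauchy's inequality on a disc whose radius is proportional to \<open>x\<close>. This
  gives the order \<open>x ^ - (b + 1)\<close> at infinity together with exponential smallness at
  0.\<close>

lemma phi_deriv_bound:
  assumes rho: "\<rho> > 0" and d: "d \<ge> 0" and eta: "\<eta> \<in> RHP" and x: "x > 0"
  shows "norm ((deriv ^^ b) (phi \<rho> d) (of_real x * \<eta>)) \<le>
    (fact b * (2 * \<rho> / Re \<eta>) * (2 / Re \<eta>) ^ b) * ((1 / x) ^ Suc b * exp (- (\<rho>\<^sup>2 * Re \<eta> / (8 * (cmod \<eta>)\<^sup>2) * d) * (1 / x)))"
proof -
  have e0: "Re \<eta> > 0" using eta by (simp add: RHP_def)
  define z where "z = of_real x * \<eta>"
  have z: "z \<in> RHP" using e0 x by (simp add: z_def RHP_def)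
  define B where "B = (2 * \<rho> / Re z) * exp (- (\<rho>\<^sup>2 * Re z / (8 * (cmod z)\<^sup>2)) * d)"
  have sub: "cball z (Re z / 2) \<subseteq> RHP" using RHP_cball(1)[OF z] by blast
  have "norm ((deriv ^^ b) (phi \<rho> d) z) \<le> fact b * B / (Re z / 2) ^ b"
  proof (rule Cauchy_inequality)
    show "phi \<rho> d holomorphic_on ball z (Re z / 2)"
      by (rule holomorphic_on_subset[OF phi_holomorphic]) (use sub ball_subset_cball in blast)
    show "continuous_on (cball z (Re z / 2)) (phi \<rho> d)"
      by (rule holomorphic_on_imp_continuous_on[OF holomorphic_on_subset[OF phi_holomorphic sub]])
    show "0 < Re z / 2" using z by (simp add: RHP_def)
    show "norm (phi \<rho> d w) \<le> B" if "norm (z - w) = Re z / 2" for w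
      unfolding B_def by (rule phi_bound[OF rho d z]) (simp add: dist_norm that)
  qed
  also have "fact b * B / (Re z / 2) ^ b = (fact b * (2 * \<rho> / Re \<eta>) * (2 / Re \<eta>) ^ b) * ((1 / x) ^ Suc b * exp (- (\<rho>\<^sup>2 * Re \<eta> / (8 * (cmod \<eta>)\<^sup>2) * d) * (1 / x)))"
  proof -
    have 1: "Re z = x * Re \<eta>" "cmod z = x * cmod \<eta>" using x by (simp_all add: z_def norm_mult)
    have 2: "- (\<rho>\<^sup>2 * (x * Re \<eta>) / (8 * (x * cmod \<eta>)\<^sup>2)) * d = - (\<rho>\<^sup>2 * Re \<eta> / (8 * (cmod \<eta>)\<^sup>2) * d) * (1 / x)"
      using x e0 by (simp add: power2_eq_square field_simps)
    show ?thesis unfolding B_def 1 2 using x e0 by (simp add: field_simps power_mult_distrib power_divide)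
  qed
  finally show ?thesis by (simp add: z_def)
qed

section \<open>Generating functions with a functional equation\<close>

locale theta_coeffs =
  fixes v :: "nat \<Rightarrow> real" and \<rho> \<kappa> :: real
  assumes v0: "v 0 = 0" and v_nonneg: "\<And>n. v n \<ge> 0" and rho: "\<rho> > 0" and kappa: "\<kappa> \<ge> 0"
    and v_summable: "\<And>y. y > 0 \<Longrightarrow> summable (\<lambda>n. v n * exp (- y * real n))"
    and functional_equation: "\<And>y. y > 0 \<Longrightarrow> suminf (\<lambda>n. v n * exp (- y * real n)) =
      - \<kappa> + \<kappa> * \<rho> / y + \<rho> / y * suminf (\<lambda>n. v n * exp (- (\<rho>\<^sup>2 / y) * real n))"
begin

definition gr :: "real \<Rightarrow> real" where "gr y = suminf (\<lambda>n. v n * exp (- y * real n))"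

lemma gr_nonneg: "y > 0 \<Longrightarrow> gr y \<ge> 0"
  unfolding gr_def by (intro suminf_nonneg v_summable mult_nonneg_nonneg v_nonneg) auto

text \<open>The functional equation exchanges small and large arguments, so
  \<open>g y = O(1 / y)\<close> as \<open>y\<close> tends to 0. With \<open>y = c / k\<close> this
  costs one factor \<open>k\<close> in the double series.\<close>

lemma gr_bound:
  assumes c: "c > 0"
  obtains C where "C \<ge> 0" "\<And>x. x \<ge> 1 \<Longrightarrow> gr (c / x) \<le> C * x"
proof (rule that[of "\<kappa> * \<rho> / c + \<rho> / c * gr (\<rho>\<^sup>2 / c)"])
  have pos: "\<rho>\<^sup>2 / c > 0" using rho c by simp
  show "\<kappa> * \<rho> / c + \<rho> / c * gr (\<rho>\<^sup>2 / c) \<ge> 0" using rho kappa c gr_nonneg[OF pos] by simp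
  fix x :: real assume x: "x \<ge> 1"
  have cx: "c / x > 0" using c x by simp
  have y: "\<rho>\<^sup>2 / (c / x) \<ge> \<rho>\<^sup>2 / c" using c x rho by (simp add: field_simps)
  then have pos': "\<rho>\<^sup>2 / (c / x) > 0" using pos by linarith
  have mono: "gr (\<rho>\<^sup>2 / (c / x)) \<le> gr (\<rho>\<^sup>2 / c)" unfolding gr_def
  proof (rule suminf_le[OF _ v_summable[OF pos'] v_summable[OF pos]])
    fix n
    have "- (\<rho>\<^sup>2 / (c / x)) * real n \<le> - (\<rho>\<^sup>2 / c) * real n" using y by (intro mult_right_mono) auto
    then show "v n * exp (- (\<rho>\<^sup>2 / (c / x)) * real n) \<le> v n * exp (- (\<rho>\<^sup>2 / c) * real n)"
      by (intro mult_left_mono v_nonneg) simp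
  qed
  have "gr (c / x) = - \<kappa> + \<kappa> * \<rho> / (c / x) + \<rho> / (c / x) * gr (\<rho>\<^sup>2 / (c / x))"
    unfolding gr_def by (rule functional_equation[OF cx])
  also have "\<dots> \<le> \<kappa> * \<rho> / (c / x) + \<rho> / (c / x) * gr (\<rho>\<^sup>2 / c)"
  proof -
    have "\<rho> / (c / x) * gr (\<rho>\<^sup>2 / (c / x)) \<le> \<rho> / (c / x) * gr (\<rho>\<^sup>2 / c)"
      by (rule mult_left_mono[OF mono], rule divide_nonneg_pos) (use rho cx in auto)
    then show ?thesis using kappa by linarith
  qed
  also have "\<dots> = (\<kappa> * \<rho> / c + \<rho> / c * gr (\<rho>\<^sup>2 / c)) * x" by (simp add: field_simps)
  finally show "gr (c / x) \<le> (\<kappa> * \<rho> / c + \<rho> / c * gr (\<rho>\<^sup>2 / c)) * x" .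
qed

text \<open>The \<open>n\<close>-th term of the series at \<open>1 / n\<close> is
  \<open>v n / e\<close>, and it is at most the whole sum \<open>gr (1 / n) = O(n)\<close>.\<close>

lemma v_bound:
  obtains C where "C \<ge> 0" "\<And>n. v n \<le> C * real n"
proof -
  obtain C where C: "C \<ge> 0" "\<And>x. x \<ge> 1 \<Longrightarrow> gr (1 / x) \<le> C * x" using gr_bound[of 1] by auto
  have "v n \<le> (exp 1 * C) * real n" for n
  proof (cases "n = 0")
    case False
    then have n: "real n \<ge> 1" by simp
    have "v n * exp (- (1 / real n) * real n) \<le> gr (1 / real n)"
      unfolding gr_def using sum_le_suminf[OF v_summable[of "1 / real n"], of "{n}"] n v_nonneg by simp
    then have "v n * exp (- 1) \<le> C * real n" using C(2)[OF n] n by simp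
    then show ?thesis by (simp add: exp_minus field_simps)
  qed (simp add: v0)
  then show ?thesis using C(1) by (intro that[of "exp 1 * C"]) auto
qed

definition gc :: "complex \<Rightarrow> complex" where "gc y = suminf (\<lambda>n. of_real (v n) * exp (- y * of_nat n))"
text \<open>This is \<open>(\<rho> / y) g (\<rho>^2 / y)\<close>, kept as a series in
  \<open>phi\<close> because it is differentiated and then summed over \<open>k\<close> term by
  term.\<close>

definition hc :: "complex \<Rightarrow> complex" where "hc y = suminf (\<lambda>n. of_real (v n) * phi \<rho> (real n) y)"

lemma gc_series:
  shows "gc holomorphic_on RHP"
    and "z \<in> RHP \<Longrightarrow> (\<lambda>n. of_real (v n) * (- of_nat n) ^ a * exp (- z * of_nat n)) sums (deriv ^^ a) gc z"
proof -
  have M: "\<exists>r>0. \<exists>M. cball z r \<subseteq> RHP \<and> summable M \<and> (\<forall>n. \<forall>w\<in>cball z r. norm (of_real (v n) * exp (- w * of_nat n)) \<le> M n)"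
    if z: "z \<in> RHP" for z
  proof (intro exI conjI allI ballI)
    have z0: "Re z > 0" using z by (simp add: RHP_def)
    show "Re z / 2 > 0" using z0 by simp
    show "cball z (Re z / 2) \<subseteq> RHP" using RHP_cball(1)[OF z] by blast
    show "summable (\<lambda>n. v n * exp (- (Re z / 2) * real n))" using z0 by (intro v_summable) simp
    fix n w assume "w \<in> cball z (Re z / 2)"
    then have "Re w \<ge> Re z / 2" by (rule RHP_cball(2)[OF z])
    then have "- Re w * real n \<le> - (Re z / 2) * real n" by (intro mult_right_mono) auto
    then show "norm (of_real (v n) * exp (- w * of_nat n)) \<le> v n * exp (- (Re z / 2) * real n)"
      using v_nonneg[of n] by (simp add: norm_mult mult_left_mono)
  qed
  have hol: "(\<lambda>w. of_real (v n) * exp (- w * of_nat n)) holomorphic_on RHP" for n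
    by (intro holomorphic_intros)
  show "gc holomorphic_on RHP"
    using higher_deriv_series(1)[OF RHP(1) hol M] by (simp add: gc_def[abs_def])
  assume z: "z \<in> RHP"
  have "(deriv ^^ a) (\<lambda>w. of_real (v n) * exp (- w * of_nat n)) z = of_real (v n) * (- of_nat n) ^ a * exp (- z * of_nat n)" for n
  proof -
    define D where "D = (\<lambda>b w. of_real (v n) * (- of_nat n) ^ b * exp (- w * of_nat n :: complex))"
    have DD: "(D b has_field_derivative D (Suc b) w) (at w)" for b w
      unfolding D_def by (auto intro!: derivative_eq_intros)
    have D0: "D 0 = (\<lambda>w. of_real (v n) * exp (- w * of_nat n))" by (simp add: D_def)
    have "(deriv ^^ a) (D 0) z = D a z" by (rule higher_deriv_explicit[OF RHP(1) _ z]) (rule DD)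
    then show ?thesis unfolding D0 by (simp add: D_def)
  qed
  then show "(\<lambda>n. of_real (v n) * (- of_nat n) ^ a * exp (- z * of_nat n)) sums (deriv ^^ a) gc z"
    using higher_deriv_series(2)[OF RHP(1) hol M z, of a] by (simp add: gc_def[abs_def])
qed

lemma hc_series:
  shows "hc holomorphic_on RHP"
    and "z \<in> RHP \<Longrightarrow> (\<lambda>n. of_real (v n) * (deriv ^^ a) (phi \<rho> (real n)) z) sums (deriv ^^ a) hc z"
proof -
  have M: "\<exists>r>0. \<exists>M. cball z r \<subseteq> RHP \<and> summable M \<and> (\<forall>n. \<forall>w\<in>cball z r. norm (of_real (v n) * phi \<rho> (real n) w) \<le> M n)"
    if z: "z \<in> RHP" for z
  proof (intro exI conjI allI ballI)
    have z0: "Re z > 0" using z by (simp add: RHP_def)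
    define c where "c = \<rho>\<^sup>2 * Re z / (8 * (cmod z)\<^sup>2)"
    have c: "c > 0" using z0 rho RHP_nonzero[OF z] by (simp add: c_def)
    show "Re z / 2 > 0" using z0 by simp
    show "cball z (Re z / 2) \<subseteq> RHP" using RHP_cball(1)[OF z] by blast
    show "summable (\<lambda>n. (2 * \<rho> / Re z) * (v n * exp (- c * real n)))" using c by (intro summable_mult v_summable)
    fix n w assume "w \<in> cball z (Re z / 2)"
    then have "norm (phi \<rho> (real n) w) \<le> (2 * \<rho> / Re z) * exp (- c * real n)"
      unfolding c_def using phi_bound[OF rho _ z] by simp
    from mult_left_mono[OF this v_nonneg[of n]]
    show "norm (of_real (v n) * phi \<rho> (real n) w) \<le> (2 * \<rho> / Re z) * (v n * exp (- c * real n))"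
      using v_nonneg[of n] by (simp add: norm_mult mult_ac)
  qed
  have hol: "(\<lambda>w. of_real (v n) * phi \<rho> (real n) w) holomorphic_on RHP" for n
    by (intro holomorphic_intros phi_holomorphic)
  show "hc holomorphic_on RHP"
    using higher_deriv_series(1)[OF RHP(1) hol M] by (simp add: hc_def[abs_def])
  assume z: "z \<in> RHP"
  have "(deriv ^^ a) (\<lambda>w. of_real (v n) * phi \<rho> (real n) w) z = of_real (v n) * (deriv ^^ a) (phi \<rho> (real n)) z" for n
    by (rule higher_deriv_explicit[OF RHP(1), of "\<lambda>b w. of_real (v n) * (deriv ^^ b) (phi \<rho> (real n)) w", simplified, OF _ z])
      (auto intro!: DERIV_cmult holomorphic_derivI[OF holomorphic_higher_deriv[OF phi_holomorphic RHP(1)] RHP(1)])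
  then show "(\<lambda>n. of_real (v n) * (deriv ^^ a) (phi \<rho> (real n)) z) sums (deriv ^^ a) hc z"
    using higher_deriv_series(2)[OF RHP(1) hol M z, of a] by (simp add: hc_def[abs_def])
qed

text \<open>Both sides are holomorphic on \<open>RHP\<close> and agree on the positive reals by
  assumption. The continuation is needed because the ray through \<open>\<eta>\<close> is not real
  in general.\<close>

lemma gc_eq:
  assumes z: "z \<in> RHP"
  shows "gc z = - of_real \<kappa> + of_real (\<kappa> * \<rho>) / z + hc z"
proof -
  have "gc z - (- of_real \<kappa> + of_real (\<kappa> * \<rho>) / z + hc z) = 0"
  proof (rule analytic_continuation[of "\<lambda>z. gc z - (- of_real \<kappa> + of_real (\<kappa> * \<rho>) / z + hc z)" RHP "complex_of_real ` {0<..}" 1 z])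
    show "(\<lambda>z. gc z - (- of_real \<kappa> + of_real (\<kappa> * \<rho>) / z + hc z)) holomorphic_on RHP"
      by (intro holomorphic_intros gc_series(1) hc_series(1)) (auto dest: RHP_nonzero)
    show "complex_of_real ` {0<..} \<subseteq> RHP" "1 \<in> RHP" by (auto simp: RHP_def)
    show "1 islimpt complex_of_real ` {0<..}"
      unfolding islimpt_sequential
    proof (intro exI[of _ "\<lambda>n. complex_of_real (1 + 1 / real (Suc n))"] conjI allI)
      fix n :: nat
      have "1 + 1 / real (Suc n) > 0" "1 + 1 / real (Suc n) \<noteq> 1" by (simp_all add: add_pos_pos)
      then show "complex_of_real (1 + 1 / real (Suc n)) \<in> complex_of_real ` {0<..} - {1}"
        by (auto simp del: of_real_add of_real_divide of_nat_Suc simp: of_real_eq_1_iff)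
      have "(\<lambda>n. 1 + 1 / real (Suc n)) \<longlonglongrightarrow> 1" by real_asymp
      from tendsto_of_real[OF this]
      show "(\<lambda>n. complex_of_real (1 + 1 / real (Suc n))) \<longlonglongrightarrow> 1" by (simp only: of_real_1)
    qed
    fix w assume "w \<in> complex_of_real ` {0<..}"
    then obtain y where y: "y > 0" "w = of_real y" by auto
    have py: "\<rho>\<^sup>2 / y > 0" using y rho by simp
    have "(\<lambda>n. complex_of_real (v n * exp (- y * real n))) sums of_real (gr y)"
      unfolding sums_of_real_iff gr_def by (rule summable_sums[OF v_summable[OF y(1)]])
    then have 1: "gc w = of_real (gr y)" by (simp add: gc_def y sums_iff exp_of_real[symmetric])
    have "(\<lambda>n. (of_real (\<rho> / y) :: complex) * of_real (v n * exp (- (\<rho>\<^sup>2 / y) * real n))) sums (of_real (\<rho> / y) * of_real (gr (\<rho>\<^sup>2 / y)))"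
      by (intro sums_mult) (unfold sums_of_real_iff gr_def, rule summable_sums[OF v_summable[OF py]])
    moreover have "(of_real (\<rho> / y) :: complex) * of_real (v n * exp (- (\<rho>\<^sup>2 / y) * real n)) = of_real (v n) * phi \<rho> (real n) w" for n
      by (simp add: phi_def y exp_of_real[symmetric])
    ultimately have 2: "hc w = of_real (\<rho> / y) * of_real (gr (\<rho>\<^sup>2 / y))" by (simp add: hc_def sums_iff)
    have "gr y = - \<kappa> + \<kappa> * \<rho> / y + \<rho> / y * gr (\<rho>\<^sup>2 / y)" unfolding gr_def by (rule functional_equation[OF y(1)])
    then show "gc w - (- of_real \<kappa> + of_real (\<kappa> * \<rho>) / w + hc w) = 0"
      unfolding 1 2 by (simp add: y)
  qed (use RHP z in auto)
  then show ?thesis by simp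
qed

text \<open>One differentiation removes the constant \<open>- \<kappa>\<close>, whence
  \<open>a \<ge> 1\<close>. The family \<open>D\<close> exhibits all derivatives at once, with the
  constant present for \<open>b = 0\<close> only.\<close>

lemma gc_higher_deriv:
  assumes z: "z \<in> RHP" and a: "a \<ge> 1"
  shows "(deriv ^^ a) gc z = of_real (\<kappa> * \<rho>) * ((-1) ^ a * fact a / z ^ Suc a) + (deriv ^^ a) hc z"
proof -
  define D where "D = (\<lambda>b z. of_real (\<kappa> * \<rho>) * ((-1) ^ b * fact b / z ^ Suc b) + (if b = 0 then - of_real \<kappa> else 0) + (deriv ^^ b) hc z)"
  have DD: "(D b has_field_derivative D (Suc b) w) (at w)" if w: "w \<in> RHP" for b w
  proof -
    have h: "((deriv ^^ b) hc has_field_derivative (deriv ^^ Suc b) hc w) (at w)"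
      using holomorphic_derivI[OF holomorphic_higher_deriv[OF hc_series(1) RHP(1)] RHP(1) w] by simp
    have i: "((\<lambda>z. 1 / z ^ Suc b) has_field_derivative (- (of_nat (Suc b)) / w ^ Suc (Suc b))) (at w)"
    proof -
      have "((\<lambda>z. inverse (z ^ Suc b)) has_field_derivative
        - ((1 + of_nat b) * (1 * w ^ b) * inverse ((w ^ Suc b) ^ Suc (Suc 0)))) (at w)"
        by (rule DERIV_inverse_fun[OF DERIV_power_Suc[OF DERIV_ident]]) (use RHP_nonzero[OF w] in simp)
      moreover have "- ((1 + of_nat b) * (1 * w ^ b) * inverse ((w ^ Suc b) ^ Suc (Suc 0))) = - (of_nat (Suc b)) / w ^ Suc (Suc b)"
        using RHP_nonzero[OF w] by (simp add: field_simps)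
      ultimately show ?thesis by (simp add: inverse_eq_divide)
    qed
    have D: "D b = (\<lambda>z. (of_real (\<kappa> * \<rho>) * ((-1) ^ b * fact b)) * (1 / z ^ Suc b) + (if b = 0 then - of_real \<kappa> else 0) + (deriv ^^ b) hc z)"
      by (simp add: D_def fun_eq_iff)
    have "(D b has_field_derivative ((of_real (\<kappa> * \<rho>) * ((-1) ^ b * fact b)) * (- (of_nat (Suc b)) / w ^ Suc (Suc b)) + 0 + (deriv ^^ Suc b) hc w)) (at w)"
      unfolding D by (intro DERIV_add DERIV_cmult i h DERIV_const)
    moreover have "(of_real (\<kappa> * \<rho>) * ((-1) ^ b * fact b)) * (- (of_nat (Suc b)) / w ^ Suc (Suc b)) + 0 + (deriv ^^ Suc b) hc w = D (Suc b) w"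
      unfolding D_def fact_Suc by (simp only: power_Suc) (simp add: mult_ac del: of_nat_Suc)
    ultimately show ?thesis by (simp only:)
  qed
  have "(deriv ^^ a) gc z = (deriv ^^ a) (D 0) z"
  proof (rule higher_deriv_transform_within_open[OF gc_series(1) _ RHP(1) z])
    show "D 0 holomorphic_on RHP" unfolding holomorphic_on_open[OF RHP(1)] using DD by blast
    show "gc w = D 0 w" if "w \<in> RHP" for w using gc_eq[OF that] by (simp add: D_def)
  qed
  also have "\<dots> = D a z" by (rule higher_deriv_explicit[OF RHP(1) _ z]) (rule DD)
  finally show ?thesis using a by (simp add: D_def)
qed

end

section \<open>Poisson summation along a ray\<close>

text \<open>Dominated convergence: from some index on, \<open>Re (Z n)\<close> exceeds
  \<open>Re w / 2\<close>, which supplies the majorant. It serves to move the Laplace variable to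
  the imaginary axis.\<close>

lemma bessel_K0_tendsto:
  assumes w: "Re w > 0" and Z: "Z \<longlonglongrightarrow> w"
  shows "(\<lambda>n. bessel_K0 (Z n)) \<longlonglongrightarrow> bessel_K0 w"
proof -
  have ev: "\<forall>\<^sub>F n in sequentially. Re (Z n) > Re w / 2"
    using order_tendstoD(1)[OF tendsto_Re[OF Z], of "Re w / 2"] w by simp
  then obtain N where N: "\<And>n. n \<ge> N \<Longrightarrow> Re (Z n) > Re w / 2" by (auto simp: eventually_sequentially)
  define Z' where "Z' = (\<lambda>n. Z (n + N))"
  have Z': "Z' \<longlonglongrightarrow> w" unfolding Z'_def by (rule LIMSEQ_ignore_initial_segment[OF Z])
  have reZ: "Re (Z' n) > Re w / 2" for n unfolding Z'_def by (rule N) simp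
  have "(\<lambda>n. \<integral>t. exp (- Z' n * of_real (cosh t)) \<partial>lborel) \<longlonglongrightarrow> (\<integral>t. exp (- w * of_real (cosh t)) \<partial>lborel)"
  proof (rule integral_dominated_convergence[where w = "\<lambda>t. norm (exp (- complex_of_real (Re w / 2) * of_real (cosh t)))"])
    show "integrable lborel (\<lambda>t. norm (exp (- complex_of_real (Re w / 2) * of_real (cosh t))))"
      using w by (intro integrable_norm integrable_exp_minus_cosh) simp
    show "AE t in lborel. (\<lambda>n. exp (- Z' n * of_real (cosh t))) \<longlonglongrightarrow> exp (- w * of_real (cosh t))"
      by (intro AE_I2 tendsto_intros Z')
    show "AE t in lborel. norm (exp (- Z' n * of_real (cosh t))) \<le> norm (exp (- complex_of_real (Re w / 2) * of_real (cosh t)))" for n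
    proof (rule AE_I2)
      fix t :: real
      have "cosh t \<ge> 0" using cosh_real_ge_1[of t] by linarith
      then have "(Re w / 2) * cosh t \<le> Re (Z' n) * cosh t" using reZ[of n] by (intro mult_right_mono) auto
      then show "norm (exp (- Z' n * of_real (cosh t))) \<le> norm (exp (- complex_of_real (Re w / 2) * of_real (cosh t)))"
        by simp
    qed
  qed (auto intro!: borel_measurable_continuous_onI continuous_intros)
  moreover have "(\<integral>t. exp (- Z' n * of_real (cosh t)) \<partial>lborel) = 2 * bessel_K0 (Z' n)" for n
    by (rule bessel_K0_eq_lebesgue[symmetric]) (use reZ[of n] w in linarith)
  moreover have "(\<integral>t. exp (- w * of_real (cosh t)) \<partial>lborel) = 2 * bessel_K0 w"
    by (rule bessel_K0_eq_lebesgue[OF w, symmetric])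
  ultimately have "(\<lambda>n. 2 * bessel_K0 (Z' n)) \<longlonglongrightarrow> 2 * bessel_K0 w" by simp
  from tendsto_mult_left[OF this, of "1 / 2"] have "(\<lambda>n. bessel_K0 (Z' n)) \<longlonglongrightarrow> bessel_K0 w" by simp
  then show ?thesis unfolding Z'_def by (rule LIMSEQ_offset)
qed

lemma exp_minus_le_cauchy:
  fixes e x :: real
  assumes e: "e > 0" and x: "x \<ge> 0"
  shows "exp (- e * x) \<le> (1 / min 1 (e\<^sup>2 / 2)) / (1 + x\<^sup>2)"
proof -
  define m where "m = min 1 (e\<^sup>2 / 2)"
  have m: "m > 0" "m \<le> 1" "m \<le> e\<^sup>2 / 2" using e by (auto simp: m_def)
  have pos: "1 + x\<^sup>2 > 0" using zero_le_power2[of x] by linarith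
  have "m * (1 + x\<^sup>2) \<le> 1 + e\<^sup>2 / 2 * x\<^sup>2"
    using m mult_right_mono[OF m(3), of "x\<^sup>2"] by (simp add: algebra_simps)
  also have "\<dots> \<le> 1 + e * x + (e * x)\<^sup>2 / 2" using e x by (simp add: power_mult_distrib)
  also have "\<dots> \<le> exp (e * x)" by (rule exp_lower_Taylor_quadratic) (use e x in simp)
  finally have "1 / exp (e * x) \<le> 1 / (m * (1 + x\<^sup>2))" using m pos by (intro divide_left_mono) auto
  then show ?thesis unfolding m_def[symmetric] by (simp add: exp_minus inverse_eq_divide)
qed

lemma lborel_integral_exp_substitution:
  fixes F :: "real \<Rightarrow> complex"
  assumes c: "continuous_on {0<..} F"
    and i: "integrable lborel (\<lambda>x. indicator {0<..} x *\<^sub>R F x)"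
    and j: "integrable lborel (\<lambda>t. exp t *\<^sub>R F (exp t))"
  shows "(\<integral>x. indicator {0<..} x *\<^sub>R F x \<partial>lborel) = (\<integral>t. exp t *\<^sub>R F (exp t) \<partial>lborel)"
proof -
  have e1: "einterval (-\<infinity>) \<infinity> = UNIV" "einterval 0 \<infinity> = {0<..}" by (auto simp: einterval_def)
  have "(LBINT x=0..\<infinity>. F x) = (LBINT x=-\<infinity>..\<infinity>. exp x *\<^sub>R F (exp x))"
  proof (rule interval_integral_substitution_integrable)
    show "DERIV exp x :> exp x" for x :: real by (rule DERIV_exp)
    show "isCont F (exp x)" for x :: real
      using c by (simp add: continuous_on_eq_continuous_at)
    show "((ereal \<circ> exp \<circ> real_of_ereal) \<longlongrightarrow> 0) (at_right (- \<infinity>))"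
      unfolding ereal_tendsto_simps zero_ereal_def[symmetric] by (simp add: o_def zero_ereal_def exp_at_bot)
    show "((ereal \<circ> exp \<circ> real_of_ereal) \<longlongrightarrow> \<infinity>) (at_left \<infinity>)"
      by (simp only: ereal_tendsto_simps exp_at_top)
    show "set_integrable lborel (einterval (-\<infinity>) \<infinity>) (\<lambda>x. exp x *\<^sub>R F (exp x))"
      using j by (simp add: set_integrable_def e1)
    show "set_integrable lborel (einterval 0 \<infinity>) F"
      using i by (simp add: set_integrable_def e1)
  qed auto
  then show ?thesis by (simp add: interval_lebesgue_integral_def set_lebesgue_integral_def e1)
qed

lemma power_eq_unique_right_half_plane:
  fixes z w :: complex
  assumes "z\<^sup>2 = w\<^sup>2" "Re z > 0" "Re w > 0"
  shows "z = w"
  using assms by (auto simp: power2_eq_iff)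

text \<open>The expression is the square root of \<open>4 p q\<close> in the right half-plane:
  \<open>\<bar>arg p\<bar> \<le> \<pi> / 2\<close> and \<open>\<bar>arg q\<bar> < \<pi> / 2\<close>
  keep half their sum strictly inside. Fourier transforms need \<open>p\<close> on the imaginary
  axis.\<close>

lemma half_Ln_sum:
  assumes p: "Re p \<ge> 0" "p \<noteq> 0" and q: "Re q > 0"
  shows "(2 * exp ((Ln p + Ln q) / 2))\<^sup>2 = 4 * p * q" "Re (2 * exp ((Ln p + Ln q) / 2)) > 0"
proof -
  have q0: "q \<noteq> 0" using q by auto
  have "(exp ((Ln p + Ln q) / 2))\<^sup>2 = exp (Ln p + Ln q)" by (simp flip: exp_double)
  also have "\<dots> = p * q" using p q0 by (simp add: exp_add)
  finally show "(2 * exp ((Ln p + Ln q) / 2))\<^sup>2 = 4 * p * q" by (simp add: power_mult_distrib)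
  have "\<bar>Im (Ln p)\<bar> \<le> pi / 2" using Re_Ln_pos_le[OF p(2)] p(1) by simp
  moreover have "\<bar>Im (Ln q)\<bar> < pi / 2" using Re_Ln_pos_lt[OF q0] q by simp
  ultimately have "\<bar>Im ((Ln p + Ln q) / 2)\<bar> < pi / 2" by simp
  then have "cos (Im ((Ln p + Ln q) / 2)) > 0" by (intro cos_gt_zero_pi) linarith+
  then show "Re (2 * exp ((Ln p + Ln q) / 2)) > 0" by (simp add: Re_exp)
qed

locale phi_poisson =
  fixes \<rho> d :: real and \<eta> :: complex
  assumes rho: "\<rho> > 0" and d: "d > 0" and eta: "\<eta> \<in> RHP"
begin

definition D :: "nat \<Rightarrow> complex \<Rightarrow> complex" where "D b = (deriv ^^ b) (phi \<rho> d)"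

text \<open>Extension by zero to the left of the origin; it is smooth because the derivatives of
  \<open>phi\<close> decay there faster than any power of \<open>x\<close>.\<close>

definition f :: "nat \<Rightarrow> real \<Rightarrow> complex" where "f b x = (if x > 0 then D b (of_real x * \<eta>) else 0)"

text \<open>With this constant, \<open>phi\<close> at \<open>x \<eta>\<close> is
  \<open>(\<rho> / \<eta>) exp (- q / x) / x\<close>, so the exponent of the Laplace integral is
  \<open>- p x - q / x\<close>.\<close>

definition q :: complex where "q = of_real (\<rho>\<^sup>2 * d) / \<eta>"

lemma eta0: "\<eta> \<noteq> 0" "Re \<eta> > 0"
  using eta RHP_nonzero by (auto simp: RHP_def)

lemma q_pos: "Re q > 0"
proof -
  have "Re q = \<rho>\<^sup>2 * d * Re \<eta> / (cmod \<eta>)\<^sup>2" by (simp add: q_def Re_divide cmod_power2)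
  then show ?thesis using rho d eta0 by simp
qed

lemma D_deriv: "z \<in> RHP \<Longrightarrow> (D b has_field_derivative D (Suc b) z) (at z)"
  unfolding D_def using holomorphic_derivI[OF holomorphic_higher_deriv[OF phi_holomorphic RHP(1)] RHP(1)] by simp

lemma x_eta: "x > 0 \<Longrightarrow> of_real x * \<eta> \<in> RHP"
  using eta0 by (simp add: RHP_def)

lemma f_bound:
  obtains K c where "K \<ge> 0" "c > 0" "\<And>x. x > 0 \<Longrightarrow> norm (f b x) \<le> K * ((1 / x) ^ Suc b * exp (- c * (1 / x)))"
proof -
  define K where "K = fact b * (2 * \<rho> / Re \<eta>) * (2 / Re \<eta>) ^ b"
  define c where "c = \<rho>\<^sup>2 * Re \<eta> / (8 * (cmod \<eta>)\<^sup>2) * d"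
  show ?thesis
  proof (rule that[of K c])
    show "K \<ge> 0" "c > 0" using rho d eta0 by (auto simp: K_def c_def)
    show "norm (f b x) \<le> K * ((1 / x) ^ Suc b * exp (- c * (1 / x)))" if "x > 0" for x
      using phi_deriv_bound[OF rho _ eta that, of d b] d that by (simp add: f_def D_def K_def c_def)
  qed
qed

lemma f_bound_power:
  obtains C where "C \<ge> 0" "\<And>x. x > 0 \<Longrightarrow> norm (f b x) \<le> C * x ^ N"
proof -
  obtain K c where K: "K \<ge> 0" "c > 0" "\<And>x. x > 0 \<Longrightarrow> norm (f b x) \<le> K * ((1 / x) ^ Suc b * exp (- c * (1 / x)))"
    by (rule f_bound[OF that])
  show ?thesis
  proof (rule that[of "K * (fact (Suc b + N) / c ^ (Suc b + N))"])
    show "K * (fact (Suc b + N) / c ^ (Suc b + N)) \<ge> 0" using K by simp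
    fix x :: real assume x: "x > 0"
    have "(1 / x) ^ (Suc b + N) * exp (- c * (1 / x)) \<le> fact (Suc b + N) / c ^ (Suc b + N)"
      by (rule power_mult_exp_minus_le) (use K x in auto)
    then have "(1 / x) ^ (Suc b + N) * exp (- c * (1 / x)) * x ^ N \<le> fact (Suc b + N) / c ^ (Suc b + N) * x ^ N"
      using x by (intro mult_right_mono) auto
    moreover have "(1 / x) ^ (Suc b + N) * exp (- c * (1 / x)) * x ^ N = (1 / x) ^ Suc b * exp (- c * (1 / x))"
      using x by (simp add: power_add power_one_over field_simps)
    ultimately have "(1 / x) ^ Suc b * exp (- c * (1 / x)) \<le> fact (Suc b + N) / c ^ (Suc b + N) * x ^ N" by (simp only:)
    from mult_left_mono[OF this K(1)] K(3)[OF x]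
    show "norm (f b x) \<le> K * (fact (Suc b + N) / c ^ (Suc b + N)) * x ^ N" by (simp add: mult.assoc)
  qed
qed

lemma f_bounded:
  obtains C where "C \<ge> 0" "\<And>x. norm (f b x) \<le> C"
proof -
  obtain C where "C \<ge> 0" "\<And>x. x > 0 \<Longrightarrow> norm (f b x) \<le> C * x ^ 0" using f_bound_power[of b 0] by blast
  then show ?thesis by (intro that[of C]) (auto simp: f_def)
qed

text \<open>At infinity \<open>f b\<close> is of order \<open>x ^ - (b + 1)\<close>, which needs
  \<open>b \<ge> 1\<close>. The two terms of \<open>A\<close> bound the products with 1 and with
  \<open>x^2\<close>.\<close>

lemma f_cauchy:
  assumes b: "b \<ge> 1"
  obtains C where "\<And>x. norm (f b x) \<le> C / (1 + x\<^sup>2)"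
proof -
  obtain K c where K: "K \<ge> 0" "c > 0" "\<And>x. x > 0 \<Longrightarrow> norm (f b x) \<le> K * ((1 / x) ^ Suc b * exp (- c * (1 / x)))"
    by (rule f_bound[OF that])
  define A where "A = fact (Suc b) / c ^ Suc b + fact (b - 1) / c ^ (b - 1)"
  have A0: "A \<ge> 0" using K by (simp add: A_def)
  have pos: "1 + x\<^sup>2 > 0" for x :: real using zero_le_power2[of x] by linarith
  show ?thesis
  proof (rule that[of "K * A"])
    fix x :: real
    show "norm (f b x) \<le> K * A / (1 + x\<^sup>2)"
    proof (cases "x > 0")
      case x: True
      have "(1 / x) ^ Suc b * x\<^sup>2 = (1 / x) ^ (b - 1)"
      proof -
        have "Suc b = (b - 1) + 2" using b by simp
        then show ?thesis using x by (simp only: power_add) (simp add: power2_eq_square)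
      qed
      moreover have "(P * E) * (1 + Q) = P * E + (P * Q) * E" for P E Q :: real by (simp add: algebra_simps)
      ultimately have "((1 / x) ^ Suc b * exp (- c * (1 / x))) * (1 + x\<^sup>2) = (1 / x) ^ Suc b * exp (- c * (1 / x)) + (1 / x) ^ (b - 1) * exp (- c * (1 / x))"
        by (simp only:)
      also have "\<dots> \<le> A" unfolding A_def by (intro add_mono power_mult_exp_minus_le) (use K x in auto)
      finally have "(1 / x) ^ Suc b * exp (- c * (1 / x)) \<le> A / (1 + x\<^sup>2)" using pos[of x] by (simp only: pos_le_divide_eq)
      from mult_left_mono[OF this K(1)] K(3)[OF x] show ?thesis by simp
    next
      case False
      then show ?thesis using K A0 pos[of x] by (simp add: f_def)
    qed
  qed
qed

text \<open>Only the origin needs an argument: the estimate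
  \<open>norm (f b h) \<le> C * h^2\<close> for \<open>h > 0\<close> makes the derivative there 0
  from the right.\<close>

lemma f_deriv: "(f b has_vector_derivative \<eta> * f (Suc b) x) (at x)"
proof -
  consider "x > 0" | "x < 0" | "x = 0" by linarith
  then show ?thesis
  proof cases
    case 1
    have "((\<lambda>z. D b (z * \<eta>)) has_field_derivative (D (Suc b) (of_real x * \<eta>) * \<eta>)) (at (of_real x))"
      by (rule DERIV_chain2[where f = "D b" and g = "\<lambda>z. z * \<eta>", OF D_deriv[OF x_eta[OF 1]]]) (auto intro!: derivative_eq_intros)
    from has_vector_derivative_real_field[OF this]
    have "((\<lambda>x. D b (of_real x * \<eta>)) has_vector_derivative \<eta> * f (Suc b) x) (at x)"
      using 1 by (simp add: f_def mult.commute)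
    then show ?thesis
      by (rule has_vector_derivative_transform_within_open[where S = "{0<..}"]) (use 1 in \<open>auto simp: f_def\<close>)
  next
    case 2
    have "((\<lambda>x. 0) has_vector_derivative \<eta> * f (Suc b) x) (at x)" using 2 by (simp add: f_def)
    then show ?thesis
      by (rule has_vector_derivative_transform_within_open[where S = "{..<0}"]) (use 2 in \<open>auto simp: f_def\<close>)
  next
    case 3
    obtain C where C: "C \<ge> 0" "\<And>x. x > 0 \<Longrightarrow> norm (f b x) \<le> C * x ^ 2" using f_bound_power[of b 2] by blast
    have "((\<lambda>h. norm (f b h) / norm h) \<longlongrightarrow> 0) (at 0)"
    proof (rule Lim_null_comparison)
      show "((\<lambda>h. C * \<bar>h\<bar>) \<longlongrightarrow> 0) (at (0::real))" by (auto intro!: tendsto_eq_intros)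
      show "\<forall>\<^sub>F h in at 0. norm (norm (f b h) / norm h) \<le> C * \<bar>h\<bar>"
      proof (intro always_eventually allI)
        fix h :: real
        show "norm (norm (f b h) / norm h) \<le> C * \<bar>h\<bar>"
        proof (cases "h > 0")
          case True
          then show ?thesis using C(2)[OF True] by (simp add: field_simps power2_eq_square)
        next
          case False
          have "0 \<le> C * \<bar>h\<bar>" using C(1) by simp
          moreover have "f b h = 0" using False by (simp add: f_def)
          ultimately show ?thesis by (simp only: norm_zero div_0)
        qed
      qed
    qed
    moreover have "f b 0 = 0" by (simp add: f_def)
    ultimately have "(f b has_derivative (\<lambda>h. 0)) (at 0)"
      unfolding has_derivative_at by simp
    then show ?thesis by (simp add: 3 f_def has_vector_derivative_def)
  qed
qed

lemma f_cont: "continuous_on A (f b)"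
  using f_deriv by (meson continuous_at_imp_continuous_on has_vector_derivative_continuous)

lemma f_measurable: "f b \<in> borel_measurable borel"
  by (rule borel_measurable_continuous_onI[OF f_cont])

lemma f_integrable: "b \<ge> 1 \<Longrightarrow> integrable lborel (f b)"
  by (rule f_cauchy) (auto intro: integrable_bounded_by_cauchy f_measurable)

lemma f_tendsto: "b \<ge> 1 \<Longrightarrow> (f b \<longlongrightarrow> 0) at_top" "b \<ge> 1 \<Longrightarrow> (f b \<longlongrightarrow> 0) at_bot"
  by (rule f_cauchy, assumption, rule tendsto_0_bounded_by_cauchy, blast)+

section \<open>Laplace and Fourier transforms of the terms\<close>

lemma laplace_cauchy:
  assumes p: "Re p > 0"
  obtains C where "\<And>x. norm (f b x * exp (- p * of_real x)) \<le> C / (1 + x\<^sup>2)"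
proof -
  obtain C where C: "C \<ge> 0" "\<And>x. norm (f b x) \<le> C" using f_bounded by blast
  define m where "m = 1 / min 1 ((Re p)\<^sup>2 / 2)"
  have pos: "1 + x\<^sup>2 > 0" for x :: real using zero_le_power2[of x] by linarith
  have m0: "m \<ge> 0" by (simp add: m_def)
  show ?thesis
  proof (rule that[of "C * m"])
    fix x :: real
    show "norm (f b x * exp (- p * of_real x)) \<le> C * m / (1 + x\<^sup>2)"
    proof (cases "x > 0")
      case True
      have "norm (f b x * exp (- p * of_real x)) = norm (f b x) * exp (- Re p * x)" by (simp add: norm_mult)
      also have "\<dots> \<le> C * (m / (1 + x\<^sup>2))"
        unfolding m_def by (intro mult_mono C exp_minus_le_cauchy p) (use True in auto)
      finally show ?thesis by simp
    next
      case False
      then show ?thesis using C m0 pos[of x] by (simp add: f_def)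
    qed
  qed
qed

lemma laplace_integrable:
  assumes p: "Re p > 0"
  shows "integrable lborel (\<lambda>x. f b x * exp (- p * of_real x))"
proof -
  obtain C where "\<And>x. norm (f b x * exp (- p * of_real x)) \<le> C / (1 + x\<^sup>2)" using laplace_cauchy[OF p] by blast
  then show ?thesis
    by (intro integrable_bounded_by_cauchy borel_measurable_continuous_onI continuous_intros f_cont)
qed

definition I :: "nat \<Rightarrow> complex \<Rightarrow> complex" where
  "I b p = (\<integral>x. f b x * exp (- p * of_real x) \<partial>lborel)"

text \<open>Integration by parts on the whole line; there is no boundary term at 0 because
  \<open>f b\<close> extends smoothly by zero.\<close>

lemma laplace_step:
  assumes p: "Re p > 0"
  shows "I (Suc b) p = (p / \<eta>) * I b p"
proof -
  define g where "g = (\<lambda>x::real. f b x * exp (- p * of_real x))"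
  define g' where "g' = (\<lambda>x::real. \<eta> * (f (Suc b) x * exp (- p * of_real x)) - p * (f b x * exp (- p * of_real x)))"
  have dg: "(g has_vector_derivative g' x) (at x)" for x
  proof -
    have "((\<lambda>z. exp (- p * z)) has_field_derivative (- p * exp (- p * of_real x))) (at (of_real x))"
      by (auto intro!: derivative_eq_intros)
    from has_vector_derivative_mult[OF f_deriv has_vector_derivative_real_field[OF this], of b]
    show ?thesis unfolding g_def by (rule has_vector_derivative_eq_rhs) (simp add: g'_def algebra_simps)
  qed
  have "(\<integral>x. g' x \<partial>lborel) = 0"
  proof (rule integral_derivative_eq_0[OF dg])
    show "continuous_on UNIV g'" unfolding g'_def by (intro continuous_intros f_cont)
    show "integrable lborel g'" unfolding g'_def
      by (intro Bochner_Integration.integrable_diff integrable_mult_right laplace_integrable p)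
    obtain C where "\<And>x. norm (g x) \<le> C / (1 + x\<^sup>2)" unfolding g_def using laplace_cauchy[OF p] by blast
    then show "(g \<longlongrightarrow> 0) at_top" "(g \<longlongrightarrow> 0) at_bot" by (rule tendsto_0_bounded_by_cauchy)+
  qed
  also have "(\<integral>x. g' x \<partial>lborel) = \<eta> * I (Suc b) p - p * I b p"
    unfolding g'_def I_def
    by (subst Bochner_Integration.integral_diff) (intro integrable_mult_right laplace_integrable p, intro integrable_mult_right laplace_integrable p, simp)
  finally show ?thesis using eta0 by (simp add: field_simps)
qed

text \<open>The substitution \<open>x = exp t\<close> turns \<open>- p x - q / x\<close> into the
  exponent of \<open>K0_two_parameter\<close> with \<open>a = Ln p\<close> and
  \<open>b = Ln q\<close>; the Jacobian cancels the factor \<open>1 / x\<close> of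
  \<open>phi\<close>.\<close>

lemma laplace_0:
  assumes p: "Re p > 0"
  shows "I 0 p = (of_real \<rho> / \<eta>) * (2 * bessel_K0 (2 * exp ((Ln p + Ln q) / 2)))"
proof -
  have p0: "p \<noteq> 0" "q \<noteq> 0" using p q_pos by auto
  have a: "\<bar>Im (Ln p)\<bar> < pi / 2" "\<bar>Im (Ln q)\<bar> < pi / 2"
    using Re_Ln_pos_lt[OF p0(1)] Re_Ln_pos_lt[OF p0(2)] p q_pos by auto
  note K = K0_two_parameter[OF a]
  define F where "F = (\<lambda>x::real. phi \<rho> d (of_real x * \<eta>) * exp (- p * of_real x))"
  have Ff: "f 0 x * exp (- p * of_real x) = indicator {0<..} x *\<^sub>R F x" for x
    by (simp add: f_def D_def F_def)
  have FE: "exp t *\<^sub>R F (exp t) = (of_real \<rho> / \<eta>) * exp (- exp (Ln q - of_real t) - exp (Ln p + of_real t))" for t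
  proof -
    have 1: "exp (Ln q - of_real t) = of_real (\<rho>\<^sup>2 * d) / (of_real (exp t) * \<eta>)"
      using p0 by (simp add: exp_diff exp_of_real q_def field_simps)
    have 2: "exp (Ln p + of_real t) = p * of_real (exp t)" using p0 by (simp add: exp_add exp_of_real)
    have 3: "exp (- A - B) = exp (- A) * exp (- B)" for A B :: complex
      by (simp flip: exp_add)
    show ?thesis unfolding 1 2 3 using eta0 by (simp add: F_def phi_def scaleR_conv_of_real)
  qed
  have "I 0 p = (\<integral>x. indicator {0<..} x *\<^sub>R F x \<partial>lborel)" unfolding I_def Ff ..
  also have "\<dots> = (\<integral>t. exp t *\<^sub>R F (exp t) \<partial>lborel)"
  proof (rule lborel_integral_exp_substitution)
    show "continuous_on {0<..} F" unfolding F_def phi_def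
      by (intro continuous_intros) (use eta0 in auto)
    show "integrable lborel (\<lambda>x. indicator {0<..} x *\<^sub>R F x)"
      using laplace_integrable[OF p, of 0] unfolding Ff .
    show "integrable lborel (\<lambda>t. exp t *\<^sub>R F (exp t))"
      unfolding FE by (intro integrable_mult_right K(1))
  qed
  also have "\<dots> = (of_real \<rho> / \<eta>) * (2 * bessel_K0 (2 * exp ((Ln p + Ln q) / 2)))"
    unfolding FE integral_mult_right_zero K(2) ..
  finally show ?thesis .
qed

lemma laplace:
  assumes p: "Re p > 0"
  shows "I b p = (p / \<eta>) ^ b * ((of_real \<rho> / \<eta>) * (2 * bessel_K0 (2 * exp ((Ln p + Ln q) / 2))))"
  by (induct b) (simp_all add: laplace_0[OF p] laplace_step[OF p])

text \<open>The Laplace transform is known for \<open>Re p > 0\<close> only, since \<^term>\<open>f 0\<close> is not integrable; for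
  \<open>b \<ge> 1\<close> one can let \<open>p\<close> tend to the imaginary axis.\<close>

lemma fourier_f:
  assumes b: "b \<ge> 1" and w: "\<omega> \<noteq> 0"
  defines "p \<equiv> 2 * pi * \<omega> * \<i>"
  shows "fourier (f b) \<omega> = (p / \<eta>) ^ b * ((of_real \<rho> / \<eta>) * (2 * bessel_K0 (2 * exp ((Ln p + Ln q) / 2))))"
proof -
  define P where "P = (\<lambda>n. p + of_real (1 / real (Suc n)))"
  have p0: "p \<noteq> 0" "Re p = 0" using w by (auto simp: p_def)
  have P: "Re (P n) > 0" for n by (simp add: P_def p0 del: of_nat_Suc)
  have Plim: "P \<longlonglongrightarrow> p"
  proof -
    have "(\<lambda>n. 1 / real (Suc n)) \<longlonglongrightarrow> 0" by real_asymp
    from tendsto_add[OF tendsto_const[of p] tendsto_of_real[OF this]] show ?thesis unfolding P_def by simp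
  qed
  have pn: "p \<notin> \<real>\<^sub>\<le>\<^sub>0" using w by (auto simp: p_def complex_nonpos_Reals_iff)
  have "(\<lambda>n. I b (P n)) \<longlonglongrightarrow> (\<integral>x. f b x * exp (- p * of_real x) \<partial>lborel)"
    unfolding I_def
  proof (rule integral_dominated_convergence[where w = "\<lambda>x. norm (f b x)"])
    show "integrable lborel (\<lambda>x. norm (f b x))" by (rule integrable_norm[OF f_integrable[OF b]])
    show "AE x in lborel. (\<lambda>n. f b x * exp (- P n * of_real x)) \<longlonglongrightarrow> f b x * exp (- p * of_real x)"
      by (intro AE_I2 tendsto_intros Plim)
    show "AE x in lborel. norm (f b x * exp (- P n * of_real x)) \<le> norm (f b x)" for n
    proof (rule AE_I2)
      fix x :: real
      show "norm (f b x * exp (- P n * of_real x)) \<le> norm (f b x)"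
      proof (cases "x > 0")
        case True
        then have "exp (- Re (P n) * x) \<le> 1" using P[of n] by simp
        then show ?thesis by (simp add: norm_mult mult_left_le)
      qed (simp add: f_def)
    qed
    have m: "(\<lambda>x. f b x * exp (- z * of_real x)) \<in> borel_measurable borel" for z
      by (intro borel_measurable_continuous_onI continuous_intros f_cont)
    show "(\<lambda>x. f b x * exp (- p * of_real x)) \<in> borel_measurable lborel"
      "(\<lambda>x. f b x * exp (- P n * of_real x)) \<in> borel_measurable lborel" for n
      using m[of p] m[of "P n"] by simp_all
  qed
  moreover have "(\<lambda>n. I b (P n)) \<longlonglongrightarrow> (p / \<eta>) ^ b * ((of_real \<rho> / \<eta>) * (2 * bessel_K0 (2 * exp ((Ln p + Ln q) / 2))))"
    unfolding laplace[OF P]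
  proof (intro tendsto_intros Plim eta0(1) bessel_K0_tendsto pn)
    show "Re (2 * exp ((Ln p + Ln q) / 2)) > 0" using half_Ln_sum(2)[OF _ p0(1) q_pos] p0 by simp
  qed auto
  ultimately have "(\<integral>x. f b x * exp (- p * of_real x) \<partial>lborel) = (p / \<eta>) ^ b * ((of_real \<rho> / \<eta>) * (2 * bessel_K0 (2 * exp ((Ln p + Ln q) / 2))))"
    by (rule LIMSEQ_unique)
  moreover have "cis (- 2 * pi * \<omega> * x) = exp (- p * of_real x)" for x
    by (simp add: cis_conv_exp p_def mult_ac)
  ultimately show ?thesis by (simp add: fourier_def)
qed

text \<open>Up to the factor \<open>\<eta>\<close>, \<open>f b\<close> is the derivative of
  \<open>f (b - 1)\<close>, which tends to 0 at both ends.\<close>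

lemma fourier_f_0:
  assumes b: "b \<ge> 2"
  shows "fourier (f b) 0 = 0"
proof -
  obtain b' where b': "b = Suc b'" "b' \<ge> 1" using b by (cases b) auto
  have "(\<integral>x. \<eta> * f (Suc b') x \<partial>lborel) = 0"
    by (rule integral_derivative_eq_0[OF f_deriv])
      (use b' in \<open>auto intro!: continuous_intros f_cont integrable_mult_right f_integrable f_tendsto\<close>)
  then show ?thesis using eta0 by (simp add: fourier_def b')
qed

text \<open>Integers \<open>k \<le> 0\<close> contribute nothing because \<open>f b\<close> vanishes
  there, and frequency 0 drops out by \<open>fourier_f_0\<close>. The frequencies \<open>j\<close>
  and \<open>- j\<close> stay separate, since they belong to different Bessel arguments.\<close>

theorem poisson_f:
  assumes b: "b \<ge> 2"
  shows "(\<lambda>j. fourier (f b) (real (Suc j)) + fourier (f b) (- real (Suc j))) sums suminf (\<lambda>k. D b (of_nat (Suc k) * \<eta>))"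
proof -
  obtain C where C: "\<And>x. norm (f b x) \<le> C / (1 + x\<^sup>2)" using f_cauchy[of b] b by auto
  have abs: "Infinite_Sum.abs_summable_on (\<lambda>k::int. f b (of_int k)) UNIV"
    by (rule abs_summable_on_int_bound) (rule C)
  have s: "(\<lambda>k::int. f b (of_int k)) summable_on UNIV" by (rule abs_summable_summable[OF abs])
  have fd: "f b (real (Suc k)) = D b (of_nat (Suc k) * \<eta>)" for k by (simp add: f_def)
  have "(\<lambda>k. if k = 0 then f b 0 else f b (of_int (int k)) + f b (of_int (- int k))) sums infsum (\<lambda>k::int. f b (of_int k)) UNIV"
    using infsum_int_sums[OF s] by (simp cong: if_cong)
  then have "(\<lambda>k. f b (real (Suc k))) sums infsum (\<lambda>k::int. f b (of_int k)) UNIV"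
  proof -
    define G where "G = (\<lambda>k::nat. if k = 0 then f b 0 else f b (of_int (int k)) + f b (of_int (- int k)))"
    assume "(\<lambda>k. if k = 0 then f b 0 else f b (of_int (int k)) + f b (of_int (- int k))) sums infsum (\<lambda>k::int. f b (of_int k)) UNIV"
    then have "G sums infsum (\<lambda>k::int. f b (of_int k)) UNIV" by (simp only: G_def)
    then have "(\<lambda>k. G (Suc k)) sums infsum (\<lambda>k::int. f b (of_int k)) UNIV"
      by (subst sums_Suc_iff) (simp add: G_def f_def)
    moreover have "G (Suc k) = f b (real (Suc k))" for k by (simp add: G_def f_def)
    ultimately show ?thesis by (simp only:)
  qed
  then have S: "suminf (\<lambda>k. D b (of_nat (Suc k) * \<eta>)) = infsum (\<lambda>k::int. f b (of_int k)) UNIV"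
    unfolding fd by (simp add: sums_iff)
  have d1: "(f b has_vector_derivative \<eta> * f (Suc b) x) (at x)" for x by (rule f_deriv)
  have d2: "((\<lambda>x. \<eta> * f (Suc b) x) has_vector_derivative \<eta> * (\<eta> * f (Suc (Suc b)) x)) (at x)" for x
    by (rule has_vector_derivative_mult_right[OF f_deriv])
  have "(\<lambda>k. if k = 0 then fourier (f b) 0 else fourier (f b) (real k) + fourier (f b) (- real k)) sums infsum (\<lambda>k::int. f b (of_int k)) UNIV"
  proof (rule poisson_summation[OF d1 d2 _ _ _ _ _ _ _ _ infsum_int_symmetric_limit[OF s]])
    show "continuous_on UNIV (\<lambda>x. \<eta> * (\<eta> * f (Suc (Suc b)) x))" by (intro continuous_intros f_cont)
    show "integrable lborel (f b)" "integrable lborel (\<lambda>x. \<eta> * f (Suc b) x)" "integrable lborel (\<lambda>x. \<eta> * (\<eta> * f (Suc (Suc b)) x))"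
      using b by (auto intro!: integrable_mult_right f_integrable)
    show "(f b \<longlongrightarrow> 0) at_top" "(f b \<longlongrightarrow> 0) at_bot" using f_tendsto[of b] b by auto
    show "((\<lambda>x. \<eta> * f (Suc b) x) \<longlongrightarrow> 0) at_top" "((\<lambda>x. \<eta> * f (Suc b) x) \<longlongrightarrow> 0) at_bot"
      using f_tendsto[of "Suc b"] by (auto intro!: tendsto_mult_right_zero)
  qed
  then have F: "(\<lambda>k. if k = 0 then 0 else fourier (f b) (real k) + fourier (f b) (- real k)) sums suminf (\<lambda>k. D b (of_nat (Suc k) * \<eta>))"
    unfolding S fourier_f_0[OF b] .
  define G where "G = (\<lambda>k. if k = 0 then 0 else fourier (f b) (real k) + fourier (f b) (- real k))"
  have "(\<lambda>k. G (Suc k)) sums suminf (\<lambda>k. D b (of_nat (Suc k) * \<eta>))"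
    using F unfolding G_def[symmetric] by (subst sums_Suc_iff) (simp add: G_def)
  then show "(\<lambda>j. fourier (f b) (real (Suc j)) + fourier (f b) (- real (Suc j))) sums suminf (\<lambda>k. D b (of_nat (Suc k) * \<eta>))"
    by (simp add: G_def)
qed

end

section \<open>The transformation formula for divisor sums\<close>

abbreviation PN :: "nat set" where "PN \<equiv> {1..}"

lemma summable_on_PN_iff:
  fixes g :: "nat \<Rightarrow> real"
  assumes "\<And>n. g n \<ge> 0"
  shows "g summable_on PN \<longleftrightarrow> summable (\<lambda>n. g (Suc n))"
proof -
  have b: "bij_betw Suc UNIV PN" by (rule bij_betwI[of _ _ _ "\<lambda>n. n - 1"]) auto
  have "g summable_on PN \<longleftrightarrow> (\<lambda>n. g (Suc n)) summable_on UNIV"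
    using summable_on_reindex_bij_betw[OF b, of g] by simp
  also have "\<dots> \<longleftrightarrow> summable (\<lambda>n. g (Suc n))"
    by (rule summable_on_UNIV_nonneg_real_iff) (rule assms)
  finally show ?thesis .
qed

lemma has_sum_PN_sums:
  fixes g :: "nat \<Rightarrow> complex"
  assumes "(g has_sum S) PN"
  shows "(\<lambda>n. g (Suc n)) sums S"
proof -
  have b: "bij_betw Suc UNIV PN" by (rule bij_betwI[of _ _ _ "\<lambda>n. n - 1"]) auto
  have "((\<lambda>n. g (Suc n)) has_sum S) UNIV" using has_sum_reindex_bij_betw[OF b, of g S] assms by simp
  then show ?thesis by (rule has_sum_imp_sums)
qed

lemma infsum_PN_eq_suminf:
  fixes g :: "nat \<Rightarrow> complex"
  assumes "g summable_on PN"
  shows "infsum g PN = suminf (\<lambda>n. g (Suc n))"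
  using has_sum_PN_sums[OF has_sum_infsum[OF assms]] by (simp add: sums_iff)

text \<open>Every pair \<open>(d, k)\<close> of positive integers arises exactly once as
  \<open>(d, n div d)\<close>, namely for \<open>n = d * k\<close>.\<close>

lemma divisor_has_sum:
  fixes G :: "nat \<Rightarrow> nat \<Rightarrow> complex"
  assumes "((\<lambda>(d, k). G d k) has_sum S) (PN \<times> PN)"
  shows "((\<lambda>n. \<Sum>d | d dvd n. G d (n div d)) has_sum S) PN"
proof -
  have bij: "bij_betw (\<lambda>(n, d). (d, n div d)) (Sigma PN (\<lambda>n. {d. d dvd n})) (PN \<times> PN)"
  proof (rule bij_betwI[of _ _ _ "\<lambda>(d, k). (d * k, d)"])
    show "(\<lambda>(n, d). (d, n div d)) \<in> Sigma PN (\<lambda>n. {d. d dvd n}) \<rightarrow> PN \<times> PN"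
      by (auto simp: Suc_le_eq elim!: dvdE)
    show "(\<lambda>(d, k). (d * k, d)) \<in> PN \<times> PN \<rightarrow> Sigma PN (\<lambda>n. {d. d dvd n})"
      by (auto simp: Suc_le_eq)
  qed (auto simp: Suc_le_eq)
  have "((\<lambda>p. (\<lambda>(d, k). G d k) ((\<lambda>(n, d). (d, n div d)) p)) has_sum S) (Sigma PN (\<lambda>n. {d. d dvd n}))"
    using has_sum_reindex_bij_betw[OF bij, of "\<lambda>(d, k). G d k" S] assms by simp
  then have "((\<lambda>(n, d). G d (n div d)) has_sum S) (Sigma PN (\<lambda>n. {d. d dvd n}))"
    by (simp add: case_prod_unfold)
  then show ?thesis
    by (rule has_sum_SigmaD) (auto intro!: has_sum_finite)
qed

lemma power_mult_exp_minus_sqrt_summable: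
  fixes c :: real
  assumes c: "c > 0"
  shows "(\<lambda>n. real n ^ N * exp (- c * sqrt (real n))) summable_on PN"
proof -
  have "summable (\<lambda>n. real (Suc n) ^ N * exp (- c * sqrt (real (Suc n))))"
  proof (rule summable_comparison_test)
    show "summable (\<lambda>n. (fact (2 * N + 4) / c ^ (2 * N + 4)) * (1 / (real (Suc n))\<^sup>2))"
      using summable_ignore_initial_segment[OF inverse_power_summable[of 2, where 'a = real], of 1]
      by (intro summable_mult) (simp add: inverse_eq_divide)
    show "\<exists>M. \<forall>n\<ge>M. norm (real (Suc n) ^ N * exp (- c * sqrt (real (Suc n)))) \<le> (fact (2 * N + 4) / c ^ (2 * N + 4)) * (1 / (real (Suc n))\<^sup>2)"
    proof (intro exI allI impI)
      fix n :: nat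
      define x where "x = real (Suc n)"
      have x: "x > 0" by (simp add: x_def)
      have sq: "sqrt x ^ (2 * N + 4) = x ^ N * x\<^sup>2"
      proof -
        have "2 * N + 4 = 2 * (N + 2)" by simp
        then have "sqrt x ^ (2 * N + 4) = ((sqrt x)\<^sup>2) ^ (N + 2)" by (simp only: power_mult)
        also have "(sqrt x)\<^sup>2 = x" using x by simp
        finally show ?thesis by (simp only: power_add)
      qed
      have "sqrt x ^ (2 * N + 4) * exp (- c * sqrt x) \<le> fact (2 * N + 4) / c ^ (2 * N + 4)"
        by (rule power_mult_exp_minus_le) (use c x in auto)
      then have "x ^ N * exp (- c * sqrt x) * x\<^sup>2 \<le> fact (2 * N + 4) / c ^ (2 * N + 4)" unfolding sq by (simp add: mult_ac)
      then have "x ^ N * exp (- c * sqrt x) \<le> (fact (2 * N + 4) / c ^ (2 * N + 4)) / x\<^sup>2" using x by (subst pos_le_divide_eq) auto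
      then show "norm (real (Suc n) ^ N * exp (- c * sqrt (real (Suc n)))) \<le> (fact (2 * N + 4) / c ^ (2 * N + 4)) * (1 / (real (Suc n))\<^sup>2)"
        unfolding x_def[symmetric] using x by (simp add: abs_mult)
    qed
  qed
  then show ?thesis by (subst summable_on_PN_iff) auto
qed

text \<open>Separates the variables in \<open>exp (- c sqrt (d k))\<close>, which is thereby bounded
  by a product of a function of \<open>d\<close> and one of \<open>k\<close>.\<close>

lemma half_sum_sqrt_le:
  fixes d k :: nat
  assumes "d \<ge> 1" "k \<ge> 1"
  shows "(sqrt (real d) + sqrt (real k)) / 2 \<le> sqrt (real (d * k))"
proof -
  have "real d * 1 \<le> real d * real k" "1 * real k \<le> real d * real k" using assms by (intro mult_left_mono mult_right_mono; simp)+
  then have "sqrt (real d) \<le> sqrt (real (d * k))" "sqrt (real k) \<le> sqrt (real (d * k))" by simp_all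
  moreover have "(s + t) / 2 \<le> u" if "s \<le> u" "t \<le> u" for s t u :: real using that by simp
  ultimately show ?thesis by blast
qed

section \<open>Absolute convergence of the double series and the transformation formula\<close>

context theta_coeffs begin

text \<open>One majorant for both sides of the formula: \<open>v\<close> grows at most linearly, and
  the exponentials on the left as well as the Bessel functions on the right decay at least like
  \<open>exp (- c sqrt (d k))\<close>.\<close>

lemma weighted_summable:
  fixes G :: "nat \<Rightarrow> nat \<Rightarrow> complex"
  assumes c: "c > 0" and G: "\<And>d k. d \<ge> 1 \<Longrightarrow> k \<ge> 1 \<Longrightarrow> norm (G d k) \<le> C * (real d ^ M * real k ^ N * exp (- c * sqrt (real (d * k))))"
  shows "Infinite_Sum.abs_summable_on (\<lambda>(d, k). of_real (v d) * G d k) (PN \<times> PN)"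
proof -
  obtain V where V: "V \<ge> 0" "\<And>n. v n \<le> V * real n" using v_bound by blast
  have C0: "C \<ge> 0"
  proof -
    have "0 \<le> C * exp (- c * sqrt 1)" using order.trans[OF norm_ge_zero G[of 1 1]] by simp
    then show ?thesis by (simp add: zero_le_mult_iff)
  qed
  define A where "A = (\<lambda>d. complex_of_real (real d ^ Suc M * exp (- (c / 2) * sqrt (real d))))"
  define B where "B = (\<lambda>k. complex_of_real (real k ^ N * exp (- (c / 2) * sqrt (real k))))"
  have "norm (A d) = real d ^ Suc M * exp (- (c / 2) * sqrt (real d))" "norm (B d) = real d ^ N * exp (- (c / 2) * sqrt (real d))" for d
    unfolding A_def B_def norm_of_real by (rule abs_of_nonneg, simp)+
  then have "Infinite_Sum.abs_summable_on A PN" "Infinite_Sum.abs_summable_on B PN"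
    using power_mult_exp_minus_sqrt_summable[of "c / 2" "Suc M"] power_mult_exp_minus_sqrt_summable[of "c / 2" N] c
    by (simp_all only:)
  from summable_on_product_mult[OF this]
  have s: "Infinite_Sum.abs_summable_on (\<lambda>p. complex_of_real (V * C) * (case p of (d, k) \<Rightarrow> A d * B k)) (PN \<times> PN)"
    using summable_on_cmult_right[of "\<lambda>p. norm (case p of (d, k) \<Rightarrow> A d * B k)" "PN \<times> PN" "\<bar>V * C\<bar>"] by (simp only: norm_mult norm_of_real)
  show ?thesis
  proof (rule Infinite_Sum.abs_summable_on_comparison_test[OF s])
    fix p assume "p \<in> PN \<times> PN"
    then obtain d k where p: "p = (d, k)" "d \<ge> 1" "k \<ge> 1" by auto
    have "exp (- c * sqrt (real (d * k))) \<le> exp (- (c / 2) * sqrt (real d) + - (c / 2) * sqrt (real k))"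
      using mult_left_mono[OF half_sum_sqrt_le[OF p(2,3)], of c] c by (simp add: algebra_simps)
    also have "\<dots> = exp (- (c / 2) * sqrt (real d)) * exp (- (c / 2) * sqrt (real k))" by (rule exp_add)
    finally have e: "exp (- c * sqrt (real (d * k))) \<le> exp (- (c / 2) * sqrt (real d)) * exp (- (c / 2) * sqrt (real k))" .
    have "norm (of_real (v d) * G d k) \<le> (V * real d) * (C * (real d ^ M * real k ^ N * exp (- c * sqrt (real (d * k)))))"
      unfolding norm_mult using V G[OF p(2,3)] v_nonneg[of d] by (intro mult_mono) auto
    also have "\<dots> \<le> (V * real d) * (C * (real d ^ M * real k ^ N * (exp (- (c / 2) * sqrt (real d)) * exp (- (c / 2) * sqrt (real k)))))"
      using V C0 by (intro mult_left_mono e) auto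
    also have "\<dots> = norm (complex_of_real (V * C) * (case p of (d, k) \<Rightarrow> A d * B k))"
      using V C0 by (simp add: p A_def B_def norm_mult norm_power abs_mult mult_ac)
    finally show "norm (case p of (d, k) \<Rightarrow> of_real (v d) * G d k) \<le> norm (complex_of_real (V * C) * (case p of (d, k) \<Rightarrow> A d * B k))"
      by (simp add: p)
  qed
qed

context
  fixes \<eta> :: complex and w1 w2 :: complex
  assumes eta: "\<eta> \<in> RHP"
    and w1: "Re w1 > 0" "w1\<^sup>2 = 8 * pi * \<i> * of_real (\<rho>\<^sup>2) / \<eta>"
    and w2: "Re w2 > 0" "w2\<^sup>2 = - (8 * pi * \<i> * of_real (\<rho>\<^sup>2) / \<eta>)"
begin

text \<open>The Bessel terms of a frequency and its negative, with the powers of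
  \<open>\<plusminus> \<i>\<close> that come from differentiation. \<open>w1\<close> and
  \<open>w2\<close> are the square roots in the right half-plane of \<open>4 p q\<close> for
  \<open>p = \<plusminus> 2 \<pi> \<i>\<close> and \<open>q = \<rho>^2 / \<eta>\<close>; for
  frequency \<open>j\<close> and the term \<open>d\<close> they are scaled by
  \<open>sqrt (d j)\<close>.\<close>

definition BB :: "nat \<Rightarrow> nat \<Rightarrow> complex" where
  "BB a n = \<i> ^ a * bessel_K0 (of_real (sqrt (real n)) * w1) + (- \<i>) ^ a * bessel_K0 (of_real (sqrt (real n)) * w2)"

lemma K_bound:
  assumes "Re w > 0"
  obtains C where "C \<ge> 0" "\<And>n. n \<ge> 1 \<Longrightarrow> norm (bessel_K0 (of_real (sqrt (real n)) * w)) \<le> C * exp (- Re w * sqrt (real n))"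
proof -
  obtain C where C: "\<And>z. Re z \<ge> Re w \<Longrightarrow> norm (bessel_K0 z) \<le> C * exp (- Re z)" by (rule bessel_K0_bound[OF assms that])
  have "0 \<le> C * exp (- Re w)" using C[of w] norm_ge_zero[of "bessel_K0 w"] by linarith
  then have C0: "C \<ge> 0" by (simp add: zero_le_mult_iff)
  have "norm (bessel_K0 (of_real (sqrt (real n)) * w)) \<le> C * exp (- Re w * sqrt (real n))" if "n \<ge> 1" for n
  proof -
    have "1 * Re w \<le> sqrt (real n) * Re w" using that assms by (intro mult_right_mono) auto
    then show ?thesis using C[of "of_real (sqrt (real n)) * w"] by (simp add: mult.commute)
  qed
  with C0 show ?thesis by (rule that)
qed

lemma R_summable:
  "Infinite_Sum.abs_summable_on (\<lambda>(d, k). of_real (v d) * (of_nat k ^ a * bessel_K0 (of_real (sqrt (real (d * k))) * w1))) (PN \<times> PN)"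
  "Infinite_Sum.abs_summable_on (\<lambda>(d, k). of_real (v d) * (of_nat k ^ a * bessel_K0 (of_real (sqrt (real (d * k))) * w2))) (PN \<times> PN)"
proof -
  have *: "Infinite_Sum.abs_summable_on (\<lambda>(d, k). of_real (v d) * (of_nat k ^ a * bessel_K0 (of_real (sqrt (real (d * k))) * w))) (PN \<times> PN)"
    if w: "Re w > 0" for w
  proof -
    obtain C where C: "C \<ge> 0" "\<And>n. n \<ge> 1 \<Longrightarrow> norm (bessel_K0 (of_real (sqrt (real n)) * w)) \<le> C * exp (- Re w * sqrt (real n))"
      by (rule K_bound[OF w that])
    show ?thesis
    proof (rule weighted_summable[OF w, of _ C 0 a])
      fix d k :: nat assume dk: "d \<ge> 1" "k \<ge> 1"
      then have "d * k \<ge> 1" by simp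
      from mult_left_mono[OF C(2)[OF this], of "real k ^ a"]
      show "norm (of_nat k ^ a * bessel_K0 (of_real (sqrt (real (d * k))) * w)) \<le> C * (real d ^ 0 * real k ^ a * exp (- Re w * sqrt (real (d * k))))"
        by (simp add: norm_mult norm_power mult_ac)
    qed
  qed
  show "Infinite_Sum.abs_summable_on (\<lambda>(d, k). of_real (v d) * (of_nat k ^ a * bessel_K0 (of_real (sqrt (real (d * k))) * w1))) (PN \<times> PN)"
    "Infinite_Sum.abs_summable_on (\<lambda>(d, k). of_real (v d) * (of_nat k ^ a * bessel_K0 (of_real (sqrt (real (d * k))) * w2))) (PN \<times> PN)"
    using *[OF w1(1)] *[OF w2(1)] by auto
qed

lemma BB_summable:
  "(\<lambda>(d, k). of_real (v d) * (of_nat k ^ a * BB a (d * k))) summable_on (PN \<times> PN)"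
proof -
  have "(\<lambda>p. \<i> ^ a * (case p of (d, k) \<Rightarrow> of_real (v d) * (of_nat k ^ a * bessel_K0 (of_real (sqrt (real (d * k))) * w1)))
     + (- \<i>) ^ a * (case p of (d, k) \<Rightarrow> of_real (v d) * (of_nat k ^ a * bessel_K0 (of_real (sqrt (real (d * k))) * w2)))) summable_on (PN \<times> PN)"
    by (intro summable_on_add summable_on_cmult_right abs_summable_summable[OF R_summable(1)] abs_summable_summable[OF R_summable(2)])
  then show ?thesis by (simp add: BB_def case_prod_unfold distrib_left mult_ac)
qed

lemma L_summable:
  "Infinite_Sum.abs_summable_on (\<lambda>(d, k). of_real (v d) * (of_nat d ^ a * exp (- \<eta> * of_nat (d * k)))) (PN \<times> PN)"
proof -
  have e0: "Re \<eta> > 0" using eta by (simp add: RHP_def)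
  show ?thesis
  proof (rule weighted_summable[OF e0, of _ 1 a 0])
    fix d k :: nat assume dk: "d \<ge> 1" "k \<ge> 1"
    have "1 \<le> d * k" using dk by simp
    then have "1 \<le> real (d * k)" using of_nat_mono[of 1 "d * k", where 'a = real] by simp
    then have "sqrt (real (d * k)) \<le> real (d * k)" by (intro real_le_lsqrt self_le_power) auto
    then have "Re \<eta> * sqrt (real (d * k)) \<le> Re \<eta> * real (d * k)" using e0 by (intro mult_left_mono) auto
    then show "norm (of_nat d ^ a * exp (- \<eta> * of_nat (d * k))) \<le> 1 * (real d ^ a * real k ^ 0 * exp (- Re \<eta> * sqrt (real (d * k))))"
      by (simp add: norm_mult norm_power mult_left_mono)
  qed
qed

text \<open>At frequency \<open>\<plusminus> j\<close> the factor \<open>(p / \<eta>) ^ a\<close>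
  splits into \<open>(2 \<pi> / \<eta>) ^ a\<close>, \<open>j ^ a\<close> and
  \<open>(\<plusminus> \<i>) ^ a\<close>; the last one is part of \<open>BB\<close>.\<close>

lemma poisson_BB:
  assumes a: "a \<ge> 2" and d: "d \<ge> 1"
  shows "suminf (\<lambda>k. (deriv ^^ a) (phi \<rho> (real d)) (of_nat (Suc k) * \<eta>)) =
    2 * (of_real \<rho> / \<eta>) * (2 * pi / \<eta>) ^ a * suminf (\<lambda>j. of_nat (Suc j) ^ a * BB a (d * Suc j))"
proof -
  interpret P: phi_poisson \<rho> "real d" \<eta>     by (rule phi_poisson.intro, rule rho, use d in simp, rule eta)
  have e0: "\<eta> \<noteq> 0" by (rule RHP_nonzero[OF eta])
  \<comment> \<open>The argument given by logarithms is identified with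
    \<open>sqrt (d j) * w\<close> through its square, as both lie in the right half-plane.\<close>
  have K: "bessel_K0 (2 * exp ((Ln p + Ln P.q) / 2)) = bessel_K0 (of_real (sqrt (real (d * j))) * w)"
    if p: "Re p \<ge> 0" "p \<noteq> 0" and w: "Re w > 0" "w\<^sup>2 * of_nat j = 4 * p * of_real (\<rho>\<^sup>2) / \<eta>" and j: "j \<ge> 1" for p w and j :: nat
  proof -
    note h = half_Ln_sum[OF p P.q_pos]
    have dj: "real (d * j) > 0" using d j by (simp add: Suc_le_eq)
    have "(of_real (sqrt (real (d * j))) * w)\<^sup>2 = of_real (real (d * j)) * w\<^sup>2"
      using dj by (simp add: power_mult_distrib flip: of_real_power)
    also have "\<dots> = of_nat d * (w\<^sup>2 * of_nat j)" by simp
    also have "\<dots> = 4 * p * P.q" unfolding w(2) by (simp add: P.q_def)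
    finally have "(2 * exp ((Ln p + Ln P.q) / 2))\<^sup>2 = (of_real (sqrt (real (d * j))) * w)\<^sup>2" using h(1) by simp
    moreover have "Re (of_real (sqrt (real (d * j))) * w) > 0" using dj w(1) by simp
    ultimately have "2 * exp ((Ln p + Ln P.q) / 2) = of_real (sqrt (real (d * j))) * w"
      by (rule power_eq_unique_right_half_plane[OF _ h(2)])
    then show ?thesis by simp
  qed
  have F: "fourier (P.f a) (real (Suc j)) + fourier (P.f a) (- real (Suc j)) =
     2 * (of_real \<rho> / \<eta>) * (2 * pi / \<eta>) ^ a * (of_nat (Suc j) ^ a * BB a (d * Suc j))" for j
  proof -
    define n where "n = real (Suc j)"
    have n: "n > 0" by (simp add: n_def)
    define p1 where "p1 = 2 * pi * n * \<i>"
    define p2 where "p2 = 2 * pi * (- n) * \<i>"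
    have 1: "bessel_K0 (2 * exp ((Ln p1 + Ln P.q) / 2)) = bessel_K0 (of_real (sqrt (real (d * Suc j))) * w1)"
      by (rule K) (use n w1 in \<open>auto simp: p1_def n_def simp del: of_nat_Suc\<close>)
    have 2: "bessel_K0 (2 * exp ((Ln p2 + Ln P.q) / 2)) = bessel_K0 (of_real (sqrt (real (d * Suc j))) * w2)"
      by (rule K) (use n w2 in \<open>auto simp: p2_def n_def simp del: of_nat_Suc\<close>)
    have q1: "(p1 / \<eta>) ^ a = (2 * pi / \<eta>) ^ a * of_nat (Suc j) ^ a * \<i> ^ a"
      "(p2 / \<eta>) ^ a = (2 * pi / \<eta>) ^ a * of_nat (Suc j) ^ a * (- \<i>) ^ a"
      unfolding power_mult_distrib[symmetric] by (simp_all add: p1_def p2_def n_def del: of_nat_Suc)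
    have "fourier (P.f a) n = (p1 / \<eta>) ^ a * ((of_real \<rho> / \<eta>) * (2 * bessel_K0 (2 * exp ((Ln p1 + Ln P.q) / 2))))"
      using P.fourier_f[of a n] a n by (simp only: p1_def)
    moreover have "fourier (P.f a) (- n) = (p2 / \<eta>) ^ a * ((of_real \<rho> / \<eta>) * (2 * bessel_K0 (2 * exp ((Ln p2 + Ln P.q) / 2))))"
      using P.fourier_f[of a "- n"] a n by (simp only: p2_def)
    ultimately show ?thesis
      unfolding n_def[symmetric] 1 2 q1 BB_def by (simp add: distrib_left mult_ac)
  qed
  have c: "2 * (of_real \<rho> / \<eta>) * (2 * pi / \<eta>) ^ a \<noteq> 0" using rho e0 by simp
  have "(\<lambda>j. 2 * (of_real \<rho> / \<eta>) * (2 * pi / \<eta>) ^ a * (of_nat (Suc j) ^ a * BB a (d * Suc j))) sums suminf (\<lambda>k. P.D a (of_nat (Suc k) * \<eta>))"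
    using P.poisson_f[OF a] unfolding F .
  then have 1: "summable (\<lambda>j. 2 * (of_real \<rho> / \<eta>) * (2 * pi / \<eta>) ^ a * (of_nat (Suc j) ^ a * BB a (d * Suc j)))"
    and 2: "suminf (\<lambda>j. 2 * (of_real \<rho> / \<eta>) * (2 * pi / \<eta>) ^ a * (of_nat (Suc j) ^ a * BB a (d * Suc j))) = suminf (\<lambda>k. P.D a (of_nat (Suc k) * \<eta>))"
    unfolding sums_iff by auto
  have "summable (\<lambda>j. of_nat (Suc j) ^ a * BB a (d * Suc j))"
    using summable_mult_D[OF 1 c] .
  from suminf_mult[OF this, of "2 * (of_real \<rho> / \<eta>) * (2 * pi / \<eta>) ^ a"] 2[symmetric] show ?thesis
    unfolding P.D_def by (rule trans[rotated])
qed

text \<open>The left-hand side is summed over \<open>d\<close> first to reach \<open>gc\<close>, the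
  series of \<open>hc\<close> is then summed over \<open>k\<close> first to apply
  \<open>poisson_BB\<close>, and the Bessel series is finally read as a double sum again. The outer
  rearrangements are safe by the decay in \<open>sqrt (d k)\<close>; the middle one rests on
  \<open>sD\<close>.\<close>

theorem koshliakov_identity:
  assumes a: "a \<ge> 2"
  shows "infsum (\<lambda>(d, k). of_real (v d) * (of_nat d ^ a * exp (- \<eta> * of_nat (d * k)))) (PN \<times> PN) =
    of_real (\<kappa> * \<rho> * fact a * suminf (\<lambda>k. 1 / real (Suc k) ^ Suc a)) / \<eta> ^ Suc a +
    (-1) ^ a * (2 * (of_real \<rho> / \<eta>) * (2 * pi / \<eta>) ^ a *
      infsum (\<lambda>(d, k). of_real (v d) * (of_nat k ^ a * BB a (d * k))) (PN \<times> PN))"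
proof -
  define Dv where "Dv = (\<lambda>(d::nat) (k::nat). (deriv ^^ a) (phi \<rho> (real d)) (of_nat k * \<eta>))"
  have e0: "Re \<eta> > 0" using eta by (simp add: RHP_def)
  have keta: "of_nat k * \<eta> \<in> RHP" if "k \<ge> 1" for k using that e0 by (simp add: RHP_def)
  define c where "c = \<rho>\<^sup>2 * Re \<eta> / (8 * (cmod \<eta>)\<^sup>2)"
  have c: "c > 0" using rho e0 RHP_nonzero[OF eta] by (simp add: c_def)
  define K where "K = fact a * (2 * \<rho> / Re \<eta>) * (2 / Re \<eta>) ^ a"
  have K0: "K \<ge> 0" using rho e0 by (simp add: K_def)
  have Db: "norm (of_real (v d) * Dv d k) \<le> K * (1 / real k) ^ Suc a * (v d * exp (- (c / real k) * real d))" if "k \<ge> 1" for d k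
  proof -
    have "norm (Dv d k) \<le> K * ((1 / real k) ^ Suc a * exp (- (c * real d) * (1 / real k)))"
      using phi_deriv_bound[OF rho _ eta, of "real d" "real k" a] that by (simp add: Dv_def K_def c_def)
    from mult_left_mono[OF this v_nonneg[of d]] show ?thesis
      using v_nonneg[of d] by (simp add: norm_mult mult_ac)
  qed
  obtain C where C: "C \<ge> 0" "\<And>x. x \<ge> 1 \<Longrightarrow> gr (c / x) \<le> C * x" by (rule gr_bound[OF c that])
  have sv: "(\<lambda>d. v d * exp (- (c / real k) * real d)) summable_on PN" if k: "k \<ge> 1" for k
  proof -
    have "summable (\<lambda>d. v d * exp (- (c / real k) * real d))" by (rule v_summable) (use c k in auto)
    from iffD2[OF summable_Suc_iff this]
    have "summable (\<lambda>n. v (Suc n) * exp (- (c / real k) * real (Suc n)))" .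
    then show ?thesis
      by (intro summable_on_PN_iff[THEN iffD2] mult_nonneg_nonneg v_nonneg) auto
  qed
  have sv2: "infsum (\<lambda>d. v d * exp (- (c / real k) * real d)) PN \<le> C * real k" if k: "k \<ge> 1" for k
  proof -
    have s: "summable (\<lambda>d. v d * exp (- (c / real k) * real d))" by (rule v_summable) (use c k in auto)
    have "(\<lambda>d. v d * exp (- (c / real k) * real d)) summable_on UNIV"
      using s v_nonneg by (subst summable_on_UNIV_nonneg_real_iff) auto
    then have "infsum (\<lambda>d. v d * exp (- (c / real k) * real d)) PN \<le> infsum (\<lambda>d. v d * exp (- (c / real k) * real d)) UNIV"
      using v_nonneg by (intro infsum_mono_neutral sv k) auto
    also have "\<dots> = gr (c / real k)" unfolding gr_def
      using has_sum_imp_sums[OF has_sum_infsum[OF \<open>_ summable_on UNIV\<close>]] by (simp add: sums_iff)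
    also have "\<dots> \<le> C * real k" using C(2)[of "real k"] k by simp
    finally show ?thesis .
  qed
  \<comment> \<open>For fixed \<open>k\<close> the sum over \<open>d\<close> is at most a constant
    times \<open>k ^ - (a + 1) * gr (c / k)\<close>, which is \<open>O(k ^ - a)\<close> by
    \<open>gr_bound\<close> and summable because \<open>a \<ge> 2\<close>.\<close>
  have sD: "(\<lambda>(k, d). of_real (v d) * Dv d k) summable_on (PN \<times> PN)"
  proof (rule abs_summable_summable, rule Infinite_Sum.abs_summable_on_comparison_test)
    show "norm (case p of (k, d) \<Rightarrow> of_real (v d) * Dv d k) \<le> norm (case p of (k, d) \<Rightarrow> K * (1 / real k) ^ Suc a * (v d * exp (- (c / real k) * real d)))" if "p \<in> PN \<times> PN" for p
    proof -
      from that obtain k d where p: "p = (k, d)" "k \<ge> 1" by auto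
      show ?thesis unfolding p prod.case by (rule order.trans[OF Db[OF p(2)]]) (simp only: real_norm_def abs_ge_self)
    qed
    have "(\<lambda>p. case p of (k, d) \<Rightarrow> K * (1 / real k) ^ Suc a * (v d * exp (- (c / real k) * real d))) summable_on (PN \<times> PN)"
    proof (rule summable_on_SigmaI)
      show "((\<lambda>d. case (k, d) of (k, d) \<Rightarrow> K * (1 / real k) ^ Suc a * (v d * exp (- (c / real k) * real d))) has_sum
        (K * (1 / real k) ^ Suc a * infsum (\<lambda>d. v d * exp (- (c / real k) * real d)) PN)) PN" if "k \<in> PN" for k
        unfolding prod.case by (intro has_sum_cmult_right has_sum_infsum sv) (use that in simp)
      show "(\<lambda>k. K * (1 / real k) ^ Suc a * infsum (\<lambda>d. v d * exp (- (c / real k) * real d)) PN) summable_on PN"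
      proof (rule summable_on_comparison_test)
        have "summable (\<lambda>k. K * C * (1 / (real (Suc k))\<^sup>2))"
          using summable_ignore_initial_segment[OF inverse_power_summable[of 2, where 'a = real], of 1]
          by (intro summable_mult) (simp add: inverse_eq_divide)
        then show "(\<lambda>k. K * C * (1 / (real k)\<^sup>2)) summable_on PN" using K0 C by (subst summable_on_PN_iff) auto
        fix k assume "k \<in> PN"
        then have k: "k \<ge> 1" "real k \<ge> 1" by auto
        have nn: "infsum (\<lambda>d. v d * exp (- (c / real k) * real d)) PN \<ge> 0" by (rule infsum_nonneg) (use v_nonneg in auto)
        then show "0 \<le> K * (1 / real k) ^ Suc a * infsum (\<lambda>d. v d * exp (- (c / real k) * real d)) PN" using K0 by simp
        have "(1 / real k) ^ Suc a \<le> (1 / real k) ^ 3" using k a by (intro power_decreasing) auto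
        then have "K * (1 / real k) ^ Suc a * infsum (\<lambda>d. v d * exp (- (c / real k) * real d)) PN \<le> K * (1 / real k) ^ 3 * (C * real k)"
          using K0 nn sv2[OF k(1)] by (intro mult_mono) auto
        also have "\<dots> = K * C * (1 / (real k)\<^sup>2)" using k by (simp add: power3_eq_cube power2_eq_square field_simps)
        finally show "K * (1 / real k) ^ Suc a * infsum (\<lambda>d. v d * exp (- (c / real k) * real d)) PN \<le> K * C * (1 / (real k)\<^sup>2)" .
      qed
    qed (use K0 v_nonneg in auto)
    then show "Infinite_Sum.abs_summable_on (\<lambda>p. case p of (k, d) \<Rightarrow> K * (1 / real k) ^ Suc a * (v d * exp (- (c / real k) * real d))) (PN \<times> PN)"
      using K0 v_nonneg by (subst summable_on_cong[where g = "\<lambda>p. case p of (k, d) \<Rightarrow> K * (1 / real k) ^ Suc a * (v d * exp (- (c / real k) * real d))"]) (auto simp: abs_mult split: prod.splits)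
  qed
  have sD': "(\<lambda>(d, k). of_real (v d) * Dv d k) summable_on (PN \<times> PN)"
    using summable_on_swap[THEN iffD1, OF sD] by (simp add: case_prod_unfold)
  have H: "infsum (\<lambda>d. of_real (v d) * Dv d k) PN = (deriv ^^ a) hc (of_nat k * \<eta>)" if k: "k \<ge> 1" for k
  proof -
    have "(\<lambda>d. of_real (v d) * Dv d k) summable_on PN"
      using summable_on_SigmaD1[OF sD, of k] k by simp
    then have "infsum (\<lambda>d. of_real (v d) * Dv d k) PN = suminf (\<lambda>d. of_real (v (Suc d)) * Dv (Suc d) k)" by (rule infsum_PN_eq_suminf)
    moreover have "(\<lambda>d. of_real (v (Suc d)) * Dv (Suc d) k) sums (deriv ^^ a) hc (of_nat k * \<eta>)"
      using hc_series(2)[OF keta[OF k], of a] unfolding Dv_def by (subst sums_Suc_iff) (simp add: v0)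
    ultimately show ?thesis by (simp add: sums_iff)
  qed
  have LS: "(\<lambda>(d, k). of_real (v d) * (of_nat d ^ a * exp (- \<eta> * of_nat (d * k)))) summable_on PN \<times> PN"
    by (rule abs_summable_summable[OF L_summable])
  have LS': "(\<lambda>(k, d). of_real (v d) * (of_nat d ^ a * exp (- \<eta> * of_nat (d * k)))) summable_on PN \<times> PN"
    using summable_on_swap[THEN iffD1, OF LS] by (simp add: case_prod_unfold)
  have Gk: "infsum (\<lambda>d. of_real (v d) * (of_nat d ^ a * exp (- \<eta> * of_nat (d * k)))) PN = (-1) ^ a * (deriv ^^ a) gc (of_nat k * \<eta>)" if k: "k \<ge> 1" for k
  proof -
    have "(\<lambda>d. of_real (v d) * (of_nat d ^ a * exp (- \<eta> * of_nat (d * k)))) summable_on PN"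
      using summable_on_SigmaD1[OF LS', of k] k by simp
    then have 1: "infsum (\<lambda>d. of_real (v d) * (of_nat d ^ a * exp (- \<eta> * of_nat (d * k)))) PN =
       suminf (\<lambda>d. of_real (v (Suc d)) * (of_nat (Suc d) ^ a * exp (- \<eta> * of_nat (Suc d * k))))" by (rule infsum_PN_eq_suminf)
    have "(\<lambda>n. (-1) ^ a * (of_real (v n) * (- of_nat n) ^ a * exp (- (of_nat k * \<eta>) * of_nat n))) sums ((-1) ^ a * (deriv ^^ a) gc (of_nat k * \<eta>))"
      by (intro sums_mult gc_series(2) keta k)
    moreover have "(-1) ^ a * (of_real (v n) * (- of_nat n) ^ a * exp (- (of_nat k * \<eta>) * of_nat n)) = of_real (v n) * (of_nat n ^ a * exp (- \<eta> * of_nat (n * k)))" for n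
    proof -
      have "(-1) ^ a * (- of_nat n) ^ a = (of_nat n :: complex) ^ a" by (simp flip: power_mult_distrib)
      moreover have "- (of_nat k * \<eta>) * of_nat n = - \<eta> * of_nat (n * k)" by simp
      ultimately show ?thesis by (metis (no_types, lifting) mult.assoc mult.left_commute)
    qed
    ultimately have "(\<lambda>n. of_real (v n) * (of_nat n ^ a * exp (- \<eta> * of_nat (n * k)))) sums ((-1) ^ a * (deriv ^^ a) gc (of_nat k * \<eta>))" by (simp only:)
    then have "(\<lambda>n. of_real (v (Suc n)) * (of_nat (Suc n) ^ a * exp (- \<eta> * of_nat (Suc n * k)))) sums ((-1) ^ a * (deriv ^^ a) gc (of_nat k * \<eta>))"
      by (subst sums_Suc_iff[of "\<lambda>n. of_real (v n) * (of_nat n ^ a * exp (- \<eta> * of_nat (n * k)))"]) (simp add: v0)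
    with 1 show ?thesis by (simp only: sums_iff)
  qed
  define Zt where "Zt = (\<lambda>k. of_real (\<kappa> * \<rho>) * (fact a / (of_nat k * \<eta>) ^ Suc a))"
  have ZD: "(-1) ^ a * (deriv ^^ a) gc (of_nat k * \<eta>) = Zt k + (-1) ^ a * infsum (\<lambda>d. of_real (v d) * Dv d k) PN" if k: "k \<ge> 1" for k
  proof -
    have m: "(-1) ^ a * (-1) ^ a = (1 :: complex)" by (simp flip: power_mult_distrib)
    have "(-1) ^ a * (deriv ^^ a) gc (of_nat k * \<eta>) = ((-1) ^ a * (-1) ^ a) * Zt k + (-1) ^ a * (deriv ^^ a) hc (of_nat k * \<eta>)"
      using gc_higher_deriv[OF keta[OF k], of a] a by (simp add: Zt_def distrib_left mult_ac)
    then show ?thesis unfolding m H[OF k] by simp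
  qed
  have sumD: "(\<lambda>k. infsum (\<lambda>d. of_real (v d) * Dv d k) PN) summable_on PN"
    using summable_on_Sigma_banach[OF sD] by simp
  have zs: "summable (\<lambda>k. 1 / real (Suc k) ^ Suc a)"
    using summable_ignore_initial_segment[OF inverse_power_summable[of "Suc a", where 'a = real], of 1] a
    by (simp add: inverse_eq_divide)
  have Zeq: "Zt k = (of_real (\<kappa> * \<rho> * fact a) / \<eta> ^ Suc a) * of_real (1 / real k ^ Suc a)" for k
    by (simp add: Zt_def power_mult_distrib)
  have zsum: "((\<lambda>k. 1 / real k ^ Suc a)) summable_on PN" using zs by (subst summable_on_PN_iff) auto
  then have zc: "(\<lambda>k. complex_of_real (1 / real k ^ Suc a)) summable_on PN" by (rule summable_on_of_real)
  have Zs: "Zt summable_on PN" unfolding Zeq by (intro summable_on_cmult_right zc)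
  have "infsum (\<lambda>k. complex_of_real (1 / real k ^ Suc a)) PN = of_real (suminf (\<lambda>k. 1 / real (Suc k) ^ Suc a))"
    unfolding infsum_PN_eq_suminf[OF zc] by (rule suminf_of_real[OF zs, symmetric])
  then have ZS: "infsum Zt PN = of_real (\<kappa> * \<rho> * fact a * suminf (\<lambda>k. 1 / real (Suc k) ^ Suc a)) / \<eta> ^ Suc a"
    unfolding Zeq infsum_cmult_right' by simp
  have "infsum (\<lambda>(d, k). of_real (v d) * (of_nat d ^ a * exp (- \<eta> * of_nat (d * k)))) (PN \<times> PN) =
     infsum (\<lambda>d. infsum (\<lambda>k. of_real (v d) * (of_nat d ^ a * exp (- \<eta> * of_nat (d * k)))) PN) PN"
    using infsum_Sigma_banach[OF LS] by simp
  also have "\<dots> = infsum (\<lambda>k. infsum (\<lambda>d. of_real (v d) * (of_nat d ^ a * exp (- \<eta> * of_nat (d * k)))) PN) PN"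
    by (rule infsum_swap_banach[OF LS])
  also have "\<dots> = infsum (\<lambda>k. Zt k + (-1) ^ a * infsum (\<lambda>d. of_real (v d) * Dv d k) PN) PN"
    by (rule infsum_cong) (simp only: Gk ZD atLeast_iff)
  also have "\<dots> = infsum Zt PN + (-1) ^ a * infsum (\<lambda>k. infsum (\<lambda>d. of_real (v d) * Dv d k) PN) PN"
    by (subst infsum_add[OF Zs summable_on_cmult_right[OF sumD]]) (simp only: infsum_cmult_right')
  also have "infsum (\<lambda>k. infsum (\<lambda>d. of_real (v d) * Dv d k) PN) PN = infsum (\<lambda>d. infsum (\<lambda>k. of_real (v d) * Dv d k) PN) PN"
    by (rule infsum_swap_banach[OF sD])
  also have "\<dots> = infsum (\<lambda>d. 2 * (of_real \<rho> / \<eta>) * (2 * pi / \<eta>) ^ a * infsum (\<lambda>k. of_real (v d) * (of_nat k ^ a * BB a (d * k))) PN) PN"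
  proof (rule infsum_cong)
    fix d assume "d \<in> PN"
    then have d: "d \<ge> 1" by simp
    have s1: "(\<lambda>k. of_real (v d) * Dv d k) summable_on PN" using summable_on_SigmaD1[OF sD', of d] d by simp
    have s2: "(\<lambda>k. of_real (v d) * (of_nat k ^ a * BB a (d * k))) summable_on PN" using summable_on_SigmaD1[OF BB_summable, of d] d by simp
    show "infsum (\<lambda>k. of_real (v d) * Dv d k) PN = 2 * (of_real \<rho> / \<eta>) * (2 * pi / \<eta>) ^ a * infsum (\<lambda>k. of_real (v d) * (of_nat k ^ a * BB a (d * k))) PN"
    \<comment> \<open>Summability of the series without the weight is recovered by dividing by
      \<open>v d\<close>; for \<open>v d = 0\<close> both sides vanish.\<close>
    proof (cases "v d = 0")
      case False
      have s1': "Dv d summable_on PN" "(\<lambda>k. of_nat k ^ a * BB a (d * k)) summable_on PN"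
        using s1 s2 False by (simp_all add: summable_on_cmult_right')
      have "infsum (\<lambda>k. of_real (v d) * Dv d k) PN = of_real (v d) * suminf (\<lambda>k. Dv d (Suc k))"
        unfolding infsum_cmult_right' infsum_PN_eq_suminf[OF s1'(1)] ..
      also have "suminf (\<lambda>k. Dv d (Suc k)) = 2 * (of_real \<rho> / \<eta>) * (2 * pi / \<eta>) ^ a * suminf (\<lambda>j. of_nat (Suc j) ^ a * BB a (d * Suc j))"
        unfolding Dv_def by (rule poisson_BB[OF a d])
      also have "suminf (\<lambda>j. of_nat (Suc j) ^ a * BB a (d * Suc j)) = infsum (\<lambda>k. of_nat k ^ a * BB a (d * k)) PN"
        unfolding infsum_PN_eq_suminf[OF s1'(2)] ..
      finally show ?thesis unfolding infsum_cmult_right' by (simp only: mult.left_commute)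
    qed simp
  qed
  also have "\<dots> = 2 * (of_real \<rho> / \<eta>) * (2 * pi / \<eta>) ^ a * infsum (\<lambda>(d, k). of_real (v d) * (of_nat k ^ a * BB a (d * k))) (PN \<times> PN)"
  proof -
    have e: "infsum (\<lambda>d. infsum (\<lambda>k. of_real (v d) * (of_nat k ^ a * BB a (d * k))) PN) PN = infsum (\<lambda>(d, k). of_real (v d) * (of_nat k ^ a * BB a (d * k))) (PN \<times> PN)"
      using infsum_Sigma_banach[OF BB_summable[of a]] by simp
    show ?thesis by (subst infsum_cmult_right') (simp only: e)
  qed
  finally show ?thesis unfolding ZS .
qed

end

end

section \<open>Theta functions of ideals\<close>

context imag_quad begin

text \<open>Divided by the covolume, the squared modulus becomes a form with
  \<open>T * B = s^2\<close>, and passing from \<open>(T, B)\<close> to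
  \<open>(1 / B, 1 / T)\<close> amounts to passing from \<open>s\<close> to \<open>1 / s\<close>
  with the same \<open>r\<close>. Geometrically, a plane lattice is similar to its dual, so no dual
  ideal occurs.\<close>

lemma lattice_theta:
  assumes V: "Im (cnj a * b) \<noteq> 0"
  defines "e \<equiv> \<lambda>s \<mu>. exp (- pi * s * (cmod \<mu>)\<^sup>2 / \<bar>Im (cnj a * b)\<bar>)"
  obtains \<theta> where "\<And>s. s > 0 \<Longrightarrow> (e s has_sum \<theta> s) (lat a b)" "\<And>s. s > 0 \<Longrightarrow> \<theta> s = \<theta> (1 / s) / s"
proof -
  define W where "W = \<bar>Im (cnj a * b)\<bar>"
  define r where "r = Re (cnj a * b) / (cmod a)\<^sup>2"
  have a0: "(cmod a)\<^sup>2 > 0" using V by auto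
  have W: "W > 0" using V by (simp add: W_def)
  define Q where "Q = (\<lambda>s. qtheta (s * (cmod a)\<^sup>2 / W) (s * W / (cmod a)\<^sup>2) r)"
  define \<theta> where "\<theta> = (\<lambda>s. Re (infsum (Q s) UNIV))"
  define g where "g = (\<lambda>(x :: int, y :: int). of_int x * a + of_int y * b)"
  have inj: "inj_on g UNIV"
  proof (rule inj_onI)
    fix p q assume "g p = g q"
    obtain x y x' y' where p: "p = (x, y)" "q = (x', y')" by (metis surj_pair)
    have eq: "of_int (x - x') * a + of_int (y - y') * b = 0" using \<open>g p = g q\<close> by (simp add: p g_def algebra_simps)
    have "Im (cnj a * (of_int (x - x') * a + of_int (y - y') * b)) = of_int (y - y') * Im (cnj a * b)"
      by (simp add: algebra_simps)
    then have y: "y = y'" using V unfolding eq by simp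
    have "a \<noteq> 0" using a0 by auto
    then have "x = x'" using eq y by simp
    with y show "p = q" by (simp add: p)
  qed
  have img: "g ` UNIV = lat a b" by (auto simp: g_def lat_def image_iff)
  have bij: "bij_betw g UNIV (lat a b)" using inj img by (simp add: bij_betw_def)
  have norm_g: "(cmod (g (x, y)))\<^sup>2 = (cmod a)\<^sup>2 * (of_int x + r * of_int y)\<^sup>2 + W\<^sup>2 / (cmod a)\<^sup>2 * (of_int y)\<^sup>2" for x y
  proof -
    have "(cmod (g (x, y)))\<^sup>2 = (cmod a)\<^sup>2 * (of_int x)\<^sup>2 + 2 * of_int x * of_int y * Re (cnj a * b) + (cmod b)\<^sup>2 * (of_int y)\<^sup>2"
      unfolding cmod_power2 by (simp add: g_def power2_eq_square algebra_simps)
    moreover have "(cmod a)\<^sup>2 * (cmod b)\<^sup>2 = (Re (cnj a * b))\<^sup>2 + W\<^sup>2"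
      unfolding W_def cmod_power2 by (simp add: power2_eq_square algebra_simps)
    then have "(cmod b)\<^sup>2 = (cmod a)\<^sup>2 * r\<^sup>2 + W\<^sup>2 / (cmod a)\<^sup>2"
    proof -
      have "(cmod a)\<^sup>2 * r\<^sup>2 + W\<^sup>2 / (cmod a)\<^sup>2 = ((Re (cnj a * b))\<^sup>2 + W\<^sup>2) / (cmod a)\<^sup>2"
        using a0 unfolding r_def add_divide_distrib power_divide by (simp add: power2_eq_square)
      then show ?thesis using \<open>_ = (Re (cnj a * b))\<^sup>2 + W\<^sup>2\<close> a0 by (metis nonzero_mult_div_cancel_left less_numeral_extra(3))
    qed
    moreover have "Re (cnj a * b) = (cmod a)\<^sup>2 * r" using a0 by (simp add: r_def)
    ultimately have "(cmod (g (x, y)))\<^sup>2 = (cmod a)\<^sup>2 * (of_int x)\<^sup>2 + 2 * of_int x * of_int y * ((cmod a)\<^sup>2 * r)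
      + ((cmod a)\<^sup>2 * r\<^sup>2 + W\<^sup>2 / (cmod a)\<^sup>2) * (of_int y)\<^sup>2" by (simp only:)
    then show ?thesis by (simp add: power2_eq_square algebra_simps)
  qed
  have Qe: "Q s p = of_real (e s (g p))" for s p
  proof -
    obtain x y where p: "p = (x, y)" by force
    have "s * (cmod (g (x, y)))\<^sup>2 / W = s * (cmod a)\<^sup>2 / W * (of_int x + r * of_int y)\<^sup>2 + s * W / (cmod a)\<^sup>2 * (of_int y)\<^sup>2"
      unfolding norm_g using W by (simp add: field_simps power2_eq_square)
    then have "- pi * (s * (cmod a)\<^sup>2 / W * (of_int x + r * of_int y)\<^sup>2 + s * W / (cmod a)\<^sup>2 * (of_int y)\<^sup>2) = - pi * (s * (cmod (g (x, y)))\<^sup>2 / W)"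
      by (simp only:)
    also have "\<dots> = - pi * s * (cmod (g (x, y)))\<^sup>2 / W" by simp
    finally have "- pi * (s * (cmod a)\<^sup>2 / W * (of_int x + r * of_int y)\<^sup>2 + s * W / (cmod a)\<^sup>2 * (of_int y)\<^sup>2) = - pi * s * (cmod (g (x, y)))\<^sup>2 / W" .
    then show ?thesis unfolding p Q_def qtheta_def e_def W_def[symmetric] by (simp only: prod.case)
  qed
  have hs: "(e s has_sum \<theta> s) (lat a b)" if s: "s > 0" for s
  proof -
    have "Q s summable_on UNIV" unfolding Q_def
      by (rule abs_summable_summable[OF qtheta_summable]) (use s a0 W in auto)
    then have "(Q s has_sum infsum (Q s) UNIV) UNIV" by (rule has_sum_infsum)
    from has_sum_Re[OF this] have "((\<lambda>p. e s (g p)) has_sum \<theta> s) UNIV" by (simp add: Qe \<theta>_def)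
    then show ?thesis using has_sum_reindex_bij_betw[OF bij, of "e s" "\<theta> s"] by simp
  qed
  have fe: "\<theta> s = \<theta> (1 / s) / s" if s: "s > 0" for s
  proof -
    have "sqrt (s * (cmod a)\<^sup>2 / W * (s * W / (cmod a)\<^sup>2)) = s" using s a0 W by (simp add: real_sqrt_mult)
    moreover have "qtheta (1 / (s * W / (cmod a)\<^sup>2)) (1 / (s * (cmod a)\<^sup>2 / W)) r = Q (1 / s)" by (simp add: Q_def)
    moreover have "infsum (Q s) UNIV = of_real (1 / sqrt (s * (cmod a)\<^sup>2 / W * (s * W / (cmod a)\<^sup>2))) *
        infsum (qtheta (1 / (s * W / (cmod a)\<^sup>2)) (1 / (s * (cmod a)\<^sup>2 / W)) r) UNIV"
      unfolding Q_def by (rule qtheta_inversion) (use s a0 W in auto)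
    ultimately have "infsum (Q s) UNIV = of_real (1 / s) * infsum (Q (1 / s)) UNIV" by (simp only:)
    then show ?thesis by (simp add: \<theta>_def)
  qed
  show ?thesis by (rule that[OF hs fe])
qed

text \<open>The covolume of \<open>J\<close> is \<open>N J * Im om\<close>, so
  \<open>s = y / \<rho>\<close> turns its theta function into the sum of
  \<open>exp (- y (cmod \<mu>)^2 / N J)\<close>. Hence \<open>g y\<close> is \<open>1 / w\<close>
  times the sum of \<open>\<Theta> J (y / \<rho>) - 1\<close> over \<open>h\<close> representatives;
  the omitted zero vectors, on the two sides of the inversion, produce the two terms with
  \<open>\<kappa>\<close>.\<close>

theorem theta_coeffs_ideal_count:
  "theta_coeffs (\<lambda>n. real (ideal_count K n)) (pi / Im om) (real (class_number K) / real (num_roots_of_unity K))"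
proof -
  define \<rho> where "\<rho> = pi / Im om"
  define wr where "wr = real (num_roots_of_unity K)"
  define v where "v = (\<lambda>n. real (ideal_count K n))"
  have rho: "\<rho> > 0" using om(2) by (simp add: \<rho>_def)
  have "\<exists>\<theta>. (\<forall>y>0. ((\<lambda>\<mu>. exp (- y * ((cmod \<mu>)\<^sup>2 / real (nrm J)))) has_sum \<theta> (y / \<rho>)) J) \<and> (\<forall>s>0. \<theta> s = \<theta> (1 / s) / s)"
    if J: "J \<in> NI" for J
  proof -
    have n: "real (nrm J) > 0" using nrm_pos[OF J] by simp
    obtain a b where ab: "J = lat a b" "\<bar>Im (cnj a * b)\<bar> = real (nrm J) * Im om" by (rule ideal_lat[OF J])
    have ne: "Im (cnj a * b) \<noteq> 0" using ab(2) n om(2) by auto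
    obtain \<theta> where th: "\<And>s. s > 0 \<Longrightarrow> ((\<lambda>\<mu>. exp (- pi * s * (cmod \<mu>)\<^sup>2 / \<bar>Im (cnj a * b)\<bar>)) has_sum \<theta> s) (lat a b)" "\<And>s. s > 0 \<Longrightarrow> \<theta> s = \<theta> (1 / s) / s"
      using lattice_theta[OF ne] by blast
    have "((\<lambda>\<mu>. exp (- y * ((cmod \<mu>)\<^sup>2 / real (nrm J)))) has_sum \<theta> (y / \<rho>)) J" if y: "y > 0" for y
    proof -
      have "- pi * (y / \<rho>) * (cmod \<mu>)\<^sup>2 / (real (nrm J) * Im om) = - y * ((cmod \<mu>)\<^sup>2 / real (nrm J))" for \<mu>
        using om(2) by (simp add: \<rho>_def)
      then show ?thesis using th(1)[of "y / \<rho>"] y rho unfolding ab(2) ab(1)[symmetric] by simp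
    qed
    with th(2) show ?thesis by blast
  qed
  then obtain \<Theta> where Th: "\<And>J y. J \<in> NI \<Longrightarrow> y > 0 \<Longrightarrow> ((\<lambda>\<mu>. exp (- y * ((cmod \<mu>)\<^sup>2 / real (nrm J)))) has_sum \<Theta> J (y / \<rho>)) J"
    "\<And>J s. J \<in> NI \<Longrightarrow> s > 0 \<Longrightarrow> \<Theta> J s = \<Theta> J (1 / s) / s" by metis
  obtain \<R> where R: "finite \<R>" "\<R> \<subseteq> NI" "card \<R> = class_number K"
    "\<And>f S. (\<And>J. J \<in> \<R> \<Longrightarrow> ((\<lambda>\<mu>. f ((cmod \<mu>)\<^sup>2 / real (nrm J))) has_sum S J) (J - {0})) \<Longrightarrow>
       ((\<lambda>n. real (ideal_count K n) * f (real n)) has_sum ((\<Sum>J\<in>\<R>. S J) / real (num_roots_of_unity K))) UNIV"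
    using ideal_sum by blast
  have sums: "(\<lambda>n. v n * exp (- y * real n)) sums ((\<Sum>J\<in>\<R>. \<Theta> J (y / \<rho>) - 1) / wr)" if y: "y > 0" for y
  proof -
    have "((\<lambda>\<mu>. exp (- y * ((cmod \<mu>)\<^sup>2 / real (nrm J)))) has_sum (\<Theta> J (y / \<rho>) - 1)) (J - {0})" if "J \<in> \<R>" for J
    proof -
      have J: "J \<in> NI" using that R(2) by blast
      have "0 \<in> J" using is_ideal_diff[OF NI_ideal[OF J]] NI_nonzero[OF J] by force
      then show ?thesis using has_sum_Diff[OF Th(1)[OF J y] has_sum_finite[of "{0}" "\<lambda>\<mu>. exp (- y * ((cmod \<mu>)\<^sup>2 / real (nrm J)))"]] by simp
    qed
    from R(4)[of "\<lambda>t. exp (- y * t)", OF this]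
    show ?thesis unfolding v_def wr_def by (rule has_sum_imp_sums)
  qed
  show ?thesis unfolding \<rho>_def[symmetric] wr_def[symmetric] v_def[symmetric]
  proof
    have "{I \<in> NI. nrm I = 0} = {}" using nrm_pos by fastforce
    then show "v 0 = 0" unfolding v_def ideal_count_def nonzero_ideals_eq by (simp only: card.empty of_nat_0)
    show "v n \<ge> 0" for n by (simp add: v_def)
    show "\<rho> > 0" by (rule rho)
    show "real (class_number K) / wr \<ge> 0" by (simp add: wr_def)
    show "summable (\<lambda>n. v n * exp (- y * real n))" if "y > 0" for y using sums[OF that] by (simp add: sums_iff)
    show "suminf (\<lambda>n. v n * exp (- y * real n)) = - (real (class_number K) / wr) + real (class_number K) / wr * \<rho> / y
      + \<rho> / y * suminf (\<lambda>n. v n * exp (- (\<rho>\<^sup>2 / y) * real n))" if y: "y > 0" for y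
    proof -
      have y': "\<rho>\<^sup>2 / y > 0" using rho y by simp
      have wr0: "wr > 0" using card_U by (simp add: wr_def)
      define T where "T = (\<Sum>J\<in>\<R>. \<Theta> J (\<rho> / y))"
      have "(\<Sum>J\<in>\<R>. \<Theta> J (y / \<rho>)) = (\<Sum>J\<in>\<R>. \<rho> / y * \<Theta> J (\<rho> / y))"
        using R(2) rho y by (intro sum.cong refl, subst Th(2)) auto
      then have 1: "(\<Sum>J\<in>\<R>. \<Theta> J (y / \<rho>)) = \<rho> / y * T" by (simp add: T_def sum_distrib_left)
      have "\<rho>\<^sup>2 / y / \<rho> = \<rho> / y" by (simp add: power2_eq_square)
      then have 2: "suminf (\<lambda>n. v n * exp (- (\<rho>\<^sup>2 / y) * real n)) = (T - real (class_number K)) / wr"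
        using sums[OF y'] R(3) by (simp add: sums_iff sum_subtractf T_def)
      have 3: "suminf (\<lambda>n. v n * exp (- y * real n)) = (\<rho> / y * T - real (class_number K)) / wr"
        using sums[OF y] R(3) 1 by (simp add: sums_iff sum_subtractf)
      show ?thesis unfolding 2 3 using y wr0 by (simp add: field_simps)
    qed
  qed
qed

end

section \<open>The identities\<close>

lemma ideal_sigma_of_nat:
  assumes n: "n \<ge> 1"
  shows "ideal_sigma K (of_nat a) n = (\<Sum>d | d dvd n. of_nat (ideal_count K d) * of_nat d ^ a)"
  unfolding ideal_sigma_def by (rule sum.cong) (use n in \<open>auto simp: powr_nat'\<close>)

text \<open>Division by the power of \<open>n\<close> replaces \<open>d ^ - a\<close> by the power
  \<open>(n / d) ^ a\<close> of the complementary divisor. Both sides of the identities thus become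
  sums over pairs \<open>(d, k)\<close> with weight \<open>v d\<close>, carrying
  \<open>d ^ a\<close> on the left and \<open>k ^ a\<close> on the right.\<close>

lemma ideal_sigma_minus_of_nat:
  assumes n: "n \<ge> 1"
  shows "ideal_sigma K (- of_nat a) n / of_nat n powr (- of_nat a) =
    (\<Sum>d | d dvd n. of_nat (ideal_count K d) * of_nat (n div d) ^ a)"
  unfolding ideal_sigma_def sum_divide_distrib
proof (rule sum.cong)
  fix d assume "d \<in> {d. d dvd n}"
  then obtain k where k: "n = d * k" by auto
  then have dk: "d > 0" "k > 0" using n by auto
  then show "complex_of_nat (ideal_count K d) * of_nat d powr - of_nat a / of_nat n powr - of_nat a =
    of_nat (ideal_count K d) * of_nat (n div d) ^ a"
    using n by (simp add: k powr_minus powr_nat' power_mult_distrib field_simps)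
qed simp

text \<open>Both square roots have argument below \<open>\<pi> / 4\<close> in absolute value, so
  their product lies in the right half-plane and is the positive root \<open>c\<close> of
  \<open>\<alpha> * \<beta>\<close>. This settles the sign that a half-integral exponent leaves
  open.\<close>

lemma half_power_eq:
  fixes \<alpha> \<beta> :: complex and c :: real
  assumes \<alpha>: "Re \<alpha> > 0" and \<beta>: "Re \<beta> > 0" and \<alpha>\<beta>: "\<alpha> * \<beta> = of_real (c\<^sup>2)" and c: "c > 0"
  shows "\<alpha> powr (of_nat m + 1 / 2) * (of_real c / \<alpha>) ^ Suc (2 * m) = \<beta> powr (of_nat m + 1 / 2)"
proof -
  have nz: "\<alpha> \<noteq> 0" "\<beta> \<noteq> 0" using \<alpha> \<beta> by auto
  have p: "z powr (of_nat m + 1 / 2) = z ^ m * csqrt z" if "z \<noteq> 0" for z :: complex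
    using that by (simp add: powr_add powr_nat' csqrt_conv_powr)
  have arg: "\<bar>Im (csqrt z)\<bar> < Re (csqrt z)" if z: "Re z > 0" for z
  proof -
    have "Re ((csqrt z)\<^sup>2) > 0" using z by simp
    then have "(Im (csqrt z))\<^sup>2 < (Re (csqrt z))\<^sup>2" by (simp add: power2_eq_square)
    then have "\<bar>Im (csqrt z)\<bar>\<^sup>2 < (Re (csqrt z))\<^sup>2" by simp
    then show ?thesis using Re_csqrt by (rule power2_less_imp_less)
  qed
  have "Re (csqrt \<alpha> * csqrt \<beta>) > 0"
  proof -
    have "\<bar>Im (csqrt \<alpha>) * Im (csqrt \<beta>)\<bar> < Re (csqrt \<alpha>) * Re (csqrt \<beta>)"
      unfolding abs_mult by (rule mult_strict_mono') (use arg[OF \<alpha>] arg[OF \<beta>] in auto)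
    then show ?thesis by simp
  qed
  moreover have "(csqrt \<alpha> * csqrt \<beta>)\<^sup>2 = (of_real c)\<^sup>2" by (simp add: power_mult_distrib \<alpha>\<beta>)
  ultimately have cs: "csqrt \<alpha> * csqrt \<beta> = of_real c"
    using power_eq_unique_right_half_plane[of "csqrt \<alpha> * csqrt \<beta>" "of_real c"] c by (simp only: Re_complex_of_real)
  have q: "\<alpha> * (of_real c / \<alpha>)\<^sup>2 = \<beta>" using \<alpha>\<beta> nz by (simp add: power_divide power2_eq_square field_simps)
  have "csqrt \<alpha> * (of_real c / \<alpha>) = csqrt \<alpha> * csqrt \<alpha> * csqrt \<beta> / \<alpha>" unfolding cs[symmetric] by simp
  also have "\<dots> = csqrt \<beta>" using nz by (simp flip: power2_eq_square)
  finally have q': "csqrt \<alpha> * (of_real c / \<alpha>) = csqrt \<beta>" .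
  have "\<alpha> ^ m * csqrt \<alpha> * (of_real c / \<alpha>) ^ Suc (2 * m) = (\<alpha> * (of_real c / \<alpha>)\<^sup>2) ^ m * (csqrt \<alpha> * (of_real c / \<alpha>))"
    unfolding power_Suc power_mult power_mult_distrib[of \<alpha> "_ ^ 2"] by (simp only: mult_ac)
  also have "\<dots> = \<beta> ^ m * csqrt \<beta>" unfolding q q' ..
  finally show ?thesis unfolding p[OF nz(1)] p[OF nz(2)] .
qed

theorem theorem1p8:
  fixes K :: "complex set" and m :: nat and \<alpha> \<beta> :: complex and DK h w A :: real
  assumes K: "imaginary_quadratic_field K"
    and m: "m \<ge> 1"
    and DK: "DK = of_int \<bar>discriminant K\<bar>"
    and h: "h = of_nat (class_number K)"
    and w: "w = of_nat (num_roots_of_unity K)"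
    and A: "A = 8 * pi / DK"
    and \<alpha>: "Re \<alpha> > 0"
    and \<beta>: "Re \<beta> > 0"
    and \<alpha>\<beta>: "\<alpha> * \<beta> = of_real (DK\<^sup>2 / (16 * pi\<^sup>2))"
  defines "E \<equiv> \<lambda>n :: nat. exp (- of_real (A * pi * of_nat n) * \<alpha>)"
    and "x \<equiv> \<lambda>n :: nat. of_real A * csqrt (of_real (pi * of_nat n) * \<beta>)"
  defines "L1 \<equiv> \<lambda>n. ideal_sigma K (2 * of_nat m - 1) n * E n"
    and "R1 \<equiv> \<lambda>n. ideal_sigma K (1 - 2 * of_nat m) n / of_nat n powr (1 - 2 * of_nat m)
                    * kelvin_kei (x n)"
    and "L2 \<equiv> \<lambda>n. ideal_sigma K (2 * of_nat m) n * E n"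
    and "R2 \<equiv> \<lambda>n. ideal_sigma K (- 2 * of_nat m) n / of_nat n powr (- 2 * of_nat m)
                    * kelvin_ker (x n)"
  shows "summable (\<lambda>n. L1 (Suc n)) \<and> summable (\<lambda>n. R1 (Suc n)) \<and>
         summable (\<lambda>n. L2 (Suc n)) \<and> summable (\<lambda>n. R2 (Suc n)) \<and>
         (m \<ge> 2 \<longrightarrow>
           \<alpha> ^ m * suminf (\<lambda>n. L1 (Suc n)) =
           - ((- \<beta>) ^ m) *
             (of_real (4 / sqrt DK) * suminf (\<lambda>n. R1 (Suc n))
              + of_real (pi * h / (w * sqrt DK) * (bernoulli (2 * m) / (2 * of_nat m))))) \<and>
         \<alpha> powr (of_nat m + 1 / 2) * suminf (\<lambda>n. L2 (Suc n)) =
         \<beta> powr (of_nat m + 1 / 2) *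
           (of_real (4 * (- 1) ^ m / sqrt DK) * suminf (\<lambda>n. R2 (Suc n))
            + of_real (h * fact (2 * m) / ((2 * pi) ^ (2 * m) * w * sqrt DK))
                * zeta (2 * of_nat m + 1))"
proof -
  interpret imag_quad K by unfold_locales (rule K)
  define v where "v = (\<lambda>n. real (ideal_count K n))"
  define \<rho> where "\<rho> = pi / Im om"
  define \<kappa> where "\<kappa> = h / w"
  define S where "S = sqrt DK"
  have DK2: "DK = (2 * Im om)\<^sup>2" unfolding DK using discriminant_eq by (simp only: of_int_abs abs_minus_cancel abs_power2)
  have S: "S = 2 * Im om" "S > 0" "S\<^sup>2 = DK" unfolding S_def DK2 using om(2) by (simp_all only: real_sqrt_abs)
  have DK0: "DK > 0" using om(2) by (simp add: DK2)
  have A0: "A > 0" using DK0 by (simp add: A)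
  have rho: "\<rho> = 2 * pi / S" by (simp add: \<rho>_def S)
  interpret tc: theta_coeffs v \<rho> \<kappa>
    unfolding v_def \<rho>_def \<kappa>_def h w by (rule theta_coeffs_ideal_count)
  have a0: "\<alpha> \<noteq> 0" "\<beta> \<noteq> 0" using \<alpha> \<beta> by auto
  define \<eta> where "\<eta> = of_real (A * pi) * \<alpha>"
  have eta: "\<eta> \<in> RHP" using \<alpha> A0 by (simp add: \<eta>_def RHP_def)
  have eta0: "\<eta> \<noteq> 0" by (rule RHP_nonzero[OF eta])
  \<comment> \<open>This is \<open>2 \<pi> / \<eta>\<close>. The prescribed value of
    \<open>\<alpha> * \<beta>\<close> is the one with \<open>\<alpha> * q^2 = \<beta>\<close>, which
    turns powers of \<open>\<alpha>\<close> on the left into powers of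
    \<open>\<beta>\<close>.\<close>
  define q where "q = of_real (DK / (4 * pi)) / \<alpha>"
  have q_eta: "2 * pi / \<eta> = q" using DK0 a0 by (simp add: q_def \<eta>_def A field_simps)
  have rho_eta: "of_real \<rho> / \<eta> = q / S" using S a0 unfolding q_eta[symmetric] by (simp add: rho)
  have c2: "\<alpha> * \<beta> = of_real ((DK / (4 * pi))\<^sup>2)" unfolding \<alpha>\<beta> by (simp add: power_divide power_mult_distrib)
  have q2: "\<alpha> * q\<^sup>2 = \<beta>"
  proof -
    have "\<alpha> * q\<^sup>2 = of_real ((DK / (4 * pi))\<^sup>2) / \<alpha>" using a0 by (simp add: q_def power_divide power2_eq_square)
    then show ?thesis unfolding c2[symmetric] using a0 by simp
  qed
  define s where "s = csqrt (of_real pi * \<beta>)"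
  have s2: "s\<^sup>2 = of_real pi * \<beta>" by (simp add: s_def)
  \<comment> \<open>That is, \<open>\<bar>arg s\<bar> < \<pi> / 4\<close>, so that rotation by
    \<open>\<plusminus> \<pi> / 4\<close> does not leave the right half-plane.\<close>
  have s_arg: "\<bar>Im s\<bar> < Re s"
  proof -
    have "Re (s\<^sup>2) > 0" unfolding s2 using \<beta> by simp
    then have "\<bar>Im s\<bar>\<^sup>2 < (Re s)\<^sup>2" by (simp add: power2_eq_square)
    moreover have "Re s \<ge> 0" unfolding s_def by (rule Re_csqrt)
    ultimately show ?thesis by (rule power2_less_imp_less)
  qed
  define w1 where "w1 = of_real A * s * cis (pi / 4)"
  define w2 where "w2 = of_real A * s * cis (- pi / 4)"
  have wRe: "Re w1 > 0" "Re w2 > 0"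
  proof -
    have e: "Re w1 = A * (sqrt 2 / 2) * (Re s - Im s)" "Re w2 = A * (sqrt 2 / 2) * (Re s + Im s)"
      by (simp_all add: w1_def w2_def cos_45 sin_45 algebra_simps)
    show "Re w1 > 0" "Re w2 > 0" unfolding e by (intro mult_pos_pos; use A0 s_arg in simp)+
  qed
  \<comment> \<open>The squared Bessel argument from Poisson summation agrees with
    \<open>(A s)^2 \<i>\<close> from the Kelvin functions; the relation between
    \<open>\<alpha>\<close> and \<open>\<beta>\<close> enters here.\<close>
  have wval: "of_real (8 * pi) * \<i> * of_real (\<rho>\<^sup>2) / \<eta> = of_real (A\<^sup>2 * pi) * \<beta> * \<i>"
  proof -
    have "\<beta> = of_real ((DK / (4 * pi))\<^sup>2) / \<alpha>" unfolding c2[symmetric] using a0 by simp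
    then show ?thesis unfolding \<eta>_def rho power_divide S(3) A using DK0 a0
      by (simp add: field_simps power2_eq_square)
  qed
  have cis: "(cis (pi / 4))\<^sup>2 = \<i>" "(cis (- pi / 4))\<^sup>2 = - \<i>" by (simp_all add: power2_eq_square cis_mult)
  have w1: "w1\<^sup>2 = of_real (8 * pi) * \<i> * of_real (\<rho>\<^sup>2) / \<eta>"
    and w2: "w2\<^sup>2 = - (of_real (8 * pi) * \<i> * of_real (\<rho>\<^sup>2) / \<eta>)"
    unfolding wval w1_def w2_def power_mult_distrib cis s2 by simp_all
  define k1 where "k1 = (\<lambda>n. bessel_K0 (of_real (sqrt (real n)) * w1))"
  define k2 where "k2 = (\<lambda>n. bessel_K0 (of_real (sqrt (real n)) * w2))"
  \<comment> \<open>The principal root lets the positive factor \<open>n\<close> split off, so the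
    Kelvin functions at \<open>x n\<close> are combinations of \<open>bessel_K0\<close> at
    \<open>sqrt n * w1\<close> and \<open>sqrt n * w2\<close>.\<close>
  have xn: "x n = of_real (sqrt (real n)) * (of_real A * s)" if n: "n \<ge> 1" for n
  proof -
    have "csqrt (of_real (pi * of_nat n) * \<beta>) = of_real (sqrt (real n)) * s"
      by (rule csqrt_unique) (use n s_arg in \<open>auto simp: power_mult_distrib s2 simp flip: of_real_power\<close>)
    then show ?thesis by (simp add: x_def)
  qed
  have kelvin: "kelvin_ker (x n) = (k1 n + k2 n) / 2" "kelvin_kei (x n) = (k1 n - k2 n) / (2 * \<i>)" if "n \<ge> 1" for n
    unfolding kelvin_ker_def kelvin_kei_def xn[OF that] k1_def k2_def w1_def w2_def by (simp_all only: mult.assoc)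
  define SL where "SL = (\<lambda>a. infsum (\<lambda>(d, k). of_real (v d) * (of_nat d ^ a * exp (- \<eta> * of_nat (d * k)))) (PN \<times> PN))"
  define R where "R = (\<lambda>(ks :: nat \<Rightarrow> complex) a. infsum (\<lambda>(d, k). of_real (v d) * (of_nat k ^ a * ks (d * k))) (PN \<times> PN))"
  note ctx = eta wRe(1) w1 wRe(2) w2
  have L: "(\<lambda>n. ideal_sigma K (of_nat a) (Suc n) * E (Suc n)) sums SL a" for a
  proof -
    have "((\<lambda>(d, k). of_real (v d) * (of_nat d ^ a * exp (- \<eta> * of_nat (d * k)))) has_sum SL a) (PN \<times> PN)"
      unfolding SL_def by (rule has_sum_infsum[OF abs_summable_summable[OF tc.L_summable[OF ctx]]])
    then have "((\<lambda>n. \<Sum>d | d dvd n. of_real (v d) * (of_nat d ^ a * exp (- \<eta> * of_nat (d * (n div d))))) has_sum SL a) PN"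
      by (rule divisor_has_sum)
    from has_sum_PN_sums[OF this] show ?thesis
    proof (rule sums_cong[THEN iffD1, rotated])
      fix n
      have "E (Suc n) = exp (- \<eta> * of_nat (Suc n))" by (simp add: E_def \<eta>_def mult_ac del: of_nat_Suc)
      then show "(\<Sum>d | d dvd Suc n. of_real (v d) * (of_nat d ^ a * exp (- \<eta> * of_nat (d * (Suc n div d))))) =
        ideal_sigma K (of_nat a) (Suc n) * E (Suc n)"
        by (subst ideal_sigma_of_nat, simp, subst sum_distrib_right, intro sum.cong refl)
          (simp add: v_def mult.assoc del: of_nat_Suc of_nat_mult)
    qed
  qed
  have Rs: "(\<lambda>n. ideal_sigma K (- of_nat a) (Suc n) / of_nat (Suc n) powr (- of_nat a) * ks (Suc n)) sums R ks a"
    if "ks \<in> {k1, k2}" for ks a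
  proof -
    have "(\<lambda>(d, k). of_real (v d) * (of_nat k ^ a * ks (d * k))) summable_on (PN \<times> PN)"
      using that abs_summable_summable[OF tc.R_summable(1)[OF ctx]] abs_summable_summable[OF tc.R_summable(2)[OF ctx]]
      by (auto simp: k1_def k2_def)
    then have "((\<lambda>(d, k). of_real (v d) * (of_nat k ^ a * ks (d * k))) has_sum R ks a) (PN \<times> PN)"
      unfolding R_def by (rule has_sum_infsum)
    then have "((\<lambda>n. \<Sum>d | d dvd n. of_real (v d) * (of_nat (n div d) ^ a * ks (d * (n div d)))) has_sum R ks a) PN"
      by (rule divisor_has_sum)
    from has_sum_PN_sums[OF this] show ?thesis
    proof (rule sums_cong[THEN iffD1, rotated])
      fix n
      show "(\<Sum>d | d dvd Suc n. of_real (v d) * (of_nat (Suc n div d) ^ a * ks (d * (Suc n div d)))) =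
        ideal_sigma K (- of_nat a) (Suc n) / of_nat (Suc n) powr (- of_nat a) * ks (Suc n)"
        by (subst ideal_sigma_minus_of_nat, simp, subst sum_distrib_right, intro sum.cong refl)
          (simp add: v_def mult.assoc del: of_nat_Suc of_nat_mult)
    qed
  qed
  have Rker: "(\<lambda>n. ideal_sigma K (- of_nat a) (Suc n) / of_nat (Suc n) powr (- of_nat a) * kelvin_ker (x (Suc n))) sums ((R k1 a + R k2 a) / 2)"
    and Rkei: "(\<lambda>n. ideal_sigma K (- of_nat a) (Suc n) / of_nat (Suc n) powr (- of_nat a) * kelvin_kei (x (Suc n))) sums ((R k1 a - R k2 a) / (2 * \<i>))" for a
  proof -
    show "(\<lambda>n. ideal_sigma K (- of_nat a) (Suc n) / of_nat (Suc n) powr (- of_nat a) * kelvin_ker (x (Suc n))) sums ((R k1 a + R k2 a) / 2)"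
      using sums_divide[OF sums_add[OF Rs[of k1 a] Rs[of k2 a]], of 2] by (simp only: kelvin One_nat_def Suc_le_mono le0 distrib_left times_divide_eq_right insert_iff simp_thms)
    show "(\<lambda>n. ideal_sigma K (- of_nat a) (Suc n) / of_nat (Suc n) powr (- of_nat a) * kelvin_kei (x (Suc n))) sums ((R k1 a - R k2 a) / (2 * \<i>))"
      using sums_divide[OF sums_diff[OF Rs[of k1 a] Rs[of k2 a]], of "2 * \<i>"] by (simp only: kelvin One_nat_def Suc_le_mono le0 right_diff_distrib times_divide_eq_right insert_iff simp_thms)
  qed
  \<comment> \<open>The parity of \<open>a\<close> decides whether \<open>R k1\<close> and
    \<open>R k2\<close> enter with equal or with opposite signs, that is, whether they combine to
    \<open>ker\<close> or to \<open>kei\<close>.\<close>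
  have main: "SL a = q ^ Suc a / S * (of_real (\<kappa> * fact a * suminf (\<lambda>k. 1 / real (Suc k) ^ Suc a) / (2 * pi) ^ a)
      + 2 * (-1) ^ a * (\<i> ^ a * R k1 a + (- \<i>) ^ a * R k2 a))" if a: "a \<ge> 2" for a
  proof -
    define Z where "Z = suminf (\<lambda>k. 1 / real (Suc k) ^ Suc a)"
    have "infsum (\<lambda>(d, k). of_real (v d) * (of_nat k ^ a * theta_coeffs.BB w1 w2 a (d * k))) (PN \<times> PN)
      = infsum (\<lambda>p. \<i> ^ a * (case p of (d, k) \<Rightarrow> of_real (v d) * (of_nat k ^ a * k1 (d * k)))
          + (- \<i>) ^ a * (case p of (d, k) \<Rightarrow> of_real (v d) * (of_nat k ^ a * k2 (d * k)))) (PN \<times> PN)"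
      by (rule infsum_cong) (auto simp: tc.BB_def[OF ctx] k1_def k2_def distrib_left mult_ac)
    also have "\<dots> = \<i> ^ a * R k1 a + (- \<i>) ^ a * R k2 a"
    proof (subst infsum_add)
      show "(\<lambda>p. \<i> ^ a * (case p of (d, k) \<Rightarrow> of_real (v d) * (of_nat k ^ a * k1 (d * k)))) summable_on PN \<times> PN"
        "(\<lambda>p. (- \<i>) ^ a * (case p of (d, k) \<Rightarrow> of_real (v d) * (of_nat k ^ a * k2 (d * k)))) summable_on PN \<times> PN"
        unfolding k1_def k2_def
        by (rule summable_on_cmult_right, rule abs_summable_summable, rule tc.R_summable[OF ctx])+
    qed (simp only: infsum_cmult_right' R_def)
    finally have BB: "infsum (\<lambda>(d, k). of_real (v d) * (of_nat k ^ a * theta_coeffs.BB w1 w2 a (d * k))) (PN \<times> PN)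
      = \<i> ^ a * R k1 a + (- \<i>) ^ a * R k2 a" .
    have "SL a = of_real (\<kappa> * \<rho> * fact a * Z) / \<eta> ^ Suc a + (-1) ^ a * (2 * (q / S) * q ^ a * (\<i> ^ a * R k1 a + (- \<i>) ^ a * R k2 a))"
      using tc.koshliakov_identity[OF ctx a] unfolding BB rho_eta q_eta SL_def Z_def .
    moreover have "of_real (\<kappa> * \<rho> * fact a * Z) / \<eta> ^ Suc a = q ^ Suc a / S * of_real (\<kappa> * fact a * Z / (2 * pi) ^ a)"
      unfolding q_eta[symmetric] rho using S(2) eta0 by (simp add: power_divide mult_ac)
    ultimately show ?thesis unfolding Z_def by (simp add: distrib_left mult_ac)
  qed
  have m1: "2 * of_nat m - 1 = (of_nat (2 * m - 1) :: complex)" using m by (simp add: of_nat_diff)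
  have m2: "1 - 2 * of_nat m = - (of_nat (2 * m - 1) :: complex)" using m by (simp add: of_nat_diff)
  have m3: "2 * of_nat m = (of_nat (2 * m) :: complex)" "- 2 * of_nat m = - (of_nat (2 * m) :: complex)" by simp_all
  have sL1: "(\<lambda>n. L1 (Suc n)) sums SL (2 * m - 1)" unfolding L1_def m1 by (rule L)
  have sL2: "(\<lambda>n. L2 (Suc n)) sums SL (2 * m)" unfolding L2_def m3 by (rule L)
  have sR1: "(\<lambda>n. R1 (Suc n)) sums ((R k1 (2 * m - 1) - R k2 (2 * m - 1)) / (2 * \<i>))" unfolding R1_def m2 by (rule Rkei)
  have sR2: "(\<lambda>n. R2 (Suc n)) sums ((R k1 (2 * m) + R k2 (2 * m)) / 2)" unfolding R2_def m3 by (rule Rker)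
  have i1: "\<alpha> ^ m * SL (2 * m - 1) = - ((- \<beta>) ^ m) * (of_real (4 / sqrt DK) * ((R k1 (2 * m - 1) - R k2 (2 * m - 1)) / (2 * \<i>))
      + of_real (pi * h / (w * sqrt DK) * (bernoulli (2 * m) / (2 * of_nat m))))" if "m \<ge> 2"
  proof -
    obtain j where j: "m = Suc j" using m by (cases m) auto
    define a where "a = 2 * m - 1"
    have a: "a \<ge> 2" "Suc a = 2 * m" "a = Suc (2 * j)" using that by (auto simp: a_def j)
    have i: "\<i> ^ a = - (\<i> * (-1) ^ m)" "(- \<i>) ^ a = \<i> * (-1) ^ m" unfolding a(3) j by (simp_all add: power_mult)
    have "(-1 :: complex) ^ a = - 1" unfolding a(3) by simp
    have f: "fact (2 * m) = 2 * real m * fact a" unfolding a(2)[symmetric] fact_Suc by (simp add: a(2))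
    \<comment> \<open>By \<open>(2 m)! = 2 m a!\<close>, and with one factor \<open>2 \<pi>\<close>
      left over from the powers, the zeta value turns into the Bernoulli term of the
      identity.\<close>
    have z: "\<kappa> * fact a * suminf (\<lambda>k. 1 / real (Suc k) ^ Suc a) / (2 * pi) ^ a = - ((-1) ^ m * (\<kappa> * pi * bernoulli (2 * m) / (2 * real m)))"
    proof -
      have "(2 * pi) ^ (2 * m) = (2 * pi) ^ a * (2 * pi)" unfolding a(2)[symmetric] by simp
      then show ?thesis unfolding a(2) suminf_inverse_even_power_bernoulli[OF m] f using m by simp
    qed
    have "\<alpha> ^ m * q ^ Suc a = (\<alpha> * q\<^sup>2) ^ m" unfolding a(2) by (simp add: power_mult_distrib power_mult)
    then have b: "\<alpha> ^ m * q ^ Suc a = \<beta> ^ m" unfolding q2 .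
    have "\<alpha> ^ m * SL a = \<alpha> ^ m * q ^ Suc a / S * (- (of_real ((-1) ^ m * (\<kappa> * pi * bernoulli (2 * m) / (2 * real m))))
        - 2 * (\<i> * (-1) ^ m * (R k2 a - R k1 a)))"
      unfolding main[OF a(1)] z i \<open>(-1 :: complex) ^ a = - 1\<close> by (simp add: algebra_simps)
    also have "\<dots> = - ((-1) ^ m * \<beta> ^ m) * (of_real (4 / S) * ((R k1 a - R k2 a) / (2 * \<i>))
      + of_real (pi * h / (w * S) * (bernoulli (2 * m) / (2 * real m))))"
      unfolding b using S(2) by (simp add: \<kappa>_def field_simps)
    also have "(-1) ^ m * \<beta> ^ m = (- \<beta>) ^ m" by (simp flip: power_mult_distrib)
    finally show ?thesis unfolding a_def S_def .
  qed
  have i2: "\<alpha> powr (of_nat m + 1 / 2) * SL (2 * m) = \<beta> powr (of_nat m + 1 / 2) *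
           (of_real (4 * (- 1) ^ m / sqrt DK) * ((R k1 (2 * m) + R k2 (2 * m)) / 2)
            + of_real (h * fact (2 * m) / ((2 * pi) ^ (2 * m) * w * sqrt DK)) * zeta (2 * of_nat m + 1))"
  proof -
    have i: "\<i> ^ (2 * m) = (-1) ^ m" "(- \<i>) ^ (2 * m) = (-1) ^ m" by (simp_all add: power_mult)
    define Z where "Z = suminf (\<lambda>k. 1 / real (Suc k) ^ Suc (2 * m))"
    have zs: "summable (\<lambda>k. 1 / real (Suc k) ^ Suc (2 * m))"
      using summable_ignore_initial_segment[OF inverse_power_summable[of "Suc (2 * m)", where 'a = real], of 1] m
      by (simp add: inverse_eq_divide)
    have z: "zeta (2 * of_nat m + 1) = of_real Z"
    proof -
      have e: "2 * of_nat m + 1 = (of_nat (Suc (2 * m)) :: complex)" by simp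
      have "1 / of_nat (Suc n) powr (of_nat (Suc (2 * m))) = complex_of_real (1 / real (Suc n) ^ Suc (2 * m))" for n
        by (subst powr_nat') (auto simp del: of_nat_Suc)
      then show ?thesis unfolding zeta_def e Z_def suminf_of_real[OF zs] by (simp only:)
    qed
    have b: "\<alpha> powr (of_nat m + 1 / 2) * q ^ Suc (2 * m) = \<beta> powr (of_nat m + 1 / 2)"
      unfolding q_def by (rule half_power_eq[OF \<alpha> \<beta> c2]) (use DK0 in simp)
    have "\<alpha> powr (of_nat m + 1 / 2) * SL (2 * m) = \<alpha> powr (of_nat m + 1 / 2) * q ^ Suc (2 * m) / S * (of_real (\<kappa> * fact (2 * m) * Z / (2 * pi) ^ (2 * m))
      + 2 * ((-1) ^ m * R k1 (2 * m) + (-1) ^ m * R k2 (2 * m)))"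
      using m unfolding Z_def by (subst main) (simp_all add: i)
    also have "\<dots> = \<beta> powr (of_nat m + 1 / 2) *
           (of_real (4 * (- 1) ^ m / S) * ((R k1 (2 * m) + R k2 (2 * m)) / 2)
            + of_real (h * fact (2 * m) / ((2 * pi) ^ (2 * m) * w * S)) * of_real Z)"
      unfolding b by (simp add: \<kappa>_def distrib_left add_divide_distrib mult_ac)
    finally show ?thesis unfolding z S_def .
  qed
  show ?thesis
    unfolding sums_unique[OF sL1, symmetric] sums_unique[OF sL2, symmetric] sums_unique[OF sR1, symmetric] sums_unique[OF sR2, symmetric]
    by (intro conjI impI i1 i2 sums_summable[OF sL1] sums_summable[OF sL2] sums_summable[OF sR1] sums_summable[OF sR2])
qed

end
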